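(* Let $n\ge1$ and let $\lambda=\sum_{i=1}^n m_i\omega_i$, $\mu=\sum_{i=1}^n m_i'\omega_i$ with $m_i,m_i'\in\mathbb Z_{\ge0}$. Then the $S(\tilde{\mathfrak n}^-)$-submodule of $\operatorname{gr}\mathcal V_0(\lambda)\otimes\operatorname{gr}\mathcal V_0(\mu)$ generated by the vector $v_\lambda\otimes v_\mu$ is isomorphic, as an $S(\tilde{\mathfrak n}^-)$-module, to $\operatorname{gr}\mathcal V_0(\lambda+\mu)$.
   Context: **Odd symplectic Lie algebra.** Let $V=\mathbb C^{2n+1}$ with basis $e_1,\dots,e_{2n+1}$ and coordinates $x_1,\dots,x_{2n+1}$, and let $\omega=\sum_{i=1}^n dx_i\wedge dx_{n+i}$, a skew-symmetric form of maximal rank $2n$. $\mathfrak{sp}_{2n+1}$ is the Lie algebra of the subgroup of $GL(V)$ preserving $\omega$. In the basis above it consists of block matrices $\begin{bmatrix} A&0\\ b&z\end{bmatrix}$ with $A\in\mathfrak{sp}_{2n}$, $b\in\mathbb C^{2n}$ a row, $z\in\mathbb C$. Let $E_{i,j}$ be matrix units. Let $\mathfrak h\subset\mathfrak{sp}_{2n}$ be the diagonal Cartan subalgebra, spanned by $E_{i,i}-E_{n+i,n+i}$, with $\varepsilon_1,\dots,\varepsilon_n$ the dual basis; simple roots of $\mathfrak{sp}_{2n}$ are $\alpha_i=\varepsilon_i-\varepsilon_{i+1}$ ($i<n$), $\alpha_n=2\varepsilon_n$, and fundamental weights are $\omega_i=\varepsilon_1+\dots+\varepsilon_i$. Let $\mathfrak{sp}_{2n}=\mathfrak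 n^+\oplus\mathfrak h\oplus\mathfrak n^-$ be the corresponding Cartan decomposition, $F^-=\bigoplus_{i=1}^n\mathbb C E_{2n+1,i}$ and $\tilde{\mathfrak n}^-=\mathfrak n^-\oplus F^-$, a nilpotent Lie subalgebra of $\mathfrak{sp}_{2n+1}$. **The representation $\mathcal V_0(\lambda)$.** Identify $\lambda=\sum m_i\omega_i$ with the Young diagram $(\lambda_1\ge\dots\ge\lambda_n\ge0)$, $\lambda_i=m_i+\dots+m_n$, $|\lambda|=\sum\lambda_i$. Let $V^\lambda\subset V^{\otimes|\lambda|}$ be the irreducible $GL(V)$-subrepresentation of highest weight $\lambda$ given as the image of the Young symmetrizer $c_\lambda$. A tensor in $V^{\otimes k}$ is trace-free if all its $k(k-1)/2$ contractions with $\omega$ (in pairs of tensor positions) vanish. $\mathcal V_0(\lambda)$ is the subspace of trace-free tensors in $V^\lambda$; it is a representation of $\mathfrak{sp}_{2n+1}$. The highest weight vector $v_\lambda\in V^\lambda$ (nonzero, of $GL(V)$-weight $(\lambda_1,\dots,\lambda_n,0,\dots,0)$) lies in $\mathcal V_0(\lambda)$. **PBW filtration.** $U^s(\mathfrak g)\subset U(\mathfrak g)$ is the span of products of at most $s$ elements of $\mathfrak g$. The PBW filtration on $\mathcal V_0(\lambda)$ is $\mathcal V_0(\lambda)^s=U^s(\tilde{\mathfrak n}^-)v_\lambda$, and $\operatorname{gr}\mathcal V_0(\lambda)=\bigoplus_s\mathcal V_0(\lambda)^s/\mathcal V_0(\lambda)^{s-1}$ is a module over the symmetric algebra $S(\tilde{\mathfrak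 n}^-)$; the class of $v_\lambda$ in it is again denoted $v_\lambda$. On the tensor product of two $S(\tilde{\mathfrak n}^-)$-modules, $x\in\tilde{\mathfrak n}^-$ acts by $x\otimes1+1\otimes x$. *)

theory Defs
  imports
    Complex_Main
    "HOL-Library.Function_Algebras"
    "HOL-Library.Set_Algebras"
    "HOL-Library.Poly_Mapping"
    "HOL-Library.Multiset"
    "HOL-Combinatorics.Permutations"
    "HOL-Algebra.Module"
    "HOL-Algebra.QuotRing"
begin

section \<open>Complex vector spaces of functions\<close>

definition cscale :: "complex \<Rightarrow> ('a \<Rightarrow> complex) \<Rightarrow> 'a \<Rightarrow> complex" where
  "cscale c f = (\<lambda>x. c * f x)"

global_interpretation cfun: vector_space cscale
  defines cspan = cfun.span
  by standard (auto simp: cscale_def fun_eq_iff algebra_simps)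

definition delta :: "'a \<Rightarrow> 'a \<Rightarrow> complex" where
  "delta a = (\<lambda>x. if x = a then 1 else 0)"


section \<open>The odd symplectic Lie algebra\<close>

text \<open>
  \<open>V\<close> has the basis \<open>e_1, ..., e_(2n+1)\<close>; a matrix is a function on pairs (row, column) that
  vanishes outside \<open>{1..2n+1} \<times> {1..2n+1}\<close>, and \<open>X e_j = (\<Sum>i. X (i, j) e_i)\<close>.
\<close>

type_synonym cmat = "nat \<times> nat \<Rightarrow> complex"

definition idx :: "nat \<Rightarrow> nat set" where
  "idx n = {1..2 * n + 1}"

definition gl :: "nat \<Rightarrow> cmat set" where
  "gl n = {X. \<forall>p. p \<notin> idx n \<times> idx n \<longrightarrow> X p = 0}"

definition mat_mult :: "nat \<Rightarrow> cmat \<Rightarrow> cmat \<Rightarrow> cmat" where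
  "mat_mult n X Y = (\<lambda>(i, k). \<Sum>j\<in>idx n. X (i, j) * Y (j, k))"

definition bracket :: "nat \<Rightarrow> cmat \<Rightarrow> cmat \<Rightarrow> cmat" where
  "bracket n X Y = mat_mult n X Y - mat_mult n Y X"

text \<open>The values \<open>\<omega>(e_i, e_j)\<close> of \<open>\<omega> = (\<Sum>i=1..n. dx_i \<and> dx_(n+i))\<close>.\<close>

definition omega :: "nat \<Rightarrow> nat \<Rightarrow> nat \<Rightarrow> complex" where
  "omega n i j =
     (if i \<in> {1..n} \<and> j = n + i then 1 else if j \<in> {1..n} \<and> i = n + j then - 1 else 0)"

text \<open>\<open>\<omega>(X e_i, e_j) + \<omega>(e_i, X e_j) = 0\<close>: the Lie algebra of the stabilizer of \<open>\<omega>\<close> in \<open>GL(V)\<close>.\<close>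

definition sp_odd :: "nat \<Rightarrow> cmat set" where
  "sp_odd n = {X \<in> gl n. \<forall>i\<in>idx n. \<forall>j\<in>idx n.
     (\<Sum>k\<in>idx n. X (k, i) * omega n k j) + (\<Sum>k\<in>idx n. omega n i k * X (k, j)) = 0}"

text \<open>The matrices in \<open>sp_odd n\<close> with \<open>b = 0\<close> and \<open>z = 0\<close>.\<close>

definition sp_even :: "nat \<Rightarrow> cmat set" where
  "sp_even n = {X \<in> sp_odd n. \<forall>j\<in>idx n. X (2 * n + 1, j) = 0}"

definition cartan :: "nat \<Rightarrow> cmat set" where
  "cartan n = cspan {delta (i, i) - delta (n + i, n + i) | i. i \<in> {1..n}}"

text \<open>\<open>simple_root n i j\<close> is the coefficient of \<open>\<epsilon>_j\<close> in \<open>\<alpha>_i\<close>; the functional \<open>\<epsilon>_j\<close> maps \<open>H\<close>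
  to \<open>H (j, j)\<close>.\<close>

definition simple_root :: "nat \<Rightarrow> nat \<Rightarrow> nat \<Rightarrow> int" where
  "simple_root n i j =
     (if i < n then (if j = i then 1 else if j = i + 1 then - 1 else 0)
      else (if j = n then 2 else 0))"

text \<open>The value at \<open>H\<close> of \<open>(\<Sum>i=1..n. k i \<cdot> \<alpha>_i)\<close>.\<close>

definition root_val :: "nat \<Rightarrow> (nat \<Rightarrow> nat) \<Rightarrow> cmat \<Rightarrow> complex" where
  "root_val n k H =
     (\<Sum>i=1..n. of_nat (k i) * (\<Sum>j=1..n. of_int (simple_root n i j) * H (j, j)))"

definition neg_root_space :: "nat \<Rightarrow> (nat \<Rightarrow> nat) \<Rightarrow> cmat set" where
  "neg_root_space n k =
     {X \<in> sp_even n. \<forall>H\<in>cartan n. bracket n H X = cscale (- root_val n k H) X}"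

definition n_minus :: "nat \<Rightarrow> cmat set" where
  "n_minus n = cspan (\<Union>k\<in>{k. \<exists>i\<in>{1..n}. k i \<noteq> 0}. neg_root_space n k)"

definition F_minus :: "nat \<Rightarrow> cmat set" where
  "F_minus n = cspan {delta (2 * n + 1, i) | i. i \<in> {1..n}}"

definition nt_minus :: "nat \<Rightarrow> cmat set" where
  "nt_minus n = n_minus n + F_minus n"


section \<open>Tensors, the Young symmetrizer and trace-free tensors\<close>

text \<open>
  \<open>T l\<close> is the coefficient of \<open>e_(l!0) \<otimes> ... \<otimes> e_(l!(k-1))\<close> in the tensor \<open>T\<close>.
  Tensor positions are counted from 0.
\<close>

type_synonym tensor = "nat list \<Rightarrow> complex"

definition tensor_power :: "nat \<Rightarrow> nat \<Rightarrow> tensor set" where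
  "tensor_power n k = {T. \<forall>l. T l \<noteq> 0 \<longrightarrow> length l = k \<and> set l \<subseteq> idx n}"

definition GL_act :: "nat \<Rightarrow> cmat \<Rightarrow> tensor \<Rightarrow> tensor" where
  "GL_act n g T = (\<lambda>l. \<Sum>l' | length l' = length l \<and> set l' \<subseteq> idx n.
     (\<Prod>p<length l. g (l ! p, l' ! p)) * T l')"

definition gl_act :: "nat \<Rightarrow> cmat \<Rightarrow> tensor \<Rightarrow> tensor" where
  "gl_act n X T = (\<lambda>l. \<Sum>p<length l. \<Sum>a\<in>idx n. X (l ! p, a) * T (l[p := a]))"

text \<open>The right action \<open>(u_0 \<otimes> ... \<otimes> u_(k-1)) \<cdot> \<sigma> = u_\<sigma>(0) \<otimes> ... \<otimes> u_\<sigma>(k-1)\<close>.\<close>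

definition perm_act :: "tensor \<Rightarrow> (nat \<Rightarrow> nat) \<Rightarrow> tensor" where
  "perm_act T \<sigma> = (\<lambda>l. T (map (\<lambda>p. l ! (inv_into UNIV \<sigma> p)) [0..<length l]))"

definition part :: "nat \<Rightarrow> (nat \<Rightarrow> nat) \<Rightarrow> nat \<Rightarrow> nat" where
  "part n m i = (\<Sum>j=i..n. m j)"

definition psize :: "nat \<Rightarrow> (nat \<Rightarrow> nat) \<Rightarrow> nat" where
  "psize n m = (\<Sum>i=1..n. part n m i)"

text \<open>The boxes of the diagram are numbered \<open>0, ..., |\<lambda>| - 1\<close> along the successive rows;
  \<open>box_row\<close> and \<open>box_col\<close> give the row (from 1) and the column (from 0) of a box.\<close>

definition box_row :: "nat \<Rightarrow> (nat \<Rightarrow> nat) \<Rightarrow> nat \<Rightarrow> nat" where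
  "box_row n m p = (LEAST i. p < (\<Sum>j=1..i. part n m j))"

definition box_col :: "nat \<Rightarrow> (nat \<Rightarrow> nat) \<Rightarrow> nat \<Rightarrow> nat" where
  "box_col n m p = p - (\<Sum>j=1..<box_row n m p. part n m j)"

definition row_group :: "nat \<Rightarrow> (nat \<Rightarrow> nat) \<Rightarrow> (nat \<Rightarrow> nat) set" where
  "row_group n m = {\<sigma>. \<sigma> permutes {..<psize n m} \<and>
     (\<forall>p<psize n m. box_row n m (\<sigma> p) = box_row n m p)}"

definition col_group :: "nat \<Rightarrow> (nat \<Rightarrow> nat) \<Rightarrow> (nat \<Rightarrow> nat) set" where
  "col_group n m = {\<sigma>. \<sigma> permutes {..<psize n m} \<and>
     (\<forall>p<psize n m. box_col n m (\<sigma> p) = box_col n m p)}"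

text \<open>The right action of \<open>c_\<lambda> = (\<Sum>\<sigma>\<in>row group. \<sigma>) (\<Sum>\<tau>\<in>column group. sgn \<tau> \<cdot> \<tau>)\<close>.\<close>

definition young_symmetrizer :: "nat \<Rightarrow> (nat \<Rightarrow> nat) \<Rightarrow> tensor \<Rightarrow> tensor" where
  "young_symmetrizer n m T =
     (\<Sum>\<tau>\<in>col_group n m. cscale (of_int (sign \<tau>))
        (perm_act (\<Sum>\<sigma>\<in>row_group n m. perm_act T \<sigma>) \<tau>))"

definition schur_module :: "nat \<Rightarrow> (nat \<Rightarrow> nat) \<Rightarrow> tensor set" where
  "schur_module n m = young_symmetrizer n m ` tensor_power n (psize n m)"

text \<open>Contraction with \<open>\<omega>\<close> in the positions \<open>p < q\<close>; it maps \<open>k\<close>-tensors to \<open>(k - 2)\<close>-tensors.\<close>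

definition contraction :: "nat \<Rightarrow> nat \<Rightarrow> nat \<Rightarrow> tensor \<Rightarrow> tensor" where
  "contraction n p q T = (\<lambda>l. \<Sum>a\<in>idx n. \<Sum>b\<in>idx n. omega n a b *
     T (take p l @ [a] @ take (q - p - 1) (drop p l) @ [b] @ drop (q - 1) l))"

definition V0 :: "nat \<Rightarrow> (nat \<Rightarrow> nat) \<Rightarrow> tensor set" where
  "V0 n m = {T \<in> schur_module n m.
     \<forall>p q. p < q \<and> q < psize n m \<longrightarrow> contraction n p q T = 0}"

text \<open>Weights with respect to the diagonal torus of \<open>GL(V)\<close>; \<open>w i\<close> is the exponent of \<open>t i\<close>.\<close>

definition GL_weight :: "nat \<Rightarrow> (nat \<Rightarrow> nat) \<Rightarrow> tensor \<Rightarrow> bool" where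
  "GL_weight n w T \<longleftrightarrow> (\<forall>t. (\<forall>i\<in>idx n. t i \<noteq> 0) \<longrightarrow>
     GL_act n (\<lambda>(i, j). if i = j \<and> i \<in> idx n then t i else 0) T =
       cscale (\<Prod>i\<in>idx n. t i ^ w i) T)"

text \<open>Membership in \<open>V0 n m\<close> instead of \<open>schur_module n m\<close> is no restriction; see
  \<open>highest_weight_vector_iff\<close> below. Such a vector is unique up to a nonzero scalar.\<close>

definition highest_weight_vector :: "nat \<Rightarrow> (nat \<Rightarrow> nat) \<Rightarrow> tensor \<Rightarrow> bool" where
  "highest_weight_vector n m v \<longleftrightarrow>
     v \<in> V0 n m \<and> v \<noteq> 0 \<and> GL_weight n (\<lambda>i. if i \<le> n then part n m i else 0) v"

lemma GL_act_diag:
  assumes "set l \<subseteq> idx n"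
  shows "GL_act n (\<lambda>(i, j). if i = j \<and> i \<in> idx n then t i else 0) T l =
    (\<Prod>p<length l. t (l ! p)) * T l"
proof -
  have fin: "finite {l'. length l' = length l \<and> set l' \<subseteq> idx n}"
    using finite_lists_length_eq[of "idx n" "length l"] by (simp add: idx_def conj_commute)
  have z: "(\<Prod>p<length l. (\<lambda>(i, j). if i = j \<and> i \<in> idx n then t i else 0) (l ! p, l' ! p)) = (0::complex)"
    if l': "length l' = length l" "l' \<noteq> l" for l'
  proof -
    obtain p where "p < length l" "l ! p \<noteq> l' ! p"
      using l' by (metis nth_equalityI)
    then show ?thesis by (intro prod_zero) auto
  qed
  have "GL_act n (\<lambda>(i, j). if i = j \<and> i \<in> idx n then t i else 0) T l =
    (\<Sum>l'\<in>{l}. (\<Prod>p<length l. (\<lambda>(i, j). if i = j \<and> i \<in> idx n then t i else 0) (l ! p, l' ! p)) * T l')"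
    unfolding GL_act_def
    by (rule sum.mono_neutral_right) (use fin assms z in auto)
  also have "\<dots> = (\<Prod>p<length l. t (l ! p)) * T l"
    using assms by (auto intro!: prod.cong simp: subset_iff)
  finally show ?thesis .
qed

lemma GL_weight_support:
  assumes "GL_weight n w T" "T l \<noteq> 0" "set l \<subseteq> idx n" "i \<in> set l"
  shows "w i \<noteq> 0"
proof
  assume wi: "w i = 0"
  define t :: "nat \<Rightarrow> complex" where "t = (\<lambda>j. if j = i then 2 else 1)"
  have "(\<Prod>p<length l. t (l ! p)) * T l = (\<Prod>j\<in>idx n. t j ^ w j) * T l"
    using assms(1) GL_act_diag[OF assms(3), of t T]
    by (auto simp: GL_weight_def t_def cscale_def)
  moreover have "(\<Prod>j\<in>idx n. t j ^ w j) = 1"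
    by (intro prod.neutral) (auto simp: t_def wi)
  ultimately have 1: "(\<Prod>p<length l. t (l ! p)) = 1"
    using assms(2) by simp
  have "(\<Prod>p<length l. t (l ! p)) = of_nat (\<Prod>p<length l. if l ! p = i then 2 else 1)"
    by (simp add: t_def of_nat_prod if_distrib cong: if_cong)
  with 1 have e: "(\<Prod>p<length l. if l ! p = i then 2 else 1 :: nat) = 1"
    by (metis of_nat_eq_1_iff)
  obtain p where p: "p < length l" "l ! p = i"
    using assms(4) by (auto simp: in_set_conv_nth)
  then have "(2::nat) dvd (\<Prod>p<length l. if l ! p = i then 2 else 1 :: nat)"
    using dvd_prodI[of "{..<length l}" p "\<lambda>p. if l ! p = i then 2 else 1 :: nat"] by simp
  with e show False by simp
qed

lemma schur_module_subset: "schur_module n m \<subseteq> tensor_power n (psize n m)"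
proof
  fix S assume "S \<in> schur_module n m"
  then obtain T where T: "T \<in> tensor_power n (psize n m)" and S: "S = young_symmetrizer n m T"
    by (auto simp: schur_module_def)
  have P: "perm_act U \<sigma> \<in> tensor_power n (psize n m)"
    if U: "U \<in> tensor_power n (psize n m)" and \<sigma>: "\<sigma> permutes {..<psize n m}" for U \<sigma>
  proof -
    have "length l = psize n m \<and> set l \<subseteq> idx n" if "perm_act U \<sigma> l \<noteq> 0" for l
    proof -
      let ?l = "map (\<lambda>p. l ! (inv_into UNIV \<sigma> p)) [0..<length l]"
      have l: "length ?l = psize n m" "set ?l \<subseteq> idx n"
        using that U unfolding perm_act_def tensor_power_def mem_Collect_eq by blast+
      have "l ! q \<in> idx n" if "q < length l" for q
      proof -
        have "\<sigma> q < length l"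
          using permutes_in_image[OF \<sigma>, of q] that l by simp
        then have "l ! (inv_into UNIV \<sigma> (\<sigma> q)) \<in> set ?l"
          by (metis (no_types, lifting) atLeastLessThan_iff imageI le0 set_map set_upt)
        then show ?thesis
          using l(2) permutes_inverses(2)[OF \<sigma>, of q] by (simp only: subset_iff)
      qed
      then show ?thesis using l by (auto simp: in_set_conv_nth)
    qed
    then show ?thesis by (auto simp: tensor_power_def)
  qed
  have sumI: "(\<Sum>x\<in>A. f x) \<in> tensor_power n k"
    if "\<And>x. x \<in> A \<Longrightarrow> f x \<in> tensor_power n k" for A :: "(nat \<Rightarrow> nat) set" and f k
    using that
  proof (induction A rule: infinite_finite_induct)
    case (insert x A)
    have "f x \<in> tensor_power n k" "(\<Sum>x\<in>A. f x) \<in> tensor_power n k"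
      using insert by auto
    then have "f x + (\<Sum>x\<in>A. f x) \<in> tensor_power n k"
      unfolding tensor_power_def mem_Collect_eq plus_fun_def by (metis add_0)
    then show ?case by (simp only: sum.insert[OF insert.hyps])
  qed (auto simp: tensor_power_def)
  have sc: "cscale c U \<in> tensor_power n k" if "U \<in> tensor_power n k" for c U k
    using that by (auto simp: tensor_power_def cscale_def)
  show "S \<in> tensor_power n (psize n m)"
    unfolding S young_symmetrizer_def
    by (intro sumI sc P T) (auto simp: row_group_def col_group_def)
qed

lemma highest_weight_vector_iff:
  "highest_weight_vector n m v \<longleftrightarrow>
     v \<in> schur_module n m \<and> v \<noteq> 0 \<and> GL_weight n (\<lambda>i. if i \<le> n then part n m i else 0) v"
proof -
  have "contraction n p q v = 0"
    if v: "v \<in> schur_module n m" and w: "GL_weight n (\<lambda>i. if i \<le> n then part n m i else 0) v" for p q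
  proof
    fix l
    have "omega n a b * v (take p l @ [a] @ take (q - p - 1) (drop p l) @ [b] @ drop (q - 1) l) = 0"
      for a b
    proof (rule ccontr)
      let ?l = "take p l @ [a] @ take (q - p - 1) (drop p l) @ [b] @ drop (q - 1) l"
      assume nz: "\<not> ?thesis"
      then have "set ?l \<subseteq> idx n"
        using v schur_module_subset by (fastforce simp: tensor_power_def)
      then have "x \<le> n" if "x \<in> {a, b}" for x
        using GL_weight_support[OF w, of ?l x] nz that by (auto split: if_splits)
      then have "a \<le> n" "b \<le> n" by blast+
      moreover have "omega n a b \<noteq> 0" using nz by auto
      ultimately show False by (auto simp: omega_def split: if_splits)
    qed
    then show "contraction n p q v l = 0 l"
      unfolding contraction_def by (simp only: sum.neutral_const zero_fun_def)
  qed
  then show ?thesis by (auto simp: highest_weight_vector_def V0_def)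
qed


section \<open>Modules over the symmetric algebra\<close>

text \<open>
  Complex vector spaces with an operator \<open>act x\<close> for each \<open>x\<close>. If the operators \<open>act x\<close>,
  \<open>x \<in> W\<close>, commute and depend linearly on \<open>x\<close>, this is turned into a module over the symmetric
  algebra of \<open>W\<close> by \<open>sym_module\<close> below. The fields \<open>mult\<close> and \<open>one\<close> of the HOL-Algebra module
  records play no role.
\<close>

record ('x, 'm) op_space = "(complex, 'm) module" +
  act :: "'x \<Rightarrow> 'm \<Rightarrow> 'm"

text \<open>
  The free commutative algebra on the set \<open>W\<close> has the finite multisets in \<open>W\<close> as its basis of
  monomials; the symmetric algebra of a subspace \<open>W\<close> is its quotient by the linear relations in
  \<open>W\<close>.
\<close>

type_synonym 'a free_poly = "('a \<Rightarrow> complex) multiset \<Rightarrow>\<^sub>0 complex"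

definition free_comm_algebra :: "('a \<Rightarrow> complex) set \<Rightarrow> 'a free_poly ring" where
  "free_comm_algebra W =
     \<lparr>carrier = {p. \<forall>K\<in>Poly_Mapping.keys p. set_mset K \<subseteq> W},
      mult = (*), one = 1, zero = 0, add = (+)\<rparr>"

definition linear_relations :: "('a \<Rightarrow> complex) set \<Rightarrow> 'a free_poly set" where
  "linear_relations W =
     {Poly_Mapping.single {#x + y#} 1 - Poly_Mapping.single {#x#} 1 - Poly_Mapping.single {#y#} 1
        | x y. x \<in> W \<and> y \<in> W} \<union>
     {Poly_Mapping.single {#cscale c x#} 1 - Poly_Mapping.single {#x#} c | c x. x \<in> W}"

definition symmetric_algebra :: "('a \<Rightarrow> complex) set \<Rightarrow> 'a free_poly set ring" where
  "symmetric_algebra W =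
     free_comm_algebra W Quot genideal (free_comm_algebra W) (linear_relations W)"

text \<open>The choices (\<open>SOME\<close>) below are immaterial: the operators \<open>act M x\<close> (\<open>x \<in> W\<close>) commute, and \<open>P\<close> is a
  coset all of whose elements act in the same way.\<close>

definition poly_act :: "('a \<Rightarrow> complex, 'm, 'z) op_space_scheme \<Rightarrow> 'a free_poly \<Rightarrow> 'm \<Rightarrow> 'm" where
  "poly_act M p u = finsum M
     (\<lambda>K. Poly_Mapping.lookup p K \<odot>\<^bsub>M\<^esub> foldr (act M) (SOME xs. mset xs = K) u)
     (Poly_Mapping.keys p)"

definition sym_module ::
  "('a \<Rightarrow> complex, 'm, 'z) op_space_scheme \<Rightarrow> ('a free_poly set, 'm) module" where
  "sym_module M = \<lparr>carrier = carrier M, mult = undefined, one = undefined, zero = zero M,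
     add = add M, smult = (\<lambda>P. poly_act M (SOME p. p \<in> P))\<rparr>"

definition generated_submodule ::
  "('r, 's) ring_scheme \<Rightarrow> ('r, 'm, 'z) module_scheme \<Rightarrow> 'm \<Rightarrow> ('r, 'm, 'z) module_scheme" where
  "generated_submodule R M u = M\<lparr>carrier := \<Inter>{H. submodule H R M \<and> u \<in> H}\<rparr>"

definition module_iso ::
  "('r, 's) ring_scheme \<Rightarrow> ('r, 'm, 'y) module_scheme \<Rightarrow> ('r, 'k, 'z) module_scheme \<Rightarrow>
   ('m \<Rightarrow> 'k) set" where
  "module_iso R M N = {f. bij_betw f (carrier M) (carrier N) \<and>
     (\<forall>u\<in>carrier M. \<forall>w\<in>carrier M. f (u \<oplus>\<^bsub>M\<^esub> w) = f u \<oplus>\<^bsub>N\<^esub> f w) \<and>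
     (\<forall>r\<in>carrier R. \<forall>u\<in>carrier M. f (r \<odot>\<^bsub>M\<^esub> u) = r \<odot>\<^bsub>N\<^esub> f u)}"


section \<open>Tensor products\<close>

text \<open>
  The tensor product over the complex numbers: finitely supported functions on
  \<open>carrier M \<times> carrier N\<close>, modulo the bilinear relations.
\<close>

definition free_space ::
  "('x, 'm, 'y) op_space_scheme \<Rightarrow> ('x, 'k, 'z) op_space_scheme \<Rightarrow> ('m \<times> 'k \<Rightarrow> complex) set" where
  "free_space M N = cspan (delta ` (carrier M \<times> carrier N))"

definition bilinear_relations ::
  "('x, 'm, 'y) op_space_scheme \<Rightarrow> ('x, 'k, 'z) op_space_scheme \<Rightarrow> ('m \<times> 'k \<Rightarrow> complex) set" where
  "bilinear_relations M N = cspan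
     ({delta (u \<oplus>\<^bsub>M\<^esub> u', w) - delta (u, w) - delta (u', w) | u u' w.
         u \<in> carrier M \<and> u' \<in> carrier M \<and> w \<in> carrier N} \<union>
      {delta (u, w \<oplus>\<^bsub>N\<^esub> w') - delta (u, w) - delta (u, w') | u w w'.
         u \<in> carrier M \<and> w \<in> carrier N \<and> w' \<in> carrier N} \<union>
      {delta (c \<odot>\<^bsub>M\<^esub> u, w) - cscale c (delta (u, w)) | c u w.
         u \<in> carrier M \<and> w \<in> carrier N} \<union>
      {delta (u, c \<odot>\<^bsub>N\<^esub> w) - cscale c (delta (u, w)) | c u w.
         u \<in> carrier M \<and> w \<in> carrier N})"

text \<open>The operator \<open>x \<otimes> 1 + 1 \<otimes> x\<close>.\<close>

definition free_space_act ::
  "('x, 'm, 'y) op_space_scheme \<Rightarrow> ('x, 'k, 'z) op_space_scheme \<Rightarrow> 'x \<Rightarrow>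
   ('m \<times> 'k \<Rightarrow> complex) \<Rightarrow> 'm \<times> 'k \<Rightarrow> complex" where
  "free_space_act M N x f = (\<Sum>(u, w) | f (u, w) \<noteq> 0.
     cscale (f (u, w)) (delta (act M x u, w) + delta (u, act N x w)))"

definition pure_tensor ::
  "('x, 'm, 'y) op_space_scheme \<Rightarrow> ('x, 'k, 'z) op_space_scheme \<Rightarrow> 'm \<Rightarrow> 'k \<Rightarrow>
   ('m \<times> 'k \<Rightarrow> complex) set" where
  "pure_tensor M N u w = delta (u, w) +o bilinear_relations M N"

text \<open>A linear map \<open>\<phi>\<close> with \<open>\<phi> ` A \<subseteq> B\<close> sends a coset \<open>C\<close> of \<open>A\<close> to the coset \<open>\<phi> ` C + B\<close> of \<open>B\<close>.\<close>

definition tensor_product ::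
  "('x, 'm, 'y) op_space_scheme \<Rightarrow> ('x, 'k, 'z) op_space_scheme \<Rightarrow>
   ('x, ('m \<times> 'k \<Rightarrow> complex) set) op_space" where
  "tensor_product M N =
     \<lparr>carrier = (\<lambda>f. f +o bilinear_relations M N) ` free_space M N,
      mult = undefined, one = undefined,
      zero = bilinear_relations M N,
      add = (\<lambda>C D. C + D),
      smult = (\<lambda>c C. cscale c ` C + bilinear_relations M N),
      act = (\<lambda>x C. free_space_act M N x ` C + bilinear_relations M N)\<rparr>"


section \<open>The PBW filtration and its associated graded space\<close>

text \<open>\<open>U^s v\<close> for the image \<open>U^s\<close> of the PBW filtration of the enveloping algebra of
  \<open>nt_minus n\<close>.\<close>

definition pbw :: "nat \<Rightarrow> tensor \<Rightarrow> nat \<Rightarrow> tensor set" where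
  "pbw n v s = cspan {foldr (gl_act n) xs v | xs. set xs \<subseteq> nt_minus n \<and> length xs \<le> s}"

definition pbw_pred :: "nat \<Rightarrow> tensor \<Rightarrow> nat \<Rightarrow> tensor set" where
  "pbw_pred n v s = (case s of 0 \<Rightarrow> {0} | Suc r \<Rightarrow> pbw n v r)"

text \<open>
  An element of the direct sum of the quotients \<open>pbw n v s / pbw_pred n v s\<close> is a family of
  cosets, almost all of which are zero. An element \<open>x\<close> of \<open>nt_minus n\<close> raises the degree by one.
\<close>

definition gr_V0 :: "nat \<Rightarrow> tensor \<Rightarrow> (cmat, nat \<Rightarrow> tensor set) op_space" where
  "gr_V0 n v =
     \<lparr>carrier = {f. (\<forall>s. f s \<in> (\<lambda>T. T +o pbw_pred n v s) ` pbw n v s) \<and>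
                    finite {s. f s \<noteq> pbw_pred n v s}},
      mult = undefined, one = undefined,
      zero = pbw_pred n v,
      add = (\<lambda>f g s. f s + g s),
      smult = (\<lambda>c f s. cscale c ` f s + pbw_pred n v s),
      act = (\<lambda>x f s. case s of 0 \<Rightarrow> pbw_pred n v 0
                       | Suc r \<Rightarrow> gl_act n x ` f r + pbw_pred n v (Suc r))\<rparr>"

text \<open>The class of \<open>v\<close> in degree 0.\<close>

definition gr_class :: "nat \<Rightarrow> tensor \<Rightarrow> nat \<Rightarrow> tensor set" where
  "gr_class n v = (\<lambda>s. if s = 0 then v +o pbw_pred n v 0 else pbw_pred n v s)"

end

theory Submission
  imports Defs
begin

text \<open>
  Write \<open>y_x\<close> for the basis of root vectors of the nilpotent algebra, indexed by positions \<open>x\<close>, and \<open>y^s\<close>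
  for the monomial of a multiset \<open>s\<close> of positions. Call a cyclic module with generator \<open>z\<close> of type \<open>m\<close> if
  (1) certain families of "rank one" elements \<open>Y\<close> satisfy \<open>Y^k z = 0\<close> as soon as \<open>k\<close> exceeds the number of
  columns of the diagram of \<open>m\<close> whose height lies in a certain interval, and (2) every \<open>s\<close> in the
  Feigin-Fourier-Littelmann polytope of \<open>m\<close> has a linear form \<open>\<Phi>\<close> with \<open>\<Phi> (y^s z) \<noteq> 0\<close> and
  \<open>\<Phi> (y^t z) = 0\<close> unless \<open>t = s\<close> or \<open>t\<close> has smaller weight.

  Comparing coefficients in (1) gives straightening relations which express each monomial through those of
  the polytope, and (2) makes the latter independent on \<open>z\<close>. Hence the annihilator of \<open>z\<close> depends
  only on \<open>m\<close>. Both properties are multiplicative: for modules of types \<open>m\<close> and \<open>m'\<close>, the tensor product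
  of the generators is of type \<open>m + m'\<close>, because the polytope of \<open>m + m'\<close> is the Minkowski sum of the
  other two.

  It remains to see that \<open>gr V\<^sub>0(\<lambda>)\<close> is of type \<open>m\<close>. The highest weight vector is antisymmetric
  along each column and a column of height \<open>h\<close> only involves \<open>e_1, ..., e_h\<close>. A matrix of rank one squares
  to zero on such a column and often kills it, and this gives (1); moving the entries of the columns along
  antichains gives (2).
\<close>

text \<open>A rank one element has the coefficients U_r U_(2n+2-c), so a monomial in one of its
  powers is weighed only by its letters r and 2n+2-c, and each relation is a sum over ways to pair
  the same letters. The weight, the sum of the products r (2n+2-c), tells these pairings apart. By
  the rearrangement inequality a chain pairs large letters with small ones and has the least weight,
  whereas an antichain pairs large with large and has the greatest. The first fact lets overfull
  chains be replaced by monomials of greater weight, the second makes the antichain moved in a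
  column a leading term. As both point in the same direction, spanning and independence hold for the
  same monomials, without a dimension count. The rank one matrices in question do not lie in the
  nilpotent algebra. They are elements of \<open>sp_odd n\<close>, and their upper triangular part
  is harmless since it does not raise the PBW degree. Such a matrix acts only through the columns
  with c <= height < r: it annihilates shorter columns, and on taller ones it acts by its trace,
  which is zero.\<close>

section \<open>The polytopes and their Minkowski sums\<close>

text \<open>One exchange that joins the largest first entry to the smallest second entry strictly
  lowers the sum of products, and the pair so obtained can be removed. This is the strict
  rearrangement inequality: an oppositely ordered pairing is the unique minimum.\<close>

lemma rearrangement_mset:
  fixes X Y :: "(nat \<times> nat) multiset"
  assumes "image_mset fst X = image_mset fst Y" "image_mset snd X = image_mset snd Y"
    and "\<And>p q. p \<in># Y \<Longrightarrow> q \<in># Y \<Longrightarrow> fst p < fst q \<Longrightarrow> snd q \<le> snd p"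
  shows "X = Y \<or> (\<Sum>p\<in>#Y. fst p * snd p) < (\<Sum>p\<in>#X. fst p * snd p)"
  using assms
proof (induction "size Y" arbitrary: X Y)
  case 0
  then show ?case by simp
next
  case (Suc k)
  then have ne: "set_mset Y \<noteq> {}" by auto
  define a where "a = Max (fst ` set_mset Y)"
  \<comment> \<open>Since \<open>Y\<close> is oppositely ordered, the least partner of the largest
    first entry is the least second entry of all.\<close>
  define b where "b = Min (snd ` {q \<in> set_mset Y. fst q = a})"
  have "a \<in> fst ` set_mset Y" unfolding a_def using ne by (intro Max_in) auto
  then have "{q \<in> set_mset Y. fst q = a} \<noteq> {}" by auto
  then have "b \<in> snd ` {q \<in> set_mset Y. fst q = a}" unfolding b_def by (intro Min_in) auto
  then have ab: "(a, b) \<in># Y" by auto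
  have amax: "fst q \<le> a" if "q \<in># Y" for q using that by (simp add: a_def)
  have bmin: "b \<le> snd q" if q: "q \<in># Y" for q
  proof (cases "fst q = a")
    case True
    then show ?thesis using q by (auto simp: b_def)
  next
    case False
    then show ?thesis using Suc.prems(3)[OF q ab] amax[OF q] by simp
  qed
  obtain Y' where Y': "Y = add_mset (a, b) Y'" using ab by (metis insert_DiffM)
  have anti': "fst p < fst q \<Longrightarrow> snd q \<le> snd p" if "p \<in># Y'" "q \<in># Y'" for p q
    using Suc.prems(3)[of p q] that by (simp add: Y')
  have k: "k = size Y'" using Suc.hyps(2) Y' by simp
  have amaxX: "fst q \<le> a" if "q \<in># X" for q
  proof -
    have "fst q \<in># image_mset fst Y" using that Suc.prems(1) by (metis imageI set_image_mset)
    then show ?thesis using amax by auto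
  qed
  have bminX: "b \<le> snd q" if "q \<in># X" for q
  proof -
    have "snd q \<in># image_mset snd Y" using that Suc.prems(2) by (metis imageI set_image_mset)
    then show ?thesis using bmin by auto
  qed
  show ?case
  proof (cases "(a, b) \<in># X")
    case True
    then obtain X' where X': "X = add_mset (a, b) X'" by (metis insert_DiffM)
    have "X' = Y' \<or> (\<Sum>p\<in>#Y'. fst p * snd p) < (\<Sum>p\<in>#X'. fst p * snd p)"
      by (rule Suc.hyps(1)) (use k Suc.prems X' Y' anti' in auto)
    then show ?thesis by (auto simp: X' Y')
  next
    case False
    have "a \<in># image_mset fst X" "b \<in># image_mset snd X"
      using ab unfolding Suc.prems by force+
    then obtain b1 a2 where X1: "(a, b1) \<in># X" and X2: "(a2, b) \<in># X" by auto
    have lt: "a2 < a" "b < b1"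
      using amaxX[OF X2] bminX[OF X1] False X1 X2 by (auto simp: le_less)
    have "(a2, b) \<in># X - {#(a, b1)#}" using X2 lt by (simp add: in_diff_count)
    then obtain X' where X': "X = add_mset (a, b1) (add_mset (a2, b) X')"
      using X1 by (metis insert_DiffM)
    \<comment> \<open>Exchanging the partners of (a, b1) and (a2, b) turns \<open>X\<close> into (a,
      b) together with \<open>?X\<close>.\<close>
    let ?X = "add_mset (a2, b1) X'"
    have "?X = Y' \<or> (\<Sum>p\<in>#Y'. fst p * snd p) < (\<Sum>p\<in>#?X. fst p * snd p)"
      by (rule Suc.hyps(1)) (use k Suc.prems X' Y' anti' in \<open>auto simp: add_mset_commute\<close>)
    then have le: "(\<Sum>p\<in>#Y'. fst p * snd p) \<le> (\<Sum>p\<in>#?X. fst p * snd p)" by auto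
    obtain d e where "a = a2 + Suc d" "b1 = b + Suc e"
      using lt by (metis add_Suc_right less_imp_Suc_add)
    then have "a * b + a2 * b1 < a * b1 + a2 * b" by (simp add: algebra_simps)
    then show ?thesis using le by (simp add: X' Y')
  qed
qed

text \<open>Order the basis as \<open>e_1, ..., e_n, e_(2n+1), e_(2n), ..., e_(n+1)\<close>. Then \<open>nt_minus n\<close> consists of strictly
  lower triangular matrices, and the entries at \<open>(r, c)\<close> and \<open>(2n+2-c, 2n+2-r)\<close> agree up to sign if
  \<open>c\<close> and \<open>2n+2-r\<close> are at most \<open>n\<close>. The set \<open>posB n\<close> contains one position of each such pair.\<close>

definition posB :: "nat \<Rightarrow> (nat \<times> nat) set" where
  "posB n = {(r, c). 1 \<le> c \<and> c \<le> n \<and> c < r \<and> r + c \<le> 2 * n + 2}"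

definition chain_mset :: "(nat \<times> nat) multiset \<Rightarrow> bool" where
  "chain_mset q \<longleftrightarrow> (\<forall>x\<in>#q. \<forall>y\<in>#q.
     fst x \<le> fst y \<and> snd x \<le> snd y \<or> fst y \<le> fst x \<and> snd y \<le> snd x)"

definition antichain_set :: "(nat \<times> nat) set \<Rightarrow> bool" where
  "antichain_set A \<longleftrightarrow> (\<forall>x\<in>A. \<forall>y\<in>A. x \<noteq> y \<longrightarrow> \<not> (fst x \<le> fst y \<and> snd x \<le> snd y))"

text \<open>The lattice points of a Feigin-Fourier-Littelmann polytope. Its Dyck paths are replaced by arbitrary
  chains of positions.\<close>

definition ffl :: "nat \<Rightarrow> (nat \<Rightarrow> nat \<Rightarrow> nat) \<Rightarrow> (nat \<times> nat) multiset set" where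
  "ffl n b = {s. set_mset s \<subseteq> posB n \<and>
     (\<forall>q c r. q \<subseteq># s \<longrightarrow> chain_mset q \<longrightarrow> (\<forall>x\<in>#q. c \<le> snd x \<and> fst x \<le> r) \<longrightarrow> size q \<le> b c r)}"

text \<open>The bound for chains with columns from c on and rows up to r. A diagram column of height
  h accommodates a position (x, y) if y <= h < x, which within these limits requires c <= h <
  r.\<close>

definition heights :: "'k set \<Rightarrow> ('k \<Rightarrow> nat) \<Rightarrow> nat \<Rightarrow> nat \<Rightarrow> nat" where
  "heights C ht c r = card {\<kappa> \<in> C. c \<le> ht \<kappa> \<and> ht \<kappa> < r}"

text \<open>Each \<open>A \<kappa>\<close> is a lattice point of the polytope of the fundamental
  weight of index \<open>ht \<kappa>\<close>; its positions move entries of that column out of the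
  column.\<close>

definition fund_family :: "nat \<Rightarrow> 'k set \<Rightarrow> ('k \<Rightarrow> nat) \<Rightarrow> ('k \<Rightarrow> (nat \<times> nat) set) \<Rightarrow> bool" where
  "fund_family n C ht A \<longleftrightarrow> (\<forall>\<kappa>\<in>C. finite (A \<kappa>) \<and> A \<kappa> \<subseteq> posB n \<and> antichain_set (A \<kappa>) \<and>
     (\<forall>x\<in>A \<kappa>. snd x \<le> ht \<kappa> \<and> ht \<kappa> < fst x))"

section \<open>Decomposition of lattice points into antichains\<close>

lemma ex_minimal_below:
  assumes "finite S" "x \<in> S"
  shows "\<exists>a\<in>S. fst a \<le> fst x \<and> snd a \<le> snd (x :: nat \<times> nat) \<and>
    (\<forall>y\<in>S. fst y \<le> fst a \<and> snd y \<le> snd a \<longrightarrow> y = a)"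
  using assms(2)
proof (induction "fst x + snd x" arbitrary: x rule: less_induct)
  case less
  show ?case
  proof (cases "\<exists>y\<in>S. fst y \<le> fst x \<and> snd y \<le> snd x \<and> y \<noteq> x")
    case True
    then obtain y where y: "y \<in> S" "fst y \<le> fst x" "snd y \<le> snd x" "y \<noteq> x" by blast
    then have "fst y + snd y < fst x + snd x" by (cases x; cases y) auto
    from less(1)[OF this y(1)] y show ?thesis by (meson order_trans)
  next
    case False
    then show ?thesis using less.prems by blast
  qed
qed

lemma chain_has_min:
  assumes "chain_mset q" "q \<noteq> {#}"
  shows "\<exists>x\<in>#q. \<forall>y\<in>#q. fst x \<le> fst y \<and> snd x \<le> snd y"
proof -
  obtain x0 where "x0 \<in># q" using assms(2) by auto
  from ex_minimal_below[OF finite_set_mset this] obtain a where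
    a: "a \<in># q" "\<forall>y\<in>#q. fst y \<le> fst a \<and> snd y \<le> snd a \<longrightarrow> y = a" by blast
  then show ?thesis using assms(1) unfolding chain_mset_def by (metis order_refl)
qed

lemma heights_insert:
  assumes "finite C" "\<kappa> \<notin> C"
  shows "heights (insert \<kappa> C) ht c r = heights C ht c r + (if c \<le> ht \<kappa> \<and> ht \<kappa> < r then 1 else 0)"
proof (cases "c \<le> ht \<kappa> \<and> ht \<kappa> < r")
  case True
  then have "{\<kappa>' \<in> insert \<kappa> C. c \<le> ht \<kappa>' \<and> ht \<kappa>' < r} = insert \<kappa> {\<kappa> \<in> C. c \<le> ht \<kappa> \<and> ht \<kappa> < r}"
    by auto
  then show ?thesis using assms True by (simp add: heights_def)
next
  case False
  then have "{\<kappa>' \<in> insert \<kappa> C. c \<le> ht \<kappa>' \<and> ht \<kappa>' < r} = {\<kappa> \<in> C. c \<le> ht \<kappa> \<and> ht \<kappa> < r}"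
    by auto
  then show ?thesis using False by (simp add: heights_def)
qed

text \<open>Greedy choice: a column of least height takes the minimal positions that fit it. A
  remaining chain within limits that count this column can be prolonged by a removed position, or it
  begins beyond the height of the column; in both cases it obeys the bound without that
  column.\<close>

lemma ffl_decompose:
  assumes "finite C" "s \<in> ffl n (heights C ht)"
  shows "\<exists>A. fund_family n C ht A \<and> s = (\<Sum>\<kappa>\<in>C. mset_set (A \<kappa>))"
  using assms
proof (induction "card C" arbitrary: C s)
  case 0
  then have C: "C = {}" by simp
  have "x \<notin># s" for x
  proof
    assume x: "x \<in># s"
    have "size {#x#} \<le> heights C ht (snd x) (fst x)"
    proof -
      have "{#x#} \<subseteq># s" "chain_mset {#x#}" using x by (auto simp: chain_mset_def)
      then show ?thesis
        using 0(3)[unfolded ffl_def, simplified, THEN conjunct2, rule_format, of "{#x#}" "snd x" "fst x"]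
        by simp
    qed
    then show False by (simp add: C heights_def)
  qed
  then have "s = {#}" by (metis multiset_nonemptyE)
  then show ?case using C by (auto simp: fund_family_def)
next
  case (Suc k)
  then have "C \<noteq> {}" by auto
  then obtain \<kappa>0 where \<kappa>0: "\<kappa>0 \<in> C" "\<And>\<kappa>. \<kappa> \<in> C \<Longrightarrow> ht \<kappa>0 \<le> ht \<kappa>"
    using ex_min_if_finite[of "ht ` C"] Suc.prems(1)
    by (smt (verit) finite_imageI image_iff image_is_empty linorder_not_le)
  have sB: "set_mset s \<subseteq> posB n" and
    bnd: "\<And>q c r. q \<subseteq># s \<Longrightarrow> chain_mset q \<Longrightarrow> (\<And>x. x \<in># q \<Longrightarrow> c \<le> snd x \<and> fst x \<le> r) \<Longrightarrow>
      size q \<le> heights C ht c r"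
    using Suc.prems(2) unfolding ffl_def by auto
  \<comment> \<open>That the rows exceed \<open>ht \<kappa>0\<close> is true for all positions of
    \<open>s\<close>; this is \<open>reg\<close>.\<close>
  define A where "A = {x \<in> set_mset s. snd x \<le> ht \<kappa>0 \<and>
    (\<forall>y\<in>#s. fst y \<le> fst x \<and> snd y \<le> snd x \<longrightarrow> y = x)}"
  have finA: "finite A" by (simp add: A_def)
  have AB: "A \<subseteq> posB n" using sB by (auto simp: A_def)
  have anti: "antichain_set A" by (auto simp: antichain_set_def A_def)
  have reg: "ht \<kappa>0 < fst x" if "x \<in># s" for x
  proof (rule ccontr)
    assume "\<not> ?thesis"
    then have "{\<kappa> \<in> C. snd x \<le> ht \<kappa> \<and> ht \<kappa> < fst x} = {}" using \<kappa>0 by force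
    moreover have "size {#x#} \<le> heights C ht (snd x) (fst x)"
      by (rule bnd) (use that in \<open>auto simp: chain_mset_def\<close>)
    ultimately show False by (metis card.empty heights_def not_one_le_zero size_single)
  qed
  have Asub: "mset_set A \<subseteq># s"
  proof (rule mset_subset_eqI)
    fix x show "count (mset_set A) x \<le> count s x"
      by (cases "x \<in> A") (auto simp: finA A_def Suc_le_eq)
  qed
  have hC: "heights C ht c r = heights (C - {\<kappa>0}) ht c r + (if c \<le> ht \<kappa>0 \<and> ht \<kappa>0 < r then 1 else 0)" for c r
    using heights_insert[of "C - {\<kappa>0}" \<kappa>0 ht c r] Suc.prems(1) \<kappa>0(1) by (simp add: insert_absorb)
  have s': "s - mset_set A \<in> ffl n (heights (C - {\<kappa>0}) ht)"
  proof -
    have "size q \<le> heights (C - {\<kappa>0}) ht c r"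
      if q: "q \<subseteq># s - mset_set A" "chain_mset q" "\<And>x. x \<in># q \<Longrightarrow> c \<le> snd x \<and> fst x \<le> r" for q c r
    proof -
      have qs: "q \<subseteq># s" using q(1) by (meson diff_subset_eq_self subset_mset.order_trans)
      have qA: "q + mset_set A \<subseteq># s" using q(1) Asub
        by (metis mset_subset_eq_mono_add_right_cancel subset_mset.diff_add)
      consider (a) "\<not> (c \<le> ht \<kappa>0 \<and> ht \<kappa>0 < r)" | (b) "q = {#}" |
        (c) "c \<le> ht \<kappa>0" "ht \<kappa>0 < r" "q \<noteq> {#}" by blast
      then show ?thesis
      proof cases
        case a
        then show ?thesis using bnd[OF qs q(2,3)] hC[of c r] by (simp split: if_splits)
      next
        case b
        then show ?thesis by simp
      next
        case c
        obtain x where x: "x \<in># q" "\<And>y. y \<in># q \<Longrightarrow> fst x \<le> fst y \<and> snd x \<le> snd y"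
          using chain_has_min[OF q(2) c(3)] by blast
        show ?thesis
        proof (cases "snd x \<le> ht \<kappa>0")
          case False
          \<comment> \<open>The chain begins beyond the height of \<open>\<kappa>0\<close>, so
            tightening \<open>c\<close> to \<open>snd x\<close> excludes \<open>\<kappa>0\<close>
            from the count.\<close>
          have "size q \<le> heights C ht (snd x) r"
            by (rule bnd[OF qs q(2)]) (use x q(3) in auto)
          also have "\<dots> \<le> heights (C - {\<kappa>0}) ht c r"
            unfolding heights_def using False q(3)[OF x(1)] Suc.prems(1)
            by (intro card_mono) auto
          finally show ?thesis .
        next
          case True
          have xs: "x \<in># s" using x(1) qs by (meson mset_subset_eqD)
          from ex_minimal_below[OF finite_set_mset xs] obtain a where
            a: "a \<in># s" "fst a \<le> fst x" "snd a \<le> snd x"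
              "\<forall>y\<in>#s. fst y \<le> fst a \<and> snd y \<le> snd a \<longrightarrow> y = a" by blast
          then have aA: "a \<in> A" using True by (auto simp: A_def)
          have "{#a#} \<subseteq># mset_set A" using aA finA by simp
          \<comment> \<open>One copy of \<open>a\<close> has been removed from \<open>s\<close>, so
            it is available to be put below \<open>q\<close>.\<close>
          then have "add_mset a q \<subseteq># s"
            using qA by (metis add_mset_add_single mset_subset_eq_mono_add subset_mset.order_refl subset_mset.order_trans)
          then have "size (add_mset a q) \<le> heights C ht (snd a) r"
          proof (rule bnd)
            have le: "fst a \<le> fst y \<and> snd a \<le> snd y" if "y \<in># q" for y
              using x(2)[OF that] a by auto
            then show "chain_mset (add_mset a q)"
              using q(2) unfolding chain_mset_def by auto
            show "\<And>y. y \<in># add_mset a q \<Longrightarrow> snd a \<le> snd y \<and> fst y \<le> r"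
              using le q(3)[OF x(1)] q(3) a(2) by (metis le_trans order_refl set_mset_add_mset_insert insertE)
          qed
          \<comment> \<open>Both \<open>snd a\<close> and \<open>c\<close> are at most the least
            height, so neither excludes a column.\<close>
          also have "\<dots> = heights C ht c r"
          proof -
            have "snd a \<le> ht \<kappa>" "c \<le> ht \<kappa>" if "\<kappa> \<in> C" for \<kappa>
              using \<kappa>0(2)[OF that] a(3) True c(1) by auto
            then show ?thesis unfolding heights_def by (metis (mono_tags, lifting))
          qed
          finally show ?thesis using hC[of c r] c by simp
        qed
      qed
    qed
    moreover have "set_mset (s - mset_set A) \<subseteq> posB n" using sB by (meson in_diffD subset_iff)
    ultimately show ?thesis by (auto simp: ffl_def)
  qed
  have "k = card (C - {\<kappa>0})" using Suc.hyps(2) \<kappa>0(1) by simp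
  from Suc.hyps(1)[OF this _ s'] Suc.prems(1) obtain A' where
    A': "fund_family n (C - {\<kappa>0}) ht A'" "s - mset_set A = (\<Sum>\<kappa>\<in>C - {\<kappa>0}. mset_set (A' \<kappa>))" by blast
  let ?A = "A'(\<kappa>0 := A)"
  have "fund_family n C ht ?A"
    using A'(1) finA AB anti reg by (auto simp: fund_family_def A_def)
  moreover have "(\<Sum>\<kappa>\<in>C. mset_set (?A \<kappa>)) = mset_set A + (\<Sum>\<kappa>\<in>C - {\<kappa>0}. mset_set (A' \<kappa>))"
    using sum.remove[OF Suc.prems(1) \<kappa>0(1), of "\<lambda>\<kappa>. mset_set (?A \<kappa>)"] by auto
  ultimately show ?case using A'(2) Asub by (metis subset_mset.add_diff_inverse)
qed

text \<open>A chain meets an antichain at most once, and a common position x of column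
  \<open>\<kappa>\<close> gives c <= \<open>snd x\<close> <= \<open>ht \<kappa>\<close> <
  \<open>fst x\<close> <= r, so that \<open>\<kappa>\<close> is counted.\<close>

lemma fund_family_sum_ffl:
  assumes "finite C" "fund_family n C ht A"
  shows "(\<Sum>\<kappa>\<in>C. mset_set (A \<kappa>)) \<in> ffl n (heights C ht)"
proof -
  have B: "set_mset (\<Sum>\<kappa>\<in>C. mset_set (A \<kappa>)) \<subseteq> posB n"
    using assms by (induction C) (auto simp: fund_family_def)
  have "size q \<le> heights C ht c r"
    if "q \<subseteq># (\<Sum>\<kappa>\<in>C. mset_set (A \<kappa>))" "chain_mset q" "\<forall>x\<in>#q. c \<le> snd x \<and> fst x \<le> r" for q c r
    using assms that
  proof (induction C arbitrary: q)
    case empty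
    then show ?case by simp
  next
    case (insert \<kappa> C)
    let ?S = "\<Sum>\<kappa>\<in>C. mset_set (A \<kappa>)"
    define q1 where "q1 = q - mset_set (A \<kappa>)"
    define q2 where "q2 = q \<inter># mset_set (A \<kappa>)"
    have q: "q = q1 + q2" unfolding q1_def q2_def by (metis add_diff_cancel_right' diff_intersect_left_idem subset_mset.diff_add subset_mset.inf_le1)
    have A: "finite (A \<kappa>)" "antichain_set (A \<kappa>)" "\<forall>x\<in>A \<kappa>. snd x \<le> ht \<kappa> \<and> ht \<kappa> < fst x"
      using insert.prems(1) by (auto simp: fund_family_def)
    have "q \<subseteq># mset_set (A \<kappa>) + ?S" using insert by simp
    then have "q1 \<subseteq># ?S" unfolding q1_def by (metis subset_eq_diff_conv add.commute)
    moreover have "chain_mset q1" "\<forall>x\<in>#q1. c \<le> snd x \<and> fst x \<le> r"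
      using insert.prems(3,4) unfolding chain_mset_def q by auto
    moreover have "fund_family n C ht A" using insert.prems(1) by (auto simp: fund_family_def)
    ultimately have 1: "size q1 \<le> heights C ht c r" using insert.IH by blast
    have q2A: "x \<in> A \<kappa>" if "x \<in># q2" for x
      using that A(1) by (auto simp: q2_def)
    have q2c: "count q2 x \<le> 1" for x
      using A(1) by (simp add: q2_def count_mset_set')
    have 2: "size q2 \<le> (if c \<le> ht \<kappa> \<and> ht \<kappa> < r then 1 else 0)"
    proof (cases "q2 = {#}")
      case False
      then obtain x where x: "x \<in># q2" by auto
      have "y = x" if "y \<in># q2" for y
        using q2A[OF x] q2A[OF that] A(2) insert.prems(3) x that
        unfolding antichain_set_def chain_mset_def q by (metis union_iff)
      then have "set_mset q2 = {x}" using x by blast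
      then have "size q2 = count q2 x" by (simp add: size_multiset_overloaded_eq)
      moreover have "c \<le> snd x" "fst x \<le> r" using insert.prems(4) x q by auto
      then have "c \<le> ht \<kappa>" "ht \<kappa> < r" using A(3) q2A[OF x] by auto
      ultimately show ?thesis using q2c[of x] by simp
    qed simp
    then show ?case using 1 2 q heights_insert[OF insert.hyps, of ht c r] by simp
  qed
  then show ?thesis using B by (auto simp: ffl_def)
qed

section \<open>Columns of a diagram and the Minkowski property\<close>

definition bnd :: "nat \<Rightarrow> (nat \<Rightarrow> nat) \<Rightarrow> nat \<Rightarrow> nat \<Rightarrow> nat" where
  "bnd n m c r = (\<Sum>h | 1 \<le> h \<and> h \<le> n \<and> c \<le> h \<and> h < r. m h)"

definition cols :: "nat \<Rightarrow> (nat \<Rightarrow> nat) \<Rightarrow> (nat \<times> nat) set" where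
  "cols n m = {(h, i). 1 \<le> h \<and> h \<le> n \<and> i < m h}"

lemma cols_Sigma: "cols n m = (SIGMA h:{1..n}. {..<m h})"
  by (auto simp: cols_def)

lemma finite_cols: "finite (cols n m)"
  by (simp add: cols_Sigma)

lemma heights_cols: "heights (cols n m) fst = bnd n m"
proof (intro ext)
  fix c r
  have "{\<kappa> \<in> cols n m. c \<le> fst \<kappa> \<and> fst \<kappa> < r} = (SIGMA h:{h. 1 \<le> h \<and> h \<le> n \<and> c \<le> h \<and> h < r}. {..<m h})"
    by (auto simp: cols_def)
  then show "heights (cols n m) fst c r = bnd n m c r"
    by (simp add: heights_def bnd_def)
qed

lemma bnd_add: "bnd n (\<lambda>i. m i + m' i) c r = bnd n m c r + bnd n m' c r"
  by (simp add: bnd_def sum.distrib)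

text \<open>Decompose along the columns of both diagrams together and sort the antichains by the
  diagram their column belongs to.\<close>

lemma ffl_split:
  assumes "s \<in> ffl n (bnd n (\<lambda>i. m i + m' i))"
  shows "\<exists>s1\<in>ffl n (bnd n m). \<exists>s2\<in>ffl n (bnd n m'). s = s1 + s2"
proof -
  let ?C1 = "Inl ` cols n m :: (nat \<times> nat + nat \<times> nat) set" and ?C2 = "Inr ` cols n m'"
  let ?ht = "\<lambda>\<kappa>. case \<kappa> of Inl x \<Rightarrow> fst x | Inr x \<Rightarrow> fst x"
  have "heights (?C1 \<union> ?C2) ?ht = bnd n (\<lambda>i. m i + m' i)"
  proof (intro ext)
    fix c r
    have "{\<kappa> \<in> ?C1 \<union> ?C2. c \<le> ?ht \<kappa> \<and> ?ht \<kappa> < r} =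
       Inl ` {x \<in> cols n m. c \<le> fst x \<and> fst x < r} \<union> Inr ` {x \<in> cols n m'. c \<le> fst x \<and> fst x < r}"
      by auto
    moreover have "card \<dots> = card {x \<in> cols n m. c \<le> fst x \<and> fst x < r} + card {x \<in> cols n m'. c \<le> fst x \<and> fst x < r}"
      by (subst card_Un_disjoint) (auto simp: finite_cols card_image)
    ultimately show "heights (?C1 \<union> ?C2) ?ht c r = bnd n (\<lambda>i. m i + m' i) c r"
      unfolding bnd_add unfolding heights_cols[symmetric] by (simp add: heights_def)
  qed
  then obtain A where A: "fund_family n (?C1 \<union> ?C2) ?ht A" "s = (\<Sum>\<kappa>\<in>?C1 \<union> ?C2. mset_set (A \<kappa>))"
    using ffl_decompose[of "?C1 \<union> ?C2" s n ?ht] assms by (auto simp: finite_cols)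
  have "s = (\<Sum>\<kappa>\<in>?C1. mset_set (A \<kappa>)) + (\<Sum>\<kappa>\<in>?C2. mset_set (A \<kappa>))"
    unfolding A(2) by (rule sum.union_disjoint) (auto simp: finite_cols)
  then have "s = (\<Sum>\<kappa>\<in>cols n m. mset_set ((A \<circ> Inl) \<kappa>)) + (\<Sum>\<kappa>\<in>cols n m'. mset_set ((A \<circ> Inr) \<kappa>))"
    by (simp add: sum.reindex)
  moreover have "fund_family n (cols n m) fst (A \<circ> Inl)" "fund_family n (cols n m') fst (A \<circ> Inr)"
    using A(1) unfolding fund_family_def by fastforce+
  ultimately show ?thesis
    using fund_family_sum_ffl[OF finite_cols] by (metis heights_cols)
qed

section \<open>Cyclic modules over the symmetric algebra\<close>

definition fcarrier :: "('a \<Rightarrow> complex) set \<Rightarrow> 'a free_poly set" where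
  "fcarrier W = {p. \<forall>K\<in>Poly_Mapping.keys p. set_mset K \<subseteq> W}"

lemma fcarrier_zero: "0 \<in> fcarrier W"
  by (simp add: fcarrier_def)

lemma fcarrier_one: "1 \<in> fcarrier W"
  by (simp add: fcarrier_def flip: single_one)

lemma fcarrier_add: "p \<in> fcarrier W \<Longrightarrow> q \<in> fcarrier W \<Longrightarrow> p + q \<in> fcarrier W"
  using keys_add[of p q] by (auto simp: fcarrier_def)

lemma fcarrier_uminus: "p \<in> fcarrier W \<Longrightarrow> - p \<in> fcarrier W"
  by (simp add: fcarrier_def)

lemma fcarrier_diff: "p \<in> fcarrier W \<Longrightarrow> q \<in> fcarrier W \<Longrightarrow> p - q \<in> fcarrier W"
  using fcarrier_add[of p W "- q"] fcarrier_uminus[of q W] by simp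

lemma fcarrier_single: "set_mset K \<subseteq> W \<Longrightarrow> Poly_Mapping.single K c \<in> fcarrier W"
  by (simp add: fcarrier_def)

lemma fcarrier_mult:
  assumes "p \<in> fcarrier W" "q \<in> fcarrier W"
  shows "p * q \<in> fcarrier W"
  unfolding fcarrier_def
proof safe
  fix K x assume "K \<in> Poly_Mapping.keys (p * q)" "x \<in># K"
  then obtain a b where "a \<in> Poly_Mapping.keys p" "b \<in> Poly_Mapping.keys q" "K = a + b"
    using keys_mult[of p q] by auto
  then show "x \<in> W" using assms \<open>x \<in># K\<close> by (auto simp: fcarrier_def)
qed

lemma fcarrier_sum: "(\<And>i. i \<in> I \<Longrightarrow> g i \<in> fcarrier W) \<Longrightarrow> sum g I \<in> fcarrier W"
  by (induction I rule: infinite_finite_induct) (auto simp: fcarrier_zero fcarrier_add)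

lemma fcarrier_power: "p \<in> fcarrier W \<Longrightarrow> p ^ k \<in> fcarrier W"
  by (induction k) (auto simp: fcarrier_one fcarrier_mult)

lemma fcarrier_induct [consumes 1, case_names zero single add]:
  assumes "p \<in> fcarrier W" and "P 0"
    and "\<And>K c. set_mset K \<subseteq> W \<Longrightarrow> P (Poly_Mapping.single K c)"
    and "\<And>p q. p \<in> fcarrier W \<Longrightarrow> q \<in> fcarrier W \<Longrightarrow> P p \<Longrightarrow> P q \<Longrightarrow> P (p + q)"
  shows "P p"
proof (rule update_induct[of "\<lambda>p. p \<in> fcarrier W \<longrightarrow> P p", THEN mp, OF _ _ assms(1)])
  show "0 \<in> fcarrier W \<longrightarrow> P 0" using assms(2) by simp
next
  fix f :: "'a free_poly" and a and b :: complex
  assume ab: "a \<notin> Poly_Mapping.keys f" "b \<noteq> 0" "f \<in> fcarrier W \<longrightarrow> P f"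
  have u: "Poly_Mapping.update a b f = f + Poly_Mapping.single a b"
    using ab(1) by (intro poly_mapping_eqI)
      (auto simp: lookup_update lookup_add lookup_single in_keys_iff)
  have k: "Poly_Mapping.keys (Poly_Mapping.update a b f) = insert a (Poly_Mapping.keys f)"
    using ab(2) by (simp add: keys_update)
  show "Poly_Mapping.update a b f \<in> fcarrier W \<longrightarrow> P (Poly_Mapping.update a b f)"
  proof
    assume "Poly_Mapping.update a b f \<in> fcarrier W"
    then have "set_mset a \<subseteq> W" "f \<in> fcarrier W" using k by (auto simp: fcarrier_def)
    then show "P (Poly_Mapping.update a b f)" unfolding u using ab(3) assms(3,4) fcarrier_single by metis
  qed
qed

lemma carrier_free: "carrier (free_comm_algebra W) = fcarrier W"
  by (simp add: free_comm_algebra_def fcarrier_def)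

lemma free_ops:
  "add (free_comm_algebra W) = (+)" "mult (free_comm_algebra W) = (*)"
  "zero (free_comm_algebra W) = 0" "one (free_comm_algebra W) = 1"
  by (simp_all add: free_comm_algebra_def)

lemma cring_free: "cring (free_comm_algebra W)"
proof (rule cringI)
  show "abelian_group (free_comm_algebra W)"
  proof (rule abelian_groupI, unfold carrier_free free_ops)
    show "\<exists>q\<in>fcarrier W. q + p = 0" if "p \<in> fcarrier W" for p
      using fcarrier_uminus[OF that] by (intro bexI[of _ "- p"]) auto
  qed (auto simp: fcarrier_zero fcarrier_add add.assoc add.commute)
  show "Group.comm_monoid (free_comm_algebra W)"
    by (rule comm_monoidI; unfold carrier_free free_ops)
      (auto simp: fcarrier_one fcarrier_mult mult.assoc mult.commute)
qed (auto simp: free_ops distrib_right)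

lemma a_inv_free:
  assumes "p \<in> fcarrier W"
  shows "a_inv (free_comm_algebra W) p = - p"
proof -
  interpret cring "free_comm_algebra W" by (rule cring_free)
  show ?thesis
    by (rule sum_zero_eq_neg[symmetric])
      (use assms fcarrier_uminus in \<open>auto simp: carrier_free free_ops\<close>)
qed

lemma linear_relations_fcarrier:
  assumes "cfun.subspace W"
  shows "linear_relations W \<subseteq> fcarrier W"
proof -
  have "Poly_Mapping.single {#x + y#} 1 - Poly_Mapping.single {#x#} 1 - Poly_Mapping.single {#y#} 1 \<in> fcarrier W"
    if "x \<in> W" "y \<in> W" for x y
    using that assms by (intro fcarrier_diff fcarrier_single) (auto intro: cfun.subspace_add)
  moreover have "Poly_Mapping.single {#cscale c x#} 1 - Poly_Mapping.single {#x#} c \<in> fcarrier W"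
    if "x \<in> W" for c x
    using that assms by (intro fcarrier_diff fcarrier_single) (auto intro: cfun.subspace_scale)
  ultimately show ?thesis by (auto simp: linear_relations_def)
qed

text \<open>Names the choice made inside \<open>poly_act\<close>, so that it can be reasoned
  about.\<close>

definition mset_list :: "'b multiset \<Rightarrow> 'b list" where
  "mset_list K = (SOME xs. mset xs = K)"

lemma mset_mset_list: "mset (mset_list K) = K"
  unfolding mset_list_def by (rule someI_ex) (rule ex_mset)

lemma set_mset_list: "set (mset_list K) = set_mset K"
  by (metis mset_mset_list set_mset_mset)

text \<open>\<open>M\<close> is presented as the quotient \<open>Z / Z0\<close> with projection \<open>pr\<close>, so that one can compute with
  representatives instead of cosets.\<close>

locale op_pres = vector_space scale
  for scale :: "complex \<Rightarrow> 'z \<Rightarrow> 'z :: ab_group_add" +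
  fixes W :: "('a \<Rightarrow> complex) set" and Z Z0 :: "'z set"
    and op :: "('a \<Rightarrow> complex) \<Rightarrow> 'z \<Rightarrow> 'z"
    and M :: "('a \<Rightarrow> complex, 'm) op_space" and pr :: "'z \<Rightarrow> 'm"
  assumes W: "cfun.subspace W" and Z: "subspace Z" and Z0: "subspace Z0" and Z0_sub: "Z0 \<subseteq> Z"
    and op_closed: "x \<in> W \<Longrightarrow> z \<in> Z \<Longrightarrow> op x z \<in> Z"
    and op_Z0: "x \<in> W \<Longrightarrow> z \<in> Z0 \<Longrightarrow> op x z \<in> Z0"
    and op_add: "x \<in> W \<Longrightarrow> z \<in> Z \<Longrightarrow> z' \<in> Z \<Longrightarrow> op x (z + z') = op x z + op x z'"
    and op_scale: "x \<in> W \<Longrightarrow> z \<in> Z \<Longrightarrow> op x (scale c z) = scale c (op x z)"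
    and op_plus: "x \<in> W \<Longrightarrow> y \<in> W \<Longrightarrow> z \<in> Z \<Longrightarrow> op (x + y) z - (op x z + op y z) \<in> Z0"
    and op_cscale: "x \<in> W \<Longrightarrow> z \<in> Z \<Longrightarrow> op (cscale c x) z - scale c (op x z) \<in> Z0"
    and op_comm: "x \<in> W \<Longrightarrow> y \<in> W \<Longrightarrow> z \<in> Z \<Longrightarrow> op x (op y z) - op y (op x z) \<in> Z0"
    and carrier_M: "carrier M = pr ` Z"
    and pr_eq: "z \<in> Z \<Longrightarrow> z' \<in> Z \<Longrightarrow> pr z = pr z' \<longleftrightarrow> z - z' \<in> Z0"
    and zero_M: "zero M = pr 0"
    and add_M: "z \<in> Z \<Longrightarrow> z' \<in> Z \<Longrightarrow> add M (pr z) (pr z') = pr (z + z')"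
    and smult_M: "z \<in> Z \<Longrightarrow> smult M c (pr z) = pr (scale c z)"
    and act_M: "x \<in> W \<Longrightarrow> z \<in> Z \<Longrightarrow> act M x (pr z) = pr (op x z)"
begin

lemmas Z_simps = subspace_0[OF Z] subspace_add[OF Z] subspace_scale[OF Z] subspace_diff[OF Z]
  subspace_neg[OF Z] subspace_sum[OF Z]
lemmas Z0_simps = subspace_0[OF Z0] subspace_add[OF Z0] subspace_scale[OF Z0] subspace_diff[OF Z0]
  subspace_neg[OF Z0] subspace_sum[OF Z0]

lemma pr_zero_iff: "z \<in> Z \<Longrightarrow> pr z = pr 0 \<longleftrightarrow> z \<in> Z0"
  using pr_eq[of z 0] Z_simps(1) by simp

lemma foldr_closed: "set xs \<subseteq> W \<Longrightarrow> z \<in> Z \<Longrightarrow> foldr op xs z \<in> Z"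
  by (induction xs) (auto intro: op_closed)

lemma foldr_Z0: "set xs \<subseteq> W \<Longrightarrow> z \<in> Z0 \<Longrightarrow> foldr op xs z \<in> Z0"
  by (induction xs) (auto intro: op_Z0)

lemma foldr_add: "set xs \<subseteq> W \<Longrightarrow> z \<in> Z \<Longrightarrow> z' \<in> Z \<Longrightarrow>
    foldr op xs (z + z') = foldr op xs z + foldr op xs z'"
  by (induction xs) (auto simp: op_add foldr_closed)

lemma foldr_scale: "set xs \<subseteq> W \<Longrightarrow> z \<in> Z \<Longrightarrow> foldr op xs (scale c z) = scale c (foldr op xs z)"
  by (induction xs) (auto simp: op_scale foldr_closed)

lemma act_foldr: "set xs \<subseteq> W \<Longrightarrow> z \<in> Z \<Longrightarrow> foldr (act M) xs (pr z) = pr (foldr op xs z)"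
  by (induction xs) (auto simp: act_M foldr_closed)

lemma act_closed: "x \<in> W \<Longrightarrow> u \<in> carrier M \<Longrightarrow> act M x u \<in> carrier M"
  by (auto simp: carrier_M act_M op_closed)

lemma act_comm:
  assumes "x \<in> W" "y \<in> W" "u \<in> carrier M"
  shows "act M x (act M y u) = act M y (act M x u)"
proof -
  obtain z where z: "z \<in> Z" "u = pr z" using assms by (auto simp: carrier_M)
  have "pr (op x (op y z)) = pr (op y (op x z))"
    using pr_eq op_comm[OF assms(1,2) z(1)] op_closed z(1) assms by simp
  then show ?thesis using z assms by (simp add: act_M op_closed)
qed

lemma foldr_act_closed: "set xs \<subseteq> W \<Longrightarrow> u \<in> carrier M \<Longrightarrow> foldr (act M) xs u \<in> carrier M"
  by (induction xs) (auto intro: act_closed)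

lemma foldr_act_move: "set xs \<subseteq> W \<Longrightarrow> x \<in> W \<Longrightarrow> u \<in> carrier M \<Longrightarrow>
    foldr (act M) xs (act M x u) = act M x (foldr (act M) xs u)"
  by (induction xs) (auto simp: act_comm foldr_act_closed)

lemma foldr_act_mset:
  "mset xs = mset ys \<Longrightarrow> set xs \<subseteq> W \<Longrightarrow> u \<in> carrier M \<Longrightarrow> foldr (act M) xs u = foldr (act M) ys u"
proof (induction xs arbitrary: ys)
  case Nil
  then show ?case by simp
next
  case (Cons x xs)
  then have "x \<in> set ys" by (metis list.set_intros(1) set_mset_mset)
  then obtain as bs where ys: "ys = as @ x # bs" by (meson split_list)
  have m: "mset xs = mset (as @ bs)" using Cons.prems(1) ys by simp
  have "set xs = set (as @ bs)" using m by (metis set_mset_mset)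
  then have sub: "set as \<subseteq> W" "set bs \<subseteq> W" "set xs \<subseteq> W" "x \<in> W"
    using Cons.prems(2) by auto
  have "foldr (act M) (x # xs) u = act M x (foldr (act M) (as @ bs) u)"
    using Cons.IH[OF m sub(3) Cons.prems(3)] by simp
  also have "\<dots> = foldr (act M) ys u"
    using sub Cons.prems(3) by (simp add: ys foldr_act_move foldr_act_closed)
  finally show ?case .
qed

lemma foldr_mset:
  assumes "mset xs = mset ys" "set xs \<subseteq> W" "z \<in> Z"
  shows "foldr op xs z - foldr op ys z \<in> Z0"
proof -
  have ys: "set ys \<subseteq> W" using assms by (metis set_mset_mset)
  have "pr (foldr op xs z) = pr (foldr op ys z)"
    using foldr_act_mset[OF assms(1,2), of "pr z"] assms ys by (simp add: act_foldr carrier_M)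
  then show ?thesis using pr_eq foldr_closed assms ys by simp
qed

section \<open>Action of polynomials on representatives, and annihilators\<close>

definition pact :: "'a free_poly \<Rightarrow> 'z \<Rightarrow> 'z" where
  "pact p z = (\<Sum>K\<in>Poly_Mapping.keys p. scale (Poly_Mapping.lookup p K) (foldr op (mset_list K) z))"

lemma pact_zero: "pact 0 z = 0"
  by (simp add: pact_def)

lemma pact_single: "pact (Poly_Mapping.single K c) z = scale c (foldr op (mset_list K) z)"
  by (cases "c = 0") (auto simp: pact_def)

lemma pact_add: "pact (p + q) z = pact p z + pact q z"
  unfolding pact_def by (rule setsum_keys_plus_distrib) (auto simp: scale_left_distrib)

lemma pact_uminus: "pact (- p) z = - pact p z"
  using pact_add[of p "- p" z] by (simp add: pact_zero minus_unique)

lemma pact_diff: "pact (p - q) z = pact p z - pact q z"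
  using pact_add[of p "- q" z] by (simp add: pact_uminus)

lemma pact_closed: "p \<in> fcarrier W \<Longrightarrow> z \<in> Z \<Longrightarrow> pact p z \<in> Z"
  unfolding pact_def
  by (intro Z_simps foldr_closed) (auto simp: fcarrier_def set_mset_list)

lemma pact_Z0: "p \<in> fcarrier W \<Longrightarrow> z \<in> Z0 \<Longrightarrow> pact p z \<in> Z0"
  unfolding pact_def
  by (intro Z0_simps foldr_Z0) (auto simp: fcarrier_def set_mset_list)

lemma pact_add_right:
  "p \<in> fcarrier W \<Longrightarrow> z \<in> Z \<Longrightarrow> z' \<in> Z \<Longrightarrow> pact p (z + z') = pact p z + pact p z'"
  unfolding pact_def sum.distrib[symmetric]
  by (intro sum.cong) (auto simp: foldr_add fcarrier_def set_mset_list scale_right_distrib)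

lemma pact_scale_right:
  "p \<in> fcarrier W \<Longrightarrow> z \<in> Z \<Longrightarrow> pact p (scale c z) = scale c (pact p z)"
  unfolding pact_def scale_sum_right
  by (intro sum.cong) (auto simp: foldr_scale fcarrier_def set_mset_list)

text \<open>The chosen list of K + L need not be that of K followed by that of L, and
  \<open>op\<close> commutes on representatives only modulo \<open>Z0\<close>; hence a congruence
  instead of an equation.\<close>

lemma pact_mult:
  assumes "p \<in> fcarrier W" "q \<in> fcarrier W" "z \<in> Z"
  shows "pact (p * q) z - pact p (pact q z) \<in> Z0"
  using assms(1)
proof (induction p rule: fcarrier_induct)
  case zero
  then show ?case by (simp add: pact_zero Z0_simps)
next
  case (single K c)
  show ?case using assms(2)
  proof (induction q rule: fcarrier_induct)
    case zero
    then show ?case using pact_scale_right[OF fcarrier_single[OF single] Z_simps(1), of c 0]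
      by (simp add: pact_zero Z0_simps(1))
  next
    case (single L d)
    let ?KL = "mset_list (K + L)"
    have "foldr op ?KL z - foldr op (mset_list K @ mset_list L) z \<in> Z0"
      by (rule foldr_mset)
        (use \<open>set_mset K \<subseteq> W\<close> single assms(3) in \<open>auto simp: mset_mset_list set_mset_list\<close>)
    then have "scale (c * d) (foldr op ?KL z - foldr op (mset_list K @ mset_list L) z) \<in> Z0"
      by (rule Z0_simps)
    moreover have "foldr op (mset_list K) (scale d (foldr op (mset_list L) z)) =
        scale d (foldr op (mset_list K @ mset_list L) z)"
      using foldr_scale[of "mset_list K" "foldr op (mset_list L) z" d] \<open>set_mset K \<subseteq> W\<close> single
        foldr_closed[of "mset_list L" z] assms(3)
      by (simp add: set_mset_list)
    ultimately show ?case
      by (simp add: mult_single pact_single scale_right_diff_distrib)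
  next
    case (add p q)
    have k: "Poly_Mapping.single K c \<in> fcarrier W" by (rule fcarrier_single[OF single])
    show ?case
      using Z0_simps(2)[OF add.IH] pact_add_right[OF k pact_closed[OF add.hyps(1) assms(3)] pact_closed[OF add.hyps(2) assms(3)]]
      by (simp add: distrib_left pact_add algebra_simps)
  qed
next
  case (add p q)
  then show ?case using Z0_simps(2)[OF add.IH] by (simp add: distrib_right pact_add algebra_simps)
qed

text \<open>The annihilator of the class of z, formed among polynomials and not in the symmetric
  algebra. Two modules can then be compared without handling cosets.\<close>

definition Ann :: "'z \<Rightarrow> 'a free_poly set" where
  "Ann z = {p \<in> fcarrier W. pact p z \<in> Z0}"

lemma Ann_add: "p \<in> Ann z \<Longrightarrow> q \<in> Ann z \<Longrightarrow> p + q \<in> Ann z"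
  by (simp add: Ann_def pact_add fcarrier_add Z0_simps)

lemma Ann_mult:
  assumes "z \<in> Z" "p \<in> Ann z" "r \<in> fcarrier W"
  shows "r * p \<in> Ann z"
proof -
  have "pact r (pact p z) \<in> Z0" using assms pact_Z0[of r "pact p z"] by (simp add: Ann_def)
  then have "pact (r * p) z \<in> Z0"
    using pact_mult[of r p z] assms Z0_simps(2)[of "pact (r * p) z - pact r (pact p z)"]
    by (force simp: Ann_def)
  then show ?thesis using assms by (simp add: Ann_def fcarrier_mult)
qed

lemma Ann_linear_relations:
  assumes z: "z \<in> Z"
  shows "linear_relations W \<subseteq> Ann z"
proof -
  have s1: "mset_list {#x#} = [x]" for x :: "'a \<Rightarrow> complex"
    using mset_mset_list[of "{#x#}"] by simp
  have "pact (Poly_Mapping.single {#x + y#} 1 - Poly_Mapping.single {#x#} 1 - Poly_Mapping.single {#y#} 1) z \<in> Z0"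
    if "x \<in> W" "y \<in> W" for x y
    using op_plus[OF that z] unfolding pact_diff pact_single s1 by (simp add: diff_diff_eq)
  moreover have "pact (Poly_Mapping.single {#cscale c x#} 1 - Poly_Mapping.single {#x#} c) z \<in> Z0"
    if "x \<in> W" for c x
    using op_cscale[OF that z] by (simp add: pact_diff pact_single s1)
  ultimately have "pact p z \<in> Z0" if "p \<in> linear_relations W" for p
    using that unfolding linear_relations_def by blast
  then show ?thesis using linear_relations_fcarrier[OF W] by (auto simp: Ann_def)
qed

lemma Ann_ideal:
  assumes z: "z \<in> Z"
  shows "ideal (Ann z) (free_comm_algebra W)"
proof (rule idealI)
  interpret cring "free_comm_algebra W" by (rule cring_free)
  show "ring (free_comm_algebra W)" by (rule ring_axioms)
  show "subgroup (Ann z) (add_monoid (free_comm_algebra W))"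
  proof (rule group.subgroupI)
    show "group (add_monoid (free_comm_algebra W))" by (rule a_group)
    show "Ann z \<subseteq> carrier (add_monoid (free_comm_algebra W))"
      by (auto simp: carrier_free Ann_def)
    have "0 \<in> Ann z" by (simp add: Ann_def fcarrier_zero pact_zero Z0_simps)
    then show "Ann z \<noteq> {}" by auto
    show "inv\<^bsub>add_monoid (free_comm_algebra W)\<^esub> p \<in> Ann z" if "p \<in> Ann z" for p
    proof -
      have "a_inv (free_comm_algebra W) p = - p" using that by (intro a_inv_free) (auto simp: Ann_def)
      then show ?thesis using that
        by (simp add: a_inv_def Ann_def fcarrier_uminus pact_uminus Z0_simps)
    qed
    show "p \<otimes>\<^bsub>add_monoid (free_comm_algebra W)\<^esub> q \<in> Ann z" if "p \<in> Ann z" "q \<in> Ann z" for p q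
      using that by (simp add: free_ops Ann_add)
  qed
  show "x \<otimes>\<^bsub>free_comm_algebra W\<^esub> a \<in> Ann z" if "a \<in> Ann z" "x \<in> carrier (free_comm_algebra W)" for a x
    using that Ann_mult[OF z] by (simp add: free_ops carrier_free)
  show "a \<otimes>\<^bsub>free_comm_algebra W\<^esub> x \<in> Ann z" if "a \<in> Ann z" "x \<in> carrier (free_comm_algebra W)" for a x
    using that Ann_mult[OF z, of a x] by (simp add: free_ops carrier_free mult.commute)
qed

lemma abelian_group_sym: "abelian_group (sym_module M)"
proof (rule abelian_groupI)
  show "\<exists>w\<in>carrier (sym_module M). w \<oplus>\<^bsub>sym_module M\<^esub> u = \<zero>\<^bsub>sym_module M\<^esub>"
    if u: "u \<in> carrier (sym_module M)" for u
  proof -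
    obtain z where "z \<in> Z" "u = pr z" using u by (auto simp: sym_module_def carrier_M)
    then show ?thesis
      by (intro bexI[of _ "pr (- z)"]) (auto simp: sym_module_def carrier_M add_M zero_M Z_simps)
  qed
qed (auto simp: sym_module_def carrier_M add_M zero_M Z_simps ac_simps)

lemma abelian_monoid_M: "abelian_monoid M"
proof (rule abelian_monoidI)
qed (auto simp: carrier_M add_M zero_M Z_simps ac_simps)

lemma finsum_pr:
  assumes "finite S" "\<And>i. i \<in> S \<Longrightarrow> g i \<in> Z"
  shows "finsum M (\<lambda>i. pr (g i)) S = pr (\<Sum>i\<in>S. g i)"
  using assms
proof (induction S rule: finite_induct)
  case empty
  show ?case by (simp add: abelian_monoid.finsum_empty[OF abelian_monoid_M] zero_M)
next
  case (insert i S)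
  then show ?case
    by (subst abelian_monoid.finsum_insert[OF abelian_monoid_M])
      (auto simp: carrier_M add_M Z_simps)
qed

lemma poly_act_pr:
  assumes "p \<in> fcarrier W" "z \<in> Z"
  shows "poly_act M p (pr z) = pr (pact p z)"
proof -
  have g: "scale (Poly_Mapping.lookup p K) (foldr op (mset_list K) z) \<in> Z" if "K \<in> Poly_Mapping.keys p" for K
    using that assms by (intro Z_simps foldr_closed) (auto simp: fcarrier_def set_mset_list)
  have "poly_act M p (pr z) = finsum M
     (\<lambda>K. pr (scale (Poly_Mapping.lookup p K) (foldr op (mset_list K) z))) (Poly_Mapping.keys p)"
    unfolding poly_act_def mset_list_def[symmetric]
  proof (rule abelian_monoid.finsum_cong'[OF abelian_monoid_M refl])
    show "(\<lambda>K. pr (scale (Poly_Mapping.lookup p K) (foldr op (mset_list K) z))) \<in>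
      Poly_Mapping.keys p \<rightarrow> carrier M" using g by (auto simp: carrier_M)
    fix K assume "K \<in> Poly_Mapping.keys p"
    then have "set (mset_list K) \<subseteq> W" using assms by (auto simp: fcarrier_def set_mset_list)
    then show "Poly_Mapping.lookup p K \<odot>\<^bsub>M\<^esub> foldr (act M) (mset_list K) (pr z) =
      pr (scale (Poly_Mapping.lookup p K) (foldr op (mset_list K) z))"
      using assms(2) by (simp add: act_foldr smult_M foldr_closed)
  qed
  also have "\<dots> = pr (pact p z)" unfolding pact_def by (rule finsum_pr) (use g in auto)
  finally show ?thesis .
qed

text \<open>The ideal generated by the linear relations lies in every annihilator, so all members of
  the coset \<open>P\<close> act alike and the choices in \<open>sym_module\<close> and
  \<open>poly_act\<close> do no harm.\<close>

lemma sym_smult: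
  assumes P: "P \<in> carrier (symmetric_algebra W)" and p: "p \<in> P" and z: "z \<in> Z"
  shows "smult (sym_module M) P (pr z) = pr (pact p z)"
proof -
  interpret R: cring "free_comm_algebra W" by (rule cring_free)
  let ?I = "genideal (free_comm_algebra W) (linear_relations W)"
  have I: "?I \<subseteq> Ann z"
    by (rule R.genideal_minimal[OF Ann_ideal[OF z] Ann_linear_relations[OF z]])
  obtain q where q: "q \<in> fcarrier W" "P = {i + q | i. i \<in> ?I}"
    using P by (auto simp: symmetric_algebra_def FactRing_def A_RCOSETS_def' a_r_coset_def' carrier_free free_ops)
  have P': "p' \<in> fcarrier W \<and> pact p' z - pact q z \<in> Z0" if "p' \<in> P" for p'
    using that I q(1) unfolding q(2) by (auto simp: Ann_def pact_add fcarrier_add)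
  have "(SOME p. p \<in> P) \<in> P" using p by (rule someI)
  then have 1: "(SOME p. p \<in> P) \<in> fcarrier W" "pact (SOME p. p \<in> P) z - pact q z \<in> Z0"
    using P' by blast+
  have "pact (SOME p. p \<in> P) z - pact p z = (pact (SOME p. p \<in> P) z - pact q z) - (pact p z - pact q z)"
    by simp
  then have "pact (SOME p. p \<in> P) z - pact p z \<in> Z0" using 1(2) P'[OF p] Z0_simps by metis
  then have "pr (pact (SOME p. p \<in> P) z) = pr (pact p z)"
    using pr_eq pact_closed z 1 P'[OF p] by simp
  then show ?thesis using poly_act_pr[OF 1(1) z] by (simp add: sym_module_def)
qed

end

section \<open>Cosets of the symmetric algebra and submodules generated by one element\<close>

lemma symmetric_algebra_coset_sub:
  assumes "cfun.subspace W" "P \<in> carrier (symmetric_algebra W)"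
  shows "P \<subseteq> fcarrier W \<and> P \<noteq> {}"
proof -
  interpret R: cring "free_comm_algebra W" by (rule cring_free)
  let ?I = "genideal (free_comm_algebra W) (linear_relations W)"
  have "linear_relations W \<subseteq> carrier (free_comm_algebra W)"
    using linear_relations_fcarrier[OF assms(1)] by (simp add: carrier_free)
  then interpret I: ideal ?I "free_comm_algebra W" by (rule R.genideal_ideal)
  have sub: "?I \<subseteq> fcarrier W" using I.a_subset by (simp add: carrier_free)
  have z: "0 \<in> ?I" using I.zero_closed by (simp add: free_ops)
  obtain q where q: "q \<in> fcarrier W" "P = {i + q | i. i \<in> ?I}"
    using assms(2) by (auto simp: symmetric_algebra_def FactRing_def A_RCOSETS_def' a_r_coset_def' carrier_free free_ops)
  then show ?thesis using sub fcarrier_add z by blast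
qed

lemma symmetric_algebra_coset_ex:
  assumes "cfun.subspace W" "p \<in> fcarrier W"
  shows "\<exists>P\<in>carrier (symmetric_algebra W). p \<in> P"
proof -
  interpret R: cring "free_comm_algebra W" by (rule cring_free)
  let ?I = "genideal (free_comm_algebra W) (linear_relations W)"
  have "linear_relations W \<subseteq> carrier (free_comm_algebra W)"
    using linear_relations_fcarrier[OF assms(1)] by (simp add: carrier_free)
  then interpret I: ideal ?I "free_comm_algebra W" by (rule R.genideal_ideal)
  have "0 \<in> ?I" using I.zero_closed by (simp add: free_ops)
  then have "p \<in> {i + p | i. i \<in> ?I}" by force
  moreover have "{i + p | i. i \<in> ?I} \<in> carrier (symmetric_algebra W)"
    unfolding symmetric_algebra_def FactRing_def A_RCOSETS_def' a_r_coset_def' partial_object.select_convs carrier_free free_ops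
    using assms(2) by blast
  ultimately show ?thesis by (rule bexI)
qed

context op_pres
begin

lemma generated_carrier:
  assumes z: "z \<in> Z"
  shows "carrier (generated_submodule (symmetric_algebra W) (sym_module M) (pr z)) =
    {pr (pact p z) | p. p \<in> fcarrier W}" (is "_ = ?S")
proof -
  let ?R = "symmetric_algebra W" and ?M = "sym_module M"
  interpret G: abelian_group ?M by (rule abelian_group_sym)
  have ops: "carrier ?M = carrier M" "add ?M = add M" "zero ?M = zero M"
    by (simp_all add: sym_module_def)
  have S: "?S \<subseteq> H" if H: "submodule H ?R ?M" "pr z \<in> H" for H
  proof
    fix u assume "u \<in> ?S"
    then obtain p where p: "p \<in> fcarrier W" "u = pr (pact p z)" by auto
    obtain P where P: "P \<in> carrier ?R" "p \<in> P" using symmetric_algebra_coset_ex[OF W p(1)] by blast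
    have "smult ?M P (pr z) \<in> H" using H P(1) by (simp add: submodule.smult_closed)
    then show "u \<in> H" using sym_smult[OF P z] p(2) by simp
  qed
  have "submodule ?S ?R ?M"
  proof (intro submodule.intro subgroup.intro submodule_axioms.intro)
    show "?S \<subseteq> carrier (add_monoid ?M)"
      using pact_closed[OF _ z] by (auto simp: ops carrier_M)
    show "u \<otimes>\<^bsub>add_monoid ?M\<^esub> w \<in> ?S" if u: "u \<in> ?S" and w: "w \<in> ?S" for u w
    proof -
      obtain p q where pq: "p \<in> fcarrier W" "q \<in> fcarrier W" "u = pr (pact p z)" "w = pr (pact q z)"
        using u w by blast
      then have "u \<otimes>\<^bsub>add_monoid ?M\<^esub> w = pr (pact (p + q) z)"
        using pact_closed[OF _ z] by (simp add: ops add_M pact_add)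
      then show ?thesis using fcarrier_add pq by blast
    qed
    have "pr 0 = pr (pact 0 z)" by (simp add: pact_zero)
    then show "\<one>\<^bsub>add_monoid ?M\<^esub> \<in> ?S" using fcarrier_zero by (auto simp: ops zero_M)
    show "inv\<^bsub>add_monoid ?M\<^esub> u \<in> ?S" if u: "u \<in> ?S" for u
    proof -
      obtain p where p: "p \<in> fcarrier W" "u = pr (pact p z)" using u by blast
      have m: "- p \<in> fcarrier W" using p fcarrier_uminus by blast
      have "pr (pact (- p) z) \<oplus>\<^bsub>?M\<^esub> u = \<zero>\<^bsub>?M\<^esub>"
        using pact_closed[OF p(1) z] pact_closed[OF m z] by (simp add: p(2) ops add_M zero_M pact_uminus)
      then have "\<ominus>\<^bsub>?M\<^esub> u = pr (pact (- p) z)"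
        by (rule G.minus_equality)
          (use p(2) pact_closed[OF p(1) z] pact_closed[OF m z] in \<open>simp_all add: ops carrier_M\<close>)
      then show ?thesis using m unfolding a_inv_def by (metis (mono_tags, lifting) mem_Collect_eq)
    qed
    show "smult ?M P u \<in> ?S" if P: "P \<in> carrier ?R" and u: "u \<in> ?S" for P u
    proof -
      obtain p where p: "p \<in> fcarrier W" "u = pr (pact p z)" using u by blast
      obtain q where q: "q \<in> P" "q \<in> fcarrier W" using symmetric_algebra_coset_sub[OF W P] by blast
      have "smult ?M P u = pr (pact q (pact p z))"
        using sym_smult[OF P q(1) pact_closed[OF p(1) z]] p(2) by simp
      also have "\<dots> = pr (pact (q * p) z)"
        using pact_mult[OF q(2) p(1) z] pr_eq[of "pact (q * p) z" "pact q (pact p z)"] p q z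
        by (simp add: pact_closed fcarrier_mult)
      finally show ?thesis using fcarrier_mult[OF q(2) p(1)] by blast
    qed
  qed
  moreover have "pr z = pr (pact 1 z)"
    by (simp add: pact_single mset_mset_list[of "{#}", simplified] flip: single_one)
  then have "pr z \<in> ?S" using fcarrier_one by blast
  ultimately show ?thesis using S unfolding generated_submodule_def by (simp, blast)
qed

end

text \<open>Both modules are the quotient of the polynomial algebra by the same ideal; the class of
  p z1 goes to the class of p z2.\<close>

lemma module_iso_cyclic:
  fixes scale1 :: "complex \<Rightarrow> 'z \<Rightarrow> 'z :: ab_group_add"
    and scale2 :: "complex \<Rightarrow> 'y \<Rightarrow> 'y :: ab_group_add"
  assumes pres1: "op_pres scale1 W Z1 Z01 op1 M1 pr1" and pres2: "op_pres scale2 W Z2 Z02 op2 M2 pr2"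
    and z1: "z1 \<in> Z1" and z2: "z2 \<in> Z2"
    and ann: "op_pres.Ann scale1 W Z01 op1 z1 = op_pres.Ann scale2 W Z02 op2 z2"
    and cyc: "\<And>z. z \<in> Z2 \<Longrightarrow> \<exists>p\<in>fcarrier W. z - op_pres.pact scale2 op2 p z2 \<in> Z02"
  shows "module_iso (symmetric_algebra W)
    (generated_submodule (symmetric_algebra W) (sym_module M1) (pr1 z1)) (sym_module M2) \<noteq> {}"
proof -
  interpret A: op_pres scale1 W Z1 Z01 op1 M1 pr1 by (rule pres1)
  interpret B: op_pres scale2 W Z2 Z02 op2 M2 pr2 by (rule pres2)
  let ?R = "symmetric_algebra W"
  let ?G = "generated_submodule ?R (sym_module M1) (pr1 z1)"
  let ?u = "\<lambda>p. pr1 (A.pact p z1)" and ?w = "\<lambda>p. pr2 (B.pact p z2)"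
  define f where "f u = ?w (SOME p. p \<in> fcarrier W \<and> u = ?u p)" for u
  have cG: "carrier ?G = ?u ` fcarrier W" using A.generated_carrier[OF z1] by auto
  have opsG: "add ?G = add M1" "smult ?G = smult (sym_module M1)"
    by (simp_all add: generated_submodule_def sym_module_def)
  have opsM: "carrier (sym_module M2) = carrier M2" "add (sym_module M2) = add M2"
    by (simp_all add: sym_module_def)
  have eq1: "?u p = ?u q \<longleftrightarrow> p - q \<in> A.Ann z1" if "p \<in> fcarrier W" "q \<in> fcarrier W" for p q
    using that z1 A.pr_eq[of "A.pact p z1" "A.pact q z1"]
    by (simp add: A.Ann_def A.pact_diff A.pact_closed fcarrier_diff)
  have eq2: "?w p = ?w q \<longleftrightarrow> p - q \<in> A.Ann z1" if "p \<in> fcarrier W" "q \<in> fcarrier W" for p q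
    unfolding ann using that z2 B.pr_eq[of "B.pact p z2" "B.pact q z2"]
    by (simp add: B.Ann_def B.pact_diff B.pact_closed fcarrier_diff)
  have f: "f (?u p) = ?w p" if "p \<in> fcarrier W" for p
  proof -
    define P where "P q \<longleftrightarrow> q \<in> fcarrier W \<and> ?u p = ?u q" for q
    have "P (SOME q. P q)" by (rule someI[of P p]) (simp add: P_def that)
    then have q: "(SOME q. P q) \<in> fcarrier W" "?u p = ?u (SOME q. P q)" by (auto simp: P_def)
    then have "?w p = ?w (SOME q. P q)" using eq1[OF that q(1)] eq2[OF that q(1)] by simp
    then show ?thesis by (simp add: f_def P_def)
  qed
  have cM: "carrier M2 = ?w ` fcarrier W"
  proof
    show "?w ` fcarrier W \<subseteq> carrier M2" using z2 by (auto simp: B.carrier_M B.pact_closed)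
    show "carrier M2 \<subseteq> ?w ` fcarrier W"
    proof
      fix u assume "u \<in> carrier M2"
      then obtain z where z: "z \<in> Z2" "u = pr2 z" by (auto simp: B.carrier_M)
      obtain p where p: "p \<in> fcarrier W" "z - B.pact p z2 \<in> Z02" using cyc[OF z(1)] by blast
      then have "u = ?w p" using B.pr_eq[of z "B.pact p z2"] z z2 by (simp add: B.pact_closed)
      then show "u \<in> ?w ` fcarrier W" using p by blast
    qed
  qed
  have "f \<in> module_iso ?R ?G (sym_module M2)"
    unfolding module_iso_def mem_Collect_eq
  proof (intro conjI ballI)
    show "bij_betw f (carrier ?G) (carrier (sym_module M2))"
    proof (rule bij_betw_imageI)
      show "inj_on f (carrier ?G)"
      proof (rule inj_onI)
        fix u w assume "u \<in> carrier ?G" "w \<in> carrier ?G" "f u = f w"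
        then obtain p q where pq: "p \<in> fcarrier W" "q \<in> fcarrier W" "u = ?u p" "w = ?u q" "?w p = ?w q"
          using f unfolding cG by auto
        then show "u = w" using eq1 eq2 by blast
      qed
      show "f ` carrier ?G = carrier (sym_module M2)"
        unfolding cG opsM cM image_image by (rule image_cong) (auto simp: f)
    qed
    show "f (u \<oplus>\<^bsub>?G\<^esub> w) = f u \<oplus>\<^bsub>sym_module M2\<^esub> f w" if uw: "u \<in> carrier ?G" "w \<in> carrier ?G" for u w
    proof -
      obtain p q where pq: "p \<in> fcarrier W" "q \<in> fcarrier W" "u = ?u p" "w = ?u q"
        using uw unfolding cG by auto
      have "u \<oplus>\<^bsub>?G\<^esub> w = ?u (p + q)" using pq z1 by (simp add: opsG A.add_M A.pact_closed A.pact_add)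
      moreover have "?w (p + q) = ?w p \<oplus>\<^bsub>sym_module M2\<^esub> ?w q"
        using pq z2 by (simp add: opsM B.add_M B.pact_closed B.pact_add)
      ultimately show ?thesis using pq by (simp add: f fcarrier_add)
    qed
    show "f (P \<odot>\<^bsub>?G\<^esub> u) = P \<odot>\<^bsub>sym_module M2\<^esub> f u" if P: "P \<in> carrier ?R" and u: "u \<in> carrier ?G" for P u
    proof -
      obtain p where p: "p \<in> fcarrier W" "u = ?u p" using u unfolding cG by auto
      obtain q where q: "q \<in> P" "q \<in> fcarrier W" using symmetric_algebra_coset_sub[OF A.W P] by blast
      have "P \<odot>\<^bsub>?G\<^esub> u = pr1 (A.pact q (A.pact p z1))"
        using A.sym_smult[OF P q(1) A.pact_closed[OF p(1) z1]] p(2) by (simp add: opsG)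
      also have "\<dots> = ?u (q * p)"
        using A.pact_mult[OF q(2) p(1) z1] A.pr_eq[of "A.pact (q * p) z1" "A.pact q (A.pact p z1)"] p q z1
        by (simp add: A.pact_closed fcarrier_mult)
      finally have "f (P \<odot>\<^bsub>?G\<^esub> u) = ?w (q * p)" using f[OF fcarrier_mult[OF q(2) p(1)]] by simp
      also have "\<dots> = pr2 (B.pact q (B.pact p z2))"
        using B.pact_mult[OF q(2) p(1) z2] B.pr_eq[of "B.pact (q * p) z2" "B.pact q (B.pact p z2)"] p q z2
        by (simp add: B.pact_closed fcarrier_mult)
      also have "\<dots> = P \<odot>\<^bsub>sym_module M2\<^esub> f u"
        using B.sym_smult[OF P q(1) B.pact_closed[OF p(1) z2]] p f by simp
      finally show ?thesis .
    qed
  qed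
  then show ?thesis by blast
qed

section \<open>Straightening\<close>

definition cst :: "complex \<Rightarrow> 'a free_poly" where
  "cst a = Poly_Mapping.single {#} a"

lemma cst_simps:
  "cst a * cst b = cst (a * b)" "cst (a + b) = cst a + cst b" "cst 1 = 1" "cst 0 = 0"
  "cst (- a) = - cst a" "cst (a - b) = cst a - cst b"
  by (simp_all add: cst_def mult_single single_add single_uminus single_diff flip: single_one zero_multiset_def)

lemma cst_fcarrier: "cst a \<in> fcarrier W"
  by (simp add: cst_def fcarrier_single)

lemma cst_single: "cst a * Poly_Mapping.single K b = Poly_Mapping.single K (a * b)"
  by (simp add: cst_def mult_single)

text \<open>The straightening relations are homogeneous in the letters, and among the multisets of positions
  with given letters a chain is the unique one of least weight.\<close>

definition letters :: "nat \<Rightarrow> (nat \<times> nat) multiset \<Rightarrow> nat multiset" where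
  "letters n t = image_mset fst t + image_mset (\<lambda>x. 2 * n + 2 - snd x) t"

definition pos_weight :: "nat \<Rightarrow> (nat \<times> nat) multiset \<Rightarrow> nat" where
  "pos_weight n t = (\<Sum>x\<in>#t. fst x * (2 * n + 2 - snd x))"

lemma pos_weight_add: "pos_weight n (s + t) = pos_weight n s + pos_weight n t"
  by (simp add: pos_weight_def)

lemma finite_posB: "finite (posB n)"
  by (rule finite_subset[of _ "{..2 * n + 2} \<times> {..2 * n + 2}"]) (auto simp: posB_def)

text \<open>A position is an interval from r to 2n+2-c, and a chain is a nested family of intervals.
  Listing each interval with its ends in both orders makes a chain an oppositely ordered pairing, to
  which the rearrangement inequality applies.\<close>

lemma chain_letters_unique:
  assumes s: "set_mset s \<subseteq> posB n" "chain_mset s" and t: "set_mset t \<subseteq> posB n"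
    and eq: "letters n t = letters n s"
  shows "t = s \<or> pos_weight n s < pos_weight n t"
proof -
  let ?u = "\<lambda>x. (fst x, 2 * n + 2 - snd x)" and ?w = "\<lambda>x. (2 * n + 2 - snd x, fst x)"
  define sy where "sy t = image_mset ?u t + image_mset ?w t" for t
  have m: "image_mset fst (sy t) = letters n t" "image_mset snd (sy t) = letters n t" for t
    by (simp_all add: sy_def letters_def multiset.map_comp comp_def add.commute)
  have wt: "(\<Sum>p\<in>#sy t. fst p * snd p) = 2 * pos_weight n t" for t
    by (simp add: sy_def pos_weight_def multiset.map_comp comp_def mult.commute)
  have "snd q \<le> snd p" if pq: "p \<in># sy s" "q \<in># sy s" "fst p < fst q" for p q
  proof -
    obtain x y where x: "x \<in># s" "p = ?u x \<or> p = ?w x" and y: "y \<in># s" "q = ?u y \<or> q = ?w y"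
      using pq(1,2) by (auto simp: sy_def)
    have "fst x \<le> fst y \<and> snd x \<le> snd y \<or> fst y \<le> fst x \<and> snd y \<le> snd x"
      using s(2) x(1) y(1) by (auto simp: chain_mset_def)
    moreover have "x \<in> posB n" "y \<in> posB n" using s(1) x(1) y(1) by auto
    ultimately show ?thesis using x(2) y(2) pq(3)
      by (cases x; cases y) (auto simp: posB_def)
  qed
  then have "sy t = sy s \<or> (\<Sum>p\<in>#sy s. fst p * snd p) < (\<Sum>p\<in>#sy t. fst p * snd p)"
    using eq by (intro rearrangement_mset) (auto simp: m)
  moreover have "t = s" if sy: "sy t = sy s"
  proof -
    \<comment> \<open>An interval whose ends coincide is listed twice in the same form, hence the
      division by 2.\<close>
    have c: "count t (r, c) = (if r = 2 * n + 2 - c then count (sy t) (r, 2 * n + 2 - c) div 2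
        else count (sy t) (r, 2 * n + 2 - c))"
      if rc: "(r, c) \<in> posB n" and t: "set_mset t \<subseteq> posB n" for r c t
    proof -
      have 1: "count (image_mset ?u t) (r, 2 * n + 2 - c) = count t (r, c)"
      proof -
        have "?u -` {(r, 2 * n + 2 - c)} \<inter> set_mset t = {(r, c)} \<inter> set_mset t"
          using t rc by (auto simp: posB_def)
        then show ?thesis unfolding count_image_mset by (cases "(r, c) \<in># t") (auto simp: not_in_iff)
      qed
      have 2: "count (image_mset ?w t) (r, 2 * n + 2 - c) = (if r = 2 * n + 2 - c then count t (r, c) else 0)"
      proof -
        have "?w -` {(r, 2 * n + 2 - c)} \<inter> set_mset t = (if r = 2 * n + 2 - c then {(r, c)} \<inter> set_mset t else {})"
        proof (rule Set.set_eqI)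
          fix x :: "nat \<times> nat"
          show "x \<in> ?w -` {(r, 2 * n + 2 - c)} \<inter> set_mset t \<longleftrightarrow>
            x \<in> (if r = 2 * n + 2 - c then {(r, c)} \<inter> set_mset t else {})"
          proof (cases "x \<in># t")
            case True
            then have "x \<in> posB n" using t by blast
            then show ?thesis using rc by (cases x) (auto simp: posB_def)
          qed simp
        qed
        then show ?thesis unfolding count_image_mset by (cases "(r, c) \<in># t") (auto simp: not_in_iff)
      qed
      show ?thesis unfolding sy_def count_union 1 2 by simp
    qed
    show ?thesis
    proof (rule multiset_eqI)
      fix x show "count t x = count s x"
      proof (cases "x \<in> posB n")
        case True
        then show ?thesis using c[of "fst x" "snd x"] s(1) t sy by simp
      next
        case False
        then show ?thesis using s(1) t by (metis not_in_iff subsetD)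
      qed
    qed
  qed
  ultimately show ?thesis by (auto simp: wt)
qed

text \<open>Scalars are constant polynomials here, so linear combinations are treated by ring
  arithmetic alone.\<close>

inductive_set spn :: "('b \<Rightarrow> 'a free_poly) \<Rightarrow> 'b set \<Rightarrow> 'a free_poly set" for pmon T where
  zero: "0 \<in> spn pmon T"
| add: "t \<in> T \<Longrightarrow> q \<in> spn pmon T \<Longrightarrow> cst a * pmon t + q \<in> spn pmon T"

lemma spn_add: "p \<in> spn pmon T \<Longrightarrow> q \<in> spn pmon T \<Longrightarrow> p + q \<in> spn pmon T"
  by (induction rule: spn.induct) (auto simp: add.assoc intro: spn.intros)

lemma spn_base: "t \<in> T \<Longrightarrow> pmon t \<in> spn pmon T"
  using spn.add[of t T 0 pmon 1] by (simp add: spn.zero cst_simps)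

lemma spn_cst: "p \<in> spn pmon T \<Longrightarrow> cst b * p \<in> spn pmon T"
proof (induction rule: spn.induct)
  case (add t q a)
  have "cst b * (cst a * pmon t + q) = cst (b * a) * pmon t + cst b * q"
    by (simp add: distrib_left cst_simps flip: mult.assoc)
  then show ?case using add by (simp add: spn.add)
qed (simp add: spn.zero)

lemma spn_sum: "(\<And>i. i \<in> I \<Longrightarrow> g i \<in> spn pmon T) \<Longrightarrow> sum g I \<in> spn pmon T"
  by (induction I rule: infinite_finite_induct) (auto simp: spn.zero spn_add)

lemma spn_expand:
  assumes "p \<in> spn pmon T"
  shows "\<exists>S a. finite S \<and> S \<subseteq> T \<and> p = (\<Sum>t\<in>S. cst (a t) * pmon t)"
  using assms
proof (induction rule: spn.induct)
  case zero
  then show ?case by (intro exI[of _ "{}"]) simp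
next
  case (add t q b)
  then obtain S a where S: "finite S" "S \<subseteq> T" "q = (\<Sum>t\<in>S. cst (a t) * pmon t)" by blast
  define a' where "a' = (\<lambda>u. (if u = t then b else 0) + (if u \<in> S then a u else 0))"
  have "(\<Sum>u\<in>insert t S. cst (a' u) * pmon u) =
      (\<Sum>u\<in>insert t S. if u = t then cst b * pmon t else 0) + (\<Sum>u\<in>insert t S. if u \<in> S then cst (a u) * pmon u else 0)"
    unfolding sum.distrib[symmetric] by (rule sum.cong) (auto simp: a'_def cst_simps distrib_right)
  also have "(\<Sum>u\<in>insert t S. if u = t then cst b * pmon t else 0) = cst b * pmon t"
    using S(1) by (simp add: sum.delta')
  also have "(\<Sum>u\<in>insert t S. if u \<in> S then cst (a u) * pmon u else 0) = q"
    unfolding S(3) using S(1) by (intro sum.mono_neutral_cong_right) auto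
  finally show ?case using S add(1) by (intro exI[of _ "insert t S"] exI[of _ a']) simp
qed

section \<open>Extracting coefficients modulo an ideal\<close>

locale lin_ideal =
  fixes W :: "('a \<Rightarrow> complex) set" and J :: "'a free_poly set"
  assumes W: "cfun.subspace W" and J_sub: "J \<subseteq> fcarrier W" and J_zero: "0 \<in> J"
    and J_add: "p \<in> J \<Longrightarrow> q \<in> J \<Longrightarrow> p + q \<in> J"
    and J_mult: "r \<in> fcarrier W \<Longrightarrow> p \<in> J \<Longrightarrow> r * p \<in> J"
    and J_lin: "linear_relations W \<subseteq> J"
begin

lemma J_uminus: "p \<in> J \<Longrightarrow> - p \<in> J"
  using J_mult[OF fcarrier_uminus[OF fcarrier_one]] by fastforce

lemma J_diff: "p \<in> J \<Longrightarrow> q \<in> J \<Longrightarrow> p - q \<in> J"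
  using J_add[OF _ J_uminus, of p q] by simp

lemma J_sum: "(\<And>i. i \<in> I \<Longrightarrow> g i \<in> J) \<Longrightarrow> sum g I \<in> J"
  by (induction I rule: infinite_finite_induct) (auto simp: J_zero J_add)

lemma J_cst: "p \<in> J \<Longrightarrow> cst a * p \<in> J"
  by (rule J_mult[OF cst_fcarrier])

lemma J_cst_cancel: "cst a * p \<in> J \<Longrightarrow> a \<noteq> 0 \<Longrightarrow> p \<in> J"
  using J_cst[of "cst a * p" "inverse a"] by (simp add: cst_simps flip: mult.assoc)

lemma J_trans: "p - q \<in> J \<Longrightarrow> q - r \<in> J \<Longrightarrow> p - r \<in> J"
  using J_add[of "p - q" "q - r"] by simp

lemma J_cong_mult:
  assumes "p - p' \<in> J" "q - q' \<in> J" "p \<in> fcarrier W" "q' \<in> fcarrier W"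
  shows "p * q - p' * q' \<in> J"
proof -
  have "p * q - p' * q' = p * (q - q') + q' * (p - p')" by (simp add: algebra_simps)
  then show ?thesis using assms J_add J_mult by metis
qed

lemma J_cong_power:
  assumes "p - q \<in> J" "p \<in> fcarrier W" "q \<in> fcarrier W"
  shows "p ^ k - q ^ k \<in> J"
proof (induction k)
  case 0
  then show ?case by (simp add: J_zero)
next
  case (Suc k)
  show ?case using J_cong_mult[OF assms(1) Suc assms(2) fcarrier_power[OF assms(3)]] by simp
qed

text \<open>Evaluating at 2z and subtracting the value at z times the top power of 2 eliminates the
  top coefficient and multiplies the others by nonzero constants.\<close>

lemma vandermonde:
  assumes "\<And>z. (\<Sum>k\<le>D. cst (z ^ k) * B k) \<in> J" "k \<le> (D :: nat)"
  shows "B k \<in> J"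
  using assms
proof (induction D arbitrary: B k)
  case 0
  then show ?case using 0(1)[of 1] by (simp add: cst_simps)
next
  case (Suc D)
  define B' where "B' k = cst (2 ^ k - 2 ^ Suc D) * B k" for k
  have "(\<Sum>k\<le>D. cst (z ^ k) * B' k) \<in> J" for z
  proof -
    have "(\<Sum>k\<le>D. cst (z ^ k) * B' k) = (\<Sum>k\<le>Suc D. cst (z ^ k) * B' k)"
      by (simp add: B'_def cst_simps)
    also have "\<dots> = (\<Sum>k\<le>Suc D. cst ((2 * z) ^ k) * B k) - cst (2 ^ Suc D) * (\<Sum>k\<le>Suc D. cst (z ^ k) * B k)"
      unfolding sum_distrib_left sum_subtractf[symmetric]
      by (intro sum.cong refl)
        (simp only: B'_def cst_simps(6) power_mult_distrib cst_simps(1)[symmetric] left_diff_distrib right_diff_distrib mult_ac)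
    also have "\<dots> \<in> J" by (intro J_diff J_cst Suc.prems(1))
    finally show ?thesis .
  qed
  then have 1: "B' k \<in> J" if "k \<le> D" for k using Suc.IH that by blast
  have 2: "B k \<in> J" if "k \<le> D" for k
  proof (rule J_cst_cancel)
    show "cst (2 ^ k - 2 ^ Suc D) * B k \<in> J" using 1[OF that] by (simp add: B'_def)
    have "(2::nat) ^ k \<noteq> 2 ^ Suc D" using that by (metis Suc_n_not_le_n one_less_numeral_iff power_inject_exp semiring_norm(76))
    then have "of_nat (2 ^ k) \<noteq> (of_nat (2 ^ Suc D) :: complex)" unfolding of_nat_eq_iff .
    then show "(2 :: complex) ^ k - 2 ^ Suc D \<noteq> 0" by simp
  qed
  have "(\<Sum>k\<le>Suc D. B k) - (\<Sum>k\<le>D. B k) \<in> J"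
    using J_diff[OF Suc.prems(1)[of 1] J_sum[of "{..D}" B]] 2 by (simp add: cst_simps)
  then have "B (Suc D) \<in> J" by simp
  then show ?case using 2 Suc.prems(2) by (auto simp: le_Suc_eq)
qed

lemma extract_power:
  fixes e :: "'i \<Rightarrow> nat"
  assumes "finite S" "\<And>z. (\<Sum>w\<in>S. cst (z ^ e w) * A w) \<in> J"
  shows "(\<Sum>w | w \<in> S \<and> e w = k. A w) \<in> J"
proof -
  define D where "D = k + (\<Sum>w\<in>S. e w)"
  define B where "B j = (\<Sum>w | w \<in> S \<and> e w = j. A w)" for j
  have eD: "e w \<le> D" if "w \<in> S" for w
    using member_le_sum[of w S e] that assms(1) by (simp add: D_def)
  have "(\<Sum>j\<le>D. cst (z ^ j) * B j) \<in> J" for z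
  proof -
    have "(\<Sum>j\<le>D. cst (z ^ j) * B j) = (\<Sum>j\<le>D. \<Sum>w | w \<in> S \<and> e w = j. cst (z ^ e w) * A w)"
      unfolding B_def sum_distrib_left by (intro sum.cong) auto
    also have "\<dots> = (\<Sum>w\<in>S. cst (z ^ e w) * A w)"
      by (rule sum.group) (use assms(1) eD in auto)
    finally show ?thesis using assms(2) by simp
  qed
  then have "B k \<in> J" by (rule vandermonde) (simp add: D_def)
  then show ?thesis by (simp add: B_def)
qed

text \<open>The variables are treated one after the other. \<open>p0\<close> keeps the value 1
  throughout, because the relations are given only under this normalisation.\<close>

lemma extract_letters:
  fixes e :: "'i \<Rightarrow> nat multiset"
  assumes "finite S" "finite L" "p0 \<notin> L"
    and "\<And>U. U p0 = 1 \<Longrightarrow> (\<Sum>w\<in>S. cst (\<Prod>l\<in>#e w. U l) * A w) \<in> J"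
    and "U p0 = 1"
  shows "(\<Sum>w | w \<in> S \<and> (\<forall>p\<in>L. count (e w) p = \<gamma> p).
    cst (\<Prod>l\<in>#filter_mset (\<lambda>l. l \<notin> L) (e w). U l) * A w) \<in> J"
  using assms(2,3,5)
proof (induction L arbitrary: U rule: finite_induct)
  case empty
  then show ?case using assms(4) by simp
next
  case (insert p L)
  let ?S = "{w \<in> S. \<forall>p\<in>L. count (e w) p = \<gamma> p}"
  let ?A = "\<lambda>w. cst (\<Prod>l\<in>#filter_mset (\<lambda>l. l \<notin> insert p L) (e w). U l) * A w"
  have "(\<Sum>w\<in>?S. cst (z ^ count (e w) p) * ?A w) \<in> J" for z
  proof -
    have split: "(\<Prod>l\<in>#filter_mset (\<lambda>l. l \<notin> L) E. (U(p := z)) l) =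
        z ^ count E p * (\<Prod>l\<in>#filter_mset (\<lambda>l. l \<notin> insert p L) E. U l)" for E
      using insert.hyps(2) by (induction E) auto
    have "(U(p := z)) p0 = 1" using insert.prems by auto
    then have "(\<Sum>w\<in>?S. cst (\<Prod>l\<in>#filter_mset (\<lambda>l. l \<notin> L) (e w). (U(p := z)) l) * A w) \<in> J"
      using insert.IH[of "U(p := z)"] insert.prems by auto
    then show ?thesis unfolding split by (simp add: cst_simps(1)[symmetric] mult.assoc)
  qed
  then have "(\<Sum>w | w \<in> ?S \<and> count (e w) p = \<gamma> p. ?A w) \<in> J"
    by (intro extract_power) (use assms(1) in auto)
  moreover have "{w. w \<in> ?S \<and> count (e w) p = \<gamma> p} = {w \<in> S. \<forall>p\<in>insert p L. count (e w) p = \<gamma> p}"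
    by auto
  ultimately show ?case by simp
qed

end

text \<open>Powers of a sum are expanded over words, so that multinomial coefficients appear only as
  numbers of words with a given multiset.\<close>

definition words :: "'b set \<Rightarrow> nat \<Rightarrow> 'b list set" where
  "words B k = {w. set w \<subseteq> B \<and> length w = k}"

lemma finite_words: "finite B \<Longrightarrow> finite (words B k)"
  unfolding words_def by (rule finite_lists_length_eq)

lemma words_Suc: "words B (Suc k) = (\<lambda>(x, w). x # w) ` (B \<times> words B k)"
  by (auto simp: words_def length_Suc_conv image_iff)

lemma power_sum_words:
  fixes g :: "'b \<Rightarrow> 'c :: comm_semiring_1"
  assumes "finite B"
  shows "(\<Sum>x\<in>B. g x) ^ k = (\<Sum>w\<in>words B k. \<Prod>x\<in>#mset w. g x)"
proof (induction k)
  case 0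
  have "words B 0 = {[]}" by (auto simp: words_def)
  then show ?case by simp
next
  case (Suc k)
  have "(\<Sum>x\<in>B. g x) ^ Suc k = (\<Sum>(x, w)\<in>B \<times> words B k. g x * (\<Prod>x\<in>#mset w. g x))"
    by (simp add: Suc sum_product sum.cartesian_product)
  also have "\<dots> = (\<Sum>w\<in>words B (Suc k). \<Prod>x\<in>#mset w. g x)"
    unfolding words_Suc by (subst sum.reindex) (auto simp: inj_on_def case_prod_unfold)
  finally show ?case .
qed

section \<open>Straightening by powers of rank one elements\<close>

definition sub_pos :: "nat \<Rightarrow> nat \<Rightarrow> nat \<Rightarrow> (nat \<times> nat) set" where
  "sub_pos n c0 r0 = {x \<in> posB n. c0 \<le> snd x \<and> fst x \<le> r0}"

text \<open>For root vectors f this is the lower triangular part of a matrix which, on the first n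
  basis vectors, has rank one; its entries are restricted to columns from c0 on and rows up to
  r0.\<close>

definition rank_one :: "(nat \<times> nat \<Rightarrow> 'a \<Rightarrow> complex) \<Rightarrow> nat \<Rightarrow> nat \<Rightarrow> nat \<Rightarrow> (nat \<Rightarrow> complex) \<Rightarrow> 'a \<Rightarrow> complex" where
  "rank_one f n c0 r0 U = (\<Sum>x\<in>sub_pos n c0 r0. cscale (U (fst x) * U (2 * n + 2 - snd x)) (f x))"

locale straightening = lin_ideal W J
  for W :: "('a \<Rightarrow> complex) set" and J +
  fixes n :: nat and m :: "nat \<Rightarrow> nat" and f :: "nat \<times> nat \<Rightarrow> 'a \<Rightarrow> complex"
  assumes fW: "x \<in> posB n \<Longrightarrow> f x \<in> W"
    and W_span: "y \<in> W \<Longrightarrow> \<exists>g. y = (\<Sum>x\<in>posB n. cscale (g x) (f x))"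
    and rank_one_J: "1 \<le> c0 \<Longrightarrow> c0 \<le> n \<Longrightarrow> c0 < r0 \<Longrightarrow> r0 \<le> n \<or> r0 = 2 * n + 1 \<Longrightarrow>
      U (2 * n + 2 - c0) = 1 \<Longrightarrow> bnd n m c0 r0 < k \<Longrightarrow>
      Poly_Mapping.single {#rank_one f n c0 r0 U#} 1 ^ k \<in> J"
begin

definition pmon :: "(nat \<times> nat) multiset \<Rightarrow> 'a free_poly" where
  "pmon t = Poly_Mapping.single (image_mset f t) 1"

lemma pmon_empty: "pmon {#} = 1"
  by (simp add: pmon_def)

lemma pmon_add: "pmon (s + t) = pmon s * pmon t"
  by (simp add: pmon_def mult_single)

lemma pmon_fcarrier: "set_mset t \<subseteq> posB n \<Longrightarrow> pmon t \<in> fcarrier W"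
  unfolding pmon_def by (rule fcarrier_single) (auto intro: fW)

lemma single_lin_comb:
  assumes "finite B" "B \<subseteq> posB n"
  shows "Poly_Mapping.single {#\<Sum>x\<in>B. cscale (g x) (f x)#} 1 - (\<Sum>x\<in>B. cst (g x) * pmon {#x#}) \<in> J"
  using assms
proof (induction B rule: finite_induct)
  case empty
  \<comment> \<open>The variable named by the zero vector is a nonzero polynomial; the relation for
    the scalar 0 places it in J.\<close>
  have "Poly_Mapping.single {#cscale 0 0#} 1 - Poly_Mapping.single {#0#} 0 \<in> linear_relations W"
    using cfun.subspace_0[OF W] unfolding linear_relations_def by blast
  moreover have "cscale 0 0 = (0 :: 'a \<Rightarrow> complex)" by (simp add: cscale_def fun_eq_iff)
  ultimately have "Poly_Mapping.single {#0#} 1 - Poly_Mapping.single {#0#} 0 \<in> J"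
    using J_lin by (metis subsetD)
  then show ?case by (simp only: sum.empty single_zero diff_zero)
next
  case (insert x B)
  let ?a = "cscale (g x) (f x)" and ?b = "\<Sum>x\<in>B. cscale (g x) (f x)"
  let ?s = "\<lambda>y. Poly_Mapping.single {#y#} (1 :: complex)"
  have x: "f x \<in> W" "?a \<in> W" using insert.prems fW cfun.subspace_scale[OF W] by auto
  have b: "?b \<in> W" using insert.prems fW W by (intro cfun.subspace_sum cfun.subspace_scale) auto
  have 1: "?s (?a + ?b) - ?s ?a - ?s ?b \<in> J"
    using x(2) b J_lin unfolding linear_relations_def by blast
  have 2: "?s ?a - cst (g x) * pmon {#x#} \<in> J"
    using x(1) J_lin unfolding linear_relations_def by (auto simp: pmon_def cst_single)
  have 3: "?s ?b - (\<Sum>x\<in>B. cst (g x) * pmon {#x#}) \<in> J" using insert by simp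
  have "(?s (?a + ?b) - ?s ?a - ?s ?b) + (?s ?a - cst (g x) * pmon {#x#}) + (?s ?b - (\<Sum>x\<in>B. cst (g x) * pmon {#x#})) \<in> J"
    by (intro J_add 1 2 3)
  moreover have "(P - A - B) + (A - C) + (B - S) = P - (C + S)" for P A B C S :: "'a free_poly"
    by (simp add: algebra_simps)
  ultimately show ?case unfolding sum.insert[OF insert.hyps(1,2)] by (simp only:)
qed

lemma prod_cst_pmon: "(\<Prod>x\<in>#t. cst (g x) * pmon {#x#}) = cst (\<Prod>x\<in>#t. g x) * pmon t"
proof (induction t)
  case empty
  show ?case by (simp add: pmon_empty cst_simps)
next
  case (add x t)
  have "pmon (add_mset x t) = pmon {#x#} * pmon t" using pmon_add[of "{#x#}" t] by simp
  then show ?case by (simp add: add cst_simps(1)[symmetric] mult_ac)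
qed

text \<open>The coefficients of the powers of \<open>rank_one f n c0 r0 U\<close>, as polynomials in the values of \<open>U\<close>. The value at
  \<open>2n+2-c0\<close> is fixed to 1, which loses nothing because the total number of letters is \<open>2k\<close>.\<close>

lemma letter_relation:
  assumes c0: "1 \<le> c0" "c0 \<le> n" "c0 < r0" "r0 \<le> n \<or> r0 = 2 * n + 1"
    and k: "bnd n m c0 r0 < k"
    and s: "set_mset s \<subseteq> posB n" "size s = k"
  shows "(\<Sum>w | w \<in> words (sub_pos n c0 r0) k \<and> letters n (mset w) = letters n s. pmon (mset w)) \<in> J"
proof -
  let ?B = "sub_pos n c0 r0" and ?p0 = "2 * n + 2 - c0"
  let ?S = "words ?B k"
  have B: "finite ?B" "?B \<subseteq> posB n"
    using finite_posB by (auto simp: sub_pos_def)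
  have "(\<Sum>w\<in>?S. cst (\<Prod>l\<in>#letters n (mset w). U l) * pmon (mset w)) \<in> J" if U: "U ?p0 = 1" for U
  proof -
    let ?g = "\<lambda>x. U (fst x) * U (2 * n + 2 - snd x)"
    let ?q = "\<Sum>x\<in>?B. cst (?g x) * pmon {#x#}"
    have YW: "rank_one f n c0 r0 U \<in> W"
      unfolding rank_one_def using B fW W by (intro cfun.subspace_sum cfun.subspace_scale) auto
    have 1: "Poly_Mapping.single {#rank_one f n c0 r0 U#} 1 - ?q \<in> J"
      unfolding rank_one_def by (rule single_lin_comb[OF B])
    have q: "?q \<in> fcarrier W"
      using B by (intro fcarrier_sum fcarrier_mult cst_fcarrier pmon_fcarrier) auto
    have "Poly_Mapping.single {#rank_one f n c0 r0 U#} 1 ^ k - ?q ^ k \<in> J"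
      using 1 q YW by (intro J_cong_power fcarrier_single) auto
    from J_diff[OF rank_one_J[where U = U, OF c0 U k] this] have "?q ^ k \<in> J" by simp
    also have "?q ^ k = (\<Sum>w\<in>?S. cst (\<Prod>x\<in>#mset w. ?g x) * pmon (mset w))"
      unfolding power_sum_words[OF B(1)] prod_cst_pmon ..
    also have "\<dots> = (\<Sum>w\<in>?S. cst (\<Prod>l\<in>#letters n (mset w). U l) * pmon (mset w))"
      by (simp add: letters_def multiset.map_comp comp_def prod_mset.distrib)
    finally show ?thesis .
  qed
  note rel = this
  define L where "L = {..2 * n + 2} - {?p0}"
  have L: "p0 \<notin> L" if "p0 = ?p0" for p0 using that by (simp add: L_def)
  have "(\<Sum>w | w \<in> ?S \<and> (\<forall>p\<in>L. count (letters n (mset w)) p = count (letters n s) p).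
    cst (\<Prod>l\<in>#filter_mset (\<lambda>l. l \<notin> L) (letters n (mset w)). (\<lambda>_. 1) l) * pmon (mset w)) \<in> J"
    by (rule extract_letters[where ?p0.0 = ?p0]) (use rel B finite_words in \<open>auto simp: L_def\<close>)
  moreover have "(\<forall>p\<in>L. count (letters n (mset w)) p = count (letters n s) p) \<longleftrightarrow>
      letters n (mset w) = letters n s" if w: "w \<in> ?S" for w
  proof
    assume eq: "\<forall>p\<in>L. count (letters n (mset w)) p = count (letters n s) p"
    have le: "p \<le> 2 * n + 2" if "p \<in># letters n t" "set_mset t \<subseteq> posB n" for p t
      using that by (auto simp: letters_def posB_def)
    have wB: "set_mset (mset w) \<subseteq> posB n" using w B by (auto simp: words_def)
    have 1: "count (letters n (mset w)) p = count (letters n s) p" if "p \<noteq> ?p0" for p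
    proof (cases "p \<le> 2 * n + 2")
      case True
      then show ?thesis using eq that by (simp add: L_def)
    next
      case False
      then have "p \<notin># letters n (mset w)" "p \<notin># letters n s" using le wB s(1) by blast+
      then show ?thesis by (simp add: not_in_iff)
    qed
    have "filter_mset (\<lambda>p. p \<noteq> ?p0) (letters n (mset w)) = filter_mset (\<lambda>p. p \<noteq> ?p0) (letters n s)"
      by (rule multiset_eqI) (simp add: 1)
    moreover have "size M = count M ?p0 + size (filter_mset (\<lambda>p. p \<noteq> ?p0) M)" for M :: "nat multiset"
      by (induction M) auto
    moreover have "size (letters n (mset w)) = size (letters n s)"
      using w s(2) by (simp add: letters_def words_def)
    ultimately have "count (letters n (mset w)) ?p0 = count (letters n s) ?p0"
      by (metis add_right_cancel)
    then show "letters n (mset w) = letters n s" using 1 by (metis multiset_eqI)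
  qed simp
  then have "{w. w \<in> ?S \<and> (\<forall>p\<in>L. count (letters n (mset w)) p = count (letters n s) p)} =
    {w. w \<in> ?S \<and> letters n (mset w) = letters n s}" by blast
  ultimately show ?thesis by (simp add: cst_simps)
qed

text \<open>In the relation for the letters of s the chain s occurs with positive multiplicity, and
  every other monomial has greater weight. Solve for s.\<close>

lemma chain_reducible:
  assumes s: "set_mset s \<subseteq> posB n" "chain_mset s" and cr: "\<forall>x\<in>#s. c \<le> snd x \<and> fst x \<le> r"
    and big: "bnd n m c r < size s"
  shows "\<exists>q\<in>spn pmon {t. set_mset t \<subseteq> posB n \<and> size t = size s \<and> pos_weight n s < pos_weight n t}.
    pmon s - q \<in> J"
proof -
  have ne: "s \<noteq> {#}" using big by auto
  define c0 where "c0 = Min (snd ` set_mset s)"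
  define r1 where "r1 = Max (fst ` set_mset s)"
  define r0 where "r0 = (if r1 \<le> n then r1 else 2 * n + 1)"
  have "c0 \<in> snd ` set_mset s" unfolding c0_def using ne by (intro Min_in) auto
  then obtain x where x: "x \<in># s" "snd x = c0" by auto
  have "r1 \<in> fst ` set_mset s" unfolding r1_def using ne by (intro Max_in) auto
  then obtain y where y: "y \<in># s" "fst y = r1" by auto
  have xy: "x \<in> posB n" "y \<in> posB n" using x y s(1) by auto
  have cmin: "c0 \<le> snd z" and rmax: "fst z \<le> r1" if "z \<in># s" for z
    using that by (auto simp: c0_def r1_def)
  have B: "x \<in> sub_pos n c0 r0" if "x \<in># s" for x
    using cmin[OF that] rmax[OF that] that s(1) by (auto simp: sub_pos_def r0_def posB_def)
  have c0: "1 \<le> c0" "c0 \<le> n" "c0 < r1"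
    using xy x cmin[OF y(1)] y(2) by (auto simp: posB_def)
  then have c0': "c0 < r0" "r0 \<le> n \<or> r0 = 2 * n + 1" by (auto simp: r0_def)
  have "bnd n m c0 r0 \<le> bnd n m c r"
    unfolding bnd_def using cr x y by (intro sum_mono2) (auto simp: r0_def split: if_splits)
  then have k: "bnd n m c0 r0 < size s" using big by simp
  let ?S = "{w. w \<in> words (sub_pos n c0 r0) (size s) \<and> letters n (mset w) = letters n s}"
  have finS: "finite ?S" by (rule finite_subset[OF _ finite_words[of "sub_pos n c0 r0" "size s"]])
      (auto simp: sub_pos_def finite_posB)
  have rel: "(\<Sum>w\<in>?S. pmon (mset w)) \<in> J"
    by (rule letter_relation[OF c0(1,2) c0' k s(1) refl])
  let ?E = "{w \<in> ?S. mset w = s}"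
  let ?T = "{t. set_mset t \<subseteq> posB n \<and> size t = size s \<and> pos_weight n s < pos_weight n t}"
  have "(\<Sum>w\<in>?S. pmon (mset w)) = (\<Sum>w\<in>?E. pmon (mset w)) + (\<Sum>w\<in>?S - ?E. pmon (mset w))"
    by (rule sum.subset_diff[OF _ finS, THEN trans[OF _ add.commute]]) auto
  also have "(\<Sum>w\<in>?E. pmon (mset w)) = cst (of_nat (card ?E)) * pmon s"
  proof -
    have "cst (of_nat N) * p = of_nat N * p" for N and p :: "'a free_poly"
      by (induction N) (auto simp: cst_simps distrib_right)
    then show ?thesis by simp
  qed
  finally have rel2: "cst (of_nat (card ?E)) * pmon s + (\<Sum>w\<in>?S - ?E. pmon (mset w)) \<in> J"
    using rel by simp
  obtain w0 where w0: "mset w0 = s" by (metis ex_mset)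
  have "set w0 = set_mset s" using w0 by auto
  then have "w0 \<in> ?E" using w0 B by (auto simp: words_def)
  moreover have "finite ?E" using finS by (rule rev_finite_subset) auto
  moreover from calculation(1) have "?E \<noteq> {}" by blast
  ultimately have N: "card ?E \<noteq> 0" by (simp only: card_0_eq not_False_eq_True)
  have T: "mset w \<in> ?T" if "w \<in> ?S - ?E" for w
  proof -
    have "set_mset (mset w) \<subseteq> posB n" using that by (auto simp: words_def sub_pos_def)
    then show ?thesis using that chain_letters_unique[OF s, of "mset w"] by (auto simp: words_def)
  qed
  let ?q = "cst (- inverse (of_nat (card ?E))) * (\<Sum>w\<in>?S - ?E. pmon (mset w))"
  have "?q \<in> spn pmon ?T" by (intro spn_cst spn_sum spn_base T)
  moreover have "pmon s - ?q \<in> J"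
  proof -
    have "cst (inverse (of_nat (card ?E))) * (cst (of_nat (card ?E)) * pmon s + (\<Sum>w\<in>?S - ?E. pmon (mset w))) = pmon s - ?q"
      using N by (simp add: distrib_left cst_simps flip: mult.assoc)
    then show ?thesis using J_cst[OF rel2, of "inverse (of_nat (card ?E))"] by (simp only:)
  qed
  ultimately show ?thesis by blast
qed

lemma spn_mult_pmon:
  assumes "q \<in> spn pmon T" "\<And>t. t \<in> T \<Longrightarrow> t + s \<in> T'"
  shows "q * pmon s \<in> spn pmon T'"
  using assms(1)
  by (induction rule: spn.induct)
    (auto simp: distrib_right mult.assoc simp flip: pmon_add intro: spn.intros assms(2))

lemma spn_reduce:
  assumes "q \<in> spn pmon T" "\<And>t. t \<in> T \<Longrightarrow> \<exists>q\<in>spn pmon T'. pmon t - q \<in> J"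
  shows "\<exists>q'\<in>spn pmon T'. q - q' \<in> J"
  using assms(1)
proof (induction rule: spn.induct)
  case zero
  then show ?case using J_zero by (intro bexI[of _ 0]) (auto simp: spn.zero)
next
  case (add t q a)
  obtain q1 where q1: "q1 \<in> spn pmon T'" "pmon t - q1 \<in> J" using assms(2)[OF add(1)] by blast
  obtain q2 where q2: "q2 \<in> spn pmon T'" "q - q2 \<in> J" using add(3) by blast
  have "cst a * (pmon t - q1) + (q - q2) \<in> J" by (intro J_add J_cst q1 q2)
  then show ?case using spn_add[OF spn_cst[OF q1(1)] q2(1)]
    by (intro bexI[of _ "cst a * q1 + q2"]) (auto simp: algebra_simps)
qed

text \<open>A monomial outside the polytope contains an overfull chain, and replacing that chain
  raises the weight at constant size. The weight is at most (2n+2)^2 times the size, so the process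
  ends.\<close>

lemma pmon_normal_form:
  assumes "set_mset s \<subseteq> posB n"
  shows "\<exists>q\<in>spn pmon (ffl n (bnd n m)). pmon s - q \<in> J"
  using assms
proof (induction "size s * (2 * n + 2) ^ 2 - pos_weight n s" arbitrary: s rule: less_induct)
  case less
  show ?case
  proof (cases "s \<in> ffl n (bnd n m)")
    case True
    then show ?thesis using J_zero by (intro bexI[of _ "pmon s"]) (auto simp: spn_base)
  next
    case False
    then obtain q c r where q: "q \<subseteq># s" "chain_mset q" "\<forall>x\<in>#q. c \<le> snd x \<and> fst x \<le> r" "bnd n m c r < size q"
      using less.prems unfolding ffl_def by (auto simp: not_le)
    define s' where "s' = s - q"
    have s: "s = q + s'" using q(1) by (simp add: s'_def)
    have qB: "set_mset q \<subseteq> posB n" "set_mset s' \<subseteq> posB n" using less.prems s by auto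
    obtain p where p: "p \<in> spn pmon {t. set_mset t \<subseteq> posB n \<and> size t = size q \<and> pos_weight n q < pos_weight n t}"
      "pmon q - p \<in> J" using chain_reducible[OF qB(1) q(2,3,4)] by blast
    let ?T = "{t. set_mset t \<subseteq> posB n \<and> size t = size s \<and> pos_weight n s < pos_weight n t}"
    have "p * pmon s' \<in> spn pmon ?T"
      using qB by (intro spn_mult_pmon[OF p(1)]) (auto simp: s pos_weight_add)
    moreover have "\<exists>q\<in>spn pmon (ffl n (bnd n m)). pmon t - q \<in> J" if t: "t \<in> ?T" for t
    proof (rule less.hyps)
      have "pos_weight n t \<le> size t * (2 * n + 2) ^ 2"
      proof -
        have "pos_weight n t \<le> (\<Sum>x\<in>#t. (2 * n + 2) ^ 2)"
          unfolding pos_weight_def power2_eq_square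
          using t by (intro sum_mset_mono mult_le_mono) (auto simp: posB_def)
        then show ?thesis by simp
      qed
      then show "size t * (2 * n + 2) ^ 2 - pos_weight n t < size s * (2 * n + 2) ^ 2 - pos_weight n s"
        using t by auto
      show "set_mset t \<subseteq> posB n" using t by simp
    qed
    ultimately obtain q' where q': "q' \<in> spn pmon (ffl n (bnd n m))" "p * pmon s' - q' \<in> J"
      using spn_reduce by blast
    have "pmon s' * (pmon q - p) \<in> J" using J_mult[OF pmon_fcarrier[OF qB(2)] p(2)] .
    then have "pmon s - p * pmon s' \<in> J" by (simp add: s pmon_add algebra_simps)
    then show ?thesis using q' J_trans by blast
  qed
qed

lemma single_normal_form:
  assumes "set_mset K \<subseteq> W"
  shows "\<exists>q\<in>spn pmon {t. set_mset t \<subseteq> posB n}. Poly_Mapping.single K 1 - q \<in> J"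
  using assms
proof (induction K)
  case empty
  have "Poly_Mapping.single {#} 1 - pmon {#} \<in> J" using J_zero by (simp add: pmon_def)
  then show ?case by (rule bexI) (simp add: spn_base)
next
  case (add y K)
  let ?T = "{t. set_mset t \<subseteq> posB n}"
  obtain q where q: "q \<in> spn pmon ?T" "Poly_Mapping.single K 1 - q \<in> J" using add by auto
  obtain g where g: "y = (\<Sum>x\<in>posB n. cscale (g x) (f x))" using W_span add.prems by force
  let ?p = "\<Sum>x\<in>posB n. cst (g x) * pmon {#x#}"
  have 1: "Poly_Mapping.single {#y#} 1 - ?p \<in> J" unfolding g by (rule single_lin_comb[OF finite_posB]) simp
  have qW: "q \<in> fcarrier W"
    using q(1) by (induction rule: spn.induct) (auto simp: fcarrier_zero fcarrier_add fcarrier_mult cst_fcarrier pmon_fcarrier)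
  have "Poly_Mapping.single {#y#} 1 * Poly_Mapping.single K 1 - ?p * q \<in> J"
    using add.prems by (intro J_cong_mult 1 q qW fcarrier_single) auto
  moreover have "Poly_Mapping.single {#y#} (1::complex) * Poly_Mapping.single K 1 = Poly_Mapping.single (add_mset y K) 1"
    by (simp add: mult_single)
  moreover have "?p * q \<in> spn pmon ?T"
  proof -
    have "cst (g x) * (q * pmon {#x#}) \<in> spn pmon ?T" if "x \<in> posB n" for x
      using that by (intro spn_cst spn_mult_pmon[OF q(1)]) auto
    then show ?thesis unfolding sum_distrib_right by (intro spn_sum) (simp add: mult_ac)
  qed
  ultimately show ?case by auto
qed

theorem normal_form:
  assumes "p \<in> fcarrier W"
  shows "\<exists>q\<in>spn pmon (ffl n (bnd n m)). p - q \<in> J"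
  using assms
proof (induction p rule: fcarrier_induct)
  case zero
  then show ?case using J_zero by (intro bexI[of _ 0]) (auto simp: spn.zero)
next
  case (single K c)
  obtain q1 where q1: "q1 \<in> spn pmon {t. set_mset t \<subseteq> posB n}" "Poly_Mapping.single K 1 - q1 \<in> J"
    using single_normal_form[OF single] by blast
  obtain q where q: "q \<in> spn pmon (ffl n (bnd n m))" "q1 - q \<in> J"
    using spn_reduce[OF q1(1)] pmon_normal_form by blast
  have "cst c * (Poly_Mapping.single K 1 - q) \<in> J" by (rule J_cst[OF J_trans[OF q1(2) q(2)]])
  then have "Poly_Mapping.single K c - cst c * q \<in> J" by (simp add: right_diff_distrib cst_single)
  then show ?case using spn_cst[OF q(1)] by blast
next
  case (add p q)
  then obtain p' q' where "p' \<in> spn pmon (ffl n (bnd n m))" "p - p' \<in> J"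
    "q' \<in> spn pmon (ffl n (bnd n m))" "q - q' \<in> J" by blast
  then show ?case using J_add[of "p - p'" "q - q'"]
    by (intro bexI[of _ "p' + q'"]) (auto simp: algebra_simps spn_add)
qed

end

section \<open>Modules of a given type\<close>

context op_pres
begin

lemma act_add:
  assumes "x \<in> W" "u \<in> carrier M" "w \<in> carrier M"
  shows "act M x (add M u w) = add M (act M x u) (act M x w)"
proof -
  obtain a b where "a \<in> Z" "b \<in> Z" "u = pr a" "w = pr b" using assms by (auto simp: carrier_M)
  then show ?thesis using assms(1) by (simp add: add_M act_M op_add op_closed Z_simps)
qed

lemma act_smult:
  assumes "x \<in> W" "u \<in> carrier M"
  shows "act M x (smult M c u) = smult M c (act M x u)"
proof -
  obtain a where "a \<in> Z" "u = pr a" using assms by (auto simp: carrier_M)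
  then show ?thesis using assms(1) by (simp add: smult_M act_M op_scale op_closed Z_simps)
qed

lemma act_plus:
  assumes "x \<in> W" "y \<in> W" "u \<in> carrier M"
  shows "act M (x + y) u = add M (act M x u) (act M y u)"
proof -
  obtain a where a: "a \<in> Z" "u = pr a" using assms by (auto simp: carrier_M)
  have xy: "x + y \<in> W" using assms W by (auto intro: cfun.subspace_add)
  have "pr (op (x + y) a) = pr (op x a + op y a)"
    using pr_eq op_plus[OF assms(1,2) a(1)] assms a xy by (simp add: op_closed Z_simps)
  then show ?thesis using a assms xy by (simp add: add_M act_M op_closed)
qed

lemma act_cscale:
  assumes "x \<in> W" "u \<in> carrier M"
  shows "act M (cscale c x) u = smult M c (act M x u)"
proof -
  obtain a where a: "a \<in> Z" "u = pr a" using assms by (auto simp: carrier_M)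
  have x: "cscale c x \<in> W" using assms W by (auto intro: cfun.subspace_scale)
  have "pr (op (cscale c x) a) = pr (scale c (op x a))"
    using pr_eq op_cscale[OF assms(1) a(1)] assms a x by (simp add: op_closed Z_simps)
  then show ?thesis using a assms x by (simp add: smult_M act_M op_closed)
qed

lemma M_closed:
  "u \<in> carrier M \<Longrightarrow> w \<in> carrier M \<Longrightarrow> add M u w \<in> carrier M"
  "u \<in> carrier M \<Longrightarrow> smult M c u \<in> carrier M" "zero M \<in> carrier M"
  by (auto simp: carrier_M add_M smult_M zero_M Z_simps)

lemma smult_zero: "u \<in> carrier M \<Longrightarrow> smult M 0 u = zero M"
  by (auto simp: carrier_M smult_M zero_M)

definition lin_form :: "('z \<Rightarrow> complex) \<Rightarrow> bool" where
  "lin_form \<Phi> \<longleftrightarrow> (\<forall>z\<in>Z. \<forall>z'\<in>Z. \<Phi> (z + z') = \<Phi> z + \<Phi> z') \<and>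
    (\<forall>c. \<forall>z\<in>Z. \<Phi> (scale c z) = c * \<Phi> z) \<and> (\<forall>z\<in>Z0. \<Phi> z = 0)"

text \<open>The bound reflects that a diagram column whose height h satisfies c0 <= h < r0 survives
  at most one application of the element, and every other column none.\<close>

definition rank_one_vanish :: "nat \<Rightarrow> (nat \<Rightarrow> nat) \<Rightarrow> (nat \<times> nat \<Rightarrow> 'a \<Rightarrow> complex) \<Rightarrow> 'z \<Rightarrow> bool" where
  "rank_one_vanish n m f z \<longleftrightarrow> (\<forall>c0 r0 U k. 1 \<le> c0 \<longrightarrow> c0 \<le> n \<longrightarrow> c0 < r0 \<longrightarrow> r0 \<le> n \<or> r0 = 2 * n + 1 \<longrightarrow>
      U (2 * n + 2 - c0) = 1 \<longrightarrow> bnd n m c0 r0 < k \<longrightarrow>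
      foldr op (replicate k (rank_one f n c0 r0 U)) z \<in> Z0)"

text \<open>The form is tested on words and not on multisets, because the operators commute on
  representatives only modulo \<open>Z0\<close>.\<close>

definition essential :: "nat \<Rightarrow> (nat \<times> nat \<Rightarrow> 'a \<Rightarrow> complex) \<Rightarrow> 'z \<Rightarrow> (nat \<times> nat) multiset \<Rightarrow> bool" where
  "essential n f z s \<longleftrightarrow> (\<exists>\<Phi>. lin_form \<Phi> \<and>
    (\<forall>ws. set ws \<subseteq> posB n \<longrightarrow> \<Phi> (foldr op (map f ws) z) \<noteq> 0 \<longrightarrow>
      mset ws = s \<or> pos_weight n (mset ws) < pos_weight n s) \<and>
    (\<exists>ws. set ws \<subseteq> posB n \<and> mset ws = s \<and> \<Phi> (foldr op (map f ws) z) \<noteq> 0))"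

lemma lin_form_diff:
  assumes "lin_form \<Phi>" "z \<in> Z" "z' \<in> Z" "z - z' \<in> Z0"
  shows "\<Phi> z = \<Phi> z'"
proof -
  have "\<Phi> (z' + (z - z')) = \<Phi> z' + \<Phi> (z - z')" using assms Z_simps unfolding lin_form_def by blast
  then show ?thesis using assms by (simp add: lin_form_def)
qed

lemma lin_form_sum:
  assumes "lin_form \<Phi>" "\<And>i. i \<in> I \<Longrightarrow> g i \<in> Z"
  shows "\<Phi> (\<Sum>i\<in>I. g i) = (\<Sum>i\<in>I. \<Phi> (g i))"
proof -
  have 0: "\<Phi> 0 = 0" using assms(1) Z0_simps(1) by (simp add: lin_form_def)
  show ?thesis using assms(2)
  proof (induction I rule: infinite_finite_induct)
    case (insert i I)
    then have "g i \<in> Z" "(\<Sum>i\<in>I. g i) \<in> Z" by (auto intro: Z_simps)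
    then show ?case using insert assms(1) by (simp add: lin_form_def)
  qed (auto simp: 0)
qed

text \<open>Among the monomials with nonzero coefficient choose one of least weight: its linear form
  vanishes on all the others.\<close>

lemma essential_independent:
  assumes z: "z \<in> Z" and f: "\<And>x. x \<in> posB n \<Longrightarrow> f x \<in> W"
    and S: "finite S" "\<And>s. s \<in> S \<Longrightarrow> essential n f z s" "\<And>s. s \<in> S \<Longrightarrow> set_mset s \<subseteq> posB n"
    and p: "(\<Sum>t\<in>S. cst (a t) * Poly_Mapping.single (image_mset f t) 1) \<in> Ann z"
    and t: "t \<in> S"
  shows "a t = 0"
proof (rule ccontr)
  assume "a t \<noteq> 0"
  then have "{t \<in> S. a t \<noteq> 0} \<noteq> {}" using t by auto
  then obtain s where s: "s \<in> S" "a s \<noteq> 0" "\<And>t. t \<in> S \<Longrightarrow> a t \<noteq> 0 \<Longrightarrow> pos_weight n s \<le> pos_weight n t"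
    using ex_min_if_finite[of "pos_weight n ` {t \<in> S. a t \<noteq> 0}"] S(1)
    by (smt (verit) finite_imageI finite_subset image_iff image_is_empty linorder_not_le mem_Collect_eq subsetI)
  obtain \<Phi> where \<Phi>: "lin_form \<Phi>"
    and nz: "\<And>ws. set ws \<subseteq> posB n \<Longrightarrow> \<Phi> (foldr op (map f ws) z) \<noteq> 0 \<Longrightarrow>
      mset ws = s \<or> pos_weight n (mset ws) < pos_weight n s"
    and ex: "\<exists>ws. set ws \<subseteq> posB n \<and> mset ws = s \<and> \<Phi> (foldr op (map f ws) z) \<noteq> 0"
    using S(2)[OF s(1)] unfolding essential_def by blast
  let ?F = "\<lambda>t. foldr op (mset_list (image_mset f t)) z"
  have FZ: "?F t \<in> Z" if "t \<in> S" for t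
    using S(3)[OF that] f z by (intro foldr_closed) (auto simp: set_mset_list)
  have F: "\<Phi> (?F (mset ws)) = \<Phi> (foldr op (map f ws) z)" if "set ws \<subseteq> posB n" for ws
  proof (rule lin_form_diff[OF \<Phi>])
    have W': "set (mset_list (image_mset f (mset ws))) \<subseteq> W" "set (map f ws) \<subseteq> W"
      using that f by (auto simp: set_mset_list)
    show "?F (mset ws) \<in> Z" "foldr op (map f ws) z \<in> Z"
      using W' z by (auto intro!: foldr_closed)
    show "?F (mset ws) - foldr op (map f ws) z \<in> Z0"
      using W' z by (intro foldr_mset) (auto simp: mset_mset_list)
  qed
  have other: "a t * \<Phi> (?F t) = (if t = s then a s * \<Phi> (?F s) else 0)" if "t \<in> S" for t
  proof (cases "t = s \<or> a t = 0")
    case False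
    obtain ws where ws: "mset ws = t" by (metis ex_mset)
    have wB: "set ws \<subseteq> posB n" using S(3)[OF that] ws by auto
    have "\<Phi> (?F t) = 0"
      using F[OF wB] nz[OF wB] s(3)[OF that] False unfolding ws by fastforce
    then show ?thesis using False by simp
  qed auto
  have pm: "(\<Sum>t\<in>S. cst (a t) * Poly_Mapping.single (image_mset f t) 1) =
      (\<Sum>t\<in>S. Poly_Mapping.single (image_mset f t) (a t))" by (simp add: cst_single)
  have pact_sum: "pact (\<Sum>t\<in>I. q t) z = (\<Sum>t\<in>I. pact (q t) z)" for I and q :: "(nat \<times> nat) multiset \<Rightarrow> 'a free_poly"
    by (induction I rule: infinite_finite_induct) (auto simp: pact_zero pact_add)
  have "\<Phi> (\<Sum>t\<in>S. scale (a t) (?F t)) = 0"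
    using p \<Phi> unfolding pm Ann_def by (simp add: pact_sum pact_single lin_form_def)
  moreover have "\<Phi> (\<Sum>t\<in>S. scale (a t) (?F t)) = (\<Sum>t\<in>S. \<Phi> (scale (a t) (?F t)))"
    by (rule lin_form_sum[OF \<Phi>]) (auto intro: Z_simps FZ)
  moreover have "\<dots> = (\<Sum>t\<in>S. a t * \<Phi> (?F t))"
    using \<Phi> FZ by (intro sum.cong) (auto simp: lin_form_def)
  moreover have "\<dots> = (\<Sum>t\<in>S. if t = s then a s * \<Phi> (?F s) else 0)"
    by (rule sum.cong) (use other in auto)
  ultimately have "a s * \<Phi> (?F s) = 0" using S(1) s(1) by simp
  moreover obtain ws where "set ws \<subseteq> posB n" "mset ws = s" "\<Phi> (foldr op (map f ws) z) \<noteq> 0"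
    using ex by blast
  ultimately show False using s(2) F by auto
qed

lemma single_power: "Poly_Mapping.single {#y#} (1 :: complex) ^ k = Poly_Mapping.single (replicate_mset k y) 1"
  by (induction k) (auto simp: mult_single)

lemma Ann_power:
  assumes "y \<in> W" "z \<in> Z" "foldr op (replicate k y) z \<in> Z0"
  shows "Poly_Mapping.single {#y#} 1 ^ k \<in> Ann z"
proof -
  have "mset_list (replicate_mset k y) = replicate k y"
  proof -
    have "set (mset_list (replicate_mset k y)) \<subseteq> {y}" by (auto simp: set_mset_list)
    moreover have "length (mset_list (replicate_mset k y)) = k"
      by (metis mset_mset_list size_mset size_replicate_mset)
    ultimately show ?thesis by (metis empty_iff insertE replicate_eqI subsetD)
  qed
  moreover have "set_mset (replicate_mset k y) \<subseteq> W" using assms(1) by auto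
  ultimately show ?thesis using assms unfolding single_power
    by (simp add: Ann_def pact_single fcarrier_single)
qed

end

text \<open>Straighten modulo both annihilators at once. If p lies in the first, then so does its
  normal form q, whence q = 0 by independence; but p - q lies in both, so p lies in the
  second.\<close>

lemma Ann_subset_of_type:
  fixes scale1 :: "complex \<Rightarrow> 'z \<Rightarrow> 'z :: ab_group_add"
    and scale2 :: "complex \<Rightarrow> 'y \<Rightarrow> 'y :: ab_group_add"
  assumes pres1: "op_pres scale1 W Z1 Z01 op1 M1 pr1" and pres2: "op_pres scale2 W Z2 Z02 op2 M2 pr2"
    and z1: "z1 \<in> Z1" and z2: "z2 \<in> Z2"
    and fW: "\<And>x. x \<in> posB n \<Longrightarrow> f x \<in> W"
    and W_span: "\<And>y. y \<in> W \<Longrightarrow> \<exists>g. y = (\<Sum>x\<in>posB n. cscale (g x) (f x))"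
    and v1: "op_pres.rank_one_vanish Z01 op1 n m f z1" and v2: "op_pres.rank_one_vanish Z02 op2 n m f z2"
    and e1: "\<And>s. s \<in> ffl n (bnd n m) \<Longrightarrow> op_pres.essential scale1 Z1 Z01 op1 n f z1 s"
  shows "op_pres.Ann scale1 W Z01 op1 z1 \<subseteq> op_pres.Ann scale2 W Z02 op2 z2"
proof -
  interpret A: op_pres scale1 W Z1 Z01 op1 M1 pr1 by (rule pres1)
  interpret B: op_pres scale2 W Z2 Z02 op2 M2 pr2 by (rule pres2)
  let ?J = "A.Ann z1 \<inter> B.Ann z2"
  have Y: "rank_one f n c0 r0 U \<in> W" for c0 r0 U
    unfolding rank_one_def
    by (intro cfun.subspace_sum[OF A.W] cfun.subspace_scale[OF A.W] fW) (simp add: sub_pos_def)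
  have "straightening W ?J n m f"
  proof (unfold_locales)
    show "?J \<subseteq> fcarrier W" by (auto simp: A.Ann_def)
    show "0 \<in> ?J" by (simp add: A.Ann_def B.Ann_def fcarrier_zero A.pact_zero B.pact_zero A.Z0_simps B.Z0_simps)
    show "p + q \<in> ?J" if "p \<in> ?J" "q \<in> ?J" for p q using that by (auto intro: A.Ann_add B.Ann_add)
    show "r * p \<in> ?J" if "r \<in> fcarrier W" "p \<in> ?J" for r p
      using that by (auto intro: A.Ann_mult[OF z1] B.Ann_mult[OF z2])
    show "linear_relations W \<subseteq> ?J" using A.Ann_linear_relations[OF z1] B.Ann_linear_relations[OF z2] by blast
    show "\<exists>g. y = (\<Sum>x\<in>posB n. cscale (g x) (f x))" if "y \<in> W" for y by (rule W_span[OF that])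
    show "Poly_Mapping.single {#rank_one f n c0 r0 U#} 1 ^ k \<in> ?J"
      if "1 \<le> c0" "c0 \<le> n" "c0 < r0" "r0 \<le> n \<or> r0 = 2 * n + 1" "U (2 * n + 2 - c0) = 1" "bnd n m c0 r0 < k"
      for c0 r0 U k
      using that v1 v2 unfolding A.rank_one_vanish_def B.rank_one_vanish_def
      by (intro IntI A.Ann_power B.Ann_power Y z1 z2) blast+
  qed (auto intro: A.W fW)
  then interpret S: straightening W ?J n m f .
  show ?thesis
  proof
    fix p assume p: "p \<in> A.Ann z1"
    then obtain q where q: "q \<in> spn S.pmon (ffl n (bnd n m))" "p - q \<in> ?J"
      using S.normal_form[of p] by (auto simp: A.Ann_def)
    obtain S a where S: "finite S" "S \<subseteq> ffl n (bnd n m)" "q = (\<Sum>t\<in>S. cst (a t) * S.pmon t)"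
      using spn_expand[OF q(1)] by blast
    have "- (p - q) + p \<in> A.Ann z1"
      using q(2) p S.J_uminus[OF q(2)] by (intro A.Ann_add) auto
    then have "q \<in> A.Ann z1" by simp
    then have "(\<Sum>t\<in>S. cst (a t) * Poly_Mapping.single (image_mset f t) 1) \<in> A.Ann z1"
      using S(3) by (simp add: S.pmon_def)
    then have "a t = 0" if "t \<in> S" for t
      using S(2) by (intro A.essential_independent[OF z1 fW S(1) e1 _ _ that]) (auto simp: ffl_def)
    then have "q = 0" unfolding S(3) by (simp add: cst_simps)
    then show "p \<in> B.Ann z2" using q(2) by simp
  qed
qed

section \<open>Tensor products of modules of given types\<close>

text \<open>The comultiplication of the symmetric algebra on a monomial: all ways to distribute the
  letters over two factors.\<close>

fun splits :: "'b list \<Rightarrow> ('b list \<times> 'b list) list" where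
  "splits [] = [([], [])]"
| "splits (x # xs) = map (\<lambda>(a, b). (x # a, b)) (splits xs) @ map (\<lambda>(a, b). (a, x # b)) (splits xs)"

lemma splits_mset: "(a, b) \<in> set (splits xs) \<Longrightarrow> mset xs = mset a + mset b"
  by (induction xs arbitrary: a b) auto

lemma splits_set: "(a, b) \<in> set (splits xs) \<Longrightarrow> set xs = set a \<union> set b"
  by (induction xs arbitrary: a b) auto

lemma splits_map: "splits (map f xs) = map (\<lambda>(a, b). (map f a, map f b)) (splits xs)"
  by (induction xs) (auto simp: comp_def case_prod_unfold)

lemma splits_append: "(xs, ys) \<in> set (splits (xs @ ys))"
proof (induction xs)
  case Nil
  have "([], ys) \<in> set (splits ys)" by (induction ys) auto
  then show ?case by simp
qed (auto simp: image_iff, force)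

lemma splits_replicate:
  "(a, b) \<in> set (splits (replicate k y)) \<Longrightarrow> \<exists>i j. i + j = k \<and> a = replicate i y \<and> b = replicate j y"
proof (induction k arbitrary: a b)
  case (Suc k)
  from Suc.prems consider a' where "a = y # a'" "(a', b) \<in> set (splits (replicate k y))" |
    b' where "b = y # b'" "(a, b') \<in> set (splits (replicate k y))" by auto
  then show ?case
  proof cases
    case 1
    with Suc.IH obtain i j where "i + j = k" "a' = replicate i y" "b = replicate j y" by blast
    then show ?thesis using 1 by (intro exI[of _ "Suc i"] exI[of _ j]) simp
  next
    case 2
    with Suc.IH obtain i j where "i + j = k" "a = replicate i y" "b' = replicate j y" by blast
    then show ?thesis using 2 by (intro exI[of _ i] exI[of _ "Suc j"]) simp
  qed
qed simp

section \<open>Arithmetic of cosets\<close>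

lemma elt_set_plus_eq_iff:
  fixes S :: "'z :: ab_group_add set"
  assumes "0 \<in> S" "\<And>x y. x \<in> S \<Longrightarrow> y \<in> S \<Longrightarrow> x - y \<in> S"
  shows "a +o S = b +o S \<longleftrightarrow> a - b \<in> S"
proof
  assume "a +o S = b +o S"
  moreover have "a \<in> a +o S" using assms(1) by (force simp: elt_set_plus_def)
  ultimately obtain s where "a = b + s" "s \<in> S" by (auto simp: elt_set_plus_def)
  then show "a - b \<in> S" by simp
next
  assume ab: "a - b \<in> S"
  have m: "- x \<in> S" if "x \<in> S" for x using assms(2)[OF assms(1) that] by simp
  have p: "x + y \<in> S" if "x \<in> S" "y \<in> S" for x y using assms(2)[OF that(1) m[OF that(2)]] by simp
  have "a + s = b + ((a - b) + s)" "b + s = a + (s - (a - b))" for s by (simp_all add: algebra_simps)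
  then show "a +o S = b +o S" unfolding elt_set_plus_def using ab assms p by (auto; metis)
qed

lemma elt_set_plus_add:
  fixes S :: "'z :: ab_group_add set"
  assumes "0 \<in> S" "\<And>x y. x \<in> S \<Longrightarrow> y \<in> S \<Longrightarrow> x + y \<in> S"
  shows "(a +o S) + (b +o S) = (a + b) +o S"
proof
  show "(a +o S) + (b +o S) \<subseteq> (a + b) +o S"
  proof
    fix x assume "x \<in> (a +o S) + (b +o S)"
    then obtain s t where "s \<in> S" "t \<in> S" "x = (a + s) + (b + t)"
      by (auto simp: elt_set_plus_def set_plus_def)
    then show "x \<in> (a + b) +o S" using assms(2)
      by (auto simp: elt_set_plus_def algebra_simps intro!: bexI[of _ "s + t"])
  qed
  show "(a + b) +o S \<subseteq> (a +o S) + (b +o S)"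
  proof
    fix x assume "x \<in> (a + b) +o S"
    then obtain s where s: "s \<in> S" "x = (a + b) + s" by (auto simp: elt_set_plus_def)
    then have "x = (a + s) + (b + 0)" by (simp add: algebra_simps)
    then show "x \<in> (a +o S) + (b +o S)" using s(1) assms(1)
      unfolding elt_set_plus_def set_plus_def by blast
  qed
qed

text \<open>Evaluates maps on cosets in the form in which \<open>tensor_product\<close> and
  \<open>gr_V0\<close> define scalar multiplication and action.\<close>

lemma image_elt_set_plus:
  fixes S T :: "'z :: ab_group_add set"
  assumes "0 \<in> S" "\<And>x y. x \<in> T \<Longrightarrow> y \<in> T \<Longrightarrow> x + y \<in> T" "0 \<in> T"
    and "\<And>s. s \<in> S \<Longrightarrow> g (a + s) - g a \<in> T"
  shows "g ` (a +o S) + T = g a +o T"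
proof
  show "g ` (a +o S) + T \<subseteq> g a +o T"
  proof
    fix x assume "x \<in> g ` (a +o S) + T"
    then obtain s t where st: "s \<in> S" "t \<in> T" "x = g (a + s) + t"
      by (auto simp: elt_set_plus_def set_plus_def)
    then have "x = g a + ((g (a + s) - g a) + t)" by simp
    then show "x \<in> g a +o T" using assms(2)[OF assms(4)[OF st(1)] st(2)]
      unfolding elt_set_plus_def by blast
  qed
  show "g a +o T \<subseteq> g ` (a +o S) + T"
  proof
    fix x assume "x \<in> g a +o T"
    then obtain t where "t \<in> T" "x = g (a + 0) + t" by (auto simp: elt_set_plus_def)
    then show "x \<in> g ` (a +o S) + T" using assms(1) unfolding elt_set_plus_def set_plus_def by blast
  qed
qed

declare plus_fun_apply [simp del] zero_fun_apply [simp del] minus_apply [simp del] uminus_apply [simp del]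

section \<open>The tensor product as a presented module\<close>

locale op_pres_pair =
  A: op_pres scale1 W Z1 Z01 op1 M pr1 + B: op_pres scale2 W Z2 Z02 op2 N pr2
  for scale1 :: "complex \<Rightarrow> 'z \<Rightarrow> 'z :: ab_group_add"
    and scale2 :: "complex \<Rightarrow> 'y \<Rightarrow> 'y :: ab_group_add"
    and W :: "('a \<Rightarrow> complex) set" and Z1 Z01 op1 and M :: "('a \<Rightarrow> complex, 'm) op_space" and pr1
    and Z2 Z02 op2 and N :: "('a \<Rightarrow> complex, 'k) op_space" and pr2
begin

abbreviation "FS \<equiv> free_space M N"
abbreviation "BR \<equiv> bilinear_relations M N"

lemma FS_subspace: "cfun.subspace FS"
  unfolding free_space_def by (rule cfun.subspace_span)

lemma BR_subspace: "cfun.subspace BR"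
  unfolding bilinear_relations_def by (rule cfun.subspace_span)

lemmas FS_simps = cfun.subspace_0[OF FS_subspace] cfun.subspace_add[OF FS_subspace]
  cfun.subspace_scale[OF FS_subspace] cfun.subspace_diff[OF FS_subspace]
lemmas BR_simps = cfun.subspace_0[OF BR_subspace] cfun.subspace_add[OF BR_subspace]
  cfun.subspace_scale[OF BR_subspace] cfun.subspace_diff[OF BR_subspace]

lemma FS_delta: "u \<in> carrier M \<Longrightarrow> w \<in> carrier N \<Longrightarrow> delta (u, w) \<in> FS"
  unfolding free_space_def by (rule cfun.span_base) auto

lemma FS_induct [consumes 1, case_names zero delta add]:
  assumes "g \<in> FS" "P 0"
    and "\<And>u w. u \<in> carrier M \<Longrightarrow> w \<in> carrier N \<Longrightarrow> P (delta (u, w))"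
    and "\<And>c g h. g \<in> FS \<Longrightarrow> h \<in> FS \<Longrightarrow> P g \<Longrightarrow> P h \<Longrightarrow> P (cscale c g + h)"
  shows "P g"
proof -
  have "g \<in> FS \<and> P g" using assms(1) unfolding free_space_def
  proof (induction rule: cfun.span_induct_alt)
    case base
    then show ?case using assms(2) cfun.span_zero by blast
  next
    case (step c x y)
    then obtain u w where "x = delta (u, w)" "u \<in> carrier M" "w \<in> carrier N" by auto
    then have "x \<in> FS" "P x" using assms(3) FS_delta by auto
    then show ?case using step(2) assms(4) unfolding free_space_def
      by (metis cfun.span_add cfun.span_scale)
  qed
  then show ?thesis by simp
qed

lemma FS_support: "g \<in> FS \<Longrightarrow> finite {p. g p \<noteq> 0} \<and> {p. g p \<noteq> 0} \<subseteq> carrier M \<times> carrier N"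
proof (induction rule: FS_induct)
  case (add c g h)
  have "{p. (cscale c g + h) p \<noteq> 0} \<subseteq> {p. g p \<noteq> 0} \<union> {p. h p \<noteq> 0}"
    by (auto simp: cscale_def plus_fun_apply)
  then show ?case using add finite_subset[OF _ finite_UnI] by blast
qed (auto simp: delta_def zero_fun_apply)

lemma support_sum:
  assumes "g \<in> FS" "finite S" "{p. g p \<noteq> 0} \<subseteq> S" and "\<And>p. H p 0 = (0 :: 'r :: comm_monoid_add)"
  shows "(\<Sum>p | g p \<noteq> 0. H p (g p)) = (\<Sum>p\<in>S. H p (g p))"
  by (rule sum.mono_neutral_left[OF assms(2,3)]) (use assms(4) in auto)

text \<open>As H vanishes at 0, all three sums may be taken over the union of the supports of g and
  h. This serves both for the action and for the product of two linear forms.\<close>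

lemma support_sum_comb:
  fixes H :: "'m \<times> 'k \<Rightarrow> complex \<Rightarrow> 'r :: comm_monoid_add"
  assumes "g \<in> FS" "h \<in> FS" and "\<And>p a b. H p (c * a + b) = S (H p a) + H p b"
    and "S 0 = 0" "\<And>a b. S (a + b) = S a + S b" "\<And>p. H p 0 = 0"
  shows "(\<Sum>p | (cscale c g + h) p \<noteq> 0. H p ((cscale c g + h) p)) =
    S (\<Sum>p | g p \<noteq> 0. H p (g p)) + (\<Sum>p | h p \<noteq> 0. H p (h p))"
proof -
  let ?S = "{p. g p \<noteq> 0} \<union> {p. h p \<noteq> 0}"
  have fin: "finite ?S" using FS_support assms(1,2) by blast
  have gh: "cscale c g + h \<in> FS" using assms FS_simps by blast
  have Ssum: "S (sum k A) = (\<Sum>i\<in>A. S (k i))" for k and A :: "('m \<times> 'k) set"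
    by (induction A rule: infinite_finite_induct) (auto simp: assms)
  have "(\<Sum>p | (cscale c g + h) p \<noteq> 0. H p ((cscale c g + h) p)) = (\<Sum>p\<in>?S. H p ((cscale c g + h) p))"
    by (rule support_sum[where H = H, OF gh fin _ assms(6)]) (auto simp: cscale_def plus_fun_apply)
  also have "\<dots> = (\<Sum>p\<in>?S. S (H p (g p)) + H p (h p))"
    by (rule sum.cong) (auto simp: cscale_def assms(3) plus_fun_apply)
  also have "\<dots> = S (\<Sum>p\<in>?S. H p (g p)) + (\<Sum>p\<in>?S. H p (h p))"
    by (simp add: sum.distrib Ssum)
  also have "(\<Sum>p\<in>?S. H p (g p)) = (\<Sum>p | g p \<noteq> 0. H p (g p))"
    by (rule support_sum[where H = H, symmetric, OF assms(1) fin _ assms(6)]) auto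
  also have "(\<Sum>p\<in>?S. H p (h p)) = (\<Sum>p | h p \<noteq> 0. H p (h p))"
    by (rule support_sum[where H = H, symmetric, OF assms(2) fin _ assms(6)]) auto
  finally show ?thesis .
qed

abbreviation "tact \<equiv> free_space_act M N"

lemma act_delta: "tact x (delta (u, w)) = delta (act M x u, w) + delta (u, act N x w)"
proof -
  have "{p. delta (u, w) p \<noteq> 0} = {(u, w)}" by (auto simp: delta_def)
  then have "{(a, b). delta (u, w) (a, b) \<noteq> 0} = {(u, w)}" by auto
  then show ?thesis by (simp add: free_space_act_def) (simp add: delta_def cscale_def fun_eq_iff plus_fun_apply)
qed

lemma act_comb:
  assumes "g \<in> FS" "h \<in> FS"
  shows "tact x (cscale c g + h) = cscale c (tact x g) + tact x h"
proof -
  define H where "H p a = cscale a (delta (act M x (fst p), snd p) + delta (fst p, act N x (snd p)))"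
    for p and a :: complex
  have H: "tact x g = (\<Sum>p | g p \<noteq> 0. H p (g p))" for g
    by (simp add: free_space_act_def H_def case_prod_unfold)
  show ?thesis unfolding H
    by (rule support_sum_comb[OF assms, of H c "cscale c"])
      (auto simp: H_def cscale_def fun_eq_iff algebra_simps plus_fun_apply zero_fun_apply)
qed

lemma act_zero: "tact x 0 = 0"
  by (simp add: free_space_act_def zero_fun_apply)

lemma act_add: "g \<in> FS \<Longrightarrow> h \<in> FS \<Longrightarrow> tact x (g + h) = tact x g + tact x h"
  using act_comb[of g h x 1] by simp

lemma act_scale: "g \<in> FS \<Longrightarrow> tact x (cscale c g) = cscale c (tact x g)"
  using act_comb[of g 0 x c] FS_simps(1) by (simp add: act_zero)

lemma act_diff: "g \<in> FS \<Longrightarrow> h \<in> FS \<Longrightarrow> tact x (g - h) = tact x g - tact x h"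
  using act_comb[of h g x "- 1"] by simp

lemma act_FS:
  assumes x: "x \<in> W" and g: "g \<in> FS"
  shows "tact x g \<in> FS"
  using g
proof (induction rule: FS_induct)
  case (delta u w)
  then show ?case using x by (simp add: act_delta FS_simps FS_delta A.act_closed B.act_closed)
qed (auto simp: act_zero act_comb FS_simps)

lemma BR_gens:
  "u \<in> carrier M \<Longrightarrow> u' \<in> carrier M \<Longrightarrow> w \<in> carrier N \<Longrightarrow>
    delta (add M u u', w) - delta (u, w) - delta (u', w) \<in> BR"
  "u \<in> carrier M \<Longrightarrow> w \<in> carrier N \<Longrightarrow> w' \<in> carrier N \<Longrightarrow>
    delta (u, add N w w') - delta (u, w) - delta (u, w') \<in> BR"
  "u \<in> carrier M \<Longrightarrow> w \<in> carrier N \<Longrightarrow> delta (smult M c u, w) - cscale c (delta (u, w)) \<in> BR"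
  "u \<in> carrier M \<Longrightarrow> w \<in> carrier N \<Longrightarrow> delta (u, smult N c w) - cscale c (delta (u, w)) \<in> BR"
  unfolding bilinear_relations_def by (rule cfun.span_base; blast)+

lemma BR_induct [consumes 1, case_names zero add1 add2 scale1 scale2 comb]:
  assumes "g \<in> BR" "P 0"
    and "\<And>u u' w. u \<in> carrier M \<Longrightarrow> u' \<in> carrier M \<Longrightarrow> w \<in> carrier N \<Longrightarrow>
      P (delta (add M u u', w) - delta (u, w) - delta (u', w))"
    and "\<And>u w w'. u \<in> carrier M \<Longrightarrow> w \<in> carrier N \<Longrightarrow> w' \<in> carrier N \<Longrightarrow>
      P (delta (u, add N w w') - delta (u, w) - delta (u, w'))"
    and "\<And>u w c. u \<in> carrier M \<Longrightarrow> w \<in> carrier N \<Longrightarrow> P (delta (smult M c u, w) - cscale c (delta (u, w)))"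
    and "\<And>u w c. u \<in> carrier M \<Longrightarrow> w \<in> carrier N \<Longrightarrow> P (delta (u, smult N c w) - cscale c (delta (u, w)))"
    and "\<And>c g h. P g \<Longrightarrow> P h \<Longrightarrow> P (cscale c g + h)"
  shows "P g"
  using assms(1) unfolding bilinear_relations_def
proof (induction rule: cfun.span_induct_alt)
  case base
  show ?case by (rule assms(2))
next
  case (step c x y)
  have "P x" using step(1) assms(3-6) by blast
  then show ?case using step(2) assms(7) by blast
qed

lemma BR_FS: "g \<in> BR \<Longrightarrow> g \<in> FS"
  by (induction rule: BR_induct) (auto intro!: FS_simps FS_delta A.M_closed B.M_closed)

text \<open>The operator x \<otimes> 1 + 1 \<otimes> x turns a bilinear relation into the sum of two
  relations of the same kind.\<close>

lemma act_BR:
  assumes x: "x \<in> W" and g: "g \<in> BR"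
  shows "tact x g \<in> BR"
proof -
  have "g \<in> BR \<and> tact x g \<in> BR" using g
  proof (induction rule: BR_induct)
    case zero
    then show ?case by (simp add: act_zero BR_simps)
  next
    case (add1 u u' w)
    have "tact x (delta (add M u u', w) - delta (u, w) - delta (u', w)) =
        (delta (add M (act M x u) (act M x u'), w) - delta (act M x u, w) - delta (act M x u', w)) +
        (delta (add M u u', act N x w) - delta (u, act N x w) - delta (u', act N x w))"
      using add1 x by (simp add: act_diff FS_delta FS_simps A.M_closed act_delta A.act_add)
    then show ?case using add1 x by (simp add: BR_simps BR_gens A.act_closed B.act_closed)
  next
    case (add2 u w w')
    have "tact x (delta (u, add N w w') - delta (u, w) - delta (u, w')) =
        (delta (u, add N (act N x w) (act N x w')) - delta (u, act N x w) - delta (u, act N x w')) +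
        (delta (act M x u, add N w w') - delta (act M x u, w) - delta (act M x u, w'))"
      using add2 x by (simp add: act_diff FS_delta FS_simps B.M_closed act_delta B.act_add)
    then show ?case using add2 x by (simp add: BR_simps BR_gens A.act_closed B.act_closed)
  next
    case (scale1 u w c)
    have "tact x (delta (smult M c u, w) - cscale c (delta (u, w))) =
        (delta (smult M c (act M x u), w) - cscale c (delta (act M x u, w))) +
        (delta (smult M c u, act N x w) - cscale c (delta (u, act N x w)))"
      using scale1 x by (simp add: act_diff act_scale FS_delta FS_simps A.M_closed act_delta A.act_smult
          cfun.scale_right_distrib)
    then show ?case using scale1 x by (simp add: BR_simps BR_gens A.act_closed B.act_closed)
  next
    case (scale2 u w c)
    have "tact x (delta (u, smult N c w) - cscale c (delta (u, w))) =
        (delta (u, smult N c (act N x w)) - cscale c (delta (u, act N x w))) +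
        (delta (act M x u, smult N c w) - cscale c (delta (act M x u, w)))"
      using scale2 x by (simp add: act_diff act_scale FS_delta FS_simps B.M_closed act_delta B.act_smult
          cfun.scale_right_distrib)
    then show ?case using scale2 x by (simp add: BR_simps BR_gens A.act_closed B.act_closed)
  next
    case (comb c g h)
    then show ?case by (simp add: act_comb BR_FS BR_simps)
  qed
  then show ?thesis by simp
qed

lemma act_plus:
  assumes x: "x \<in> W" "y \<in> W" and g: "g \<in> FS"
  shows "tact (x + y) g - (tact x g + tact y g) \<in> BR"
  using g
proof (induction rule: FS_induct)
  case zero
  then show ?case by (simp add: act_zero BR_simps)
next
  case (delta u w)
  have "tact (x + y) (delta (u, w)) - (tact x (delta (u, w)) + tact y (delta (u, w))) =
      (delta (add M (act M x u) (act M y u), w) - delta (act M x u, w) - delta (act M y u, w)) +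
      (delta (u, add N (act N x w) (act N y w)) - delta (u, act N x w) - delta (u, act N y w))"
    using delta x by (simp add: act_delta A.act_plus B.act_plus)
  then show ?case using delta x by (simp add: BR_simps BR_gens A.act_closed B.act_closed)
next
  case (add c g h)
  have "tact (x + y) (cscale c g + h) - (tact x (cscale c g + h) + tact y (cscale c g + h)) =
      cscale c (tact (x + y) g - (tact x g + tact y g)) + (tact (x + y) h - (tact x h + tact y h))"
    using add by (simp add: act_comb cfun.scale_right_diff_distrib cfun.scale_right_distrib)
  then show ?case using add by (simp add: BR_simps)
qed

lemma act_cscale:
  assumes x: "x \<in> W" and g: "g \<in> FS"
  shows "tact (cscale b x) g - cscale b (tact x g) \<in> BR"
  using g
proof (induction rule: FS_induct)
  case zero
  then show ?case by (simp add: act_zero BR_simps)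
next
  case (delta u w)
  have "tact (cscale b x) (delta (u, w)) - cscale b (tact x (delta (u, w))) =
      (delta (smult M b (act M x u), w) - cscale b (delta (act M x u, w))) +
      (delta (u, smult N b (act N x w)) - cscale b (delta (u, act N x w)))"
    using delta x by (simp add: act_delta A.act_cscale B.act_cscale cfun.scale_right_distrib)
  then show ?case using delta x by (simp add: BR_simps BR_gens A.act_closed B.act_closed)
next
  case (add c g h)
  have "tact (cscale b x) (cscale c g + h) - cscale b (tact x (cscale c g + h)) =
      cscale c (tact (cscale b x) g - cscale b (tact x g)) + (tact (cscale b x) h - cscale b (tact x h))"
    using add by (simp add: act_comb cfun.scale_right_diff_distrib cfun.scale_right_distrib mult.commute)
  then show ?case using add by (simp add: BR_simps)
qed

lemma act_comm:
  assumes x: "x \<in> W" "y \<in> W" and g: "g \<in> FS"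
  shows "tact x (tact y g) = tact y (tact x g)"
  using g
proof (induction rule: FS_induct)
  case zero
  then show ?case by (simp add: act_zero)
next
  case (delta u w)
  then show ?case using x
    by (simp add: act_delta act_add FS_delta A.act_closed B.act_closed A.act_comm[of y x u] B.act_comm[of y x w])
next
  case (add c g h)
  then show ?case using x by (simp add: act_comb act_FS)
qed

sublocale T: op_pres cscale W FS BR tact "tensor_product M N" "\<lambda>g. g +o BR"
proof (unfold_locales)
  show "cfun.subspace W" by (rule A.W)
  show "cfun.subspace FS" by (rule FS_subspace)
  show "cfun.subspace BR" by (rule BR_subspace)
  show "BR \<subseteq> FS" using BR_FS by blast
  show "carrier (tensor_product M N) = (\<lambda>g. g +o BR) ` FS" by (simp add: tensor_product_def)
  show "g +o BR = h +o BR \<longleftrightarrow> g - h \<in> BR" for g h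
    by (rule elt_set_plus_eq_iff) (auto intro: BR_simps)
  show "zero (tensor_product M N) = 0 +o BR" by (simp add: tensor_product_def)
  show "add (tensor_product M N) (g +o BR) (h +o BR) = (g + h) +o BR" for g h
    unfolding tensor_product_def by simp (rule elt_set_plus_add; auto intro: BR_simps)
  show "smult (tensor_product M N) c (g +o BR) = cscale c g +o BR" for c g
    unfolding tensor_product_def
    by simp (rule image_elt_set_plus; auto intro: BR_simps simp: cfun.scale_right_distrib)
  show "act (tensor_product M N) x (g +o BR) = tact x g +o BR" if "x \<in> W" "g \<in> FS" for x g
    unfolding tensor_product_def
    by simp (rule image_elt_set_plus; use that in \<open>auto intro: BR_simps act_BR simp: act_add BR_FS\<close>)
qed (auto intro: act_FS act_BR act_add act_scale act_plus act_cscale simp: act_comm BR_simps)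

lemma foldr_delta:
  assumes "set xs \<subseteq> W" "u \<in> carrier M" "w \<in> carrier N"
  shows "foldr tact xs (delta (u, w)) =
    (\<Sum>(a, b)\<leftarrow>splits xs. delta (foldr (act M) a u, foldr (act N) b w))"
  using assms(1)
proof (induction xs)
  case Nil
  then show ?case by simp
next
  case (Cons x xs)
  define d where "d p = delta (foldr (act M) (fst p) u, foldr (act N) (snd p) w)" for p
  have d: "d p \<in> FS \<and> tact x (d p) = d (x # fst p, snd p) + d (fst p, x # snd p)" if "p \<in> set (splits xs)" for p
    using that splits_set[of "fst p" "snd p" xs] assms Cons.prems
    by (auto simp: d_def act_delta intro!: FS_delta A.foldr_act_closed B.foldr_act_closed)
  have "tact x (\<Sum>p\<leftarrow>ps. d p) = (\<Sum>p\<leftarrow>ps. d (x # fst p, snd p)) + (\<Sum>p\<leftarrow>ps. d (fst p, x # snd p)) \<and>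
      (\<Sum>p\<leftarrow>ps. d p) \<in> FS"
    if "set ps \<subseteq> set (splits xs)" for ps
    using that
  proof (induction ps)
    case (Cons p ps)
    then show ?case using d[of p] by (simp add: FS_simps act_add ac_simps)
  qed (simp add: act_zero FS_simps)
  moreover have "foldr tact xs (delta (u, w)) = (\<Sum>p\<leftarrow>splits xs. d p)"
    using Cons by (simp add: d_def case_prod_unfold)
  ultimately have "foldr tact (x # xs) (delta (u, w)) =
      (\<Sum>p\<leftarrow>splits xs. d (x # fst p, snd p)) + (\<Sum>p\<leftarrow>splits xs. d (fst p, x # snd p))" by simp
  then show ?case by (simp add: comp_def case_prod_unfold d_def)
qed

section \<open>The tensor product of two generators\<close>

lemma delta_zero_BR:
  "w \<in> carrier N \<Longrightarrow> delta (zero M, w) \<in> BR" "u \<in> carrier M \<Longrightarrow> delta (u, zero N) \<in> BR"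
  using BR_gens(3)[of "zero M" w 0] BR_gens(4)[of u "zero N" 0]
  by (simp_all add: A.M_closed B.M_closed A.smult_zero B.smult_zero)

text \<open>By the Leibniz rule the power is a sum of terms with i factors on the left and j = k - i
  on the right. If k exceeds the sum of the two bounds, then i exceeds the first or j the
  second.\<close>

lemma rank_one_vanish_tensor:
  assumes f: "\<And>x. x \<in> posB n \<Longrightarrow> f x \<in> W" and z: "z1 \<in> Z1" "z2 \<in> Z2"
    and v: "A.rank_one_vanish n m f z1" "B.rank_one_vanish n m' f z2"
  shows "T.rank_one_vanish n (\<lambda>i. m i + m' i) f (delta (pr1 z1, pr2 z2))"
  unfolding T.rank_one_vanish_def
proof (intro allI impI)
  fix c0 r0 U k
  assume c: "1 \<le> c0" "c0 \<le> n" "c0 < r0" "r0 \<le> n \<or> r0 = 2 * n + 1" "U (2 * n + 2 - c0) = (1 :: complex)"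
    and k: "bnd n (\<lambda>i. m i + m' i) c0 r0 < k"
  let ?y = "rank_one f n c0 r0 U"
  have y: "?y \<in> W" unfolding rank_one_def
    by (intro cfun.subspace_sum[OF A.W] cfun.subspace_scale[OF A.W] f) (simp add: sub_pos_def)
  have cM: "pr1 z1 \<in> carrier M" "pr2 z2 \<in> carrier N" using z by (auto simp: A.carrier_M B.carrier_M)
  have "delta (foldr (act M) a (pr1 z1), foldr (act N) b (pr2 z2)) \<in> BR"
    if ab: "(a, b) \<in> set (splits (replicate k ?y))" for a b
  proof -
    obtain i j where ij: "i + j = k" "a = replicate i ?y" "b = replicate j ?y"
      using splits_replicate[OF ab] by blast
    have W: "set a \<subseteq> W" "set b \<subseteq> W"
      using y by (auto simp: ij set_replicate_conv_if split: if_splits)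
    have eq: "foldr (act M) a (pr1 z1) = pr1 (foldr op1 a z1)" "foldr (act N) b (pr2 z2) = pr2 (foldr op2 b z2)"
      using A.act_foldr[OF W(1) z(1)] B.act_foldr[OF W(2) z(2)] by auto
    have cl: "foldr (act M) a (pr1 z1) \<in> carrier M" "foldr (act N) b (pr2 z2) \<in> carrier N"
      using A.foldr_act_closed[OF W(1) cM(1)] B.foldr_act_closed[OF W(2) cM(2)] by auto
    have "bnd n m c0 r0 < i \<or> bnd n m' c0 r0 < j" using k ij(1) unfolding bnd_add by linarith
    then show ?thesis
    proof
      assume "bnd n m c0 r0 < i"
      then have "foldr op1 a z1 \<in> Z01"
        using v(1) c unfolding A.rank_one_vanish_def ij by blast
      then have "foldr (act M) a (pr1 z1) = zero M"
        using A.pr_zero_iff[OF A.foldr_closed[OF W(1) z(1)]] by (simp add: eq A.zero_M)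
      then show ?thesis using delta_zero_BR(1) cl by simp
    next
      assume "bnd n m' c0 r0 < j"
      then have "foldr op2 b z2 \<in> Z02"
        using v(2) c unfolding B.rank_one_vanish_def ij by blast
      then have "foldr (act N) b (pr2 z2) = zero N"
        using B.pr_zero_iff[OF B.foldr_closed[OF W(2) z(2)]] by (simp add: eq B.zero_M)
      then show ?thesis using delta_zero_BR(2) cl by simp
    qed
  qed
  note d = this
  have "(\<Sum>(a, b)\<leftarrow>ps. delta (foldr (act M) a (pr1 z1), foldr (act N) b (pr2 z2))) \<in> BR"
    if "set ps \<subseteq> set (splits (replicate k ?y))" for ps
    using that by (induction ps) (auto simp: BR_simps d)
  then show "foldr tact (replicate k ?y) (delta (pr1 z1, pr2 z2)) \<in> BR"
    using y cM by (subst foldr_delta) auto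
qed

end

context op_pres
begin

text \<open>The free space on pairs is built from classes, so a form on representatives has to
  descend before two forms can be multiplied.\<close>

lemma lin_form_carrier:
  assumes "lin_form \<Phi>"
  shows "\<exists>\<phi>. (\<forall>z\<in>Z. \<phi> (pr z) = \<Phi> z)"
proof -
  define \<phi> where "\<phi> u = \<Phi> (SOME z. z \<in> Z \<and> pr z = u)" for u
  have "\<phi> (pr z) = \<Phi> z" if z: "z \<in> Z" for z
  proof -
    have "(SOME z'. z' \<in> Z \<and> pr z' = pr z) \<in> Z \<and> pr (SOME z'. z' \<in> Z \<and> pr z' = pr z) = pr z"
      by (rule someI[of "\<lambda>z'. z' \<in> Z \<and> pr z' = pr z" z]) (use z in simp)
    then show ?thesis unfolding \<phi>_def using lin_form_diff[OF assms] pr_eq z by blast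
  qed
  then show ?thesis by blast
qed

end

context op_pres_pair
begin

text \<open>Take the product of the two forms. Weight is additive, and a distribution (a, b) of a
  word contributes only if a is s1 or lighter and b is s2 or lighter. For a word of s1 + s2 this
  leaves the contents s1 and s2, whose terms all have the same value and cannot cancel.\<close>

lemma essential_tensor:
  assumes f: "\<And>x. x \<in> posB n \<Longrightarrow> f x \<in> W" and z: "z1 \<in> Z1" "z2 \<in> Z2"
    and e: "A.essential n f z1 s1" "B.essential n f z2 s2"
  shows "T.essential n f (delta (pr1 z1, pr2 z2)) (s1 + s2)"
proof -
  obtain \<Phi> where \<Phi>: "A.lin_form \<Phi>"
    and \<Phi>nz: "\<And>ws. set ws \<subseteq> posB n \<Longrightarrow> \<Phi> (foldr op1 (map f ws) z1) \<noteq> 0 \<Longrightarrow>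
      mset ws = s1 \<or> pos_weight n (mset ws) < pos_weight n s1"
    and \<Phi>ex: "\<exists>ws. set ws \<subseteq> posB n \<and> mset ws = s1 \<and> \<Phi> (foldr op1 (map f ws) z1) \<noteq> 0"
    using e(1) unfolding A.essential_def by blast
  obtain \<Psi> where \<Psi>: "B.lin_form \<Psi>"
    and \<Psi>nz: "\<And>ws. set ws \<subseteq> posB n \<Longrightarrow> \<Psi> (foldr op2 (map f ws) z2) \<noteq> 0 \<Longrightarrow>
      mset ws = s2 \<or> pos_weight n (mset ws) < pos_weight n s2"
    and \<Psi>ex: "\<exists>ws. set ws \<subseteq> posB n \<and> mset ws = s2 \<and> \<Psi> (foldr op2 (map f ws) z2) \<noteq> 0"
    using e(2) unfolding B.essential_def by blast
  obtain \<phi> where \<phi>: "\<And>z. z \<in> Z1 \<Longrightarrow> \<phi> (pr1 z) = \<Phi> z" using A.lin_form_carrier[OF \<Phi>] by blast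
  obtain \<psi> where \<psi>: "\<And>z. z \<in> Z2 \<Longrightarrow> \<psi> (pr2 z) = \<Psi> z" using B.lin_form_carrier[OF \<Psi>] by blast
  have \<phi>lin: "\<phi> (add M u u') = \<phi> u + \<phi> u'" "\<phi> (smult M c u) = c * \<phi> u"
    if "u \<in> carrier M" "u' \<in> carrier M" for u u' c
    using that \<Phi> by (auto simp: A.carrier_M A.add_M A.smult_M \<phi> A.Z_simps A.lin_form_def)
  have \<psi>lin: "\<psi> (add N u u') = \<psi> u + \<psi> u'" "\<psi> (smult N c u) = c * \<psi> u"
    if "u \<in> carrier N" "u' \<in> carrier N" for u u' c
    using that \<Psi> by (auto simp: B.carrier_M B.add_M B.smult_M \<psi> B.Z_simps B.lin_form_def)
  define \<Theta> where "\<Theta> g = (\<Sum>p | g p \<noteq> 0. g p * (\<phi> (fst p) * \<psi> (snd p)))" for g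
  have \<Theta>comb: "\<Theta> (cscale c g + h) = c * \<Theta> g + \<Theta> h" if "g \<in> FS" "h \<in> FS" for c g h
    unfolding \<Theta>_def
    by (rule support_sum_comb[OF that, of "\<lambda>p a. a * (\<phi> (fst p) * \<psi> (snd p))" c "(*) c"])
      (auto simp: algebra_simps)
  have \<Theta>delta: "\<Theta> (delta (u, w)) = \<phi> u * \<psi> w" for u w
  proof -
    have "{p. delta (u, w) p \<noteq> 0} = {(u, w)}" by (auto simp: delta_def)
    then show ?thesis by (simp add: \<Theta>_def) (simp add: delta_def)
  qed
  have \<Theta>0: "\<Theta> 0 = 0" by (simp add: \<Theta>_def zero_fun_apply)
  have \<Theta>add: "\<Theta> (g + h) = \<Theta> g + \<Theta> h" if "g \<in> FS" "h \<in> FS" for g h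
    using \<Theta>comb[OF that, of 1] by simp
  have \<Theta>diff: "\<Theta> (g - h) = \<Theta> g - \<Theta> h" if "g \<in> FS" "h \<in> FS" for g h
    using \<Theta>comb[OF that(2,1), of "- 1"] by simp
  have \<Theta>scale: "\<Theta> (cscale c g) = c * \<Theta> g" if "g \<in> FS" for c g
    using \<Theta>comb[OF that FS_simps(1), of c] by (simp add: \<Theta>0)
  have \<Theta>BR: "\<Theta> g = 0" if "g \<in> BR" for g
  proof -
    have "g \<in> FS \<and> \<Theta> g = 0" using that
    proof (induction rule: BR_induct)
      case (comb c g h)
      then show ?case by (simp add: FS_simps \<Theta>comb)
    qed (auto simp: \<Theta>0 \<Theta>diff \<Theta>scale \<Theta>delta FS_simps FS_delta A.M_closed B.M_closed \<phi>lin \<psi>lin \<Theta>add algebra_simps)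
    then show ?thesis by simp
  qed
  have \<Theta>lin: "T.lin_form \<Theta>"
    unfolding T.lin_form_def using \<Theta>add \<Theta>scale \<Theta>BR by blast
  let ?t = "\<lambda>a b. \<Phi> (foldr op1 (map f a) z1) * \<Psi> (foldr op2 (map f b) z2)"
  have val: "\<Theta> (foldr tact (map f ws) (delta (pr1 z1, pr2 z2))) = (\<Sum>(a, b)\<leftarrow>splits ws. ?t a b)"
    if ws: "set ws \<subseteq> posB n" for ws
  proof -
    have W: "set (map f ws) \<subseteq> W" using ws f by auto
    have cM: "pr1 z1 \<in> carrier M" "pr2 z2 \<in> carrier N" using z by (auto simp: A.carrier_M B.carrier_M)
    let ?d = "\<lambda>(a, b). delta (foldr (act M) (map f a) (pr1 z1), foldr (act N) (map f b) (pr2 z2))"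
    have p: "?d p \<in> FS \<and> \<Theta> (?d p) = (case p of (a, b) \<Rightarrow> ?t a b)" if "p \<in> set (splits ws)" for p
    proof -
      obtain a b where ab: "p = (a, b)" by (cases p) auto
      have W: "set (map f a) \<subseteq> W" "set (map f b) \<subseteq> W"
        using splits_set[of a b ws] that ab ws f by auto
      then show ?thesis unfolding ab prod.case
        using FS_delta[OF A.foldr_act_closed[OF W(1) cM(1)] B.foldr_act_closed[OF W(2) cM(2)]]
        by (simp only: \<Theta>delta A.act_foldr[OF W(1) z(1)] B.act_foldr[OF W(2) z(2)]
            \<phi>[OF A.foldr_closed[OF W(1) z(1)]] \<psi>[OF B.foldr_closed[OF W(2) z(2)]])
    qed
    have "(\<Sum>p\<leftarrow>ps. ?d p) \<in> FS \<and> \<Theta> (\<Sum>p\<leftarrow>ps. ?d p) = (\<Sum>(a, b)\<leftarrow>ps. ?t a b)"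
      if "set ps \<subseteq> set (splits ws)" for ps
      using that
    proof (induction ps)
      case (Cons q ps)
      then show ?case using p[of q] by (simp add: FS_simps \<Theta>add)
    qed (simp add: \<Theta>0 FS_simps)
    then show ?thesis unfolding foldr_delta[OF W cM] splits_map
      by (simp add: comp_def case_prod_unfold)
  qed
  have nz: "mset a = s1 \<and> mset b = s2 \<or> pos_weight n (mset ws) < pos_weight n (s1 + s2)"
    if "set ws \<subseteq> posB n" "(a, b) \<in> set (splits ws)" "?t a b \<noteq> 0" for ws a b
  proof -
    have "set a \<subseteq> posB n" "set b \<subseteq> posB n" using that splits_set by blast+
    then have "mset a = s1 \<or> pos_weight n (mset a) < pos_weight n s1"
      "mset b = s2 \<or> pos_weight n (mset b) < pos_weight n s2" using \<Phi>nz \<Psi>nz that(3) by auto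
    then show ?thesis using splits_mset[OF that(2)] by (auto simp: pos_weight_add)
  qed
  have 1: "mset ws = s1 + s2 \<or> pos_weight n (mset ws) < pos_weight n (s1 + s2)"
    if ws: "set ws \<subseteq> posB n" "\<Theta> (foldr tact (map f ws) (delta (pr1 z1, pr2 z2))) \<noteq> 0" for ws
  proof -
    have "\<exists>p\<in>set (splits ws). (case p of (a, b) \<Rightarrow> ?t a b) \<noteq> 0"
    proof (rule ccontr)
      assume "\<not> ?thesis"
      then have "map (\<lambda>(a, b). ?t a b) (splits ws) = map (\<lambda>_. 0) (splits ws)" by (intro map_cong) auto
      then have "(\<Sum>(a, b)\<leftarrow>splits ws. ?t a b) = 0" by (metis sum_list_0)
      then show False using ws val by simp
    qed
    then obtain a b where ab: "(a, b) \<in> set (splits ws)" "?t a b \<noteq> 0" by auto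
    show ?thesis using nz[OF ws(1) ab] splits_mset[OF ab(1)] by auto
  qed
  obtain w1 where w1: "set w1 \<subseteq> posB n" "mset w1 = s1" "\<Phi> (foldr op1 (map f w1) z1) \<noteq> 0" using \<Phi>ex by blast
  obtain w2 where w2: "set w2 \<subseteq> posB n" "mset w2 = s2" "\<Psi> (foldr op2 (map f w2) z2) \<noteq> 0" using \<Psi>ex by blast
  let ?ws = "w1 @ w2"
  have ws: "set ?ws \<subseteq> posB n" "mset ?ws = s1 + s2" using w1 w2 by auto
  have t: "?t a b = (if mset a = s1 \<and> mset b = s2 then ?t w1 w2 else 0)" if ab: "(a, b) \<in> set (splits ?ws)" for a b
  proof (cases "mset a = s1 \<and> mset b = s2")
    case True
    have W: "set (map f a) \<subseteq> W" "set (map f b) \<subseteq> W" "set (map f w1) \<subseteq> W" "set (map f w2) \<subseteq> W"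
      using subset_trans[OF _ ws(1), of "set a"] subset_trans[OF _ ws(1), of "set b"] splits_set[OF ab]
        w1(1) w2(1) f by auto
    have "\<Phi> (foldr op1 (map f a) z1) = \<Phi> (foldr op1 (map f w1) z1)"
      by (rule A.lin_form_diff[OF \<Phi> A.foldr_closed[OF W(1) z(1)] A.foldr_closed[OF W(3) z(1)] A.foldr_mset[OF _ W(1) z(1)]])
        (use True w1 in \<open>simp flip: mset_map add: mset_map\<close>)
    moreover have "\<Psi> (foldr op2 (map f b) z2) = \<Psi> (foldr op2 (map f w2) z2)"
      by (rule B.lin_form_diff[OF \<Psi> B.foldr_closed[OF W(2) z(2)] B.foldr_closed[OF W(4) z(2)] B.foldr_mset[OF _ W(2) z(2)]])
        (use True w2 in \<open>simp add: mset_map\<close>)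
    ultimately show ?thesis using True by simp
  next
    case False
    then show ?thesis using nz[OF ws(1) ab] ws(2) by auto
  qed
  \<comment> \<open>k is the number of distributions with contents s1 and s2; (w1, w2) is one of
    them.\<close>
  have "\<exists>k. (\<Sum>(a, b)\<leftarrow>ps. ?t a b) = of_nat k * ?t w1 w2 \<and> ((w1, w2) \<in> set ps \<longrightarrow> 0 < k)"
    if "set ps \<subseteq> set (splits ?ws)" for ps
    using that
  proof (induction ps)
    case Nil
    then show ?case by (intro exI[of _ 0]) simp
  next
    case (Cons p ps)
    then obtain k where k: "(\<Sum>(a, b)\<leftarrow>ps. ?t a b) = of_nat k * ?t w1 w2" "(w1, w2) \<in> set ps \<longrightarrow> 0 < k" by auto
    obtain a b where p: "p = (a, b)" by (cases p) auto
    have ab: "(a, b) \<in> set (splits ?ws)" using Cons.prems p by auto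
    show ?case
    proof (cases "mset a = s1 \<and> mset b = s2")
      case True
      then have "?t a b = ?t w1 w2" using t[OF ab] by simp
      then show ?thesis using k p by (intro exI[of _ "Suc k"]) (simp add: algebra_simps)
    next
      case False
      then have "?t a b = 0" by (simp only: t[OF ab] if_False)
      moreover have "(a, b) \<noteq> (w1, w2)" using False w1 w2 by auto
      ultimately show ?thesis using k p by (intro exI[of _ k]) auto
    qed
  qed
  then obtain k where "(\<Sum>(a, b)\<leftarrow>splits ?ws. ?t a b) = of_nat k * ?t w1 w2" "0 < k"
    using splits_append[of w1 w2] by blast
  then have "\<Theta> (foldr tact (map f ?ws) (delta (pr1 z1, pr2 z2))) \<noteq> 0"
    using val[OF ws(1)] w1 w2 by simp
  then show ?thesis unfolding T.essential_def using \<Theta>lin 1 ws by blast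
qed

end

section \<open>Root vectors of the odd symplectic algebra\<close>

lemma omega_sum_right:
  "j \<in> {1..n} \<Longrightarrow> (\<Sum>k\<in>idx n. g k * omega n k j) = - g (n + j)"
  "j \<in> {1..n} \<Longrightarrow> (\<Sum>k\<in>idx n. g k * omega n k (n + j)) = g j"
  "(\<Sum>k\<in>idx n. g k * omega n k (2 * n + 1)) = 0"
proof -
  show "(\<Sum>k\<in>idx n. g k * omega n k j) = - g (n + j)" if j: "j \<in> {1..n}"
  proof -
    have "(\<Sum>k\<in>idx n. g k * omega n k j) = (\<Sum>k\<in>idx n. if k = n + j then - g k else 0)"
      by (rule sum.cong) (use j in \<open>auto simp: omega_def\<close>)
    then show ?thesis using j by (simp add: idx_def)
  qed
  show "(\<Sum>k\<in>idx n. g k * omega n k (n + j)) = g j" if j: "j \<in> {1..n}"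
  proof -
    have "(\<Sum>k\<in>idx n. g k * omega n k (n + j)) = (\<Sum>k\<in>idx n. if k = j then g k else 0)"
      by (rule sum.cong) (use j in \<open>auto simp: omega_def\<close>)
    then show ?thesis using j by (simp add: idx_def)
  qed
  show "(\<Sum>k\<in>idx n. g k * omega n k (2 * n + 1)) = 0"
    by (rule sum.neutral) (auto simp: omega_def)
qed

lemma omega_antisym: "omega n i j = - omega n j i"
  by (auto simp: omega_def)

lemma omega_sum_left:
  "i \<in> {1..n} \<Longrightarrow> (\<Sum>k\<in>idx n. omega n i k * g k) = g (n + i)"
  "i \<in> {1..n} \<Longrightarrow> (\<Sum>k\<in>idx n. omega n (n + i) k * g k) = - g i"
  "(\<Sum>k\<in>idx n. omega n (2 * n + 1) k * g k) = 0"
proof -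
  have "(\<Sum>k\<in>idx n. omega n i k * g k) = - (\<Sum>k\<in>idx n. g k * omega n k i)" for i
    unfolding sum_negf[symmetric] by (rule sum.cong) (auto simp: omega_antisym[of n i])
  then show "i \<in> {1..n} \<Longrightarrow> (\<Sum>k\<in>idx n. omega n i k * g k) = g (n + i)"
    "i \<in> {1..n} \<Longrightarrow> (\<Sum>k\<in>idx n. omega n (n + i) k * g k) = - g i"
    "(\<Sum>k\<in>idx n. omega n (2 * n + 1) k * g k) = 0"
    by (simp_all only: omega_sum_right minus_minus minus_zero)
qed

lemma idx_cases:
  assumes "i \<in> idx n"
  obtains "i \<in> {1..n}" | k where "i = n + k" "k \<in> {1..n}" | "i = 2 * n + 1"
proof -
  have "i \<in> {1..n} \<or> i = n + (i - n) \<and> i - n \<in> {1..n} \<or> i = 2 * n + 1"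
    using assms by (auto simp: idx_def)
  then show ?thesis using that by blast
qed

lemma sp_odd_iff:
  "X \<in> sp_odd n \<longleftrightarrow> X \<in> gl n \<and>
    (\<forall>i\<in>{1..n}. \<forall>j\<in>{1..n}. X (n + i, j) = X (n + j, i)) \<and>
    (\<forall>i\<in>{1..n}. \<forall>j\<in>{1..n}. X (n + i, n + j) = - X (j, i)) \<and>
    (\<forall>i\<in>{1..n}. \<forall>j\<in>{1..n}. X (i, n + j) = X (j, n + i)) \<and>
    (\<forall>i\<in>{1..n}. X (i, 2 * n + 1) = 0 \<and> X (n + i, 2 * n + 1) = 0)" (is "_ \<longleftrightarrow> ?R")
proof -
  let ?E = "\<lambda>i j. (\<Sum>k\<in>idx n. X (k, i) * omega n k j) + (\<Sum>k\<in>idx n. omega n i k * X (k, j))"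
  have E: "?E i j = - X (n + j, i) + X (n + i, j)" "?E i (n + j) = X (j, i) + X (n + i, n + j)"
    "?E (n + i) j = - X (n + j, n + i) + - X (i, j)" "?E (n + i) (n + j) = X (j, n + i) + - X (i, n + j)"
    if "i \<in> {1..n}" "j \<in> {1..n}" for i j
    by (simp_all only: omega_sum_left(1,2)[OF that(1)] omega_sum_right(1,2)[OF that(2)])
  have E2: "?E i (2 * n + 1) = X (n + i, 2 * n + 1)" "?E (n + i) (2 * n + 1) = - X (i, 2 * n + 1)"
    "?E (2 * n + 1) i = - X (n + i, 2 * n + 1)" "?E (2 * n + 1) (n + i) = X (i, 2 * n + 1)"
    if "i \<in> {1..n}" for i
    by (simp_all only: omega_sum_left(1,2)[OF that] omega_sum_right(1,2)[OF that] omega_sum_left(3) omega_sum_right(3)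
        add_0 add_0_right)
  have E3: "?E (2 * n + 1) (2 * n + 1) = 0"
    by (simp only: omega_sum_left(3) omega_sum_right(3) add_0)
  have m: "i \<in> idx n" "n + i \<in> idx n" if "i \<in> {1..n}" for i using that by (auto simp: idx_def)
  have m3: "2 * n + 1 \<in> idx n" by (simp add: idx_def)
  show ?thesis
  proof
    assume X: "X \<in> sp_odd n"
    then have gl: "X \<in> gl n" and e: "\<And>i j. i \<in> idx n \<Longrightarrow> j \<in> idx n \<Longrightarrow> ?E i j = 0" by (auto simp: sp_odd_def)
    show ?R
    proof (intro conjI ballI gl)
      fix i j assume ij: "i \<in> {1..n}" "j \<in> {1..n}"
      show "X (n + i, j) = X (n + j, i)" using E(1)[OF ij] e[OF m(1)[OF ij(1)] m(1)[OF ij(2)]] by simp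
      show "X (n + i, n + j) = - X (j, i)" using E(2)[OF ij] e[OF m(1)[OF ij(1)] m(2)[OF ij(2)]]
        by (simp add: eq_neg_iff_add_eq_0 add.commute)
      show "X (i, n + j) = X (j, n + i)" using E(4)[OF ij] e[OF m(2)[OF ij(1)] m(2)[OF ij(2)]] by simp
    next
      fix i assume i: "i \<in> {1..n}"
      show "X (i, 2 * n + 1) = 0" using E2(2)[OF i] e[OF m(2)[OF i] m3] by simp
      show "X (n + i, 2 * n + 1) = 0" using E2(1)[OF i] e[OF m(1)[OF i] m3] by simp
    qed
  next
    assume R: ?R
    have R1: "X (n + i, j) = X (n + j, i)" "X (n + i, n + j) = - X (j, i)" "X (i, n + j) = X (j, n + i)"
      "X (i, 2 * n + 1) = 0" "X (n + i, 2 * n + 1) = 0" if "i \<in> {1..n}" "j \<in> {1..n}" for i j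
      using R that by blast+
    have "?E i j = 0" if "i \<in> idx n" "j \<in> idx n" for i j
      using that(1)
    proof (cases rule: idx_cases)
      case i: 1
      show ?thesis using that(2)
      proof (cases rule: idx_cases)
        case j: 1
        show ?thesis unfolding E(1)[OF i j] R1(1)[OF i j] by simp
      next
        case (2 l)
        show ?thesis unfolding 2(1) E(2)[OF i 2(2)] R1(2)[OF i 2(2)] by simp
      next
        case 3
        show ?thesis unfolding 3 E2(1)[OF i] R1(5)[OF i i] ..
      qed
    next
      case (2 k)
      note i1 = 2(1) and i = 2(2)
      show ?thesis using that(2)
      proof (cases rule: idx_cases)
        case j: 1
        show ?thesis unfolding i1 E(3)[OF i j] R1(2)[OF j i] by simp
      next
        case (2 l)
        show ?thesis unfolding i1 2(1) E(4)[OF i 2(2)] R1(3)[OF i 2(2)] by simp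
      next
        case 3
        show ?thesis unfolding i1 3 E2(2)[OF i] R1(4)[OF i i] by simp
      qed
    next
      case 3
      note i1 = 3
      show ?thesis using that(2)
      proof (cases rule: idx_cases)
        case j: 1
        show ?thesis unfolding i1 E2(3)[OF j] R1(5)[OF j j] by simp
      next
        case (2 l)
        show ?thesis unfolding i1 2(1) E2(4)[OF 2(2)] R1(4)[OF 2(2) 2(2)] ..
      next
        case 3
        show ?thesis unfolding i1 3 by (rule E3)
      qed
    qed
    then show "X \<in> sp_odd n" using R by (simp add: sp_odd_def)
  qed
qed

lemma sp_odd_subspace: "cfun.subspace (sp_odd n)"
  unfolding cfun.subspace_def
  by (auto simp: sp_odd_iff gl_def cscale_def plus_fun_apply zero_fun_apply)

text \<open>Carrying the two factors of a product across omega costs two signs and reverses their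
  order, so the left side for XY is the right side for YX.\<close>

lemma sp_odd_bracket:
  assumes X: "X \<in> sp_odd n" and Y: "Y \<in> sp_odd n"
  shows "bracket n X Y \<in> sp_odd n"
proof -
  have gl: "mat_mult n A B \<in> gl n" if "A \<in> gl n" "B \<in> gl n" for A B
    using that by (auto simp: gl_def mat_mult_def intro!: sum.neutral)
  have X1: "(\<Sum>k\<in>idx n. X (k, i) * omega n k j) = - (\<Sum>k\<in>idx n. omega n i k * X (k, j))"
    if "i \<in> idx n" "j \<in> idx n" for i j
    using X that by (auto simp: sp_odd_def eq_neg_iff_add_eq_0)
  have Y1: "(\<Sum>k\<in>idx n. Y (k, i) * omega n k j) = - (\<Sum>k\<in>idx n. omega n i k * Y (k, j))"
    if "i \<in> idx n" "j \<in> idx n" for i j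
    using Y that by (auto simp: sp_odd_def eq_neg_iff_add_eq_0)
  have key: "(\<Sum>k\<in>idx n. mat_mult n A B (k, i) * omega n k j) = (\<Sum>k\<in>idx n. omega n i k * mat_mult n B A (k, j))"
    if A: "\<And>i j. i \<in> idx n \<Longrightarrow> j \<in> idx n \<Longrightarrow> (\<Sum>k\<in>idx n. A (k, i) * omega n k j) = - (\<Sum>k\<in>idx n. omega n i k * A (k, j))"
      and B: "\<And>i j. i \<in> idx n \<Longrightarrow> j \<in> idx n \<Longrightarrow> (\<Sum>k\<in>idx n. B (k, i) * omega n k j) = - (\<Sum>k\<in>idx n. omega n i k * B (k, j))"
      and ij: "i \<in> idx n" "j \<in> idx n" for A B i j
  proof -
    have "(\<Sum>k\<in>idx n. mat_mult n A B (k, i) * omega n k j) = (\<Sum>k\<in>idx n. \<Sum>l\<in>idx n. A (k, l) * B (l, i) * omega n k j)"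
      by (simp add: mat_mult_def sum_distrib_right)
    also have "\<dots> = (\<Sum>l\<in>idx n. B (l, i) * (\<Sum>k\<in>idx n. A (k, l) * omega n k j))"
      by (subst sum.swap) (simp add: sum_distrib_left mult_ac)
    also have "\<dots> = (\<Sum>l\<in>idx n. B (l, i) * - (\<Sum>k\<in>idx n. omega n l k * A (k, j)))"
      by (intro sum.cong refl) (simp add: A ij)
    also have "\<dots> = (\<Sum>l\<in>idx n. \<Sum>k\<in>idx n. - (B (l, i) * omega n l k * A (k, j)))"
      by (simp add: sum_distrib_left sum_negf mult.assoc)
    also have "\<dots> = (\<Sum>k\<in>idx n. - (\<Sum>l\<in>idx n. B (l, i) * omega n l k) * A (k, j))"
      by (subst sum.swap) (simp add: sum_distrib_right sum_negf)
    also have "\<dots> = (\<Sum>k\<in>idx n. (\<Sum>l\<in>idx n. omega n i l * B (l, k)) * A (k, j))"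
      by (intro sum.cong refl) (simp add: B ij)
    also have "\<dots> = (\<Sum>k\<in>idx n. \<Sum>l\<in>idx n. omega n i l * (B (l, k) * A (k, j)))"
      by (simp add: sum_distrib_right mult.assoc)
    also have "\<dots> = (\<Sum>l\<in>idx n. omega n i l * mat_mult n B A (l, j))"
      by (subst sum.swap) (simp add: mat_mult_def sum_distrib_left)
    finally show ?thesis .
  qed
  have "bracket n X Y \<in> gl n"
    using gl[of X Y] gl[of Y X] X Y by (auto simp: sp_odd_def gl_def bracket_def minus_apply)
  moreover have "(\<Sum>k\<in>idx n. bracket n X Y (k, i) * omega n k j) + (\<Sum>k\<in>idx n. omega n i k * bracket n X Y (k, j)) = 0"
    if ij: "i \<in> idx n" "j \<in> idx n" for i j
    using key[OF X1 Y1 ij] key[OF Y1 X1 ij]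
    by (simp add: bracket_def minus_apply left_diff_distrib right_diff_distrib sum_subtractf)
  ultimately show ?thesis by (simp add: sp_odd_def)
qed

section \<open>Coordinates with respect to root vectors\<close>

text \<open>The index of the basis vector at place r in the order e_1, ..., e_n, e_(2n+1), e_(2n),
  ..., e_(n+1); \<open>idx_pos\<close> is the inverse.\<close>

definition row_idx :: "nat \<Rightarrow> nat \<Rightarrow> nat" where
  "row_idx n r = (if r \<le> n then r else if r = n + 1 then 2 * n + 1 else 3 * n + 2 - r)"

definition idx_pos :: "nat \<Rightarrow> nat \<Rightarrow> nat" where
  "idx_pos n i = (if i \<le> n then i else if i = 2 * n + 1 then n + 1 else 3 * n + 2 - i)"

text \<open>The four cases are the root \<epsilon>_r - \<epsilon>_c, a vector of
  \<open>F_minus n\<close>, the long root -2\<epsilon>_c, and the root -\<epsilon>_c - \<epsilon>_i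
  with i = 2n+2-r.\<close>

definition sp_basis :: "nat \<Rightarrow> nat \<times> nat \<Rightarrow> cmat" where
  "sp_basis n = (\<lambda>(r, c).
     if r \<le> n then delta (r, c) - delta (n + c, n + r)
     else if r = n + 1 then delta (2 * n + 1, c)
     else if r + c = 2 * n + 2 then delta (n + c, c)
     else delta (3 * n + 2 - r, c) + delta (n + c, 2 * n + 2 - r))"

lemma row_idx_idx: "1 \<le> r \<Longrightarrow> r \<le> 2 * n + 1 \<Longrightarrow> row_idx n r \<in> idx n"
  by (auto simp: row_idx_def idx_def)

lemma idx_pos_row_idx: "1 \<le> r \<Longrightarrow> r \<le> 2 * n + 1 \<Longrightarrow> idx_pos n (row_idx n r) = r"
  by (auto simp: row_idx_def idx_pos_def)

lemma row_idx_idx_pos: "i \<in> idx n \<Longrightarrow> row_idx n (idx_pos n i) = i"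
  by (auto simp: row_idx_def idx_pos_def idx_def)

lemma posB_cases:
  assumes "x \<in> posB n"
  obtains (A) r c where "x = (r, c)" "1 \<le> c" "c < r" "r \<le> n"
  | (F) c where "x = (n + 1, c)" "1 \<le> c" "c \<le> n"
  | (S) i c where "x = (2 * n + 2 - i, c)" "1 \<le> c" "c \<le> i" "i \<le> n"
proof -
  obtain r c where x: "x = (r, c)" by (cases x) auto
  have B: "1 \<le> c" "c \<le> n" "c < r" "r + c \<le> 2 * n + 2" using assms by (auto simp: x posB_def)
  consider "r \<le> n" | "r = n + 1" | "n + 1 < r" by linarith
  then show ?thesis
  proof cases
    case 3
    then have "x = (2 * n + 2 - (2 * n + 2 - r), c)" "c \<le> 2 * n + 2 - r" "2 * n + 2 - r \<le> n" using B x by auto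
    then show ?thesis using S B by blast
  qed (use that B x in auto)
qed

lemma sp_basis_simps:
  "r \<le> n \<Longrightarrow> sp_basis n (r, c) = delta (r, c) - delta (n + c, n + r)"
  "sp_basis n (n + 1, c) = delta (2 * n + 1, c)"
  "1 \<le> i \<Longrightarrow> i \<le> n \<Longrightarrow> sp_basis n (2 * n + 2 - i, c) =
    (if i = c then delta (n + c, c) else delta (n + i, c) + delta (n + c, i))"
proof -
  assume i: "1 \<le> i" "i \<le> n"
  then have "3 * n + 2 - (2 * n + 2 - i) = n + i" "2 * n + 2 - (2 * n + 2 - i) = i"
    "2 * n + 2 - i + c = 2 * n + 2 \<longleftrightarrow> i = c" "\<not> 2 * n + 2 - i \<le> n" "2 * n + 2 - i \<noteq> n + 1" by auto
  then show "sp_basis n (2 * n + 2 - i, c) =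
    (if i = c then delta (n + c, c) else delta (n + i, c) + delta (n + c, i))"
    by (simp only: sp_basis_def prod.case if_False)
qed (simp_all add: sp_basis_def)

lemma row_idx_simps:
  "r \<le> n \<Longrightarrow> row_idx n r = r" "row_idx n (n + 1) = 2 * n + 1"
  "1 \<le> i \<Longrightarrow> i \<le> n \<Longrightarrow> row_idx n (2 * n + 2 - i) = n + i"
  by (auto simp: row_idx_def)

lemma sp_basis_row_idx:
  assumes "x \<in> posB n" "y \<in> posB n"
  shows "sp_basis n x (row_idx n (fst y), snd y) = (if x = y then 1 else 0)"
  using assms(1)
proof (cases rule: posB_cases)
  case (A r c)
  show ?thesis using assms(2)
    by (cases rule: posB_cases)
      (use A in \<open>simp_all only: sp_basis_simps row_idx_simps fst_conv snd_conv\<close>,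
       use A in \<open>auto simp: delta_def minus_apply\<close>)
next
  case (F c)
  show ?thesis using assms(2)
    by (cases rule: posB_cases)
      (use F in \<open>simp_all only: sp_basis_simps row_idx_simps fst_conv snd_conv\<close>,
       use F in \<open>auto simp: delta_def\<close>)
next
  case (S i c)
  show ?thesis using assms(2)
    by (cases rule: posB_cases)
      (use S in \<open>simp_all only: sp_basis_simps row_idx_simps fst_conv snd_conv\<close>,
       use S in \<open>auto simp: delta_def plus_fun_apply\<close>)
qed

lemma sp_basis_sp_odd:
  assumes "x \<in> posB n"
  shows "sp_basis n x \<in> sp_odd n"
  using assms
proof (cases rule: posB_cases)
  case (A r c)
  have eq: "sp_basis n x = delta (r, c) - delta (n + c, n + r)" using A by (simp only: sp_basis_simps)
  show ?thesis unfolding eq sp_odd_iff gl_def idx_def using A by (auto simp: delta_def minus_apply)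
next
  case (F c)
  have eq: "sp_basis n x = delta (2 * n + 1, c)" using F by (simp only: sp_basis_simps)
  show ?thesis unfolding eq sp_odd_iff gl_def idx_def using F by (auto simp: delta_def)
next
  case (S i c)
  have eq: "sp_basis n x = (if i = c then delta (n + c, c) else delta (n + i, c) + delta (n + c, i))"
    using S by (simp only: sp_basis_simps)
  show ?thesis unfolding eq sp_odd_iff gl_def idx_def using S by (auto simp: delta_def plus_fun_apply)
qed

lemma sp_basis_lower:
  assumes "x \<in> posB n" "sp_basis n x (i, j) \<noteq> 0"
  shows "idx_pos n j < idx_pos n i"
  using assms(1)
proof (cases rule: posB_cases)
  case (A r c)
  then have "(i, j) = (r, c) \<or> (i, j) = (n + c, n + r)"
    using assms(2) by (simp only: sp_basis_simps) (auto simp: delta_def minus_apply split: if_splits)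
  then show ?thesis using A by (auto simp: idx_pos_def)
next
  case (F c)
  then have "(i, j) = (2 * n + 1, c)"
    using assms(2) by (simp only: sp_basis_simps) (auto simp: delta_def split: if_splits)
  then show ?thesis using F by (auto simp: idx_pos_def)
next
  case (S k c)
  then have "(i, j) = (n + k, c) \<or> (i, j) = (n + c, k)"
    using assms(2) by (simp only: sp_basis_simps) (auto simp: delta_def plus_fun_apply split: if_splits)
  then show ?thesis using S by (auto simp: idx_pos_def)
qed

text \<open>On \<open>sp_odd n\<close> this is the projection to \<open>nt_minus n\<close>. It reads
  off the entries in \<open>posB n\<close>, which are coordinates for the root vectors.\<close>

definition lower_part :: "nat \<Rightarrow> cmat \<Rightarrow> cmat" where
  "lower_part n X = (\<Sum>x\<in>posB n. cscale (X (row_idx n (fst x), snd x)) (sp_basis n x))"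

lemma sum_fun_apply: "(\<Sum>i\<in>I. g i) x = (\<Sum>i\<in>I. g i (x :: 'b) :: complex)"
  by (induction I rule: infinite_finite_induct) (auto simp: plus_fun_apply zero_fun_apply)

lemma lower_part_sp_odd: "lower_part n X \<in> sp_odd n"
  unfolding lower_part_def
  by (intro cfun.subspace_sum[OF sp_odd_subspace] cfun.subspace_scale[OF sp_odd_subspace] sp_basis_sp_odd)

lemma lower_part_entry:
  assumes "(r, c) \<in> posB n"
  shows "lower_part n X (row_idx n r, c) = X (row_idx n r, c)"
proof -
  have "lower_part n X (row_idx n r, c) = (\<Sum>x\<in>posB n. if x = (r, c) then X (row_idx n r, c) else 0)"
    unfolding lower_part_def sum_fun_apply
    by (rule sum.cong) (use sp_basis_row_idx[OF _ assms] in \<open>auto simp: cscale_def\<close>)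
  then show ?thesis using assms by (simp add: finite_posB)
qed

text \<open>Places below the diagonal in the first n columns but outside \<open>posB n\<close> lie
  in the lower left block, whose symmetry carries them into \<open>posB n\<close>.\<close>

lemma sp_odd_lower_zero:
  assumes X: "X \<in> sp_odd n" and z: "\<And>r c. (r, c) \<in> posB n \<Longrightarrow> X (row_idx n r, c) = 0"
    and ia: "i \<in> idx n" "a \<in> {1..n}" "a < idx_pos n i"
  shows "X (i, a) = 0"
proof (cases "idx_pos n i + a \<le> 2 * n + 2")
  case True
  then have "(idx_pos n i, a) \<in> posB n" using ia by (auto simp: posB_def)
  then show ?thesis using z row_idx_idx_pos[OF ia(1)] by metis
next
  case False
  then obtain k where k: "i = n + k" "k \<in> {1..n}" "k < a"
    using ia by (cases rule: idx_cases[OF ia(1)]) (auto simp: idx_pos_def split: if_splits)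
  have "X (i, a) = X (n + a, k)" using X k ia(2) unfolding sp_odd_iff by blast
  also have "(2 * n + 2 - a, k) \<in> posB n" using k ia(2) by (auto simp: posB_def)
  then have "X (n + a, k) = 0" using z[of "2 * n + 2 - a" k] ia(2) by (auto simp: row_idx_def split: if_splits)
  finally show ?thesis .
qed

lemma minus_lower_part_zero:
  assumes X: "X \<in> sp_odd n" and ia: "i \<in> idx n" "a \<in> {1..n}" "a < idx_pos n i"
  shows "(X - lower_part n X) (i, a) = 0"
proof (rule sp_odd_lower_zero[OF _ _ ia])
  show "X - lower_part n X \<in> sp_odd n" by (intro cfun.subspace_diff[OF sp_odd_subspace] X lower_part_sp_odd)
  show "(X - lower_part n X) (row_idx n r, c) = 0" if "(r, c) \<in> posB n" for r c
    using lower_part_entry[OF that, of X] by (simp add: minus_apply)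
qed

lemma strictly_lower_eq_lower_part:
  assumes X: "X \<in> sp_odd n" and low: "\<And>i j. X (i, j) \<noteq> 0 \<Longrightarrow> idx_pos n j < idx_pos n i"
  shows "X = lower_part n X"
proof -
  let ?Y = "X - lower_part n X"
  have Y: "?Y \<in> sp_odd n" by (intro cfun.subspace_diff[OF sp_odd_subspace] X lower_part_sp_odd)
  have low': "idx_pos n j < idx_pos n i" if nz: "?Y (i, j) \<noteq> 0" for i j
  proof (rule ccontr)
    assume n: "\<not> ?thesis"
    then have "X (i, j) = 0" using low by blast
    moreover have "lower_part n X (i, j) = 0"
      unfolding lower_part_def sum_fun_apply by (rule sum.neutral) (use n sp_basis_lower in \<open>auto simp: cscale_def\<close>)
    ultimately show False using nz by (simp add: minus_apply)
  qed
  have z1: "?Y (i, a) = 0" if "i \<in> idx n" "a \<in> {1..n}" for i a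
  proof (cases "a < idx_pos n i")
    case True
    then show ?thesis by (rule minus_lower_part_zero[OF X that])
  next
    case False
    then show ?thesis using low'[of i a] that(2) by (auto simp: idx_pos_def)
  qed
  have "?Y (i, j) = 0" for i j
  proof (cases "i \<in> idx n \<and> j \<in> idx n")
    case False
    then show ?thesis using Y by (auto simp: sp_odd_iff gl_def)
  next
    case True
    then have i: "i \<in> idx n" and j: "j \<in> idx n" by auto
    show ?thesis using j
    proof (cases rule: idx_cases)
      case 1
      then show ?thesis using z1 i by blast
    next
      case (2 k)
      note j = 2
      show ?thesis using i
      proof (cases rule: idx_cases)
        case (2 l)
        have "?Y (n + l, n + k) = - ?Y (k, l)" using Y j(2) 2(2) unfolding sp_odd_iff by blast
        then have "?Y (i, j) = - ?Y (k, l)" using 2(1) j(1) by simp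
        moreover have "?Y (k, l) = 0" using z1[of k l] 2(2) j(2) by (auto simp: idx_def)
        ultimately show ?thesis by simp
      next
        case 1
        then have "idx_pos n i < idx_pos n j" using j by (auto simp: idx_pos_def)
        then show ?thesis using low' by force
      next
        case 3
        then have "idx_pos n i < idx_pos n j" using j by (auto simp: idx_pos_def)
        then show ?thesis using low' by force
      qed
    next
      case 3
      note j = 3
      show ?thesis using i
      proof (cases rule: idx_cases)
        case 3
        then have "idx_pos n i \<le> idx_pos n j" using j by simp
        then show ?thesis using low' by force
      qed (use Y j in \<open>auto simp: sp_odd_iff\<close>)
    qed
  qed
  then have "?Y = 0" by (auto simp: fun_eq_iff zero_fun_apply)
  then show ?thesis by simp
qed

section \<open>Comparison with the root spaces\<close>

lemma cartan_entries:
  assumes "H \<in> cartan n"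
  shows "(\<forall>i j. i \<noteq> j \<longrightarrow> H (i, j) = 0) \<and> (\<forall>i\<in>{1..n}. H (n + i, n + i) = - H (i, i)) \<and> H (2 * n + 1, 2 * n + 1) = 0"
proof -
  let ?S = "{H :: cmat. (\<forall>i j. i \<noteq> j \<longrightarrow> H (i, j) = 0) \<and> (\<forall>i\<in>{1..n}. H (n + i, n + i) = - H (i, i)) \<and> H (2 * n + 1, 2 * n + 1) = 0}"
  have "cfun.subspace ?S" unfolding cfun.subspace_def by (auto simp: cscale_def plus_fun_apply zero_fun_apply)
  moreover have "{delta (i, i) - delta (n + i, n + i) | i. i \<in> {1..n}} \<subseteq> ?S"
    by (auto simp: delta_def minus_apply)
  ultimately have "cartan n \<subseteq> ?S" unfolding cartan_def by (intro cfun.span_minimal)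
  then show ?thesis using assms by blast
qed

lemma bracket_diag:
  assumes H: "\<And>i j. i \<noteq> j \<Longrightarrow> H (i, j) = 0" and X: "X \<in> gl n"
  shows "bracket n H X (i, j) = (H (i, i) - H (j, j)) * X (i, j)"
proof (cases "i \<in> idx n \<and> j \<in> idx n")
  case True
  have "(\<Sum>k\<in>idx n. H (i, k) * X (k, j)) = (\<Sum>k\<in>idx n. if k = i then H (i, i) * X (i, j) else 0)"
    by (rule sum.cong) (auto simp: H)
  moreover have "(\<Sum>k\<in>idx n. X (i, k) * H (k, j)) = (\<Sum>k\<in>idx n. if k = j then X (i, j) * H (j, j) else 0)"
    by (rule sum.cong) (auto simp: H)
  ultimately have e: "(\<Sum>k\<in>idx n. H (i, k) * X (k, j)) = H (i, i) * X (i, j)"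
    "(\<Sum>k\<in>idx n. X (i, k) * H (k, j)) = X (i, j) * H (j, j)"
    using True by (simp_all add: idx_def)
  show ?thesis unfolding bracket_def minus_apply mat_mult_def prod.case e by (simp add: algebra_simps)
next
  case False
  then have "X (i, j) = 0" using X by (auto simp: gl_def)
  moreover have "(\<Sum>k\<in>idx n. H (i, k) * X (k, j)) = 0" "(\<Sum>k\<in>idx n. X (i, k) * H (k, j)) = 0"
  proof -
    show "(\<Sum>k\<in>idx n. H (i, k) * X (k, j)) = 0"
    proof (rule sum.neutral, rule ballI)
      fix k show "H (i, k) * X (k, j) = 0"
        using \<open>X (i, j) = 0\<close> H by (cases "i = k") auto
    qed
    show "(\<Sum>k\<in>idx n. X (i, k) * H (k, j)) = 0"
    proof (rule sum.neutral, rule ballI)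
      fix k show "X (i, k) * H (k, j) = 0"
        using \<open>X (i, j) = 0\<close> H by (cases "k = j") auto
    qed
  qed
  ultimately show ?thesis by (simp add: bracket_def mat_mult_def minus_apply)
qed

lemma simple_root_sum:
  assumes "i \<in> {1..n}"
  shows "(\<Sum>j=1..n. of_int (simple_root n i j) * h j) = (if i < n then h i - h (i + 1) else 2 * h n :: complex)"
proof (cases "i < n")
  case True
  have "(\<Sum>j=1..n. of_int (simple_root n i j) * h j) =
      (\<Sum>j=1..n. (if j = i then h i else 0) - (if j = i + 1 then h (i + 1) else 0))"
    by (rule sum.cong) (auto simp: simple_root_def True)
  also have "\<dots> = h i - h (i + 1)" using True assms by (simp add: sum_subtractf)
  finally show ?thesis using True by simp
next
  case False
  have "(\<Sum>j=1..n. of_int (simple_root n i j) * h j) = (\<Sum>j=1..n. (if j = n then 2 * h n else 0))"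
    by (rule sum.cong) (auto simp: simple_root_def False)
  then show ?thesis using False assms by simp
qed

lemma telescope_interval:
  fixes h :: "nat \<Rightarrow> complex"
  assumes "1 \<le> c" "c \<le> r" "r \<le> n"
  shows "(\<Sum>i=1..n. (if c \<le> i \<and> i < r then 1 else 0) * (if i < n then h i - h (i + 1) else 2 * h n)) = h c - h r"
proof -
  have "(\<Sum>i=1..n. (if c \<le> i \<and> i < r then 1 else 0) * (if i < n then h i - h (i + 1) else 2 * h n)) =
      (\<Sum>i\<in>{c..<r}. h i - h (i + 1))"
    by (rule sum.mono_neutral_cong_right) (use assms in auto)
  also have "\<dots> = h c - h r"
    using assms(2) by (induction r rule: dec_induct) auto
  finally show ?thesis .
qed

lemma sp_basis_neg_root:
  assumes x: "x \<in> posB n" "fst x \<noteq> n + 1"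
  shows "\<exists>k. (\<exists>i\<in>{1..n}. k i \<noteq> 0) \<and> sp_basis n x \<in> neg_root_space n k"
proof -
  obtain r c where rc: "x = (r, c)" by (cases x) auto
  have B: "1 \<le> c" "c \<le> n" "c < r" "r + c \<le> 2 * n + 2" "r \<noteq> n + 1" using x by (auto simp: rc posB_def)
  have sp: "sp_basis n x \<in> sp_odd n" by (rule sp_basis_sp_odd[OF x(1)])
  have even: "sp_basis n x \<in> sp_even n"
    unfolding sp_even_def using sp B by (auto simp: rc sp_basis_def delta_def plus_fun_apply minus_apply)
  \<comment> \<open>\<epsilon>_c - \<epsilon>_r is \<alpha>_c + ... + \<alpha>_(r-1). With i =
    2n+2-r, \<epsilon>_c + \<epsilon>_i is (\<alpha>_c + ... + \<alpha>_(n-1)) + (\<alpha>_i + ... +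
    \<alpha>_(n-1)) + \<alpha>_n.\<close>
  let ?k = "\<lambda>i :: nat. if r \<le> n then (if c \<le> i \<and> i < r then 1 else 0)
    else (if c \<le> i \<and> i < n then 1 else 0) + (if 2 * n + 2 - r \<le> i \<and> i < n then 1 else 0) + (if i = n then 1 else 0 :: nat)"
  have root: "root_val n ?k H = (if r \<le> n then H (c, c) - H (r, r) else H (c, c) + H (2 * n + 2 - r, 2 * n + 2 - r))" for H
  proof -
    let ?a = "\<lambda>i. if i < n then H (i, i) - H (i + 1, i + 1) else 2 * H (n, n)"
    have 1: "root_val n ?k H = (\<Sum>i=1..n. of_nat (?k i) * ?a i)"
      unfolding root_val_def
      by (intro sum.cong refl arg_cong2[of _ _ _ _ "(*)"] simple_root_sum[of _ n "\<lambda>j. H (j, j)"])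
    show ?thesis
    proof (cases "r \<le> n")
      case True
      have "(\<Sum>i=1..n. of_nat (?k i) * ?a i) = (\<Sum>i=1..n. (if c \<le> i \<and> i < r then 1 else 0) * ?a i)"
        by (rule sum.cong) (use True in auto)
      then show ?thesis using telescope_interval[of c r n "\<lambda>j. H (j, j)"] B True 1 by simp
    next
      case False
      let ?i = "2 * n + 2 - r"
      have i: "1 \<le> ?i" "?i \<le> n" using B False by auto
      have "(\<Sum>i=1..n. of_nat (?k i) * ?a i) = (\<Sum>i=1..n. (if c \<le> i \<and> i < n then 1 else 0) * ?a i) +
          (\<Sum>i=1..n. (if ?i \<le> i \<and> i < n then 1 else 0) * ?a i) + (\<Sum>i=1..n. (if i = n then 2 * H (n, n) else 0))"
        unfolding sum.distrib[symmetric]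
        by (rule sum.cong) (use False in \<open>auto simp: algebra_simps\<close>)
      also have "\<dots> = (H (c, c) - H (n, n)) + (H (?i, ?i) - H (n, n)) + 2 * H (n, n)"
        using telescope_interval[of c n n "\<lambda>j. H (j, j)"] telescope_interval[of ?i n n "\<lambda>j. H (j, j)"] B i by simp
      finally show ?thesis using 1 False by simp
    qed
  qed
  have "bracket n H (sp_basis n x) = cscale (- root_val n ?k H) (sp_basis n x)" if H: "H \<in> cartan n" for H
  proof
    fix p :: "nat \<times> nat"
    obtain i j where p: "p = (i, j)" by (cases p) auto
    have ent: "\<And>i j. i \<noteq> j \<Longrightarrow> H (i, j) = 0" "\<And>i. i \<in> {1..n} \<Longrightarrow> H (n + i, n + i) = - H (i, i)"
      using cartan_entries[OF H] by auto
    have br: "bracket n H (sp_basis n x) p = (H (i, i) - H (j, j)) * sp_basis n x (i, j)"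
      unfolding p by (rule bracket_diag) (use ent sp in \<open>auto simp: sp_odd_iff\<close>)
    show "bracket n H (sp_basis n x) p = cscale (- root_val n ?k H) (sp_basis n x) p"
    proof (cases "sp_basis n x (i, j) = 0")
      case True
      then show ?thesis unfolding br by (simp add: cscale_def p)
    next
      case False
      have "H (i, i) - H (j, j) = - root_val n ?k H"
      proof (cases "r \<le> n")
        case True
        then have "(i, j) = (r, c) \<or> (i, j) = (n + c, n + r)"
          using False by (auto simp: rc sp_basis_def delta_def minus_apply split: if_splits)
        then show ?thesis unfolding root using True B ent(2)[of c] ent(2)[of r] by auto
      next
        case rn: False
        let ?i = "2 * n + 2 - r"
        have i: "?i \<in> {1..n}" "3 * n + 2 - r = n + ?i" using B rn by auto
        have "(i, j) = (n + ?i, c) \<or> (i, j) = (n + c, ?i)"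
          using False rn B(5) i(2) by (auto simp: rc sp_basis_def delta_def plus_fun_apply split: if_splits)
        then show ?thesis unfolding root using rn B ent(2)[of c] ent(2)[OF i(1)] by auto
      qed
      then show ?thesis unfolding br by (simp add: cscale_def p)
    qed
  qed
  then have "sp_basis n x \<in> neg_root_space n ?k" using even by (simp add: neg_root_space_def)
  moreover have "\<exists>i\<in>{1..n}. ?k i \<noteq> 0"
  proof (cases "r \<le> n")
    case True
    then show ?thesis using B by (intro bexI[of _ c]) auto
  next
    case False
    then show ?thesis using B by (intro bexI[of _ n]) auto
  qed
  ultimately show ?thesis by (intro exI[of _ ?k] conjI)
qed

lemma sp_basis_nt_minus:
  assumes x: "x \<in> posB n"
  shows "sp_basis n x \<in> nt_minus n"
proof (cases "fst x = n + 1")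
  case True
  then obtain c where c: "x = (n + 1, c)" "c \<in> {1..n}" using x by (cases x) (auto simp: posB_def)
  have "sp_basis n x \<in> F_minus n" unfolding F_minus_def c
    by (rule cfun.span_base) (use c in \<open>auto simp: sp_basis_def\<close>)
  moreover have "0 \<in> n_minus n" unfolding n_minus_def by (rule cfun.span_zero)
  ultimately show ?thesis unfolding nt_minus_def by (metis add_0 set_plus_intro)
next
  case False
  from sp_basis_neg_root[OF x this] obtain k where k: "\<exists>i\<in>{1..n}. k i \<noteq> 0" "sp_basis n x \<in> neg_root_space n k" by blast
  then have "sp_basis n x \<in> n_minus n" unfolding n_minus_def by (intro cfun.span_base) blast
  moreover have "0 \<in> F_minus n" unfolding F_minus_def by (rule cfun.span_zero)
  ultimately show ?thesis unfolding nt_minus_def by (metis add_0_right set_plus_intro)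
qed

lemma nt_minus_subspace: "cfun.subspace (nt_minus n)"
proof -
  have "nt_minus n = {x + y | x y. x \<in> n_minus n \<and> y \<in> F_minus n}"
    by (auto simp: nt_minus_def set_plus_def)
  then show ?thesis
    using cfun.subspace_sums[of "n_minus n" "F_minus n"]
    by (simp add: n_minus_def F_minus_def)
qed

text \<open>The Cartan element with upper diagonal entries n, n-1, ..., 1 has the eigenvalue n+1
  minus its place on each basis vector, and all simple roots are positive on it. So a vector of a
  negative root moves basis vectors to later places.\<close>

lemma neg_root_space_lower:
  assumes k: "\<exists>i\<in>{1..n}. k i \<noteq> 0" and X: "X \<in> neg_root_space n k" and nz: "X (i, j) \<noteq> 0"
  shows "idx_pos n j < idx_pos n i"
proof -
  let ?d = "\<lambda>a. delta (a, a) - delta (n + a, n + a) :: cmat"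
  define H where "H = (\<Sum>a\<in>{1..n}. cscale (of_nat (n + 1 - a)) (?d a))"
  have H: "H \<in> cartan n" unfolding H_def cartan_def
    by (intro cfun.span_sum cfun.span_scale cfun.span_base) blast
  have Hd: "H (a, a) = of_nat (n + 1 - a)" if a: "a \<in> {1..n}" for a
  proof -
    have "H (a, a) = (\<Sum>b\<in>{1..n}. if b = a then of_nat (n + 1 - a) else 0)"
      unfolding H_def sum_fun_apply
      by (rule sum.cong) (use a in \<open>auto simp: cscale_def delta_def minus_apply\<close>)
    then show ?thesis using a by simp
  qed
  have ent: "\<And>i j. i \<noteq> j \<Longrightarrow> H (i, j) = 0" "\<And>i. i \<in> {1..n} \<Longrightarrow> H (n + i, n + i) = - H (i, i)" "H (2 * n + 1, 2 * n + 1) = 0"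
    using cartan_entries[OF H] by auto
  have Hp: "H (i, i) = of_int (int n + 1 - int (idx_pos n i))" if i: "i \<in> idx n" for i
    using i
  proof (cases rule: idx_cases)
    case 1
    then show ?thesis by (simp add: Hd idx_pos_def of_nat_diff)
  next
    case (2 k)
    then show ?thesis by (simp add: ent(2) Hd idx_pos_def of_nat_diff)
  next
    case 3
    then show ?thesis using ent(3) by (simp add: idx_pos_def)
  qed
  have Xgl: "X \<in> gl n" using X by (auto simp: neg_root_space_def sp_even_def sp_odd_def)
  then have ij: "i \<in> idx n" "j \<in> idx n" using nz by (auto simp: gl_def)
  have root: "root_val n k H = of_nat (\<Sum>i=1..n. k i * (if i < n then 1 else 2))"
  proof -
    have "(\<Sum>j=1..n. of_int (simple_root n i j) * H (j, j)) = (if i < n then 1 else 2)" if i: "i \<in> {1..n}" for i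
    proof (cases "i < n")
      case True
      then show ?thesis using simple_root_sum[OF i, of "\<lambda>j. H (j, j)"] i Hd[of i] Hd[of "i + 1"]
        by (simp add: of_nat_diff)
    next
      case False
      then show ?thesis using simple_root_sum[OF i, of "\<lambda>j. H (j, j)"] i Hd[of n] by simp
    qed
    then have "root_val n k H = (\<Sum>i=1..n. of_nat (k i) * (if i < n then 1 else 2))"
      unfolding root_val_def by (intro sum.cong) auto
    also have "\<dots> = of_nat (\<Sum>i=1..n. k i * (if i < n then 1 else 2))"
      unfolding of_nat_sum by (intro sum.cong) auto
    finally show ?thesis .
  qed
  obtain i0 where i0: "i0 \<in> {1..n}" "k i0 \<noteq> 0" using k by blast
  have "k i0 * (if i0 < n then 1 else 2) \<le> (\<Sum>i=1..n. k i * (if i < n then 1 else 2))"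
    by (rule member_le_sum) (use i0 in auto)
  then have pos: "0 < (\<Sum>i=1..n. k i * (if i < n then 1 else 2))" using i0 by (auto split: if_splits)
  have "bracket n H X (i, j) = cscale (- root_val n k H) X (i, j)" using X H by (auto simp: neg_root_space_def)
  then have "(H (i, i) - H (j, j)) * X (i, j) = - root_val n k H * X (i, j)"
    using bracket_diag[of H X n i j, OF ent(1) Xgl] by (simp add: cscale_def)
  then have "H (i, i) - H (j, j) = - root_val n k H" by (simp only: mult_right_cancel[OF nz])
  then have "(of_int (int (idx_pos n j) - int (idx_pos n i)) :: complex) = of_int (- int (\<Sum>i=1..n. k i * (if i < n then 1 else 2)))"
    unfolding Hp[OF ij(1)] Hp[OF ij(2)] root by (simp only: of_int_diff of_int_add of_int_minus of_int_of_nat_eq of_int_1) (simp add: algebra_simps)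
  then have "int (idx_pos n j) - int (idx_pos n i) = - int (\<Sum>i=1..n. k i * (if i < n then 1 else 2))"
    by (simp only: of_int_eq_iff)
  then show ?thesis using pos by linarith
qed

lemma nt_minus_lower:
  assumes "X \<in> nt_minus n"
  shows "X \<in> sp_odd n \<and> (\<forall>i j. X (i, j) \<noteq> 0 \<longrightarrow> idx_pos n j < idx_pos n i)"
proof -
  let ?L = "{X \<in> sp_odd n. \<forall>i j. X (i, j) \<noteq> 0 \<longrightarrow> idx_pos n j < idx_pos n i}"
  have L: "cfun.subspace ?L"
    unfolding cfun.subspace_def
  proof (intro conjI ballI allI)
    show "0 \<in> ?L" using cfun.subspace_0[OF sp_odd_subspace] by (simp add: zero_fun_apply)
    show "X + Y \<in> ?L" if "X \<in> ?L" "Y \<in> ?L" for X Y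
      using that cfun.subspace_add[OF sp_odd_subspace] by (auto simp: plus_fun_apply) (metis add_0)
    show "cscale c X \<in> ?L" if "X \<in> ?L" for c X
      using that cfun.subspace_scale[OF sp_odd_subspace] by (auto simp: cscale_def)
  qed
  have "(\<Union>k\<in>{k. \<exists>i\<in>{1..n}. k i \<noteq> 0}. neg_root_space n k) \<subseteq> ?L"
  proof
    fix X assume "X \<in> (\<Union>k\<in>{k. \<exists>i\<in>{1..n}. k i \<noteq> 0}. neg_root_space n k)"
    then obtain k where k: "\<exists>i\<in>{1..n}. k i \<noteq> 0" "X \<in> neg_root_space n k" by blast
    then have "X \<in> sp_odd n" by (simp add: neg_root_space_def sp_even_def)
    then show "X \<in> ?L" using neg_root_space_lower[OF k] by blast
  qed
  then have 1: "n_minus n \<subseteq> ?L" unfolding n_minus_def using L by (rule cfun.span_minimal)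
  have "{delta (2 * n + 1, i) | i. i \<in> {1..n}} \<subseteq> ?L"
    by (auto simp: sp_odd_iff gl_def idx_def delta_def idx_pos_def)
  then have 2: "F_minus n \<subseteq> ?L" unfolding F_minus_def using L by (rule cfun.span_minimal)
  obtain a b where "X = a + b" "a \<in> n_minus n" "b \<in> F_minus n"
    using assms by (auto simp: nt_minus_def set_plus_def)
  then have "X \<in> ?L" using 1 2 cfun.subspace_add[OF L, of a b] by blast
  then show ?thesis by blast
qed

lemma nt_minus_span: "X \<in> nt_minus n \<Longrightarrow> \<exists>g. X = (\<Sum>x\<in>posB n. cscale (g x) (sp_basis n x))"
  using strictly_lower_eq_lower_part[of X n] nt_minus_lower[of X n] unfolding lower_part_def
  by (intro exI[of _ "\<lambda>x. X (row_idx n (fst x), snd x)"]) auto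

lemma lower_part_nt_minus: "lower_part n X \<in> nt_minus n"
  unfolding lower_part_def
  by (intro cfun.subspace_sum[OF nt_minus_subspace] cfun.subspace_scale[OF nt_minus_subspace] sp_basis_nt_minus)

section \<open>The associated graded module\<close>

lemma gl_act_linear:
  "gl_act n X (S + T) = gl_act n X S + gl_act n X T"
  "gl_act n X (cscale c T) = cscale c (gl_act n X T)"
  "gl_act n X (S - T) = gl_act n X S - gl_act n X T"
  "gl_act n X 0 = 0"
  "gl_act n (X + Y) T = gl_act n X T + gl_act n Y T"
  "gl_act n (cscale c X) T = cscale c (gl_act n X T)"
  "gl_act n (X - Y) T = gl_act n X T - gl_act n Y T"
  by (auto simp: gl_act_def fun_eq_iff cscale_def plus_fun_apply minus_apply zero_fun_apply
      sum.distrib sum_subtractf sum_distrib_left algebra_simps)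

text \<open>Terms in which X and Y act at different tensor positions are symmetric in X and Y and
  cancel; those at a common position give the matrix commutator.\<close>

lemma gl_act_bracket:
  "gl_act n X (gl_act n Y T) - gl_act n Y (gl_act n X T) = gl_act n (bracket n X Y) T"
proof
  fix l
  define D where "D X Y p = (\<Sum>b\<in>idx n. mat_mult n X Y (l ! p, b) * T (l[p := b]))" for X Y p
  define R where "R X Y p q = (\<Sum>a\<in>idx n. \<Sum>b\<in>idx n. X (l ! p, a) * (Y (l ! q, b) * T (l[p := a, q := b])))"
    for X Y and p q :: nat
  have e: "gl_act n X (gl_act n Y T) l = (\<Sum>p<length l. \<Sum>q<length l. if q = p then D X Y p else R X Y p q)" for X Y
  proof -
    have "gl_act n X (gl_act n Y T) l = (\<Sum>p<length l. \<Sum>a\<in>idx n. \<Sum>q<length l. \<Sum>b\<in>idx n.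
        X (l ! p, a) * (Y (l[p := a] ! q, b) * T (l[p := a, q := b])))"
      by (simp add: gl_act_def sum_distrib_left)
    also have "\<dots> = (\<Sum>p<length l. \<Sum>q<length l. \<Sum>a\<in>idx n. \<Sum>b\<in>idx n.
        X (l ! p, a) * (Y (l[p := a] ! q, b) * T (l[p := a, q := b])))"
      by (intro sum.cong refl sum.swap)
    also have "\<dots> = (\<Sum>p<length l. \<Sum>q<length l. if q = p then D X Y p else R X Y p q)"
    proof (intro sum.cong refl)
      fix p q assume pq: "p \<in> {..<length l}" "q \<in> {..<length l}"
      show "(\<Sum>a\<in>idx n. \<Sum>b\<in>idx n. X (l ! p, a) * (Y (l[p := a] ! q, b) * T (l[p := a, q := b]))) =
        (if q = p then D X Y p else R X Y p q)"
      proof (cases "q = p")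
        case True
        have "(\<Sum>a\<in>idx n. \<Sum>b\<in>idx n. X (l ! p, a) * (Y (a, b) * T (l[p := b]))) = D X Y p"
          unfolding D_def mat_mult_def prod.case sum_distrib_right
          by (subst sum.swap) (simp add: mult.assoc)
        then show ?thesis using True pq by simp
      next
        case False
        then show ?thesis by (simp add: R_def)
      qed
    qed
    finally show ?thesis .
  qed
  have sw: "R X Y p q = R Y X q p" if "p \<noteq> q" for X Y p q
    unfolding R_def by (subst sum.swap) (simp add: list_update_swap[OF that] mult_ac)
  have "(\<Sum>p<length l. \<Sum>q<length l. if q = p then D Y X p else R Y X p q) =
      (\<Sum>q<length l. \<Sum>p<length l. if q = p then D Y X p else R Y X p q)" by (rule sum.swap)
  also have "\<dots> = (\<Sum>p<length l. \<Sum>q<length l. if q = p then D Y X p else R X Y p q)"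
    by (intro sum.cong refl) (auto simp: sw)
  finally have swp: "(\<Sum>p<length l. \<Sum>q<length l. if q = p then D Y X p else R Y X p q) =
      (\<Sum>p<length l. \<Sum>q<length l. if q = p then D Y X p else R X Y p q)" .
  have "(gl_act n X (gl_act n Y T) - gl_act n Y (gl_act n X T)) l =
      (\<Sum>p<length l. \<Sum>q<length l. if q = p then D X Y p - D Y X p else 0)"
    unfolding minus_apply e swp sum_subtractf[symmetric] by (intro sum.cong refl) auto
  also have "\<dots> = (\<Sum>p<length l. D X Y p - D Y X p)" by (simp add: sum.delta)
  also have "\<dots> = gl_act n (bracket n X Y) T l"
    by (simp add: gl_act_def D_def bracket_def minus_apply sum_subtractf left_diff_distrib)
  finally show "(gl_act n X (gl_act n Y T) - gl_act n Y (gl_act n X T)) l = gl_act n (bracket n X Y) T l" .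
qed

lemma pbw_subspace: "cfun.subspace (pbw n v s)"
  unfolding pbw_def by (rule cfun.subspace_span)

lemma pbw_pred_subspace: "cfun.subspace (pbw_pred n v s)"
  by (cases s) (auto simp: pbw_pred_def pbw_subspace cfun.subspace_def[of "{0}"])

lemmas pbw_simps = cfun.subspace_0[OF pbw_subspace] cfun.subspace_add[OF pbw_subspace]
  cfun.subspace_scale[OF pbw_subspace] cfun.subspace_diff[OF pbw_subspace]
lemmas pbw_pred_simps = cfun.subspace_0[OF pbw_pred_subspace] cfun.subspace_add[OF pbw_pred_subspace]
  cfun.subspace_scale[OF pbw_pred_subspace] cfun.subspace_diff[OF pbw_pred_subspace]

lemma pbw_word: "set xs \<subseteq> nt_minus n \<Longrightarrow> length xs \<le> s \<Longrightarrow> foldr (gl_act n) xs v \<in> pbw n v s"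
  unfolding pbw_def by (rule cfun.span_base) blast

lemma pbw_mono: "s \<le> t \<Longrightarrow> pbw n v s \<subseteq> pbw n v t"
  unfolding pbw_def by (rule cfun.span_mono) auto

lemma pbw_induct [consumes 1, case_names zero word]:
  assumes "T \<in> pbw n v s" "P 0"
    and "\<And>c xs T. set xs \<subseteq> nt_minus n \<Longrightarrow> length xs \<le> s \<Longrightarrow> T \<in> pbw n v s \<Longrightarrow> P T \<Longrightarrow>
      P (cscale c (foldr (gl_act n) xs v) + T)"
  shows "P T"
proof -
  have "T \<in> pbw n v s \<and> P T" using assms(1) unfolding pbw_def
  proof (induction rule: cfun.span_induct_alt)
    case base
    then show ?case using assms(2) cfun.span_zero by blast
  next
    case (step c x y)
    then obtain xs where xs: "x = foldr (gl_act n) xs v" "set xs \<subseteq> nt_minus n" "length xs \<le> s" by auto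
    then have x: "x \<in> pbw n v s" by (simp add: pbw_word)
    have y: "y \<in> pbw n v s" "P y" using step(2) by (auto simp: pbw_def)
    then have "cscale c x + y \<in> pbw n v s" using x by (simp add: pbw_simps)
    then show ?case unfolding pbw_def[symmetric] using assms(3)[OF xs(2,3) y, of c] xs(1) by simp
  qed
  then show ?thesis by simp
qed

lemma pbw_act:
  assumes "x \<in> nt_minus n" "T \<in> pbw n v s"
  shows "gl_act n x T \<in> pbw n v (Suc s)"
  using assms(2)
proof (rule pbw_induct)
  show "gl_act n x 0 \<in> pbw n v (Suc s)" by (simp add: gl_act_linear pbw_simps)
  fix c xs T assume xs: "set xs \<subseteq> nt_minus n" "length xs \<le> s" and IH: "gl_act n x T \<in> pbw n v (Suc s)"
  have "foldr (gl_act n) (x # xs) v \<in> pbw n v (Suc s)" using xs assms(1) by (intro pbw_word) auto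
  then show "gl_act n x (cscale c (foldr (gl_act n) xs v) + T) \<in> pbw n v (Suc s)"
    using IH by (simp add: gl_act_linear pbw_simps)
qed

lemma pbw_pred_Suc: "pbw_pred n v (Suc s) = pbw n v s"
  by (simp add: pbw_pred_def)

lemma pbw_pred_0: "pbw_pred n v 0 = {0}"
  by (simp add: pbw_pred_def)

lemma pbw_pred_sub: "pbw_pred n v s \<subseteq> pbw n v s"
  using pbw_mono[of "s - 1" s n v] by (cases s) (auto simp: pbw_pred_0 pbw_pred_Suc pbw_simps)

lemma pbw_pred_act: "x \<in> nt_minus n \<Longrightarrow> T \<in> pbw_pred n v s \<Longrightarrow> gl_act n x T \<in> pbw_pred n v (Suc s)"
  by (cases s) (auto simp: pbw_pred_0 pbw_pred_Suc pbw_simps gl_act_linear intro: pbw_act)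

text \<open>The upper triangular part of a matrix does not raise the PBW degree, so modulo lower degree the powers
  of any matrix in \<open>sp_odd n\<close> agree with those of its lower triangular part.\<close>

definition upper_mats :: "nat \<Rightarrow> cmat set" where
  "upper_mats n = {Y \<in> sp_odd n. \<forall>i\<in>idx n. \<forall>a\<in>{1..n}. a < idx_pos n i \<longrightarrow> Y (i, a) = 0}"

lemma minus_lower_part_upper: "X \<in> sp_odd n \<Longrightarrow> X - lower_part n X \<in> upper_mats n"
  using minus_lower_part_zero[of X n]
  by (auto simp: upper_mats_def intro: cfun.subspace_diff[OF sp_odd_subspace] lower_part_sp_odd)

lemma nt_minus_sp_odd: "x \<in> nt_minus n \<Longrightarrow> x \<in> sp_odd n"
  using nt_minus_lower by blast

text \<open>All that the construction of the graded module has to know about v.\<close>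

locale upper_eigen =
  fixes n :: nat and v :: tensor
  assumes eigen: "Y \<in> upper_mats n \<Longrightarrow> \<exists>c. gl_act n Y v = cscale c v"
begin

text \<open>Move Y past the first letter x. The lower part of [Y, x] is one letter in place of x,
  and its upper part falls under the induction hypothesis, which is therefore needed for all
  Y.\<close>

lemma upper_word:
  "set xs \<subseteq> nt_minus n \<Longrightarrow> Y \<in> upper_mats n \<Longrightarrow> gl_act n Y (foldr (gl_act n) xs v) \<in> pbw n v (length xs)"
proof (induction xs arbitrary: Y)
  case Nil
  obtain c where "gl_act n Y v = cscale c v" using eigen Nil by blast
  then show ?case using pbw_simps(3)[OF pbw_word[of "[]" n 0 v]] by simp
next
  case (Cons x xs)
  let ?w = "foldr (gl_act n) xs v"
  let ?B = "bracket n Y x"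
  have x: "x \<in> nt_minus n" "set xs \<subseteq> nt_minus n" using Cons.prems by auto
  have B: "?B \<in> sp_odd n" using Cons.prems x nt_minus_sp_odd by (intro sp_odd_bracket) (auto simp: upper_mats_def)
  have w: "?w \<in> pbw n v (length xs)" using x by (intro pbw_word) auto
  have 1: "gl_act n x (gl_act n Y ?w) \<in> pbw n v (Suc (length xs))"
    using Cons.IH[OF x(2) Cons.prems(2)] by (rule pbw_act[OF x(1)])
  have 2: "gl_act n (lower_part n ?B) ?w \<in> pbw n v (Suc (length xs))"
    by (rule pbw_act[OF lower_part_nt_minus w])
  have 3: "gl_act n (?B - lower_part n ?B) ?w \<in> pbw n v (Suc (length xs))"
    by (rule subsetD[OF pbw_mono Cons.IH[OF x(2) minus_lower_part_upper[OF B]]]) simp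
  have "gl_act n Y (gl_act n x ?w) = gl_act n x (gl_act n Y ?w) + gl_act n ?B ?w"
    using gl_act_bracket[of n Y x ?w] by (simp add: algebra_simps)
  also have "gl_act n ?B ?w = gl_act n (lower_part n ?B) ?w + gl_act n (?B - lower_part n ?B) ?w"
    by (simp add: gl_act_linear)
  finally have "gl_act n Y (gl_act n x ?w) \<in> pbw n v (Suc (length xs))"
    using 1 2 3 by (simp only: pbw_simps)
  then show ?case by simp
qed

lemma upper_pbw:
  assumes Y: "Y \<in> upper_mats n" and T: "T \<in> pbw n v s"
  shows "gl_act n Y T \<in> pbw n v s"
  using T
proof (rule pbw_induct)
  show "gl_act n Y 0 \<in> pbw n v s" by (simp add: gl_act_linear pbw_simps)
  fix c xs T assume xs: "set xs \<subseteq> nt_minus n" "length xs \<le> s" and IH: "gl_act n Y T \<in> pbw n v s"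
  have "gl_act n Y (foldr (gl_act n) xs v) \<in> pbw n v s"
    using upper_word[OF xs(1) Y] pbw_mono[OF xs(2), of n v] by blast
  then show "gl_act n Y (cscale c (foldr (gl_act n) xs v) + T) \<in> pbw n v s"
    using IH by (simp add: gl_act_linear pbw_simps)
qed

lemma sp_odd_pbw:
  assumes X: "X \<in> sp_odd n" and T: "T \<in> pbw n v s"
  shows "gl_act n X T \<in> pbw n v (Suc s)"
proof -
  have "gl_act n X T = gl_act n (lower_part n X) T + gl_act n (X - lower_part n X) T"
    by (simp add: gl_act_linear)
  then show ?thesis
    using pbw_act[OF lower_part_nt_minus T] upper_pbw[OF minus_lower_part_upper[OF X] T]
      pbw_mono[of s "Suc s" n v] pbw_simps(2) by (metis le_Suc_eq order_refl subsetD)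
qed

lemma lower_part_power:
  assumes X: "X \<in> sp_odd n"
  shows "foldr (gl_act n) (replicate k X) v \<in> pbw n v k \<and>
    foldr (gl_act n) (replicate k X) v - foldr (gl_act n) (replicate k (lower_part n X)) v \<in> pbw_pred n v k"
proof (induction k)
  case 0
  show ?case using pbw_word[of "[]" n 0 v] by (simp add: pbw_pred_simps)
next
  case (Suc k)
  let ?a = "foldr (gl_act n) (replicate k X) v" and ?b = "foldr (gl_act n) (replicate k (lower_part n X)) v"
  have "gl_act n X ?a - gl_act n (lower_part n X) ?b =
      gl_act n (lower_part n X) (?a - ?b) + gl_act n (X - lower_part n X) ?a"
    by (simp add: gl_act_linear)
  moreover have "gl_act n (lower_part n X) (?a - ?b) \<in> pbw_pred n v (Suc k)"
    using Suc by (intro pbw_pred_act lower_part_nt_minus) simp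
  moreover have "gl_act n (X - lower_part n X) ?a \<in> pbw_pred n v (Suc k)"
    using Suc unfolding pbw_pred_Suc by (intro upper_pbw minus_lower_part_upper X) simp
  ultimately have "gl_act n X ?a - gl_act n (lower_part n X) ?b \<in> pbw_pred n v (Suc k)"
    by (simp only: pbw_pred_simps)
  then show ?case using sp_odd_pbw[OF X] Suc by simp
qed

end

section \<open>Representatives for the associated graded module\<close>

definition gscale :: "complex \<Rightarrow> (nat \<Rightarrow> tensor) \<Rightarrow> nat \<Rightarrow> tensor" where
  "gscale c T = (\<lambda>s. cscale c (T s))"

definition gr_reps :: "nat \<Rightarrow> tensor \<Rightarrow> (nat \<Rightarrow> tensor) set" where
  "gr_reps n v = {T. (\<forall>s. T s \<in> pbw n v s) \<and> finite {s. T s \<noteq> 0}}"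

definition gr_null :: "nat \<Rightarrow> tensor \<Rightarrow> (nat \<Rightarrow> tensor) set" where
  "gr_null n v = {T \<in> gr_reps n v. \<forall>s. T s \<in> pbw_pred n v s}"

definition gr_op :: "nat \<Rightarrow> cmat \<Rightarrow> (nat \<Rightarrow> tensor) \<Rightarrow> nat \<Rightarrow> tensor" where
  "gr_op n x T = (\<lambda>s. case s of 0 \<Rightarrow> 0 | Suc r \<Rightarrow> gl_act n x (T r))"

definition gr_proj :: "nat \<Rightarrow> tensor \<Rightarrow> (nat \<Rightarrow> tensor) \<Rightarrow> nat \<Rightarrow> tensor set" where
  "gr_proj n v T = (\<lambda>s. T s +o pbw_pred n v s)"

definition in_degree :: "nat \<Rightarrow> tensor \<Rightarrow> nat \<Rightarrow> tensor" where
  "in_degree d t = (\<lambda>s. if s = d then t else 0)"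

lemma pbw_pred_coset_eq: "a +o pbw_pred n v s = b +o pbw_pred n v s \<longleftrightarrow> a - b \<in> pbw_pred n v s"
  by (rule elt_set_plus_eq_iff) (auto intro: pbw_pred_simps)

lemma gscale_vector_space: "vector_space gscale"
  by standard (auto simp: gscale_def fun_eq_iff cfun.scale_right_distrib cfun.scale_left_distrib plus_fun_apply
      cscale_def algebra_simps)

context upper_eigen
begin

lemma gr_op_pres: "op_pres gscale (nt_minus n) (gr_reps n v) (gr_null n v) (gr_op n) (gr_V0 n v) (gr_proj n v)"
proof -
  interpret V: vector_space gscale by (rule gscale_vector_space)
  have fin: "finite {s. gr_op n x T s \<noteq> 0}" if "finite {s. T s \<noteq> 0}" for x T
  proof (rule finite_subset[OF _ finite_imageI[OF that, of Suc]])
    show "{s. gr_op n x T s \<noteq> 0} \<subseteq> Suc ` {s. T s \<noteq> 0}"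
    proof
      fix s assume s: "s \<in> {s. gr_op n x T s \<noteq> 0}"
      then obtain r where r: "s = Suc r" "gl_act n x (T r) \<noteq> 0" by (cases s) (auto simp: gr_op_def)
      then have "T r \<noteq> 0" using gl_act_linear(4) by metis
      then show "s \<in> Suc ` {s. T s \<noteq> 0}" using r by blast
    qed
  qed
  have add: "S + T \<in> gr_reps n v" if "S \<in> gr_reps n v" "T \<in> gr_reps n v" for S T
  proof -
    have "{s. (S + T) s \<noteq> 0} \<subseteq> {s. S s \<noteq> 0} \<union> {s. T s \<noteq> 0}" by (auto simp: plus_fun_apply)
    then show ?thesis using that finite_subset[OF _ finite_UnI]
      by (auto simp: gr_reps_def plus_fun_apply pbw_simps)
  qed
  have scale: "gscale c T \<in> gr_reps n v" if "T \<in> gr_reps n v" for c T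
  proof -
    have "{s. gscale c T s \<noteq> 0} \<subseteq> {s. T s \<noteq> 0}" by (auto simp: gscale_def)
    then show ?thesis using that finite_subset by (auto simp: gr_reps_def gscale_def pbw_simps)
  qed
  have zero: "0 \<in> gr_reps n v" by (simp add: gr_reps_def zero_fun_apply pbw_simps)
  have op: "gr_op n x T \<in> gr_reps n v" if "x \<in> nt_minus n" "T \<in> gr_reps n v" for x T
    using that fin by (auto simp: gr_reps_def gr_op_def pbw_simps pbw_act split: nat.splits)
  show ?thesis
  proof (unfold_locales)
    show "cfun.subspace (nt_minus n)" by (rule nt_minus_subspace)
    show "V.subspace (gr_reps n v)" using add scale zero by (auto simp: V.subspace_def)
    show "V.subspace (gr_null n v)" unfolding V.subspace_def
      using add scale zero by (auto simp: gr_null_def plus_fun_apply zero_fun_apply gscale_def pbw_pred_simps)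
    show "gr_null n v \<subseteq> gr_reps n v" by (auto simp: gr_null_def)
    show "gr_op n x T \<in> gr_reps n v" if "x \<in> nt_minus n" "T \<in> gr_reps n v" for x T
      using op that .
    show "gr_op n x T \<in> gr_null n v" if "x \<in> nt_minus n" "T \<in> gr_null n v" for x T
      using that op by (auto simp: gr_null_def gr_op_def pbw_pred_simps pbw_pred_act split: nat.splits)
    show "gr_op n x (S + T) = gr_op n x S + gr_op n x T" for x S T
      by (auto simp: gr_op_def fun_eq_iff plus_fun_apply zero_fun_apply gl_act_linear split: nat.splits)
    show "gr_op n x (gscale c T) = gscale c (gr_op n x T)" for x c T
      by (rule ext) (simp add: gr_op_def gscale_def gl_act_linear split: nat.splits)
    have nul: "T \<in> gr_null n v" if "T = 0" for T using that zero by (simp add: gr_null_def zero_fun_apply pbw_pred_simps)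
    show "gr_op n (x + y) T - (gr_op n x T + gr_op n y T) \<in> gr_null n v" for x y T
      by (rule nul) (auto simp: gr_op_def fun_eq_iff plus_fun_apply minus_apply zero_fun_apply gl_act_linear split: nat.splits)
    show "gr_op n (cscale c x) T - gscale c (gr_op n x T) \<in> gr_null n v" for c x T
      by (rule nul, rule ext) (simp add: gr_op_def gscale_def minus_apply zero_fun_apply gl_act_linear split: nat.splits)
    show "gr_op n x (gr_op n y T) - gr_op n y (gr_op n x T) \<in> gr_null n v"
      if xy: "x \<in> nt_minus n" "y \<in> nt_minus n" and T: "T \<in> gr_reps n v" for x y T
    proof -
      \<comment> \<open>The commutator of two letters is a single element of
        \<open>sp_odd n\<close>, which raises the degree by at most one where two letters raise it
        by two.\<close>
      have B: "bracket n x y \<in> sp_odd n" using xy nt_minus_sp_odd by (intro sp_odd_bracket) auto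
      have "(gr_op n x (gr_op n y T) - gr_op n y (gr_op n x T)) s \<in> pbw_pred n v s" for s
      proof -
        consider "s = 0" | "s = 1" | r where "s = Suc (Suc r)" by (metis One_nat_def old.nat.exhaust)
        then show ?thesis
        proof cases
          case 3
          then have "(gr_op n x (gr_op n y T) - gr_op n y (gr_op n x T)) s = gl_act n (bracket n x y) (T r)"
            by (simp add: minus_apply gr_op_def gl_act_bracket)
          then show ?thesis using sp_odd_pbw[OF B, of "T r" r] T 3 by (simp add: pbw_pred_Suc gr_reps_def)
        qed (simp_all add: minus_apply gr_op_def pbw_pred_simps gl_act_linear)
      qed
      moreover have "gr_op n x (gr_op n y T) - gr_op n y (gr_op n x T) \<in> gr_reps n v"
        using add[OF op[OF xy(1) op[OF xy(2) T]] scale[OF op[OF xy(2) op[OF xy(1) T]], of "- 1"]]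
        by (simp add: V.scale_minus_left)
      ultimately show ?thesis by (simp add: gr_null_def)
    qed
    show "carrier (gr_V0 n v) = gr_proj n v ` gr_reps n v"
    proof
      show "gr_proj n v ` gr_reps n v \<subseteq> carrier (gr_V0 n v)"
      proof
        fix f assume "f \<in> gr_proj n v ` gr_reps n v"
        then obtain T where T: "T \<in> gr_reps n v" "f = gr_proj n v T" by blast
        have "{s. f s \<noteq> pbw_pred n v s} \<subseteq> {s. T s \<noteq> 0}"
          by (auto simp: T(2) gr_proj_def)
        then show "f \<in> carrier (gr_V0 n v)"
          using T finite_subset by (auto simp: gr_V0_def gr_reps_def gr_proj_def)
      qed
      show "carrier (gr_V0 n v) \<subseteq> gr_proj n v ` gr_reps n v"
      proof
        fix f assume f: "f \<in> carrier (gr_V0 n v)"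
        define T where "T s = (if f s = pbw_pred n v s then 0 else SOME t. t \<in> pbw n v s \<and> f s = t +o pbw_pred n v s)" for s
        have T: "T s \<in> pbw n v s \<and> f s = T s +o pbw_pred n v s" for s
        proof (cases "f s = pbw_pred n v s")
          case True
          then show ?thesis by (simp add: T_def pbw_simps)
        next
          case False
          have "\<exists>t. t \<in> pbw n v s \<and> f s = t +o pbw_pred n v s" using f by (auto simp: gr_V0_def)
          from someI_ex[OF this] show ?thesis using False by (simp add: T_def)
        qed
        have "{s. T s \<noteq> 0} \<subseteq> {s. f s \<noteq> pbw_pred n v s}" by (auto simp: T_def)
        then have "finite {s. T s \<noteq> 0}" using f finite_subset by (auto simp: gr_V0_def)
        then have "T \<in> gr_reps n v" using T by (simp add: gr_reps_def)
        moreover have "f = gr_proj n v T" using T by (auto simp: gr_proj_def)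
        ultimately show "f \<in> gr_proj n v ` gr_reps n v" by blast
      qed
    qed
    show "gr_proj n v S = gr_proj n v T \<longleftrightarrow> S - T \<in> gr_null n v" if "S \<in> gr_reps n v" "T \<in> gr_reps n v" for S T
    proof -
      have "S - T \<in> gr_reps n v" using add[OF that(1) scale[OF that(2), of "- 1"]] by (simp add: V.scale_minus_left)
      then show ?thesis
        by (simp add: gr_proj_def fun_eq_iff[of "\<lambda>s. S s +o _ s"] pbw_pred_coset_eq gr_null_def minus_apply)
    qed
    show "zero (gr_V0 n v) = gr_proj n v 0"
      by (auto simp: gr_V0_def gr_proj_def zero_fun_apply)
    show "add (gr_V0 n v) (gr_proj n v S) (gr_proj n v T) = gr_proj n v (S + T)" for S T
      by (auto simp: gr_V0_def gr_proj_def plus_fun_apply intro!: ext elt_set_plus_add pbw_pred_simps)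
    show "smult (gr_V0 n v) c (gr_proj n v T) = gr_proj n v (gscale c T)" for c T
      unfolding gr_V0_def gr_proj_def gscale_def
      by simp (intro ext image_elt_set_plus; auto intro: pbw_pred_simps simp: cfun.scale_right_distrib)
    show "act (gr_V0 n v) x (gr_proj n v T) = gr_proj n v (gr_op n x T)" if x: "x \<in> nt_minus n" for x T
    proof
      fix s
      show "act (gr_V0 n v) x (gr_proj n v T) s = gr_proj n v (gr_op n x T) s"
      proof (cases s)
        case 0
        then show ?thesis by (simp add: gr_V0_def gr_proj_def gr_op_def)
      next
        case (Suc r)
        have "gl_act n x ` (T r +o pbw_pred n v r) + pbw_pred n v (Suc r) = gl_act n x (T r) +o pbw_pred n v (Suc r)"
          by (rule image_elt_set_plus) (auto intro: pbw_pred_simps pbw_pred_act[OF x] simp: gl_act_linear)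
        then show ?thesis using Suc by (simp add: gr_V0_def gr_proj_def gr_op_def)
      qed
    qed
  qed
qed

sublocale G: op_pres gscale "nt_minus n" "gr_reps n v" "gr_null n v" "gr_op n" "gr_V0 n v" "gr_proj n v"
  by (rule gr_op_pres)

lemma gr_class_proj: "gr_class n v = gr_proj n v (in_degree 0 v)"
  by (rule ext) (simp add: gr_class_def gr_proj_def in_degree_def)

lemma in_degree_reps: "t \<in> pbw n v d \<Longrightarrow> in_degree d t \<in> gr_reps n v"
  by (auto simp: gr_reps_def in_degree_def pbw_simps)

lemma v_reps: "in_degree 0 v \<in> gr_reps n v"
  using pbw_word[of "[]" n 0 v] by (simp add: in_degree_reps)

lemma gr_op_in_degree: "gr_op n x (in_degree d t) = in_degree (Suc d) (gl_act n x t)"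
  by (rule ext) (simp add: gr_op_def in_degree_def gl_act_linear split: nat.splits)

lemma foldr_in_degree: "foldr (gr_op n) xs (in_degree 0 v) = in_degree (length xs) (foldr (gl_act n) xs v)"
  by (induction xs) (simp_all add: gr_op_in_degree)

lemma in_degree_comb: "in_degree d (cscale c s + t) = gscale c (in_degree d s) + in_degree d t"
  by (auto simp: in_degree_def gscale_def fun_eq_iff plus_fun_apply cscale_def zero_fun_apply)

text \<open>A word of length d is a monomial applied to the generator; a shorter word is zero in
  degree d of the graded module.\<close>

lemma gr_cyclic_degree:
  assumes "t \<in> pbw n v d"
  shows "\<exists>p\<in>fcarrier (nt_minus n). in_degree d t - G.pact p (in_degree 0 v) \<in> gr_null n v"
  using assms
proof (rule pbw_induct)
  have "in_degree d 0 = 0" by (auto simp: in_degree_def fun_eq_iff zero_fun_apply)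
  then show "\<exists>p\<in>fcarrier (nt_minus n). in_degree d 0 - G.pact p (in_degree 0 v) \<in> gr_null n v"
    by (intro bexI[of _ 0]) (auto simp: G.pact_zero G.Z0_simps fcarrier_zero)
next
  fix c xs t
  assume xs: "set xs \<subseteq> nt_minus n" "length xs \<le> d" and t: "t \<in> pbw n v d"
    and IH: "\<exists>p\<in>fcarrier (nt_minus n). in_degree d t - G.pact p (in_degree 0 v) \<in> gr_null n v"
  then obtain p where p: "p \<in> fcarrier (nt_minus n)" "in_degree d t - G.pact p (in_degree 0 v) \<in> gr_null n v" by blast
  let ?w = "foldr (gl_act n) xs v"
  have "\<exists>q\<in>fcarrier (nt_minus n). gscale c (in_degree d ?w) - G.pact q (in_degree 0 v) \<in> gr_null n v"
  proof (cases "length xs = d")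
    case True
    have m: "set_mset (mset xs) \<subseteq> nt_minus n" using xs(1) by simp
    have "foldr (gr_op n) xs (in_degree 0 v) - foldr (gr_op n) (mset_list (mset xs)) (in_degree 0 v) \<in> gr_null n v"
      by (rule G.foldr_mset[OF _ xs(1) v_reps]) (simp add: mset_mset_list)
    from G.Z0_simps(3)[OF this, of c] show ?thesis
      using True fcarrier_single[OF m, of c]
      by (intro bexI[of _ "Poly_Mapping.single (mset xs) c"])
        (simp_all add: G.pact_single foldr_in_degree G.scale_right_diff_distrib)
  next
    case False
    then have "?w \<in> pbw_pred n v d" using xs pbw_word[OF xs(1), of "d - 1" v] by (cases d) (auto simp: pbw_pred_Suc)
    then have "in_degree d ?w \<in> gr_null n v"
      using pbw_pred_sub[of n v d] by (auto simp: gr_null_def in_degree_reps) (auto simp: in_degree_def pbw_pred_simps)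
    then show ?thesis by (intro bexI[of _ 0]) (auto simp: G.pact_zero G.Z0_simps fcarrier_zero)
  qed
  then obtain q where q: "q \<in> fcarrier (nt_minus n)" "gscale c (in_degree d ?w) - G.pact q (in_degree 0 v) \<in> gr_null n v" by blast
  have "in_degree d (cscale c ?w + t) - G.pact (q + p) (in_degree 0 v) =
      (gscale c (in_degree d ?w) - G.pact q (in_degree 0 v)) + (in_degree d t - G.pact p (in_degree 0 v))"
    unfolding in_degree_comb G.pact_add by (simp add: algebra_simps)
  then show "\<exists>p\<in>fcarrier (nt_minus n). in_degree d (cscale c ?w + t) - G.pact p (in_degree 0 v) \<in> gr_null n v"
    using G.Z0_simps(2)[OF q(2) p(2)] fcarrier_add[OF q(1) p(1)] by metis
qed

lemma gr_cyclic:
  assumes "T \<in> gr_reps n v"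
  shows "\<exists>p\<in>fcarrier (nt_minus n). T - G.pact p (in_degree 0 v) \<in> gr_null n v"
proof -
  have fin: "finite {s. T s \<noteq> 0}" and T: "\<And>s. T s \<in> pbw n v s" using assms by (auto simp: gr_reps_def)
  have sum: "\<exists>p\<in>fcarrier (nt_minus n). (\<Sum>s\<in>S. in_degree s (T s)) - G.pact p (in_degree 0 v) \<in> gr_null n v"
    if "finite S" for S
    using that
  proof (induction S rule: finite_induct)
    case empty
    then show ?case by (intro bexI[of _ 0]) (auto simp: G.pact_zero G.Z0_simps fcarrier_zero)
  next
    case (insert s S)
    then obtain p q where p: "p \<in> fcarrier (nt_minus n)" "(\<Sum>s\<in>S. in_degree s (T s)) - G.pact p (in_degree 0 v) \<in> gr_null n v"
      and q: "q \<in> fcarrier (nt_minus n)" "in_degree s (T s) - G.pact q (in_degree 0 v) \<in> gr_null n v"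
      using gr_cyclic_degree[OF T] by meson
    have "(\<Sum>s\<in>insert s S. in_degree s (T s)) - G.pact (q + p) (in_degree 0 v) =
       (in_degree s (T s) - G.pact q (in_degree 0 v)) + ((\<Sum>s\<in>S. in_degree s (T s)) - G.pact p (in_degree 0 v))"
      unfolding sum.insert[OF insert.hyps(1,2)] G.pact_add by (simp add: algebra_simps)
    then show ?case using G.Z0_simps(2)[OF q(2) p(2)] fcarrier_add[OF q(1) p(1)] by metis
  qed
  have app: "(\<Sum>s\<in>S. in_degree s (T s)) r = (if r \<in> S then T r else 0)" if "finite S" for S r
    using that by (induction S rule: finite_induct) (auto simp: plus_fun_apply zero_fun_apply in_degree_def)
  have "T = (\<Sum>s | T s \<noteq> 0. in_degree s (T s))"
    by (rule ext) (simp add: app[OF fin])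
  then show ?thesis using sum[OF fin] by simp
qed

end

section \<open>Tensors antisymmetric along columns\<close>

text \<open>These conditions describe, up to a nonzero scalar, the product over all columns of e_1
  \<and> ... \<and> e_h with h the height, without reference to Young symmetrizers.\<close>

locale column_tensor =
  fixes n N :: nat and col ht :: "nat \<Rightarrow> nat" and v :: tensor
  assumes supp: "v l \<noteq> 0 \<Longrightarrow> length l = N \<and> (\<forall>p<N. l ! p \<in> {1..ht (col p)})"
    and ht_le: "p < N \<Longrightarrow> ht (col p) \<le> n"
    and card_col: "p < N \<Longrightarrow> card {q. q < N \<and> col q = col p} = ht (col p)"
    and antisym: "length l = N \<Longrightarrow> p < N \<Longrightarrow> q < N \<Longrightarrow> p \<noteq> q \<Longrightarrow> col p = col q \<Longrightarrow>
      v (l[p := l ! q, q := l ! p]) = - v l"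
    and nonzero: "v \<noteq> 0"
begin

lemma repeat_zero:
  assumes "p < N" "q < N" "p \<noteq> q" "col p = col q" "l ! p = l ! q"
  shows "v l = 0"
proof (cases "length l = N")
  case True
  have "l[p := l ! q, q := l ! p] = l" using assms(5) by (metis list_update_id)
  then show ?thesis using antisym[OF True assms(1-4)] by simp
next
  case False
  then show ?thesis using supp by blast
qed

lemma supp_column:
  assumes "v l \<noteq> 0" "p < N"
  shows "bij_betw (\<lambda>q. l ! q) {q. q < N \<and> col q = col p} {1..ht (col p)}"
proof -
  let ?P = "{q. q < N \<and> col q = col p}"
  have inj: "inj_on (\<lambda>q. l ! q) ?P"
  proof (rule inj_onI)
    fix q r assume "q \<in> ?P" "r \<in> ?P" "l ! q = l ! r"
    then show "q = r" using repeat_zero[of q r l] assms(1) by force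
  qed
  have "(\<lambda>q. l ! q) ` ?P \<subseteq> {1..ht (col p)}"
  proof
    fix x assume "x \<in> (\<lambda>q. l ! q) ` ?P"
    then obtain q where "q < N" "col q = col p" "x = l ! q" by auto
    then show "x \<in> {1..ht (col p)}" using supp[OF assms(1)] by metis
  qed
  moreover have "card ((\<lambda>q. l ! q) ` ?P) = card {1..ht (col p)}"
    using card_image[OF inj] card_col[OF assms(2)] by simp
  ultimately have "(\<lambda>q. l ! q) ` ?P = {1..ht (col p)}" by (intro card_subset_eq) auto
  then show ?thesis using inj by (simp add: bij_betw_def)
qed

text \<open>A matrix that preserves the span of e_1, ..., e_h acts on e_1 \<and> ... \<and> e_h by
  its trace on that span. The cases are: an entry of the column exceeds its range, the entries are
  distinct, or two of them agree.\<close>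

lemma column_trace:
  assumes Y: "\<And>i a. a \<in> {1..ht \<kappa>} \<Longrightarrow> i \<notin> {1..ht \<kappa>} \<Longrightarrow> Y (i, a) = 0"
    and \<kappa>: "\<kappa> \<in> col ` {..<N}" and len: "length l = N"
  shows "(\<Sum>p | p < N \<and> col p = \<kappa>. \<Sum>a\<in>idx n. Y (l ! p, a) * v (l[p := a])) =
    (\<Sum>k=1..ht \<kappa>. Y (k, k)) * v l"
proof -
  let ?P = "{p. p < N \<and> col p = \<kappa>}" and ?h = "ht \<kappa>"
  obtain p1 where p1: "p1 < N" "col p1 = \<kappa>" using \<kappa> by auto
  have hn: "?h \<le> n" using ht_le[OF p1(1)] p1(2) by simp
  have cardP: "card ?P = ?h" using card_col[OF p1(1)] p1(2) by simp
  have supp': "l' ! p \<in> {1..?h}" if "v l' \<noteq> 0" "p \<in> ?P" for l' p using supp[OF that(1)] that(2) by auto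
  show ?thesis
  proof (cases "\<forall>p\<in>?P. l ! p \<in> {1..?h}")
    case False
    then obtain p0 where p0: "p0 \<in> ?P" "l ! p0 \<notin> {1..?h}" by blast
    have "Y (l ! p, a) * v (l[p := a]) = 0" if "p \<in> ?P" for p a
    proof (rule ccontr)
      assume nz: "\<not> ?thesis"
      then have v: "v (l[p := a]) \<noteq> 0" by auto
      show False
      proof (cases "p = p0")
        case True
        then have "a \<in> {1..?h}" using supp'[OF v that] len that by simp
        then show False using Y p0(2) nz True by auto
      next
        case False
        then show False using supp'[OF v p0(1)] p0(2) by simp
      qed
    qed
    then have "(\<Sum>p\<in>?P. \<Sum>a\<in>idx n. Y (l ! p, a) * v (l[p := a])) = 0"
      by (intro sum.neutral ballI) auto
    moreover have "v l = 0" using supp' p0 by blast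
    ultimately show ?thesis by simp
  next
    case True
    show ?thesis
    proof (cases "inj_on (\<lambda>q. l ! q) ?P")
      case inj: True
      have "(\<lambda>q. l ! q) ` ?P \<subseteq> {1..?h}" using True by auto
      moreover have "card ((\<lambda>q. l ! q) ` ?P) = card {1..?h}" using card_image[OF inj] cardP by simp
      ultimately have im: "(\<lambda>q. l ! q) ` ?P = {1..?h}" by (intro card_subset_eq) auto
      have "(\<Sum>a\<in>idx n. Y (l ! p, a) * v (l[p := a])) = Y (l ! p, l ! p) * v l" if p: "p \<in> ?P" for p
      proof -
        have "v (l[p := a]) = 0" if a: "a \<noteq> l ! p" for a
        proof (rule ccontr)
          assume v: "v (l[p := a]) \<noteq> 0"
          then have "a \<in> {1..?h}" using supp'[OF v p] len p by simp
          then have "a \<in> (\<lambda>q. l ! q) ` ?P" using im by simp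
          then obtain q where q: "q \<in> ?P" "l ! q = a" by blast
          then have "q \<noteq> p" using a by auto
          then have "v (l[p := a]) = 0" using repeat_zero[of p q "l[p := a]"] p q len by simp
          then show False using v by simp
        qed
        then have "(\<Sum>a\<in>idx n. Y (l ! p, a) * v (l[p := a])) = (\<Sum>a\<in>{l ! p}. Y (l ! p, a) * v (l[p := a]))"
          using True p hn by (intro sum.mono_neutral_right) (auto simp: idx_def)
        then show ?thesis by simp
      qed
      then have "(\<Sum>p\<in>?P. \<Sum>a\<in>idx n. Y (l ! p, a) * v (l[p := a])) = (\<Sum>p\<in>?P. Y (l ! p, l ! p) * v l)"
        by (intro sum.cong) auto
      also have "\<dots> = (\<Sum>k\<in>(\<lambda>q. l ! q) ` ?P. Y (k, k) * v l)" by (simp add: sum.reindex[OF inj])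
      finally show ?thesis unfolding im by (simp add: sum_distrib_right)
    next
      case False
      \<comment> \<open>With equal entries at p0 and q0 only a change at one of these two positions
        can contribute, and the two contributions cancel by antisymmetry.\<close>
      then obtain p0 q0 where pq: "p0 \<in> ?P" "q0 \<in> ?P" "p0 \<noteq> q0" "l ! p0 = l ! q0" unfolding inj_on_def by blast
      then have vl: "v l = 0" by (intro repeat_zero[of p0 q0]) auto
      let ?t = "\<lambda>p. \<Sum>a\<in>idx n. Y (l ! p, a) * v (l[p := a])"
      have other: "?t p = 0" if "p \<in> ?P - {p0, q0}" for p
      proof (rule sum.neutral, rule ballI)
        fix a
        have "v (l[p := a]) = 0" by (rule repeat_zero[of p0 q0]) (use that pq in auto)
        then show "Y (l ! p, a) * v (l[p := a]) = 0" by simp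
      qed
      have "v (l[q0 := a]) = - v (l[p0 := a])" for a
      proof -
        have "(l[p0 := a])[p0 := (l[p0 := a]) ! q0, q0 := (l[p0 := a]) ! p0] = l[q0 := a]"
          using pq len by simp (metis list_update_id)
        then show ?thesis using antisym[of "l[p0 := a]" p0 q0] pq len by simp
      qed
      then have "?t q0 = - ?t p0" using pq(4) by (simp add: sum_negf)
      moreover have "(\<Sum>p\<in>?P. ?t p) = (\<Sum>p\<in>{p0, q0}. ?t p)"
        by (rule sum.mono_neutral_right) (use pq other in auto)
      ultimately have "(\<Sum>p\<in>?P. ?t p) = 0" using pq(3) by simp
      then show ?thesis using vl by simp
    qed
  qed
qed

lemma sum_columns:
  fixes g :: "nat \<Rightarrow> complex"
  shows "(\<Sum>p<N. g p) = (\<Sum>\<kappa>\<in>col ` {..<N}. \<Sum>p | p < N \<and> col p = \<kappa>. g p)"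
proof -
  have "(\<Sum>\<kappa>\<in>col ` {..<N}. \<Sum>p | p \<in> {..<N} \<and> col p = \<kappa>. g p) = (\<Sum>p<N. g p)"
    by (rule sum.group) auto
  then show ?thesis by simp
qed

text \<open>For every h <= n an upper triangular matrix preserves the span of e_1, ..., e_h, so each
  column contributes a trace to the eigenvalue.\<close>

lemma upper_eigen: "upper_eigen n v"
proof
  fix Y assume Y: "Y \<in> upper_mats n"
  let ?c = "\<Sum>\<kappa>\<in>col ` {..<N}. \<Sum>k=1..ht \<kappa>. Y (k, k)"
  have "gl_act n Y v l = cscale ?c v l" for l
  proof (cases "length l = N")
    case True
    have "gl_act n Y v l = (\<Sum>\<kappa>\<in>col ` {..<N}. \<Sum>p | p < N \<and> col p = \<kappa>. \<Sum>a\<in>idx n. Y (l ! p, a) * v (l[p := a]))"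
      unfolding gl_act_def True by (rule sum_columns)
    also have "\<dots> = (\<Sum>\<kappa>\<in>col ` {..<N}. (\<Sum>k=1..ht \<kappa>. Y (k, k)) * v l)"
    proof (intro sum.cong refl column_trace[OF _ _ True])
      fix \<kappa> i a assume \<kappa>: "\<kappa> \<in> col ` {..<N}" and a: "a \<in> {1..ht \<kappa>}" and i: "i \<notin> {1..ht \<kappa>}"
      have h: "ht \<kappa> \<le> n" using \<kappa> ht_le by auto
      show "Y (i, a) = 0"
      proof (cases "i \<in> idx n")
        case True
        then have "a < idx_pos n i" using a i h by (auto simp: idx_pos_def idx_def)
        then show ?thesis using Y True a h by (auto simp: upper_mats_def)
      next
        case False
        then show ?thesis using Y by (auto simp: upper_mats_def sp_odd_def gl_def)
      qed
    qed
    finally show ?thesis by (simp add: cscale_def sum_distrib_right)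
  next
    case False
    then have "v l = 0" "\<And>p a. v (l[p := a]) = 0" using supp by (metis, metis length_list_update)
    then show ?thesis by (simp add: gl_act_def cscale_def)
  qed
  then show "\<exists>c. gl_act n Y v = cscale c v" by blast
qed

sublocale upper_eigen n v by (rule upper_eigen)

text \<open>X acts on v as a sum of commuting operators, one for each column. Each squares to zero
  on v. It kills v if the height is below c0, because \<eta> vanishes on the column, or at least r0,
  because then the column operator is the trace, which is 0. Too many applications must repeat a
  column or use one that is killed.\<close>

lemma rank_one_power_zero:
  fixes X :: cmat and u \<eta> :: "nat \<Rightarrow> complex"
  assumes X: "\<And>i j. j \<in> {1..n} \<Longrightarrow> X (i, j) = u i * \<eta> j"
    and Xu: "\<And>i. (\<Sum>a\<in>idx n. X (i, a) * u a) = 0"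
    and low: "\<And>j. 1 \<le> j \<Longrightarrow> j < c0 \<Longrightarrow> \<eta> j = 0"
    and high: "\<And>h i. r0 \<le> h \<Longrightarrow> h \<le> n \<Longrightarrow> i \<notin> {1..h} \<Longrightarrow> u i = 0"
    and tr: "\<And>h. r0 \<le> h \<Longrightarrow> h \<le> n \<Longrightarrow> (\<Sum>k=1..h. u k * \<eta> k) = 0"
    and k: "heights (col ` {..<N}) ht c0 r0 < k"
  shows "foldr (gl_act n) (replicate k X) v = 0"
proof -
  let ?C = "col ` {..<N}"
  define cop where "cop \<kappa> T = (\<lambda>l. if length l = N then \<Sum>p | p < N \<and> col p = \<kappa>. \<Sum>a\<in>idx n. X (l ! p, a) * T (l[p := a]) else 0)"
    for \<kappa> and T :: tensor
  have vn: "l ! p \<in> {1..n}" if "v l \<noteq> 0" "p < N" for l p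
    using supp[OF that(1)] ht_le[OF that(2)] that(2) by fastforce
  have Xv: "X (i, a) * v (l[p := a]) = u i * \<eta> a * v (l[p := a])" if "p < N" "length l = N" for i a l p
  proof (cases "v (l[p := a]) = 0")
    case False
    then have "a \<in> {1..n}" using vn[OF False that(1)] that by simp
    then show ?thesis using X by simp
  qed simp
  have comm: "cop \<kappa> (cop \<kappa>' T) = cop \<kappa>' (cop \<kappa> T)" if "\<kappa> \<noteq> \<kappa>'" for \<kappa> \<kappa>' T
  proof
    fix l
    have e: "cop \<kappa> (cop \<kappa>' T) l = (\<Sum>p | p < N \<and> col p = \<kappa>. \<Sum>q | q < N \<and> col q = \<kappa>'. \<Sum>a\<in>idx n. \<Sum>b\<in>idx n.
        X (l ! p, a) * (X (l ! q, b) * T (l[p := a, q := b])))"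
      if l: "length l = N" and ne: "\<kappa> \<noteq> \<kappa>'" for \<kappa> \<kappa>'
    proof -
      have "cop \<kappa> (cop \<kappa>' T) l = (\<Sum>p | p < N \<and> col p = \<kappa>. \<Sum>a\<in>idx n. \<Sum>q | q < N \<and> col q = \<kappa>'. \<Sum>b\<in>idx n.
        X (l ! p, a) * (X (l[p := a] ! q, b) * T (l[p := a, q := b])))"
        using l by (simp add: cop_def sum_distrib_left)
      also have "\<dots> = (\<Sum>p | p < N \<and> col p = \<kappa>. \<Sum>q | q < N \<and> col q = \<kappa>'. \<Sum>a\<in>idx n. \<Sum>b\<in>idx n.
        X (l ! p, a) * (X (l[p := a] ! q, b) * T (l[p := a, q := b])))"
        by (intro sum.cong refl sum.swap)
      also have "\<dots> = (\<Sum>p | p < N \<and> col p = \<kappa>. \<Sum>q | q < N \<and> col q = \<kappa>'. \<Sum>a\<in>idx n. \<Sum>b\<in>idx n.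
        X (l ! p, a) * (X (l ! q, b) * T (l[p := a, q := b])))"
      proof (intro sum.cong refl)
        fix p q a b assume "p \<in> {p. p < N \<and> col p = \<kappa>}" "q \<in> {q. q < N \<and> col q = \<kappa>'}"
        then have "p \<noteq> q" using ne by auto
        then show "X (l ! p, a) * (X (l[p := a] ! q, b) * T (l[p := a, q := b])) =
          X (l ! p, a) * (X (l ! q, b) * T (l[p := a, q := b]))" by simp
      qed
      finally show ?thesis .
    qed
    show "cop \<kappa> (cop \<kappa>' T) l = cop \<kappa>' (cop \<kappa> T) l"
    proof (cases "length l = N")
      case True
      show ?thesis unfolding e[OF True that] e[OF True that[symmetric]]
      proof (subst sum.swap, rule sum.cong[OF refl], rule sum.cong[OF refl])
        fix q p assume qp: "q \<in> {q. q < N \<and> col q = \<kappa>'}" "p \<in> {p. p < N \<and> col p = \<kappa>}"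
        then have "p \<noteq> q" using that by auto
        then show "(\<Sum>a\<in>idx n. \<Sum>b\<in>idx n. X (l ! p, a) * (X (l ! q, b) * T (l[p := a, q := b]))) =
          (\<Sum>a\<in>idx n. \<Sum>b\<in>idx n. X (l ! q, a) * (X (l ! p, b) * T (l[q := a, p := b])))"
          by (subst sum.swap) (simp add: list_update_swap mult_ac)
      qed
    qed (simp add: cop_def)
  qed
  \<comment> \<open>Applied twice at one position, X meets X u = 0. At two positions of a column the
    factor \<eta> \<otimes> \<eta> is symmetric while v is antisymmetric.\<close>
  have sq: "cop \<kappa> (cop \<kappa> v) = 0" for \<kappa>
  proof
    fix l
    show "cop \<kappa> (cop \<kappa> v) l = (0 :: tensor) l"
    proof (cases "length l = N")
      case True
      have "(\<Sum>a\<in>idx n. \<Sum>b\<in>idx n. X (l ! p, a) * (X (l[p := a] ! q, b) * v (l[p := a, q := b]))) = 0"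
        if pq: "p < N" "col p = \<kappa>" "q < N" "col q = \<kappa>" for p q
      proof (cases "p = q")
        case eq: True
        have "(\<Sum>a\<in>idx n. \<Sum>b\<in>idx n. X (l ! p, a) * (X (l[p := a] ! q, b) * v (l[p := a, q := b]))) =
          (\<Sum>a\<in>idx n. \<Sum>b\<in>idx n. X (l ! p, a) * u a * (\<eta> b * v (l[p := b])))"
        proof (intro sum.cong refl)
          fix a b
          have "X (l ! p, a) * (X (l[p := a] ! q, b) * v (l[p := a, q := b])) = X (l ! p, a) * (X (a, b) * v (l[p := b]))"
            using eq pq True by simp
          also have "\<dots> = X (l ! p, a) * (u a * \<eta> b * v (l[p := b]))" by (simp only: Xv[OF pq(1) True])
          finally show "X (l ! p, a) * (X (l[p := a] ! q, b) * v (l[p := a, q := b])) =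
            X (l ! p, a) * u a * (\<eta> b * v (l[p := b]))" by (simp only: mult.assoc)
        qed
        also have "\<dots> = (\<Sum>a\<in>idx n. X (l ! p, a) * u a) * (\<Sum>b\<in>idx n. \<eta> b * v (l[p := b]))"
          by (simp add: sum_product)
        finally show ?thesis using Xu by simp
      next
        case ne: False
        let ?w = "\<lambda>a b. v (l[p := a, q := b])"
        let ?S = "\<Sum>a\<in>idx n. \<Sum>b\<in>idx n. \<eta> a * \<eta> b * ?w a b"
        have t: "X (l ! p, a) * (X (l[p := a] ! q, b) * ?w a b) = u (l ! p) * u (l ! q) * (\<eta> a * \<eta> b * ?w a b)" for a b
        proof -
          have "X (l ! q, b) * ?w a b = u (l ! q) * \<eta> b * ?w a b" using Xv[of q "l[p := a]"] pq True by simp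
          moreover have "X (l ! p, a) * ?w a b = u (l ! p) * \<eta> a * ?w a b"
            using Xv[of p "l[q := b]" "l ! p" a] pq True ne by (simp add: list_update_swap)
          moreover have "l[p := a] ! q = l ! q" using ne by simp
          ultimately show ?thesis by (metis (no_types, lifting) mult.assoc mult.left_commute)
        qed
        have neg: "?w b a = - ?w a b" for a b
        proof -
          have "(l[p := a, q := b])[p := (l[p := a, q := b]) ! q, q := (l[p := a, q := b]) ! p] = l[p := b, q := a]"
            using pq True ne by (simp add: list_update_swap)
          then show ?thesis using antisym[of "l[p := a, q := b]" p q] pq True ne by simp
        qed
        have e2: "\<eta> b * \<eta> a * ?w b a = - (\<eta> a * \<eta> b * ?w a b)" for a b
          unfolding neg[where a = a and b = b] by (simp only: mult_minus_right mult.commute[of "\<eta> b"])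
        have "(\<Sum>a\<in>idx n. \<Sum>b\<in>idx n. \<eta> b * \<eta> a * ?w b a) = - ?S"
          unfolding sum_negf[symmetric] by (rule sum.cong[OF refl], rule sum.cong[OF refl], rule e2)
        moreover have "(\<Sum>a\<in>idx n. \<Sum>b\<in>idx n. \<eta> b * \<eta> a * ?w b a) = ?S" by (rule sum.swap)
        ultimately have "?S = 0" by simp
        then show ?thesis unfolding t by (simp add: sum_distrib_left[symmetric])
      qed
      note z = this
      have "cop \<kappa> (cop \<kappa> v) l = (\<Sum>p | p < N \<and> col p = \<kappa>. \<Sum>a\<in>idx n. \<Sum>q | q < N \<and> col q = \<kappa>. \<Sum>b\<in>idx n.
          X (l ! p, a) * (X (l[p := a] ! q, b) * v (l[p := a, q := b])))"
        using True by (simp add: cop_def sum_distrib_left)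
      also have "\<dots> = (\<Sum>p | p < N \<and> col p = \<kappa>. \<Sum>q | q < N \<and> col q = \<kappa>. \<Sum>a\<in>idx n. \<Sum>b\<in>idx n.
          X (l ! p, a) * (X (l[p := a] ! q, b) * v (l[p := a, q := b])))"
        by (intro sum.cong refl sum.swap)
      also have "\<dots> = 0" by (rule sum.neutral, rule ballI, rule sum.neutral, rule ballI) (use z in auto)
      finally show ?thesis by (simp add: zero_fun_apply)
    qed (simp add: cop_def zero_fun_apply)
  qed
  have bad: "cop \<kappa> v = 0" if \<kappa>: "\<kappa> \<in> ?C" and b: "\<not> (c0 \<le> ht \<kappa> \<and> ht \<kappa> < r0)" for \<kappa>
  proof
    fix l
    have hn: "ht \<kappa> \<le> n" using \<kappa> ht_le by auto
    show "cop \<kappa> v l = (0 :: tensor) l"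
    proof (cases "length l = N")
      case True
      show ?thesis
      proof (cases "c0 \<le> ht \<kappa>")
        case False
        have "X (l ! p, a) * v (l[p := a]) = 0" if "p < N" "col p = \<kappa>" for p a
        proof (cases "v (l[p := a]) = 0")
          case nz: False
          then have "a \<in> {1..ht \<kappa>}" using supp[OF nz] that True by force
          then show ?thesis using X[of a] low[of a] False hn by simp
        qed simp
        then have "(\<Sum>p | p < N \<and> col p = \<kappa>. \<Sum>a\<in>idx n. X (l ! p, a) * v (l[p := a])) = 0"
          by (intro sum.neutral ballI) auto
        then show ?thesis by (simp add: cop_def zero_fun_apply)
      next
        case c: True
        then have r: "r0 \<le> ht \<kappa>" using b by simp
        have "(\<Sum>p | p < N \<and> col p = \<kappa>. \<Sum>a\<in>idx n. X (l ! p, a) * v (l[p := a])) = (\<Sum>k=1..ht \<kappa>. X (k, k)) * v l"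
          by (rule column_trace[OF _ \<kappa> True]) (use X high[OF r hn] hn in auto)
        also have "(\<Sum>k=1..ht \<kappa>. X (k, k)) = (\<Sum>k=1..ht \<kappa>. u k * \<eta> k)"
          using X hn by (intro sum.cong) auto
        finally show ?thesis using tr[OF r hn] True by (simp add: cop_def zero_fun_apply)
      qed
    qed (simp add: cop_def zero_fun_apply)
  qed
  have zero: "cop \<kappa> 0 = 0" for \<kappa> by (auto simp: cop_def fun_eq_iff zero_fun_apply)
  have move: "foldr cop ks (cop \<kappa> v) = cop \<kappa> (foldr cop ks v)" for ks \<kappa>
  proof (induction ks)
    case (Cons \<kappa>' ks)
    then show ?case using comm[of \<kappa>' \<kappa>] by (cases "\<kappa>' = \<kappa>") auto
  qed simp
  have foldr_zero: "foldr cop ks 0 = 0" for ks by (induction ks) (auto simp: zero)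
  have word_bad: "foldr cop ks v = 0" if "\<kappa> \<in> set ks" "cop \<kappa> v = 0" for ks \<kappa>
    using that
  proof (induction ks)
    case (Cons \<kappa>' ks)
    show ?case
    proof (cases "\<kappa> = \<kappa>'")
      case True
      then show ?thesis using move[of ks \<kappa>'] Cons.prems by (simp add: foldr_zero)
    qed (use Cons zero in auto)
  qed simp
  have word_rep: "foldr cop ks v = 0" if "\<not> distinct ks" for ks
    using that
  proof (induction ks)
    case (Cons \<kappa> ks)
    show ?case
    proof (cases "distinct ks")
      case True
      then obtain as bs where ks: "ks = as @ \<kappa> # bs" using Cons.prems by (auto dest: split_list)
      have mv: "foldr cop as (cop \<kappa> T) = cop \<kappa> (foldr cop as T)" for T
      proof (induction as)
        case (Cons \<kappa>' as)
        then show ?case using comm[of \<kappa>' \<kappa>] by (cases "\<kappa>' = \<kappa>") auto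
      qed simp
      have "foldr cop (\<kappa> # ks) v = cop \<kappa> (cop \<kappa> (foldr cop (as @ bs) v))" by (simp add: ks mv)
      also have "\<dots> = foldr cop (as @ bs) (cop \<kappa> (cop \<kappa> v))"
      proof -
        have "foldr cop cs (cop \<kappa> T) = cop \<kappa> (foldr cop cs T)" for cs T
        proof (induction cs)
          case (Cons \<kappa>' cs)
          then show ?case using comm[of \<kappa>' \<kappa>] by (cases "\<kappa>' = \<kappa>") auto
        qed simp
        then show ?thesis by simp
      qed
      finally show ?thesis by (simp add: sq foldr_zero)
    qed (use Cons zero in auto)
  qed simp
  have lenN: "foldr cop ks v l = 0" if "length l \<noteq> N" for ks l
    using that supp by (cases ks) (auto simp: cop_def)
  have exp: "foldr (gl_act n) (replicate k X) v = (\<Sum>ks\<in>words ?C k. foldr cop ks v)" for k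
  proof (induction k)
    case 0
    have "words ?C 0 = {[]}" by (auto simp: words_def)
    then show ?case by simp
  next
    case (Suc k)
    have lin: "gl_act n X (\<Sum>i\<in>I. g i) = (\<Sum>i\<in>I. gl_act n X (g i))" for I and g :: "nat list \<Rightarrow> tensor"
      by (induction I rule: infinite_finite_induct) (auto simp: gl_act_linear)
    have one: "gl_act n X (foldr cop ks v) = (\<Sum>\<kappa>\<in>?C. cop \<kappa> (foldr cop ks v))" for ks
    proof
      fix l
      show "gl_act n X (foldr cop ks v) l = (\<Sum>\<kappa>\<in>?C. cop \<kappa> (foldr cop ks v)) l"
      proof (cases "length l = N")
        case True
        then show ?thesis unfolding gl_act_def sum_fun_apply by (simp add: sum_columns cop_def)
      next
        case False
        then have "\<And>p a. foldr cop ks v (l[p := a]) = 0" using lenN by simp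
        then show ?thesis using False by (simp add: gl_act_def sum_fun_apply cop_def)
      qed
    qed
    have "foldr (gl_act n) (replicate (Suc k) X) v = (\<Sum>ks\<in>words ?C k. \<Sum>\<kappa>\<in>?C. foldr cop (\<kappa> # ks) v)"
    proof -
      have "foldr (gl_act n) (replicate (Suc k) X) v = gl_act n X (\<Sum>ks\<in>words ?C k. foldr cop ks v)"
        by (simp only: replicate_Suc foldr_Cons o_apply Suc.IH)
      also have "\<dots> = (\<Sum>ks\<in>words ?C k. gl_act n X (foldr cop ks v))" by (rule lin)
      finally show ?thesis by (simp only: one foldr_Cons o_apply)
    qed
    also have "\<dots> = (\<Sum>(\<kappa>, ks)\<in>?C \<times> words ?C k. foldr cop (\<kappa> # ks) v)"
      by (subst sum.swap) (simp add: sum.cartesian_product)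
    also have "\<dots> = (\<Sum>ks\<in>words ?C (Suc k). foldr cop ks v)"
      unfolding words_Suc by (subst sum.reindex) (auto simp: inj_on_def case_prod_unfold)
    finally show ?case .
  qed
  have "foldr cop ks v = 0" if ks: "ks \<in> words ?C k" for ks
  proof (cases "distinct ks")
    case True
    let ?G = "{\<kappa> \<in> ?C. c0 \<le> ht \<kappa> \<and> ht \<kappa> < r0}"
    have "\<not> set ks \<subseteq> ?G"
    proof
      assume "set ks \<subseteq> ?G"
      then have "card (set ks) \<le> card ?G" by (intro card_mono) auto
      then show False using k ks True by (simp add: heights_def words_def distinct_card)
    qed
    then obtain \<kappa> where "\<kappa> \<in> set ks" "\<kappa> \<notin> ?G" by blast
    moreover have "\<kappa> \<in> ?C" using ks calculation by (auto simp: words_def)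
    ultimately show ?thesis using word_bad bad by blast
  qed (rule word_rep)
  then show ?thesis unfolding exp by (simp add: sum.neutral)
qed

text \<open>Each rank one element is the lower part of a matrix X in \<open>sp_odd n\<close> with
  X^k v = 0; in the graded module the powers of X and of its lower part agree on v.\<close>

lemma rank_one_vanish:
  assumes hts: "heights (col ` {..<N}) ht = bnd n m"
  shows "G.rank_one_vanish n m (sp_basis n) (in_degree 0 v)"
  unfolding G.rank_one_vanish_def
proof (intro allI impI)
  fix c0 r0 k and U :: "nat \<Rightarrow> complex"
  assume c0: "1 \<le> c0" "c0 \<le> n" "c0 < r0" and r0: "r0 \<le> n \<or> r0 = 2 * n + 1"
    and U: "U (2 * n + 2 - c0) = 1" and k: "bnd n m c0 r0 < k"
  have main: "foldr (gr_op n) (replicate k (rank_one (sp_basis n) n c0 r0 U)) (in_degree 0 v) \<in> gr_null n v"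
    if X: "X \<in> sp_odd n" and z: "foldr (gl_act n) (replicate k X) v = 0"
      and ent: "\<And>r c. (r, c) \<in> posB n \<Longrightarrow> X (row_idx n r, c) = (if c0 \<le> c \<and> r \<le> r0 then U r * U (2 * n + 2 - c) else 0)"
    for X
  proof -
    have L: "lower_part n X = rank_one (sp_basis n) n c0 r0 U"
      unfolding lower_part_def rank_one_def
    proof (rule sum.mono_neutral_cong_right[OF finite_posB])
      show "sub_pos n c0 r0 \<subseteq> posB n" by (auto simp: sub_pos_def)
      show "\<forall>x\<in>posB n - sub_pos n c0 r0. cscale (X (row_idx n (fst x), snd x)) (sp_basis n x) = 0"
      proof
        fix x assume "x \<in> posB n - sub_pos n c0 r0"
        then have "X (row_idx n (fst x), snd x) = 0" using ent[of "fst x" "snd x"] by (auto simp: sub_pos_def)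
        then show "cscale (X (row_idx n (fst x), snd x)) (sp_basis n x) = 0" by simp
      qed
      fix x assume "x \<in> sub_pos n c0 r0"
      then show "cscale (X (row_idx n (fst x), snd x)) (sp_basis n x) =
          cscale (U (fst x) * U (2 * n + 2 - snd x)) (sp_basis n x)"
        using ent[of "fst x" "snd x"] by (auto simp: sub_pos_def)
    qed
    let ?w = "foldr (gl_act n) (replicate k (rank_one (sp_basis n) n c0 r0 U)) v"
    have "0 - ?w \<in> pbw_pred n v k" using lower_part_power[OF X, of k] unfolding z L by blast
    then have "cscale (- 1) (0 - ?w) \<in> pbw_pred n v k" by (rule pbw_pred_simps)
    then have "?w \<in> pbw_pred n v k" by simp
    then have "in_degree k ?w \<in> gr_null n v"
      using subsetD[OF pbw_pred_sub] by (simp add: gr_null_def in_degree_reps) (simp add: in_degree_def pbw_pred_simps)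
    then show ?thesis by (simp only: foldr_in_degree length_replicate)
  qed
  have hk: "heights (col ` {..<N}) ht c0 r0 < k" using hts k by simp
  show "foldr (gr_op n) (replicate k (rank_one (sp_basis n) n c0 r0 U)) (in_degree 0 v) \<in> gr_null n v"
  proof (cases "r0 \<le> n")
    case True
    \<comment> \<open>\<open>u c0\<close> is chosen such that \<open>\<eta>\<close> vanishes on \<open>u\<close>; the position \<open>(c0, c0)\<close> is not in \<open>posB n\<close>.\<close>
    define u where "u i = (if i = c0 then - (\<Sum>k\<in>{c0<..r0}. U k * U (2 * n + 2 - k)) else if c0 < i \<and> i \<le> r0 then U i else 0)" for i
    define \<eta> where "\<eta> j = (if c0 \<le> j \<and> j \<le> n then U (2 * n + 2 - j) else 0)" for j
    \<comment> \<open>The rank one block u \<eta> among the first n indices, together with the lower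
      right block that membership in \<open>sp_odd n\<close> then forces.\<close>
    define X :: cmat where "X = (\<lambda>(i, j). if i \<in> {1..n} \<and> j \<in> {1..n} then u i * \<eta> j
      else if i \<in> {n + 1..2 * n} \<and> j \<in> {n + 1..2 * n} then - (u (j - n) * \<eta> (i - n)) else 0)"
    have Xsp: "X \<in> sp_odd n" unfolding sp_odd_iff gl_def by (auto simp: X_def idx_def)
    have u0: "u i = 0" if "i \<notin> {c0..r0}" for i using that by (auto simp: u_def)
    have tr: "(\<Sum>k\<in>A. u k * \<eta> k) = 0" if A: "finite A" "{c0..r0} \<subseteq> A" for A
    proof -
      have "(\<Sum>k\<in>A. u k * \<eta> k) = (\<Sum>k\<in>{c0..r0}. u k * \<eta> k)"
        by (rule sum.mono_neutral_right) (use A u0 in auto)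
      also have "{c0..r0} = insert c0 {c0<..r0}" using c0 by auto
      also have "(\<Sum>k\<in>insert c0 {c0<..r0}. u k * \<eta> k) = u c0 * \<eta> c0 + (\<Sum>k\<in>{c0<..r0}. u k * \<eta> k)" by simp
      also have "(\<Sum>k\<in>{c0<..r0}. u k * \<eta> k) = (\<Sum>k\<in>{c0<..r0}. U k * U (2 * n + 2 - k))"
        using True by (intro sum.cong) (auto simp: u_def \<eta>_def)
      also have "u c0 * \<eta> c0 = - (\<Sum>k\<in>{c0<..r0}. U k * U (2 * n + 2 - k))"
        using c0 U by (simp add: u_def \<eta>_def)
      finally show ?thesis by simp
    qed
    have "foldr (gl_act n) (replicate k X) v = 0"
    proof (rule rank_one_power_zero[where u = u and \<eta> = \<eta>, OF _ _ _ _ _ hk])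
      show "X (i, j) = u i * \<eta> j" if "j \<in> {1..n}" for i j
        using that True c0 u0[of i] by (auto simp: X_def)
      show "(\<Sum>a\<in>idx n. X (i, a) * u a) = 0" for i
      proof -
        have "(\<Sum>a\<in>idx n. X (i, a) * u a) = (\<Sum>a\<in>idx n. u i * (u a * \<eta> a))"
        proof (rule sum.cong[OF refl])
          fix a
          show "X (i, a) * u a = u i * (u a * \<eta> a)"
            using True c0 u0[of i] u0[of a] by (cases "a \<in> {c0..r0}") (auto simp: X_def)
        qed
        also have "\<dots> = u i * (\<Sum>a\<in>idx n. u a * \<eta> a)" by (simp add: sum_distrib_left)
        also have "\<dots> = 0" using tr[of "idx n"] c0 True by (simp add: idx_def)
        finally show ?thesis .
      qed
      show "\<eta> j = 0" if "1 \<le> j" "j < c0" for j using that by (simp add: \<eta>_def)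
      show "u i = 0" if "r0 \<le> h" "h \<le> n" "i \<notin> {1..h}" for h i using that c0 by (intro u0) auto
      show "(\<Sum>k=1..h. u k * \<eta> k) = 0" if "r0 \<le> h" "h \<le> n" for h using that c0 by (intro tr) auto
    qed
    moreover have "X (row_idx n r, c) = (if c0 \<le> c \<and> r \<le> r0 then U r * U (2 * n + 2 - c) else 0)"
      if "(r, c) \<in> posB n" for r c
      using that True by (auto simp: posB_def row_idx_def X_def u_def \<eta>_def)
    ultimately show ?thesis using main[OF Xsp] by blast
  next
    case False
    then have r0': "r0 = 2 * n + 1" using r0 by simp
    \<comment> \<open>The cut after place 2n+2-c0 makes \<eta> vanish on the columns before c0. It
      removes no row of a position with c >= c0, because such a position has r <= 2n+2-c.\<close>
    define u where "u i = (if i \<in> idx n \<and> idx_pos n i \<le> 2 * n + 2 - c0 then U (idx_pos n i) else 0)" for i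
    \<comment> \<open>\<open>\<eta>\<close> is the contraction of \<open>\<omega>\<close> with \<open>u\<close>, up to sign.\<close>
    define \<eta> where "\<eta> j = (if j \<in> {1..n} then u (n + j) else if j \<in> {n + 1..2 * n} then - u (j - n) else 0)" for j
    \<comment> \<open>Up to sign the map x \<mapsto> omega(u, x) u. It preserves omega
      infinitesimally, and it kills u because omega is alternating.\<close>
    define X :: cmat where "X = (\<lambda>(i, j). u i * \<eta> j)"
    have u0: "u i = 0" if "i \<notin> idx n" for i using that by (simp add: u_def)
    have \<eta>0: "\<eta> j = 0" if "j \<notin> idx n" for j using that by (auto simp: \<eta>_def idx_def)
    have \<eta>s: "\<eta> j = u (n + j)" "\<eta> (n + j) = - u j" if "j \<in> {1..n}" for j using that by (auto simp: \<eta>_def)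
    have Xsp: "X \<in> sp_odd n" unfolding sp_odd_iff
    proof (intro conjI ballI)
      show "X \<in> gl n" using u0 \<eta>0 by (auto simp: gl_def X_def)
      fix i assume "i \<in> {1..n}"
      show "X (i, 2 * n + 1) = 0" "X (n + i, 2 * n + 1) = 0" by (auto simp: X_def \<eta>_def)
    qed (auto simp: X_def \<eta>s simp del: atLeastAtMost_iff)
    have "foldr (gl_act n) (replicate k X) v = 0"
    proof (rule rank_one_power_zero[where u = u and \<eta> = \<eta>, OF _ _ _ _ _ hk])
      show "X (i, j) = u i * \<eta> j" for i j by (simp add: X_def)
      show "(\<Sum>a\<in>idx n. X (i, a) * u a) = 0" for i
      proof -
        have I: "idx n = {1..n} \<union> (\<lambda>j. n + j) ` {1..n} \<union> {2 * n + 1}" by (auto simp: idx_def image_iff)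
        have "(\<Sum>a\<in>idx n. \<eta> a * u a) = (\<Sum>a\<in>{1..n}. \<eta> a * u a) + (\<Sum>a\<in>(\<lambda>j. n + j) ` {1..n}. \<eta> a * u a) + \<eta> (2 * n + 1) * u (2 * n + 1)"
          unfolding I by (subst sum.union_disjoint; (subst sum.union_disjoint)?) auto
        also have "(\<Sum>a\<in>(\<lambda>j. n + j) ` {1..n}. \<eta> a * u a) = (\<Sum>a\<in>{1..n}. \<eta> (n + a) * u (n + a))"
          by (subst sum.reindex) (auto simp: comp_def)
        also have "(\<Sum>a\<in>{1..n}. \<eta> (n + a) * u (n + a)) = - (\<Sum>a\<in>{1..n}. \<eta> a * u a)"
          unfolding sum_negf[symmetric] by (intro sum.cong) (auto simp: \<eta>s simp del: atLeastAtMost_iff)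
        also have "\<eta> (2 * n + 1) = 0" by (simp add: \<eta>_def)
        finally have "(\<Sum>a\<in>idx n. \<eta> a * u a) = 0" by simp
        moreover have "(\<Sum>a\<in>idx n. X (i, a) * u a) = u i * (\<Sum>a\<in>idx n. \<eta> a * u a)"
          by (simp add: X_def sum_distrib_left mult.assoc)
        ultimately show ?thesis by simp
      qed
      show "\<eta> j = 0" if "1 \<le> j" "j < c0" for j
        using that c0 by (auto simp: \<eta>_def u_def idx_def idx_pos_def)
    \<comment> \<open>No height h satisfies r0 <= h <= n, so the two remaining conditions hold
      vacuously.\<close>
    qed (use r0' in auto)
    moreover have "X (row_idx n r, c) = (if c0 \<le> c \<and> r \<le> r0 then U r * U (2 * n + 2 - c) else 0)"
      if rc: "(r, c) \<in> posB n" for r c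
    proof -
      have r: "1 \<le> r" "r \<le> 2 * n + 1" "c \<in> {1..n}" "r \<le> 2 * n + 2 - c" using rc by (auto simp: posB_def)
      have "X (row_idx n r, c) = u (row_idx n r) * u (n + c)" using r(3) by (simp add: X_def \<eta>s)
      moreover have "u (row_idx n r) = (if r \<le> 2 * n + 2 - c0 then U r else 0)"
        using row_idx_idx[OF r(1,2)] idx_pos_row_idx[OF r(1,2)] by (simp add: u_def)
      moreover have "u (n + c) = (if 2 * n + 2 - c \<le> 2 * n + 2 - c0 then U (2 * n + 2 - c) else 0)"
        using r(3) by (auto simp: u_def idx_def idx_pos_def)
      ultimately show ?thesis using r r0' c0 by auto
    qed
    ultimately show ?thesis using main[OF Xsp] by blast
  qed
qed

end

text \<open>The position in \<open>posB n\<close> among \<open>(r, a)\<close> and its mirror image \<open>(2n+2-a, 2n+2-r)\<close>.\<close>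

definition fold_pos :: "nat \<Rightarrow> nat \<Rightarrow> nat \<Rightarrow> nat \<times> nat" where
  "fold_pos n r a = (if r + a \<le> 2 * n + 2 then (r, a) else (2 * n + 2 - a, 2 * n + 2 - r))"

text \<open>In the first n columns a root vector has only entries 0 and 1; its negative entries lie
  in later columns. This later excludes cancellation in \<open>word_value\<close>.\<close>

lemma sp_basis_entry:
  assumes x: "x \<in> posB n" and ia: "i \<in> idx n" "a \<in> {1..n}" "a < idx_pos n i"
  shows "sp_basis n x (i, a) = (if x = fold_pos n (idx_pos n i) a then 1 else 0)"
proof (cases "idx_pos n i + a \<le> 2 * n + 2")
  case True
  then have "(idx_pos n i, a) \<in> posB n" using ia by (auto simp: posB_def)
  from sp_basis_row_idx[OF x this] show ?thesis
    using row_idx_idx_pos[OF ia(1)] True by (simp add: fold_pos_def)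
next
  case False
  then obtain k where k: "i = n + k" "k \<in> {1..n}" "k < a"
    using ia by (cases rule: idx_cases[OF ia(1)]) (auto simp: idx_pos_def split: if_splits)
  have "sp_basis n x (i, a) = sp_basis n x (n + a, k)"
    using sp_basis_sp_odd[OF x] k ia(2) unfolding sp_odd_iff by blast
  moreover have B: "(2 * n + 2 - a, k) \<in> posB n" using k ia(2) by (auto simp: posB_def)
  moreover have "row_idx n (2 * n + 2 - a) = n + a" using ia(2) by (auto simp: row_idx_def)
  moreover have "fold_pos n (idx_pos n i) a = (2 * n + 2 - a, k)"
    using False k by (auto simp: fold_pos_def idx_pos_def)
  ultimately show ?thesis using sp_basis_row_idx[OF x B] by simp
qed

lemma image_mset_mset_set_sum: "finite D \<Longrightarrow> image_mset g (mset_set D) = (\<Sum>p\<in>D. {#g p#})"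
  by (induction D rule: finite_induct) auto

section \<open>Coefficients of words applied to the highest weight vector\<close>

context column_tensor
begin

text \<open>A coefficient at \<open>l\<close> of a word of length \<open>k\<close> applied to \<open>v\<close> can only be nonzero if at most \<open>k\<close> entries of
  \<open>l\<close> are bad; if there are exactly \<open>k\<close>, each letter of the word must repair one of them.\<close>

definition bad :: "nat list \<Rightarrow> nat set" where
  "bad l = {p. p < N \<and> l ! p \<notin> {1..ht (col p)}}"

lemma finite_bad: "finite (bad l)"
  by (simp add: bad_def)

lemma bad_update:
  assumes "length l = N"
  shows "bad l - {p} \<subseteq> bad (l[p := a])"
    and "p < N \<Longrightarrow> a \<in> {1..ht (col p)} \<Longrightarrow> bad (l[p := a]) = bad l - {p}"
    and "p < N \<Longrightarrow> a \<notin> {1..ht (col p)} \<Longrightarrow> bad (l[p := a]) = insert p (bad l)"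
proof -
  have nth: "l[p := a] ! q = (if q = p then a else l ! q)" if "q < N" for q
    using that assms by (simp add: nth_list_update)
  show "bad l - {p} \<subseteq> bad (l[p := a])" using nth by (auto simp: bad_def)
  show "bad (l[p := a]) = bad l - {p}" if "p < N" "a \<in> {1..ht (col p)}"
    using nth that by (auto simp: bad_def split: if_splits)
  show "bad (l[p := a]) = insert p (bad l)" if "p < N" "a \<notin> {1..ht (col p)}"
    using nth that by (auto simp: bad_def split: if_splits)
qed

lemma word_support:
  assumes "foldr (gl_act n) xs v l \<noteq> 0"
  shows "length l = N \<and> card (bad l) \<le> length xs"
  using assms
proof (induction xs arbitrary: l)
  case Nil
  then have v: "v l \<noteq> 0" by simp
  have "bad l = {}" using supp[OF v] by (auto simp: bad_def)
  then show ?case using supp[OF v] by simp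
next
  case (Cons x xs)
  have "foldr (gl_act n) (x # xs) v l = (\<Sum>p<length l. \<Sum>a\<in>idx n. x (l ! p, a) * foldr (gl_act n) xs v (l[p := a]))"
    by (simp add: gl_act_def)
  with Cons.prems have "(\<Sum>p<length l. \<Sum>a\<in>idx n. x (l ! p, a) * foldr (gl_act n) xs v (l[p := a])) \<noteq> 0"
    by argo
  then obtain p a where pa: "foldr (gl_act n) xs v (l[p := a]) \<noteq> 0"
    by (metis (no_types, lifting) mult_zero_right sum.neutral)
  from Cons.IH[OF this] have l: "length l = N" "card (bad (l[p := a])) \<le> length xs" by auto
  have "card (bad l - {p}) \<le> card (bad (l[p := a]))"
    by (rule card_mono[OF finite_bad bad_update(1)[OF l(1)]])
  moreover have "card (bad l) \<le> Suc (card (bad l - {p}))"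
    using card_Suc_Diff1[OF finite_bad, of p l] by (cases "p \<in> bad l") auto
  ultimately show ?case using l by simp
qed

text \<open>Makes the coefficient at l a well-defined linear form on the graded piece of degree
  \<open>card (bad l)\<close>.\<close>

lemma pbw_vanish:
  assumes "T \<in> pbw n v s" "s < card (bad l)"
  shows "T l = 0"
  using assms(1)
proof (rule pbw_induct)
  show "(0 :: tensor) l = 0" by (simp add: zero_fun_apply)
  fix c and xs :: "cmat list" and T assume xs: "length xs \<le> s" and T: "T l = (0 :: complex)"
  have "foldr (gl_act n) xs v l = 0" using word_support[of xs l] xs assms(2) by force
  then show "(cscale c (foldr (gl_act n) xs v) + T) l = 0" using T by (simp add: plus_fun_apply cscale_def)
qed

definition refills :: "nat list \<Rightarrow> nat list \<Rightarrow> bool" where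
  "refills l l' \<longleftrightarrow> v l' \<noteq> 0 \<and> (\<forall>p<N. p \<notin> bad l \<longrightarrow> l' ! p = l ! p)"

text \<open>The root vectors that carry l' to l, one for each bad position of l: the entry of l'
  becomes the entry of l.\<close>

definition moves :: "nat list \<Rightarrow> nat list \<Rightarrow> (nat \<times> nat) multiset" where
  "moves l l' = image_mset (\<lambda>p. fold_pos n (idx_pos n (l ! p)) (l' ! p)) (mset_set (bad l))"

lemma bad_idx_pos:
  assumes "p \<in> bad l" "set l \<subseteq> idx n" "length l = N"
  shows "l ! p \<in> idx n \<and> ht (col p) < idx_pos n (l ! p) \<and> ht (col p) \<le> n"
proof -
  have p: "p < N" "l ! p \<notin> {1..ht (col p)}" using assms(1) by (auto simp: bad_def)
  then have "l ! p \<in> idx n" using assms(2,3) by auto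
  then show ?thesis using p ht_le[OF p(1)] by (auto simp: idx_pos_def idx_def)
qed

text \<open>Any other change of l leaves more bad positions than the remaining letters can
  repair.\<close>

lemma word_term:
  assumes b: "b \<in> posB n" and l: "length l = N" "set l \<subseteq> idx n"
    and card: "card (bad l) = Suc (length xs)" and p: "p < N"
  shows "sp_basis n b (l ! p, a) * foldr (gl_act n) xs v (l[p := a]) =
    (if p \<in> bad l \<and> a \<in> {1..ht (col p)} \<and> b = fold_pos n (idx_pos n (l ! p)) a
     then foldr (gl_act n) xs v (l[p := a]) else 0)"
proof (cases "p \<in> bad l \<and> a \<in> {1..ht (col p)}")
  case True
  then have a: "a \<in> {1..n}" "a < idx_pos n (l ! p)" "l ! p \<in> idx n"
    using bad_idx_pos[of p l] l by auto
  show ?thesis using sp_basis_entry[OF b a(3,1,2)] True by simp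
next
  case False
  have "length xs < card (bad (l[p := a]))"
  proof (cases "a \<in> {1..ht (col p)}")
    case True
    then have "bad (l[p := a]) = bad l" using bad_update(2)[OF l(1) p True] False by auto
    then show ?thesis using card by simp
  next
    case a: False
    have "card (bad l) \<le> card (bad (l[p := a]))"
      unfolding bad_update(3)[OF l(1) p a] by (rule card_mono) (auto simp: finite_bad)
    then show ?thesis using card by simp
  qed
  then have "foldr (gl_act n) xs v (l[p := a]) = 0" using word_support[of xs "l[p := a]"] by force
  then show ?thesis using False by simp
qed

lemma moves_update:
  assumes "p \<in> bad l" "a \<in> {1..ht (col p)}" "length l = N" "l' ! p = a"
  shows "moves l l' = add_mset (fold_pos n (idx_pos n (l ! p)) a) (moves (l[p := a]) l')"
proof -
  have p: "p < N" using assms(1) by (simp add: bad_def)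
  have "mset_set (bad l) = add_mset p (mset_set (bad l - {p}))"
    using assms(1) finite_bad by (metis mset_set.remove)
  moreover have "image_mset (\<lambda>q. fold_pos n (idx_pos n (l ! q)) (l' ! q)) (mset_set (bad l - {p})) = moves (l[p := a]) l'"
    unfolding moves_def bad_update(2)[OF assms(3) p assms(2)]
    by (rule image_mset_cong) (auto simp: finite_bad)
  ultimately show ?thesis using assms(4) by (simp add: moves_def)
qed

lemma refills_update:
  assumes "p \<in> bad l" "a \<in> {1..ht (col p)}" "length l = N"
  shows "refills (l[p := a]) l' \<longleftrightarrow> refills l l' \<and> l' ! p = a"
proof -
  have p: "p < N" using assms(1) by (simp add: bad_def)
  show ?thesis unfolding refills_def bad_update(2)[OF assms(3) p assms(2)]
    using p assms(1,3) by (auto simp: nth_list_update)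
qed

text \<open>Follow a nonzero term of the coefficient: every letter repairs one bad position, and the
  word reached at the end is in the support of v.\<close>

lemma word_moves:
  assumes "foldr (gl_act n) (map (sp_basis n) bs) v l \<noteq> 0" "set bs \<subseteq> posB n"
    "set l \<subseteq> idx n" "card (bad l) = length bs"
  shows "\<exists>l'. refills l l' \<and> mset bs = moves l l'"
  using assms
proof (induction bs arbitrary: l)
  case Nil
  then show ?case using finite_bad by (intro exI[of _ l]) (auto simp: refills_def moves_def)
next
  case (Cons b bs)
  let ?w = "foldr (gl_act n) (map (sp_basis n) bs) v"
  have l: "length l = N" using word_support[OF Cons.prems(1)] by simp
  have card: "card (bad l) = Suc (length (map (sp_basis n) bs))" using Cons.prems(4) by simp
  have "foldr (gl_act n) (map (sp_basis n) (b # bs)) v l = (\<Sum>p<N. \<Sum>a\<in>idx n. sp_basis n b (l ! p, a) * ?w (l[p := a]))"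
    using l by (simp add: gl_act_def)
  with Cons.prems(1) have "(\<Sum>p<N. \<Sum>a\<in>idx n. sp_basis n b (l ! p, a) * ?w (l[p := a])) \<noteq> 0"
    by argo
  then obtain p a where pa: "p < N" "a \<in> idx n" "sp_basis n b (l ! p, a) * ?w (l[p := a]) \<noteq> 0"
    by (metis (no_types, lifting) lessThan_iff sum.neutral)
  then have *: "p \<in> bad l" "a \<in> {1..ht (col p)}" "b = fold_pos n (idx_pos n (l ! p)) a" "?w (l[p := a]) \<noteq> 0"
    using word_term[OF _ l Cons.prems(3) card pa(1), of b a] Cons.prems(2) by (auto split: if_splits)
  have "card (bad (l[p := a])) = length bs"
    using bad_update(2)[OF l pa(1) *(2)] *(1) card finite_bad[of l] by simp
  moreover have "set (l[p := a]) \<subseteq> idx n" using Cons.prems(3) pa(2) set_update_subset_insert by fastforce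
  ultimately obtain l' where l': "refills (l[p := a]) l'" "mset bs = moves (l[p := a]) l'"
    using Cons.IH[OF *(4)] Cons.prems(2) by auto
  then have "refills l l'" "l' ! p = a" using refills_update[OF *(1,2) l] by auto
  then show ?case using moves_update[OF *(1,2) l] l'(2) *(3) by auto
qed

text \<open>All terms are natural multiples of v l1, because the matrix entries that matter are 0 or
  1; so a single nonvanishing term decides.\<close>

lemma word_value:
  assumes "set bs \<subseteq> posB n" "length l = N" "set l \<subseteq> idx n" "card (bad l) = length bs"
    and "\<And>l'. refills l l' \<Longrightarrow> moves l l' = mset bs \<Longrightarrow> l' = l1"
  shows "\<exists>k :: nat. foldr (gl_act n) (map (sp_basis n) bs) v l = of_nat k * v l1 \<and>
    (refills l l1 \<and> moves l l1 = mset bs \<longrightarrow> 0 < k)"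
  using assms
proof (induction bs arbitrary: l)
  case Nil
  then have bad: "bad l = {}" using finite_bad[of l] by simp
  show ?case
  proof (cases "v l = 0")
    case True
    have "\<not> refills l l1"
    proof
      assume r: "refills l l1"
      then have "l1 = l" using bad Nil.prems(2) supp by (intro nth_equalityI) (auto simp: refills_def)
      then show False using r True by (simp add: refills_def)
    qed
    then show ?thesis using True by (intro exI[of _ 0]) simp
  next
    case False
    then have "l = l1" using bad by (intro Nil.prems(5)) (auto simp: refills_def moves_def)
    then show ?thesis by (intro exI[of _ 1]) simp
  qed
next
  case (Cons b bs)
  let ?w = "foldr (gl_act n) (map (sp_basis n) bs) v"
  let ?t = "\<lambda>p a. sp_basis n b (l ! p, a) * ?w (l[p := a])"
  let ?good = "\<lambda>p a. p \<in> bad l \<and> a \<in> {1..ht (col p)} \<and> b = fold_pos n (idx_pos n (l ! p)) a"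
  note l = Cons.prems(2)
  have card: "card (bad l) = Suc (length (map (sp_basis n) bs))" using Cons.prems(4) by simp
  have "\<exists>k :: nat. ?t p a = of_nat k * v l1 \<and>
      (refills l l1 \<and> moves l l1 = mset (b # bs) \<and> ?good p a \<and> l1 ! p = a \<longrightarrow> 0 < k)"
    if p: "p < N" and a: "a \<in> idx n" for p a
  proof (cases "?good p a")
    case True
    then have g: "p \<in> bad l" "a \<in> {1..ht (col p)}" "b = fold_pos n (idx_pos n (l ! p)) a" by auto
    have "card (bad (l[p := a])) = length bs"
      using bad_update(2)[OF l p g(2)] g(1) card finite_bad[of l] by simp
    moreover have "set (l[p := a]) \<subseteq> idx n" using Cons.prems(3) a set_update_subset_insert by fastforce
    moreover have "l' = l1" if "refills (l[p := a]) l'" "moves (l[p := a]) l' = mset bs" for l'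
    proof -
      have "refills l l'" "l' ! p = a" using that(1) refills_update[OF g(1,2) l] by auto
      then show ?thesis using moves_update[OF g(1,2) l, of l'] that(2) g(3) by (intro Cons.prems(5)) auto
    qed
    ultimately obtain k :: nat where k: "?w (l[p := a]) = of_nat k * v l1"
      "refills (l[p := a]) l1 \<and> moves (l[p := a]) l1 = mset bs \<longrightarrow> 0 < k"
      using Cons.IH[of "l[p := a]"] Cons.prems(1) l by auto
    have "?t p a = of_nat k * v l1"
      using word_term[OF _ l Cons.prems(3) card p, of b a] Cons.prems(1) True k(1) by simp
    moreover have "0 < k" if "refills l l1" "moves l l1 = mset (b # bs)" "l1 ! p = a"
      using k(2) refills_update[OF g(1,2) l] moves_update[OF g(1,2) l that(3)] that g(3) by auto
    ultimately show ?thesis by blast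
  next
    case False
    then have "?t p a = 0" using word_term[OF _ l Cons.prems(3) card p, of b a] Cons.prems(1) by auto
    then show ?thesis using False by (intro exI[of _ 0]) auto
  qed
  then obtain k :: "nat \<Rightarrow> nat \<Rightarrow> nat" where k: "\<And>p a. p < N \<Longrightarrow> a \<in> idx n \<Longrightarrow> ?t p a = of_nat (k p a) * v l1"
    and kpos: "\<And>p a. p < N \<Longrightarrow> a \<in> idx n \<Longrightarrow> refills l l1 \<Longrightarrow> moves l l1 = mset (b # bs) \<Longrightarrow> ?good p a \<Longrightarrow> l1 ! p = a \<Longrightarrow> 0 < k p a"
    by metis
  have "foldr (gl_act n) (map (sp_basis n) (b # bs)) v l = (\<Sum>p<N. \<Sum>a\<in>idx n. ?t p a)"
    using l by (simp add: gl_act_def)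
  also have "\<dots> = (\<Sum>p<N. \<Sum>a\<in>idx n. of_nat (k p a) * v l1)" by (intro sum.cong refl) (simp add: k)
  also have "\<dots> = of_nat (\<Sum>p<N. \<Sum>a\<in>idx n. k p a) * v l1" by (simp add: sum_distrib_right)
  finally have val: "foldr (gl_act n) (map (sp_basis n) (b # bs)) v l = of_nat (\<Sum>p<N. \<Sum>a\<in>idx n. k p a) * v l1" .
  have "0 < (\<Sum>p<N. \<Sum>a\<in>idx n. k p a)" if r: "refills l l1" and m: "moves l l1 = mset (b # bs)"
  proof -
    have "b \<in># moves l l1" using m by simp
    then obtain p where p: "p \<in> bad l" "b = fold_pos n (idx_pos n (l ! p)) (l1 ! p)"
      using finite_bad by (auto simp: moves_def)
    have pN: "p < N" using p(1) by (simp add: bad_def)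
    have a: "l1 ! p \<in> {1..ht (col p)}" using supp r pN by (auto simp: refills_def)
    then have ai: "l1 ! p \<in> idx n" using ht_le[OF pN] by (auto simp: idx_def)
    have "0 < k p (l1 ! p)" by (rule kpos[OF pN ai r m]) (use p a in auto)
    also have "k p (l1 ! p) \<le> (\<Sum>a\<in>idx n. k p a)" by (rule member_le_sum) (use ai in \<open>auto simp: idx_def\<close>)
    also have "\<dots> \<le> (\<Sum>p<N. \<Sum>a\<in>idx n. k p a)" by (rule member_le_sum) (use pN in auto)
    finally show ?thesis .
  qed
  then show ?case using val by blast
qed

text \<open>Split s into antichains, one per column, and let l be a word l1 of the support with
  these moves carried out. Another refill of l permutes the moved entries within the columns. Since
  larger rows of an antichain go with smaller columns, the rearrangement inequality makes l1 the
  only refill of greatest weight.\<close>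

lemma essential:
  assumes s: "s \<in> ffl n (heights (col ` {..<N}) ht)"
  shows "G.essential n (sp_basis n) (in_degree 0 v) s"
proof -
  let ?C = "col ` {..<N}" and ?K = "2 * n + 2"
  obtain A where A: "fund_family n ?C ht A" "s = (\<Sum>\<kappa>\<in>?C. mset_set (A \<kappa>))"
    using ffl_decompose[OF _ s] by auto
  obtain l1 where l1: "v l1 \<noteq> 0" using nonzero by (auto simp: fun_eq_iff zero_fun_apply)
  have l1': "length l1 = N" "\<And>p. p < N \<Longrightarrow> l1 ! p \<in> {1..ht (col p)}" using supp[OF l1] by auto
  define D where "D = {p. p < N \<and> (\<exists>r. (r, l1 ! p) \<in> A (col p))}"
  \<comment> \<open>An antichain has at most one position in a given matrix column, so the choice is
    forced; this is \<open>anti\<close>.\<close>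
  define R where "R p = (SOME r. (r, l1 ! p) \<in> A (col p))" for p
  have RA: "(R p, l1 ! p) \<in> A (col p)" if "p \<in> D" for p
    using that someI_ex[of "\<lambda>r. (r, l1 ! p) \<in> A (col p)"] by (auto simp: D_def R_def)
  have DN: "p < N" if "p \<in> D" for p using that by (simp add: D_def)
  have R: "(R p, l1 ! p) \<in> posB n" "ht (col p) < R p" if "p \<in> D" for p
    using RA[OF that] A(1) DN[OF that] by (force simp: fund_family_def)+
  have R': "1 \<le> R p" "R p \<le> 2 * n + 1" if "p \<in> D" for p using R[OF that] by (auto simp: posB_def)
  have anti: "r = R p" if "p \<in> D" "(r, l1 ! p) \<in> A (col p)" for r p
  proof (rule ccontr)
    assume "r \<noteq> R p"
    then have "(r, l1 ! p) \<noteq> (R p, l1 ! p)" by simp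
    moreover have "antichain_set (A (col p))" using A(1) DN[OF that(1)] by (auto simp: fund_family_def)
    ultimately show False using RA[OF that(1)] that(2) unfolding antichain_set_def
      by (metis fst_conv linorder_le_cases order_refl snd_conv)
  qed
  \<comment> \<open>The linear form is the coefficient at the word \<open>l\<close> in degree \<open>size s\<close>.\<close>
  define l where "l = map (\<lambda>p. if p \<in> D then row_idx n (R p) else l1 ! p) [0..<N]"
  have ln: "length l = N" "\<And>p. p < N \<Longrightarrow> l ! p = (if p \<in> D then row_idx n (R p) else l1 ! p)"
    by (auto simp: l_def)
  have bad: "bad l = D"
  proof -
    have "l ! p \<notin> {1..ht (col p)}" if p: "p \<in> D" for p
      using ln(2)[OF DN[OF p]] p R(2)[OF p] ht_le[OF DN[OF p]] R'[OF p] by (auto simp: row_idx_def)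
    moreover have "l ! p \<in> {1..ht (col p)}" if "p < N" "p \<notin> D" for p using ln(2) l1'(2) that by auto
    ultimately show ?thesis using DN by (auto simp: bad_def)
  qed
  have idxl: "set l \<subseteq> idx n"
  proof
    fix x assume "x \<in> set l"
    then obtain p where p: "p < N" "x = l ! p" using ln(1) by (metis in_set_conv_nth)
    show "x \<in> idx n"
    proof (cases "p \<in> D")
      case True
      then show ?thesis using p ln(2) row_idx_idx R' by auto
    next
      case False
      then show ?thesis using p ln(2) l1'(2)[OF p(1)] ht_le[OF p(1)] by (auto simp: idx_def)
    qed
  qed
  have pos: "idx_pos n (l ! p) = R p" if "p \<in> D" for p
    using that ln(2)[OF DN[OF that]] idx_pos_row_idx R'[OF that] by simp
  have finD: "finite D" by (simp add: D_def)
  define Dk where "Dk \<kappa> = {p \<in> D. col p = \<kappa>}" for \<kappa>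
  have finDk: "finite (Dk \<kappa>)" for \<kappa> using finD by (simp add: Dk_def)
  have group: "(\<Sum>p\<in>D. g p) = (\<Sum>\<kappa>\<in>?C. \<Sum>p\<in>Dk \<kappa>. g p)" for g :: "nat \<Rightarrow> 'r :: comm_monoid_add"
    unfolding Dk_def by (rule sum.group[symmetric]) (use finD DN in auto)
  have inj1: "inj_on (\<lambda>p. l' ! p) {p. p < N \<and> col p = \<kappa>}" and im1: "\<kappa> \<in> ?C \<Longrightarrow> (\<lambda>p. l' ! p) ` {p. p < N \<and> col p = \<kappa>} = {1..ht \<kappa>}"
    if "v l' \<noteq> 0" for l' \<kappa>
  proof -
    show "inj_on (\<lambda>p. l' ! p) {p. p < N \<and> col p = \<kappa>}"
    proof (cases "\<kappa> \<in> ?C")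
      case True
      then show ?thesis using supp_column[OF that] by (auto simp: bij_betw_def)
    next
      case False
      then have "{p. p < N \<and> col p = \<kappa>} = {}" by auto
      then show ?thesis by (metis inj_on_empty)
    qed
    show "(\<lambda>p. l' ! p) ` {p. p < N \<and> col p = \<kappa>} = {1..ht \<kappa>}" if "\<kappa> \<in> ?C"
      using supp_column[OF \<open>v l' \<noteq> 0\<close>] that by (auto simp: bij_betw_def)
  qed
  have m1: "moves l l1 = s"
  proof -
    have "moves l l1 = image_mset (\<lambda>p. (R p, l1 ! p)) (mset_set D)"
      unfolding moves_def bad
    proof (rule image_mset_cong)
      fix p assume "p \<in># mset_set D"
      then have p: "p \<in> D" using finD by simp
      then show "fold_pos n (idx_pos n (l ! p)) (l1 ! p) = (R p, l1 ! p)"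
        using pos[OF p] R(1)[OF p] by (auto simp: fold_pos_def posB_def)
    qed
    also have "\<dots> = (\<Sum>\<kappa>\<in>?C. \<Sum>p\<in>Dk \<kappa>. {#(R p, l1 ! p)#})"
      by (simp add: image_mset_mset_set_sum[OF finD] group)
    also have "\<dots> = (\<Sum>\<kappa>\<in>?C. mset_set (A \<kappa>))"
    proof (rule sum.cong[OF refl])
      fix \<kappa> assume \<kappa>: "\<kappa> \<in> ?C"
      have inj: "inj_on (\<lambda>p. (R p, l1 ! p)) (Dk \<kappa>)"
      proof (rule inj_onI)
        fix p q assume pq: "p \<in> Dk \<kappa>" "q \<in> Dk \<kappa>" "(R p, l1 ! p) = (R q, l1 ! q)"
        then show "p = q" using inj_onD[OF inj1[OF l1, of \<kappa>], of p q] DN by (auto simp: Dk_def)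
      qed
      have "(\<lambda>p. (R p, l1 ! p)) ` Dk \<kappa> = A \<kappa>"
      proof
        show "(\<lambda>p. (R p, l1 ! p)) ` Dk \<kappa> \<subseteq> A \<kappa>" using RA by (auto simp: Dk_def)
        show "A \<kappa> \<subseteq> (\<lambda>p. (R p, l1 ! p)) ` Dk \<kappa>"
        proof
          fix x assume x: "x \<in> A \<kappa>"
          obtain r c where rc: "x = (r, c)" by (cases x) auto
          have "(r, c) \<in> posB n" "c \<le> ht \<kappa>" using bspec[OF A(1)[unfolded fund_family_def] \<kappa>] x rc by auto
          then have "c \<in> {1..ht \<kappa>}" by (auto simp: posB_def)
          then have "c \<in> (\<lambda>p. l1 ! p) ` {p. p < N \<and> col p = \<kappa>}" using im1[OF l1 \<kappa>] by simp
          then obtain p where p: "p < N" "col p = \<kappa>" "c = l1 ! p" by blast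
          then have pD: "p \<in> D" using x rc by (auto simp: D_def)
          have "r = R p" using anti[OF pD] x rc p by simp
          with pD show "x \<in> (\<lambda>p. (R p, l1 ! p)) ` Dk \<kappa>" using rc p by (auto simp: Dk_def)
        qed
      qed
      then show "(\<Sum>p\<in>Dk \<kappa>. {#(R p, l1 ! p)#}) = mset_set (A \<kappa>)"
        using image_mset_mset_set[OF inj] by (simp add: image_mset_mset_set_sum[OF finDk])
    qed
    finally show ?thesis using A(2) by simp
  qed
  have r1: "refills l l1" unfolding refills_def bad using l1 ln(2) by auto
  \<comment> \<open>Folding a position only exchanges the two factors r and 2n+2-c of its
    weight.\<close>
  have wt: "pos_weight n (moves l l') = (\<Sum>p\<in>D. R p * (?K - l' ! p))" if "refills l l'" for l'
  proof -
    have "pos_weight n (moves l l') = (\<Sum>p\<in>D. (\<lambda>x. fst x * (?K - snd x)) (fold_pos n (idx_pos n (l ! p)) (l' ! p)))"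
      unfolding pos_weight_def moves_def bad by (simp add: sum_unfold_sum_mset multiset.map_comp comp_def)
    also have "\<dots> = (\<Sum>p\<in>D. R p * (?K - l' ! p))"
    proof (rule sum.cong[OF refl])
      fix p assume p: "p \<in> D"
      then show "(\<lambda>x. fst x * (?K - snd x)) (fold_pos n (idx_pos n (l ! p)) (l' ! p)) = R p * (?K - l' ! p)"
        using pos[OF p] R'[OF p] by (auto simp: fold_pos_def)
    qed
    finally show ?thesis .
  qed
  have unique: "l' = l1 \<or> pos_weight n (moves l l') < pos_weight n s" if r: "refills l l'" for l'
  proof -
    have l': "v l' \<noteq> 0" "\<And>p. p < N \<Longrightarrow> p \<notin> D \<Longrightarrow> l' ! p = l1 ! p"
      using r ln(2) by (auto simp: refills_def bad)
    have le: "l' ! p \<le> ?K" "l1 ! p \<le> ?K" if "p < N" for p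
      using supp[OF l'(1)] supp[OF l1] ht_le[OF that] that by fastforce+
    have col: "(\<forall>p\<in>Dk \<kappa>. l' ! p = l1 ! p) \<or> (\<Sum>p\<in>Dk \<kappa>. R p * l1 ! p) < (\<Sum>p\<in>Dk \<kappa>. R p * l' ! p)" if \<kappa>: "\<kappa> \<in> ?C" for \<kappa>
    proof -
      let ?P = "{p. p < N \<and> col p = \<kappa>}"
      let ?X = "image_mset (\<lambda>p. (R p, l' ! p)) (mset_set (Dk \<kappa>))" and ?Y = "image_mset (\<lambda>p. (R p, l1 ! p)) (mset_set (Dk \<kappa>))"
      have DP: "Dk \<kappa> \<subseteq> ?P" using DN by (auto simp: Dk_def)
      \<comment> \<open>Both words fill the column with 1, ..., height and agree outside
        \<open>Dk \<kappa>\<close>, so they use the same entries inside.\<close>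
      have "(\<lambda>p. l' ! p) ` (?P - Dk \<kappa>) = (\<lambda>p. l1 ! p) ` (?P - Dk \<kappa>)"
        by (rule image_cong) (use l'(2) in \<open>auto simp: Dk_def\<close>)
      moreover have "(\<lambda>p. k ! p) ` Dk \<kappa> = {1..ht \<kappa>} - (\<lambda>p. k ! p) ` (?P - Dk \<kappa>)" if "v k \<noteq> 0" for k
      proof -
        have "(\<lambda>p. k ! p) ` (?P - (?P - Dk \<kappa>)) = (\<lambda>p. k ! p) ` ?P - (\<lambda>p. k ! p) ` (?P - Dk \<kappa>)"
          by (rule inj_on_image_set_diff[OF inj1[OF that, of \<kappa>]]) auto
        moreover have "?P - (?P - Dk \<kappa>) = Dk \<kappa>" using DP by blast
        ultimately show ?thesis using im1[OF that \<kappa>] by simp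
      qed
      ultimately have im: "(\<lambda>p. l' ! p) ` Dk \<kappa> = (\<lambda>p. l1 ! p) ` Dk \<kappa>" using l'(1) l1 by simp
      have "?X = ?Y \<or> (\<Sum>x\<in>#?Y. fst x * snd x) < (\<Sum>x\<in>#?X. fst x * snd x)"
      proof (rule rearrangement_mset)
        show "image_mset fst ?X = image_mset fst ?Y" by (simp add: multiset.map_comp comp_def)
        have "image_mset (\<lambda>p. k ! p) (mset_set (Dk \<kappa>)) = mset_set ((\<lambda>p. k ! p) ` Dk \<kappa>)" if "v k \<noteq> 0" for k
          by (rule image_mset_mset_set[OF inj_on_subset[OF inj1[OF that] DP]])
        then show "image_mset snd ?X = image_mset snd ?Y"
          using l'(1) l1 im by (simp add: multiset.map_comp comp_def)
        fix x y assume "x \<in># ?Y" "y \<in># ?Y" and lt: "fst x < fst y"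
        then obtain p q where pq: "p \<in> Dk \<kappa>" "x = (R p, l1 ! p)" "q \<in> Dk \<kappa>" "y = (R q, l1 ! q)"
          using finDk by auto
        then have xy: "x \<in> A \<kappa>" "y \<in> A \<kappa>" using RA[of p] RA[of q] by (auto simp: Dk_def)
        have "antichain_set (A \<kappa>)" using A(1) \<kappa> by (auto simp: fund_family_def)
        then have "\<not> snd x \<le> snd y" using xy lt unfolding antichain_set_def by (metis less_imp_le_nat nat_neq_iff)
        then show "snd y \<le> snd x" by simp
      qed
      then show ?thesis
      proof
        \<comment> \<open>A row of an antichain contains only one position, so equal multisets of
          pairs give equal entries.\<close>
        assume XY: "?X = ?Y"
        have "l' ! p = l1 ! p" if p: "p \<in> Dk \<kappa>" for p
        proof -
          have "(R p, l' ! p) \<in># ?X" using p finDk by auto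
          then obtain q where q: "q \<in> Dk \<kappa>" "R q = R p" "l' ! p = l1 ! q" unfolding XY using finDk by auto
          have "(R p, l1 ! p) \<in> A \<kappa>" "(R q, l1 ! q) \<in> A \<kappa>" using RA[of p] RA[of q] p q(1) by (auto simp: Dk_def)
          moreover have "antichain_set (A \<kappa>)" using A(1) \<kappa> by (auto simp: fund_family_def)
          ultimately have "l1 ! p = l1 ! q" using q(2) unfolding antichain_set_def
            by (metis fst_conv linorder_le_cases order_refl prod.inject snd_conv)
          then show ?thesis using q(3) by simp
        qed
        then show ?thesis by blast
      next
        assume "(\<Sum>x\<in>#?Y. fst x * snd x) < (\<Sum>x\<in>#?X. fst x * snd x)"
        then show ?thesis by (simp add: sum_unfold_sum_mset multiset.map_comp comp_def)
      qed
    qed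
    show ?thesis
    proof (cases "\<forall>p\<in>D. l' ! p = l1 ! p")
      case True
      then have "l' = l1" using supp[OF l'(1)] l1'(1) l'(2) by (intro nth_equalityI) auto
      then show ?thesis by simp
    next
      case False
      then obtain p where p: "p \<in> D" "l' ! p \<noteq> l1 ! p" by blast
      let ?S = "\<lambda>k \<kappa>. \<Sum>p\<in>Dk \<kappa>. R p * k ! p"
      have "(\<Sum>\<kappa>\<in>?C. ?S l1 \<kappa>) < (\<Sum>\<kappa>\<in>?C. ?S l' \<kappa>)"
      proof (rule sum_strict_mono_ex1)
        show "\<forall>\<kappa>\<in>?C. ?S l1 \<kappa> \<le> ?S l' \<kappa>"
        proof
          fix \<kappa> assume "\<kappa> \<in> ?C"
          from col[OF this] show "?S l1 \<kappa> \<le> ?S l' \<kappa>"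
          proof
            assume "\<forall>p\<in>Dk \<kappa>. l' ! p = l1 ! p"
            then show ?thesis by (intro eq_imp_le sum.cong) auto
          qed simp
        qed
        have "col p \<in> ?C" "p \<in> Dk (col p)" using p DN by (auto simp: Dk_def)
        then show "\<exists>\<kappa>\<in>?C. ?S l1 \<kappa> < ?S l' \<kappa>" using col p(2) by blast
      qed simp
      then have lt: "(\<Sum>p\<in>D. R p * l1 ! p) < (\<Sum>p\<in>D. R p * l' ! p)" by (simp add: group)
      \<comment> \<open>Complementing the entries reverses the comparison: a greater sum of the R p
        * l' ! p is a smaller weight.\<close>
      have tot: "(\<Sum>p\<in>D. R p * (?K - k ! p)) + (\<Sum>p\<in>D. R p * k ! p) = (\<Sum>p\<in>D. R p * ?K)"
        if "\<And>p. p < N \<Longrightarrow> k ! p \<le> ?K" for k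
        unfolding sum.distrib[symmetric]
      proof (rule sum.cong[OF refl])
        fix p assume "p \<in> D"
        then have "k ! p \<le> ?K" using that DN by blast
        then show "R p * (?K - k ! p) + R p * k ! p = R p * ?K" by (metis add_mult_distrib2 le_add_diff_inverse2)
      qed
      have "(\<Sum>p\<in>D. R p * (?K - l' ! p)) < (\<Sum>p\<in>D. R p * (?K - l1 ! p))"
        using tot[of l', OF le(1)] tot[of l1, OF le(2)] lt by linarith
      then show ?thesis using wt[OF r] wt[OF r1] m1 by simp
    qed
  qed
  define d where "d = card D"
  have sz: "size s = d" unfolding m1[symmetric] by (simp add: moves_def bad d_def)
  define \<Phi> where "\<Phi> T = T d l" for T :: "nat \<Rightarrow> tensor"
  have lin: "G.lin_form \<Phi>"
    unfolding G.lin_form_def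
  proof (intro conjI ballI allI)
    show "\<Phi> (S + T) = \<Phi> S + \<Phi> T" for S T by (simp add: \<Phi>_def plus_fun_apply)
    show "\<Phi> (gscale c T) = c * \<Phi> T" for c T by (simp add: \<Phi>_def gscale_def cscale_def)
    fix T assume "T \<in> gr_null n v"
    then have "T d \<in> pbw_pred n v d" by (simp add: gr_null_def)
    then show "\<Phi> T = 0"
      using pbw_vanish[of "T d" "d - 1" l] bad
      by (cases d) (auto simp: \<Phi>_def pbw_pred_0 pbw_pred_Suc zero_fun_apply d_def)
  qed
  have val: "\<Phi> (foldr (gr_op n) (map (sp_basis n) ws) (in_degree 0 v)) =
      (if length ws = d then foldr (gl_act n) (map (sp_basis n) ws) v l else 0)" for ws
    by (simp only: \<Phi>_def foldr_in_degree) (simp add: in_degree_def zero_fun_apply)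
  show ?thesis unfolding G.essential_def
  proof (intro exI[of _ \<Phi>] conjI allI impI lin)
    fix ws assume ws: "set ws \<subseteq> posB n" "\<Phi> (foldr (gr_op n) (map (sp_basis n) ws) (in_degree 0 v)) \<noteq> 0"
    then have "foldr (gl_act n) (map (sp_basis n) ws) v l \<noteq> 0" "card (bad l) = length ws"
      by (auto simp: val bad d_def split: if_splits)
    from word_moves[OF this(1) ws(1) idxl this(2)] obtain l' where "refills l l'" "mset ws = moves l l'" by blast
    then show "mset ws = s \<or> pos_weight n (mset ws) < pos_weight n s" using unique m1 by metis
  next
    obtain ws where ws: "mset ws = s" by (metis ex_mset)
    have wB: "set ws \<subseteq> posB n" using s ws by (auto simp: ffl_def)
    have len: "length ws = d" using sz ws by (metis size_mset)
    have "\<exists>k :: nat. foldr (gl_act n) (map (sp_basis n) ws) v l = of_nat k * v l1 \<and>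
      (refills l l1 \<and> moves l l1 = mset ws \<longrightarrow> 0 < k)"
    proof (rule word_value[OF wB ln(1) idxl])
      show "card (bad l) = length ws" using len by (simp add: bad d_def)
      show "l' = l1" if "refills l l'" "moves l l' = mset ws" for l'
        using unique[OF that(1)] that(2) ws by auto
    qed
    then have "foldr (gl_act n) (map (sp_basis n) ws) v l \<noteq> 0" using r1 m1 ws l1 by auto
    then show "\<exists>ws. set ws \<subseteq> posB n \<and> mset ws = s \<and> \<Phi> (foldr (gr_op n) (map (sp_basis n) ws) (in_degree 0 v)) \<noteq> 0"
      using wB ws len by (intro exI[of _ ws]) (simp add: val)
  qed
qed

end

section \<open>The highest weight vector\<close>

definition box_sum :: "nat \<Rightarrow> (nat \<Rightarrow> nat) \<Rightarrow> nat \<Rightarrow> nat" where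
  "box_sum n m i = (\<Sum>j=1..i. part n m j)"

text \<open>The parts of the conjugate partition, with columns counted from 0.\<close>

definition col_height :: "nat \<Rightarrow> (nat \<Rightarrow> nat) \<Rightarrow> nat \<Rightarrow> nat" where
  "col_height n m \<kappa> = card {i \<in> {1..n}. \<kappa> < part n m i}"

lemma part_antimono: "i \<le> j \<Longrightarrow> part n m j \<le> part n m i"
  unfolding part_def by (rule sum_mono2) auto

lemma part_Suc: "i \<le> n \<Longrightarrow> part n m i = m i + part n m (Suc i)"
  by (simp add: part_def sum.atLeast_Suc_atMost)

lemma box_sum_mono: "i \<le> j \<Longrightarrow> box_sum n m i \<le> box_sum n m j"
  unfolding box_sum_def by (rule sum_mono2) auto

lemma down_closed_interval:
  fixes S :: "nat set"
  assumes "S \<subseteq> {1..n}" "\<And>i j. i \<in> S \<Longrightarrow> 1 \<le> j \<Longrightarrow> j \<le> i \<Longrightarrow> j \<in> S"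
  shows "S = {1..card S}"
proof (cases "S = {}")
  case False
  have fin: "finite S" using assms(1) by (rule finite_subset) simp
  have "x \<in> S \<longleftrightarrow> x \<in> {1..Max S}" for x
    using assms(1) assms(2)[OF Max_in[OF fin False], of x] Max_ge[OF fin, of x] by fastforce
  then have "S = {1..Max S}" by blast
  then show ?thesis by (metis card_atLeastAtMost add_diff_cancel_right' Suc_eq_plus1)
qed simp

lemma col_height_set: "{i \<in> {1..n}. \<kappa> < part n m i} = {1..col_height n m \<kappa>}"
  unfolding col_height_def
  by (rule down_closed_interval[of _ n]) (auto dest: part_antimono[of _ _ n m])

lemma col_height_le: "col_height n m \<kappa> \<le> n"
  unfolding col_height_def by (rule order_trans[OF card_mono[of "{1..n}"]]) auto

lemma le_col_height_iff: "i \<in> {1..n} \<Longrightarrow> i \<le> col_height n m \<kappa> \<longleftrightarrow> \<kappa> < part n m i"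
  using col_height_set[of n \<kappa> m] by (auto simp: set_eq_iff)

lemma box_row_col:
  assumes "p < psize n m"
  shows "box_row n m p \<in> {1..n}" "box_col n m p < part n m (box_row n m p)"
    "p = box_sum n m (box_row n m p - 1) + box_col n m p"
proof -
  let ?P = "\<lambda>i. p < box_sum n m i"
  have row: "box_row n m p = Least ?P" by (simp add: box_row_def box_sum_def)
  have "?P n" using assms by (simp add: psize_def box_sum_def)
  then have P: "?P (box_row n m p)" "box_row n m p \<le> n" unfolding row by (rule LeastI, rule Least_le)
  have pos: "1 \<le> box_row n m p"
    using P(1) by (cases "box_row n m p") (auto simp: box_sum_def)
  then show "box_row n m p \<in> {1..n}" using P(2) by simp
  obtain k where k: "box_row n m p = Suc k" using pos by (cases "box_row n m p") auto
  have "\<not> ?P k" using not_less_Least[of k ?P] k row by simp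
  moreover have "box_col n m p = p - box_sum n m k"
    by (simp add: box_col_def box_sum_def k atLeastLessThanSuc_atLeastAtMost)
  moreover have "p < box_sum n m k + part n m (Suc k)" using P(1) by (simp add: k box_sum_def)
  ultimately show "box_col n m p < part n m (box_row n m p)"
    "p = box_sum n m (box_row n m p - 1) + box_col n m p" by (auto simp: k)
qed

lemma box_exists:
  assumes "i \<in> {1..n}" "c < part n m i"
  shows "\<exists>p < psize n m. box_row n m p = i \<and> box_col n m p = c"
proof -
  obtain k where k: "i = Suc k" using assms(1) by (cases i) auto
  let ?p = "box_sum n m k + c"
  have Sk: "box_sum n m i = box_sum n m k + part n m i" by (simp add: k box_sum_def)
  have "?p < psize n m"
    using assms Sk box_sum_mono[of i n n m] by (simp add: psize_def box_sum_def)
  moreover have "box_row n m ?p = i"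
    unfolding box_row_def
  proof (rule Least_equality)
    show "?p < (\<Sum>j=1..i. part n m j)" using assms(2) Sk by (simp add: box_sum_def)
    fix j assume j: "?p < (\<Sum>j=1..j. part n m j)"
    show "i \<le> j"
    proof (rule ccontr)
      assume "\<not> i \<le> j"
      then have "box_sum n m j \<le> box_sum n m k" by (intro box_sum_mono) (simp add: k)
      then show False using j by (simp add: box_sum_def)
    qed
  qed
  moreover from this have "box_col n m ?p = c"
    by (simp add: box_col_def box_sum_def k atLeastLessThanSuc_atLeastAtMost)
  ultimately show ?thesis by blast
qed

lemma bij_betw_box_row:
  "bij_betw (box_row n m) {p. p < psize n m \<and> box_col n m p = \<kappa>} {1..col_height n m \<kappa>}"
  unfolding col_height_set[symmetric]
proof (rule bij_betwI')
  fix p q assume "p \<in> {p. p < psize n m \<and> box_col n m p = \<kappa>}" "q \<in> {p. p < psize n m \<and> box_col n m p = \<kappa>}"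
  then show "box_row n m p = box_row n m q \<longleftrightarrow> p = q"
    by (metis (mono_tags) box_row_col(3) mem_Collect_eq)
next
  fix p assume "p \<in> {p. p < psize n m \<and> box_col n m p = \<kappa>}"
  then show "box_row n m p \<in> {i \<in> {1..n}. \<kappa> < part n m i}"
    using box_row_col(1,2)[of p n m] by auto
next
  fix i assume "i \<in> {i \<in> {1..n}. \<kappa> < part n m i}"
  then show "\<exists>p\<in>{p. p < psize n m \<and> box_col n m p = \<kappa>}. i = box_row n m p"
    using box_exists[of i n \<kappa> m] by auto
qed

lemma card_column: "card {p. p < psize n m \<and> box_col n m p = \<kappa>} = col_height n m \<kappa>"
  using bij_betw_same_card[OF bij_betw_box_row, of n m \<kappa>] by simp

lemma box_col_image: "box_col n m ` {..<psize n m} = {\<kappa>. 1 \<le> col_height n m \<kappa>}"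
proof -
  have "\<kappa> \<in> box_col n m ` {..<psize n m} \<longleftrightarrow> {p. p < psize n m \<and> box_col n m p = \<kappa>} \<noteq> {}" for \<kappa>
    by auto
  also have "\<dots> \<kappa> \<longleftrightarrow> 1 \<le> col_height n m \<kappa>" for \<kappa>
    unfolding card_column[symmetric] by (simp add: Suc_le_eq card_gt_0_iff)
  finally show ?thesis by auto
qed

lemma col_height_eq_iff:
  assumes "h \<in> {1..n}"
  shows "col_height n m \<kappa> = h \<longleftrightarrow> part n m (Suc h) \<le> \<kappa> \<and> \<kappa> < part n m h"
proof -
  have "\<not> Suc h \<le> col_height n m \<kappa> \<longleftrightarrow> part n m (Suc h) \<le> \<kappa>"
  proof (cases "Suc h \<le> n")
    case True
    then show ?thesis using le_col_height_iff[of "Suc h" n m \<kappa>] by auto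
  next
    case False
    then show ?thesis using col_height_le[of n m \<kappa>] by (auto simp: part_def)
  qed
  then show ?thesis using le_col_height_iff[OF assms, of m \<kappa>] by auto
qed

text \<open>The columns of height h are those from \<open>part n m (Suc h)\<close> to below
  \<open>part n m h\<close>, and there are m h of them.\<close>

lemma heights_box_col: "heights (box_col n m ` {..<psize n m}) (col_height n m) = bnd n m"
proof (intro ext)
  fix c r
  let ?H = "{h. 1 \<le> h \<and> h \<le> n \<and> c \<le> h \<and> h < r}"
  have "{\<kappa> \<in> box_col n m ` {..<psize n m}. c \<le> col_height n m \<kappa> \<and> col_height n m \<kappa> < r} =
      (\<Union>h\<in>?H. {part n m (Suc h)..<part n m h})" (is "?L = ?R")
  proof (rule Set.set_eqI)
    fix \<kappa>
    have "\<kappa> \<in> ?L \<longleftrightarrow> (\<exists>h\<in>?H. col_height n m \<kappa> = h)"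
      using col_height_le[of n m \<kappa>] by (auto simp: box_col_image)
    also have "\<dots> \<longleftrightarrow> \<kappa> \<in> ?R" using col_height_eq_iff[of _ n m \<kappa>] by auto
    finally show "\<kappa> \<in> ?L \<longleftrightarrow> \<kappa> \<in> ?R" .
  qed
  moreover have "card ?R = (\<Sum>h\<in>?H. card {part n m (Suc h)..<part n m h})"
  proof (rule card_UN_disjoint)
    show "finite ?H" by (rule finite_subset[of _ "{..n}"]) auto
    have "h = k" if "h \<in> {1..n}" "k \<in> {1..n}" "\<kappa> \<in> {part n m (Suc h)..<part n m h}" "\<kappa> \<in> {part n m (Suc k)..<part n m k}" for h k \<kappa>
      using col_height_eq_iff[OF that(1), of m \<kappa>] col_height_eq_iff[OF that(2), of m \<kappa>] that by simp
    then show "\<forall>h\<in>?H. \<forall>k\<in>?H. h \<noteq> k \<longrightarrow> {part n m (Suc h)..<part n m h} \<inter> {part n m (Suc k)..<part n m k} = {}"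
      by fastforce
  qed auto
  ultimately show "heights (box_col n m ` {..<psize n m}) (col_height n m) c r = bnd n m c r"
    by (simp add: heights_def bnd_def part_Suc)
qed

text \<open>Both sides count the boxes in the first k rows.\<close>

lemma box_sum_columns:
  assumes "k \<le> n"
  shows "box_sum n m k = (\<Sum>\<kappa>\<in>box_col n m ` {..<psize n m}. min k (col_height n m \<kappa>))"
proof -
  let ?C = "box_col n m ` {..<psize n m}"
  have "part n m i = (\<Sum>\<kappa>\<in>?C. if \<kappa> < part n m i then 1 else 0)" if i: "i \<in> {1..n}" for i
  proof -
    have "?C \<inter> {\<kappa>. \<kappa> < part n m i} = {..<part n m i}"
    proof -
      have "1 \<le> col_height n m \<kappa>" if "\<kappa> < part n m i" for \<kappa>
        using le_col_height_iff[OF i, of m \<kappa>] i that by auto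
      then show ?thesis by (auto simp: box_col_image)
    qed
    then show ?thesis by (simp add: sum.If_cases)
  qed
  then have "box_sum n m k = (\<Sum>i=1..k. \<Sum>\<kappa>\<in>?C. if \<kappa> < part n m i then 1 else 0)"
    unfolding box_sum_def using assms by (intro sum.cong) auto
  also have "\<dots> = (\<Sum>\<kappa>\<in>?C. \<Sum>i=1..k. if \<kappa> < part n m i then 1 else 0)" by (rule sum.swap)
  also have "\<dots> = (\<Sum>\<kappa>\<in>?C. min k (col_height n m \<kappa>))"
  proof (rule sum.cong[OF refl])
    fix \<kappa>
    have "{1..k} \<inter> {i. \<kappa> < part n m i} = {1..min k (col_height n m \<kappa>)}"
      using le_col_height_iff[of _ n m \<kappa>] assms by auto
    then show "(\<Sum>i=1..k. if \<kappa> < part n m i then 1 else 0) = min k (col_height n m \<kappa>)" by (simp add: sum.If_cases)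
  qed
  finally show ?thesis .
qed

section \<open>Antisymmetry and support of the highest weight vector\<close>

lemma perm_act_comp:
  assumes "\<sigma> permutes {..<length l}" "\<tau> permutes {..<length l}"
  shows "perm_act (perm_act T \<tau>) \<sigma> l = perm_act T (\<tau> \<circ> \<sigma>) l"
proof -
  have "inv_into UNIV \<tau> p < length l" if "p < length l" for p
    using permutes_in_image[OF permutes_inv[OF assms(2)], of p] that by simp
  then have "map (\<lambda>p. map (\<lambda>p. l ! inv_into UNIV \<sigma> p) [0..<length l] ! inv_into UNIV \<tau> p) [0..<length l] = map (\<lambda>p. l ! inv_into UNIV (\<tau> \<circ> \<sigma>) p) [0..<length l]"
    using o_inv_distrib[OF permutes_bij[OF assms(2)] permutes_bij[OF assms(1)]] by auto
  then show ?thesis unfolding perm_act_def by (simp only: length_map length_upt diff_zero)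
qed

lemma perm_act_transpose:
  assumes "p < length l" "q < length l"
  shows "perm_act T (transpose p q) l = T (l[p := l ! q, q := l ! p])"
proof -
  have "map (\<lambda>i. l ! inv_into UNIV (transpose p q) i) [0..<length l] = l[p := l ! q, q := l ! p]"
    using assms by (intro nth_equalityI) (auto simp: nth_list_update transpose_def)
  then show ?thesis by (simp add: perm_act_def)
qed

text \<open>The column group acts last in the Young symmetrizer. Composition with a transposition
  inside a column permutes this group and reverses all signs.\<close>

lemma schur_module_antisym:
  assumes v: "v \<in> schur_module n m" and l: "length l = psize n m"
    and pq: "p < psize n m" "q < psize n m" "p \<noteq> q" "box_col n m p = box_col n m q"
  shows "v (l[p := l ! q, q := l ! p]) = - v l"
proof -
  obtain T where T: "v = young_symmetrizer n m T" using v by (auto simp: schur_module_def)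
  define B where "B = (\<Sum>\<sigma>\<in>row_group n m. perm_act T \<sigma>)"
  let ?G = "col_group n m" and ?t = "transpose p q"
  have val: "v k = (\<Sum>\<tau>\<in>?G. of_int (sign \<tau>) * perm_act B \<tau> k)" for k
    by (simp add: T young_symmetrizer_def B_def sum_fun_apply cscale_def)
  have tp: "?t permutes {..<psize n m}" using pq by (intro permutes_swap_id) auto
  have G: "\<tau> permutes {..<psize n m}" if "\<tau> \<in> ?G" for \<tau> using that by (simp add: col_group_def)
  have tG: "\<tau> \<circ> ?t \<in> ?G" if "\<tau> \<in> ?G" for \<tau>
    using that pq permutes_compose[OF tp G[OF that]] by (auto simp: col_group_def transpose_def)
  have bij: "bij_betw (\<lambda>\<tau>. \<tau> \<circ> ?t) ?G ?G"
    by (rule bij_betw_byWitness[where f' = "\<lambda>\<tau>. \<tau> \<circ> ?t"]) (auto simp: tG comp_assoc)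
  have fin: "finite {..<psize n m}" by simp
  have sgn: "sign (\<tau> \<circ> ?t) = - sign \<tau>" if "\<tau> \<in> ?G" for \<tau>
    using sign_compose[OF permutation_permutes[THEN iffD2] permutation_swap_id, of \<tau> p q] G[OF that] fin pq(3)
    by (auto simp: sign_swap_id)
  have "v (l[p := l ! q, q := l ! p]) = perm_act v ?t l" using pq l by (simp add: perm_act_transpose)
  also have "\<dots> = (\<Sum>\<tau>\<in>?G. of_int (sign \<tau>) * perm_act (perm_act B \<tau>) ?t l)" by (simp add: perm_act_def[of _ ?t] val)
  also have "\<dots> = (\<Sum>\<tau>\<in>?G. - (of_int (sign (\<tau> \<circ> ?t)) * perm_act B (\<tau> \<circ> ?t) l))"
    by (intro sum.cong refl) (simp add: sgn perm_act_comp l tp G)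
  also have "\<dots> = - v l"
    unfolding val sum_negf
    using sum.reindex_bij_betw[OF bij, of "\<lambda>\<tau>. of_int (sign \<tau>) * perm_act B \<tau> l"] by simp
  finally show ?thesis .
qed

text \<open>A diagonal matrix with one eigenvalue 2 and all others 1 detects how often its index
  occurs.\<close>

lemma GL_weight_content:
  assumes "GL_weight n w T" "T l \<noteq> 0" "set l \<subseteq> idx n" "i \<in> idx n"
  shows "card {p. p < length l \<and> l ! p = i} = w i"
proof -
  define t :: "nat \<Rightarrow> complex" where "t = (\<lambda>j. if j = i then 2 else 1)"
  have "(\<Prod>p<length l. t (l ! p)) * T l = (\<Prod>j\<in>idx n. t j ^ w j) * T l"
    using assms(1) GL_act_diag[OF assms(3), of t T]
    by (auto simp: GL_weight_def t_def cscale_def)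
  then have "(\<Prod>p<length l. t (l ! p)) = (\<Prod>j\<in>idx n. t j ^ w j)" using assms(2) by simp
  moreover have "(\<Prod>p<length l. t (l ! p)) = 2 ^ card {p. p < length l \<and> l ! p = i}"
  proof -
    have "{..<length l} \<inter> {p. l ! p = i} = {p. p < length l \<and> l ! p = i}" by auto
    then show ?thesis by (simp add: t_def prod.If_cases)
  qed
  moreover have "(\<Prod>j\<in>idx n. t j ^ w j) = (\<Prod>j\<in>idx n. if j = i then 2 ^ w i else 1)"
    by (intro prod.cong) (auto simp: t_def)
  then have "(\<Prod>j\<in>idx n. t j ^ w j) = 2 ^ w i" using assms(4) by (simp add: idx_def)
  ultimately have "(of_nat (2 ^ card {p. p < length l \<and> l ! p = i}) :: complex) = of_nat (2 ^ w i)" by simp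
  then have "(2 :: nat) ^ card {p. p < length l \<and> l ! p = i} = 2 ^ w i" by (rule of_nat_eq_iff[THEN iffD1])
  then show ?thesis by simp
qed

text \<open>The entries of a column are distinct, so at most min(k, height) of them are <= k. Summed
  over the columns this bound is exactly the number of entries <= k prescribed by the weight, so it
  is attained in each column; now take k to be the height.\<close>

lemma highest_weight_vector_support:
  assumes hw: "highest_weight_vector n m v" and vl: "v l \<noteq> 0"
  shows "length l = psize n m \<and> (\<forall>p<psize n m. l ! p \<in> {1..col_height n m (box_col n m p)})"
proof -
  let ?N = "psize n m" and ?C = "box_col n m ` {..<psize n m}"
  have v: "v \<in> schur_module n m" and w: "GL_weight n (\<lambda>i. if i \<le> n then part n m i else 0) v"
    using hw by (auto simp: highest_weight_vector_iff)
  have l: "length l = ?N" "set l \<subseteq> idx n"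
    using v vl schur_module_subset[of n m] by (auto simp: tensor_power_def)
  have ent: "l ! p \<in> {1..n}" if "p < ?N" for p
  proof -
    have "l ! p \<in> set l" using that l(1) by simp
    then show ?thesis using GL_weight_support[OF w vl l(2), of "l ! p"] l(2) by (force simp: idx_def split: if_splits)
  qed
  define P where "P \<kappa> k = {p. p < ?N \<and> box_col n m p = \<kappa> \<and> l ! p \<le> k}" for \<kappa> k
  have finP: "finite (P \<kappa> k)" for \<kappa> k by (simp add: P_def)
  have inj: "inj_on (\<lambda>p. l ! p) {p. p < ?N \<and> box_col n m p = \<kappa>}" for \<kappa>
  proof (rule inj_onI, rule ccontr)
    fix p q assume pq: "p \<in> {p. p < ?N \<and> box_col n m p = \<kappa>}" "q \<in> {p. p < ?N \<and> box_col n m p = \<kappa>}"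
      "l ! p = l ! q" "p \<noteq> q"
    then have "v (l[p := l ! q, q := l ! p]) = - v l" by (intro schur_module_antisym[OF v l(1)]) auto
    moreover have "l[p := l ! q, q := l ! p] = l" using pq(3) by (metis list_update_id)
    ultimately show False using vl by simp
  qed
  have le: "card (P \<kappa> k) \<le> min k (col_height n m \<kappa>)" for \<kappa> k
  proof -
    have "card (P \<kappa> k) \<le> col_height n m \<kappa>"
      unfolding card_column[symmetric] by (rule card_mono) (auto simp: P_def)
    moreover have "card (P \<kappa> k) \<le> card {1..k}"
      by (rule card_inj_on_le[of "\<lambda>p. l ! p"]) (use inj[of \<kappa>] ent in \<open>auto simp: P_def inj_on_def\<close>)
    ultimately show ?thesis by simp
  qed
  have eq: "card (P \<kappa> k) = min k (col_height n m \<kappa>)" if k: "k \<le> n" and \<kappa>: "\<kappa> \<in> ?C" for \<kappa> k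
  proof -
    have "(\<Sum>\<kappa>\<in>?C. card (P \<kappa> k)) = card (\<Union>\<kappa>\<in>?C. P \<kappa> k)"
      by (rule card_UN_disjoint[symmetric]) (auto simp: P_def)
    also have "(\<Union>\<kappa>\<in>?C. P \<kappa> k) = (\<Union>i\<in>{1..k}. {p. p < ?N \<and> l ! p = i})"
      using ent by (auto simp: P_def)
    also have "card \<dots> = (\<Sum>i=1..k. card {p. p < ?N \<and> l ! p = i})"
      by (rule card_UN_disjoint) auto
    also have "\<dots> = (\<Sum>i=1..k. part n m i)"
    proof (rule sum.cong[OF refl])
      fix i assume "i \<in> {1..k}"
      then show "card {p. p < ?N \<and> l ! p = i} = part n m i"
        using GL_weight_content[OF w vl l(2), of i] l(1) k by (simp add: idx_def)
    qed
    also have "\<dots> = (\<Sum>\<kappa>\<in>?C. min k (col_height n m \<kappa>))"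
      using box_sum_columns[OF k, of m] by (simp add: box_sum_def)
    finally have S: "(\<Sum>\<kappa>\<in>?C. card (P \<kappa> k)) = (\<Sum>\<kappa>\<in>?C. min k (col_height n m \<kappa>))" .
    show ?thesis
    proof (rule ccontr)
      assume "card (P \<kappa> k) \<noteq> min k (col_height n m \<kappa>)"
      then have "card (P \<kappa> k) < min k (col_height n m \<kappa>)" using le[of \<kappa> k] by linarith
      then have "(\<Sum>\<kappa>\<in>?C. card (P \<kappa> k)) < (\<Sum>\<kappa>\<in>?C. min k (col_height n m \<kappa>))"
        using \<kappa> le by (intro sum_strict_mono_ex1) auto
      then show False using S by simp
    qed
  qed
  have "l ! p \<in> {1..col_height n m (box_col n m p)}" if p: "p < ?N" for p
  proof -
    let ?\<kappa> = "box_col n m p" let ?h = "col_height n m ?\<kappa>"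
    have "card (P ?\<kappa> ?h) = card {p. p < ?N \<and> box_col n m p = ?\<kappa>}"
      using eq[OF col_height_le, of ?\<kappa>] p by (simp add: card_column)
    then have "P ?\<kappa> ?h = {p. p < ?N \<and> box_col n m p = ?\<kappa>}"
      by (intro card_subset_eq) (auto simp: P_def)
    then have "p \<in> P ?\<kappa> ?h" using p by simp
    then show ?thesis using ent[OF p] by (simp add: P_def)
  qed
  then show ?thesis using l(1) by simp
qed

lemma column_tensor_highest_weight:
  assumes "highest_weight_vector n m v"
  shows "column_tensor n (psize n m) (box_col n m) (col_height n m) v"
proof
  show "length l = psize n m \<and> (\<forall>p<psize n m. l ! p \<in> {1..col_height n m (box_col n m p)})" if "v l \<noteq> 0" for l
    using highest_weight_vector_support[OF assms that] .
  show "col_height n m (box_col n m p) \<le> n" for p by (rule col_height_le)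
  show "card {q. q < psize n m \<and> box_col n m q = box_col n m p} = col_height n m (box_col n m p)" for p
    by (rule card_column)
  show "v (l[p := l ! q, q := l ! p]) = - v l"
    if "length l = psize n m" "p < psize n m" "q < psize n m" "p \<noteq> q" "box_col n m p = box_col n m q" for l p q
    using schur_module_antisym[of v n m l p q] assms that by (simp add: highest_weight_vector_iff)
  show "v \<noteq> 0" using assms by (simp add: highest_weight_vector_def)
qed

section \<open>The graded module has the type of its weight\<close>

lemma gr_of_type:
  assumes "highest_weight_vector n m v"
  shows "op_pres gscale (nt_minus n) (gr_reps n v) (gr_null n v) (gr_op n) (gr_V0 n v) (gr_proj n v)"
    and "op_pres.rank_one_vanish (gr_null n v) (gr_op n) n m (sp_basis n) (in_degree 0 v)"
    and "s \<in> ffl n (bnd n m) \<Longrightarrow> op_pres.essential gscale (gr_reps n v) (gr_null n v) (gr_op n) n (sp_basis n) (in_degree 0 v) s"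
    and "in_degree 0 v \<in> gr_reps n v"
    and "T \<in> gr_reps n v \<Longrightarrow> \<exists>p\<in>fcarrier (nt_minus n). T - op_pres.pact gscale (gr_op n) p (in_degree 0 v) \<in> gr_null n v"
    and "gr_class n v = gr_proj n v (in_degree 0 v)"
proof -
  interpret C: column_tensor n "psize n m" "box_col n m" "col_height n m" v
    by (rule column_tensor_highest_weight[OF assms])
  show "op_pres gscale (nt_minus n) (gr_reps n v) (gr_null n v) (gr_op n) (gr_V0 n v) (gr_proj n v)"
    by (rule C.gr_op_pres)
  show "C.G.rank_one_vanish n m (sp_basis n) (in_degree 0 v)"
    by (rule C.rank_one_vanish[OF heights_box_col])
  show "C.G.essential n (sp_basis n) (in_degree 0 v) s" if "s \<in> ffl n (bnd n m)"
    by (rule C.essential) (use that in \<open>simp add: heights_box_col\<close>)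
  show "in_degree 0 v \<in> gr_reps n v" by (rule C.v_reps)
  show "\<exists>p\<in>fcarrier (nt_minus n). T - C.G.pact p (in_degree 0 v) \<in> gr_null n v" if "T \<in> gr_reps n v"
    by (rule C.gr_cyclic[OF that])
  show "gr_class n v = gr_proj n v (in_degree 0 v)" by (rule C.gr_class_proj)
qed

theorem theorem1p13:
  fixes n :: nat and m m' :: "nat \<Rightarrow> nat" and v v' v'' :: tensor
  assumes "n \<ge> 1"
    and "highest_weight_vector n m v"
    and "highest_weight_vector n m' v'"
    and "highest_weight_vector n (\<lambda>i. m i + m' i) v''"
  shows "module_iso (symmetric_algebra (nt_minus n))
    (generated_submodule (symmetric_algebra (nt_minus n))
      (sym_module (tensor_product (gr_V0 n v) (gr_V0 n v')))
      (pure_tensor (gr_V0 n v) (gr_V0 n v') (gr_class n v) (gr_class n v')))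
    (sym_module (gr_V0 n v'')) \<noteq> {}"
proof -
  note g = gr_of_type[OF assms(2)] and g' = gr_of_type[OF assms(3)] and g'' = gr_of_type[OF assms(4)]
  interpret P: op_pres_pair gscale gscale "nt_minus n" "gr_reps n v" "gr_null n v" "gr_op n" "gr_V0 n v" "gr_proj n v"
    "gr_reps n v'" "gr_null n v'" "gr_op n" "gr_V0 n v'" "gr_proj n v'"
    by (rule op_pres_pair.intro[OF g(1) g'(1)])
  let ?z = "delta (gr_proj n v (in_degree 0 v), gr_proj n v' (in_degree 0 v'))"
  have z: "?z \<in> P.FS"
    by (rule P.FS_delta) (use g(4) g'(4) in \<open>auto simp: P.A.carrier_M P.B.carrier_M\<close>)
  have PR: "P.T.rank_one_vanish n (\<lambda>i. m i + m' i) (sp_basis n) ?z"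
    by (rule P.rank_one_vanish_tensor[OF sp_basis_nt_minus g(4) g'(4) g(2) g'(2)])
  have LEAD: "P.T.essential n (sp_basis n) ?z s" if "s \<in> ffl n (bnd n (\<lambda>i. m i + m' i))" for s
  proof -
    obtain s1 s2 where s: "s1 \<in> ffl n (bnd n m)" "s2 \<in> ffl n (bnd n m')" "s = s1 + s2"
      using ffl_split[OF \<open>s \<in> _\<close>] by blast
    show ?thesis unfolding s(3)
      by (rule P.essential_tensor[OF sp_basis_nt_minus g(4) g'(4) g(3)[OF s(1)] g'(3)[OF s(2)]])
  qed
  note T = P.T.op_pres_axioms
  \<comment> \<open>Each inclusion uses the independence of the polytope monomials on one side and
    the vanishing of rank one powers on both.\<close>
  have ann: "P.T.Ann ?z = op_pres.Ann gscale (nt_minus n) (gr_null n v'') (gr_op n) (in_degree 0 v'')"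
    by (intro equalityI Ann_subset_of_type[OF T g''(1) z g''(4) sp_basis_nt_minus nt_minus_span PR g''(2) LEAD]
        Ann_subset_of_type[OF g''(1) T g''(4) z sp_basis_nt_minus nt_minus_span g''(2) PR g''(3)])
  show ?thesis
    using module_iso_cyclic[OF T g''(1) z g''(4) ann g''(5)]
    by (simp add: pure_tensor_def g(6) g'(6))
qed

end
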